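(* There exists a universal constant $M>0$ with the following property. Let $T>0$, $h\in\mathbb{R}$, and suppose $e,w\in C([0,T])$ satisfy $e(t)-|w(t)|>M|h|$ for all $t\in[0,T]$. Then there exists a weak solution $(u,B)\in L^\infty(\mathbb{T}^3\times[0,T])$ of the ideal MHD system such that $$\mathcal{E}(u,B)(t)=e(t),\qquad\mathcal{W}(u,B)(t)=w(t)\qquad\text{for a.e. }t\in[0,T]$$ and $$\mathcal{H}(B)(t)=h\qquad\text{for a.e. }t\in[0,T].$$
   Context: $\mathbb{T}^3$ is the (fixed) flat three-dimensional torus. A weak solution of the ideal MHD system is a pair $(u,B)\in L^2_{loc}$ which satisfies, in the sense of distributions on $\mathbb{T}^3\times(0,T)$ and for some pressure (a distribution) $p$, $$\partial_tu+\mathrm{div}(u\otimes u-B\otimes B+p\,\mathrm{Id})=0,\quad \partial_tB+\nabla\times(B\times u)=0,\quad\nabla\cdot u=\nabla\cdot B=0.$$ The total energy, cross-helicity and magnetic helicity at time $t$ are $$\mathcal{E}(u,B)(t)=\tfrac12\int_{\mathbb{T}^3}(|u|^2+|B|^2)\,dx,\quad\mathcal{W}(u,B)(t)=\int_{\mathbb{T}^3}u\cdot B\,dx,\quad\mathcal{H}(B)(t)=\int_{\mathbb{T}^3}A\cdot B\,dx,$$ where $A(\cdot,t)=\mathrm{curl}^{-1}B(\cdot,t)$ is the (zero-mean) vector potential with $\mathrm{curl}\,A=B$, $\mathrm{div}\,A=0$ on $\mathbb{T}^3$; stating $\mathcal{H}(B)(t)$ includes that $B(\cdot,t)$ has zero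 mean. *)

theory Defs
  imports "HOL-Analysis.Analysis"
begin

section \<open>Smooth functions and distributional calculus\<close>

primrec iter_deriv :: "'a list \<Rightarrow> ('a::euclidean_space \<Rightarrow> real) \<Rightarrow> 'a \<Rightarrow> real" where
  "iter_deriv [] f = f"
| "iter_deriv (v # vs) f = (\<lambda>z. frechet_derivative (iter_deriv vs f) (at z) v)"

definition smooth :: "('a::euclidean_space \<Rightarrow> real) \<Rightarrow> bool" where
  "smooth f \<longleftrightarrow> (\<forall>vs z. iter_deriv vs f differentiable (at z))"

text \<open>
  A distribution is a functional that is only ever applied to the test functions of the
  domain under consideration.
\<close>

type_synonym 'a distr = "('a \<Rightarrow> real) \<Rightarrow> real"

definition regular_distr :: "'a::euclidean_space set \<Rightarrow> ('a \<Rightarrow> real) \<Rightarrow> 'a distr" where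
  "regular_distr \<Omega> f \<phi> = (LINT z:\<Omega>|lborel. f z * \<phi> z)"

definition deriv_distr :: "'a::euclidean_space \<Rightarrow> 'a distr \<Rightarrow> 'a distr" where
  "deriv_distr v \<Lambda> \<phi> = - \<Lambda> (\<lambda>z. frechet_derivative \<phi> (at z) v)"

text \<open>
  Below, \<open>d i\<close> is the \<open>i\<close>-th spatial direction, either in space or in space-time.
  In the index type \<open>3\<close> addition is modulo 3, so the components of the curl are given by
  the cyclic formula.
\<close>

definition div_distr :: "(3 \<Rightarrow> 'a::euclidean_space) \<Rightarrow> (3 \<Rightarrow> 'a distr) \<Rightarrow> 'a distr" where
  "div_distr d F \<phi> = (\<Sum>i\<in>UNIV. deriv_distr (d i) (F i) \<phi>)"

definition curl_distr :: "(3 \<Rightarrow> 'a::euclidean_space) \<Rightarrow> (3 \<Rightarrow> 'a distr) \<Rightarrow> 3 \<Rightarrow> 'a distr" where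
  "curl_distr d F i \<phi> =
     deriv_distr (d (i + 1)) (F (i + 2)) \<phi> - deriv_distr (d (i + 2)) (F (i + 1)) \<phi>"


section \<open>The torus\<close>

text \<open>
  The torus is \<open>\<real>\<^sup>3/\<int>\<^sup>3\<close>: functions on it are functions on \<open>\<real>\<^sup>3\<close> of period 1 in each
  coordinate, and integrals over it are integrals over the unit cube.
\<close>

definition torus_cell :: "(real^3) set" where
  "torus_cell = cbox 0 1"

definition periodic :: "(real^3 \<Rightarrow> 'b) \<Rightarrow> bool" where
  "periodic f \<longleftrightarrow> (\<forall>x i. f (x + axis i 1) = f x)"

definition torus_tests :: "(real^3 \<Rightarrow> real) set" where
  "torus_tests = {\<psi>. smooth \<psi> \<and> periodic \<psi>}"

definition torus_L2 :: "(real^3 \<Rightarrow> real^3) \<Rightarrow> bool" where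
  "torus_L2 f \<longleftrightarrow> f \<in> borel_measurable borel \<and> periodic f \<and>
     set_integrable lborel torus_cell (\<lambda>x. (norm (f x))\<^sup>2)"

text \<open>\<open>a = curl\<^sup>-\<^sup>1 b\<close>; this determines \<open>a\<close> up to a null set.\<close>

definition vector_potential :: "(real^3 \<Rightarrow> real^3) \<Rightarrow> (real^3 \<Rightarrow> real^3) \<Rightarrow> bool" where
  "vector_potential b a \<longleftrightarrow>
     torus_L2 a \<and> (LINT x:torus_cell|lborel. a x) = 0 \<and>
     (\<forall>\<psi>\<in>torus_tests.
        div_distr (\<lambda>i. axis i 1) (\<lambda>i. regular_distr torus_cell (\<lambda>x. a x $ i)) \<psi> = 0 \<and>
        (\<forall>i. curl_distr (\<lambda>j. axis j 1) (\<lambda>j. regular_distr torus_cell (\<lambda>x. a x $ j)) i \<psi>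
             = regular_distr torus_cell (\<lambda>x. b x $ i) \<psi>))"

text \<open>
  The helicity is a relation because \<open>curl\<^sup>-\<^sup>1 b\<close> exists only for divergence-free \<open>b\<close> of
  zero mean.
\<close>

definition has_helicity :: "(real^3 \<Rightarrow> real^3) \<Rightarrow> real \<Rightarrow> bool" where
  "has_helicity b h \<longleftrightarrow>
     torus_L2 b \<and> (LINT x:torus_cell|lborel. b x) = 0 \<and>
     (\<exists>a. vector_potential b a \<and> (LINT x:torus_cell|lborel. a x \<bullet> b x) = h)"

definition total_energy :: "(real^3 \<Rightarrow> real^3) \<Rightarrow> (real^3 \<Rightarrow> real^3) \<Rightarrow> real" where
  "total_energy v b = 1/2 * (LINT x:torus_cell|lborel. (norm (v x))\<^sup>2 + (norm (b x))\<^sup>2)"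

definition cross_helicity :: "(real^3 \<Rightarrow> real^3) \<Rightarrow> (real^3 \<Rightarrow> real^3) \<Rightarrow> real" where
  "cross_helicity v b = (LINT x:torus_cell|lborel. v x \<bullet> b x)"


section \<open>Space-time functions and distributions\<close>

type_synonym spacetime = "(real^3) \<times> real"

definition torus_Linfty :: "real set \<Rightarrow> (spacetime \<Rightarrow> real^3) \<Rightarrow> bool" where
  "torus_Linfty J f \<longleftrightarrow>
     set_borel_measurable borel (UNIV \<times> J) f \<and> (\<forall>t\<in>J. periodic (\<lambda>x. f (x, t))) \<and>
     (\<exists>C. AE z\<in>UNIV \<times> J in lborel. norm (f z) \<le> C)"

definition torus_L2_loc :: "real \<Rightarrow> (spacetime \<Rightarrow> real^3) \<Rightarrow> bool" where
  "torus_L2_loc T f \<longleftrightarrow>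
     set_borel_measurable borel (UNIV \<times> {0<..<T}) f \<and>
     (\<forall>t\<in>{0<..<T}. periodic (\<lambda>x. f (x, t))) \<and>
     (\<forall>a b. 0 < a \<and> b < T \<longrightarrow>
        set_integrable lborel (torus_cell \<times> {a..b}) (\<lambda>z. (norm (f z))\<^sup>2))"

definition tests_supported_in :: "real set \<Rightarrow> (spacetime \<Rightarrow> real) set" where
  "tests_supported_in K =
     {\<phi>. smooth \<phi> \<and> (\<forall>t. periodic (\<lambda>x. \<phi> (x, t))) \<and> (\<forall>x t. \<phi> (x, t) \<noteq> 0 \<longrightarrow> t \<in> K)}"

definition spacetime_tests :: "real \<Rightarrow> (spacetime \<Rightarrow> real) set" where
  "spacetime_tests T = {\<phi>. \<exists>a b. 0 < a \<and> b < T \<and> \<phi> \<in> tests_supported_in {a..b}}"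

text \<open>
  The last clause is the usual continuity estimate on test functions supported in a fixed compact
  set, \<open>S\<close> being any bound for the partial derivatives of \<open>\<phi>\<close> of order at most \<open>N\<close>.
\<close>

definition spacetime_distribution :: "real \<Rightarrow> spacetime distr \<Rightarrow> bool" where
  "spacetime_distribution T \<Lambda> \<longleftrightarrow>
     (\<forall>\<phi>\<in>spacetime_tests T. \<forall>\<psi>\<in>spacetime_tests T. \<Lambda> (\<lambda>z. \<phi> z + \<psi> z) = \<Lambda> \<phi> + \<Lambda> \<psi>) \<and>
     (\<forall>c. \<forall>\<phi>\<in>spacetime_tests T. \<Lambda> (\<lambda>z. c * \<phi> z) = c * \<Lambda> \<phi>) \<and>
     (\<forall>a b. 0 < a \<and> b < T \<longrightarrow>
        (\<exists>C N. \<forall>\<phi>\<in>tests_supported_in {a..b}. \<forall>S.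
           (\<forall>vs z. length vs \<le> N \<and> set vs \<subseteq> Basis \<longrightarrow> \<bar>iter_deriv vs \<phi> z\<bar> \<le> S) \<longrightarrow>
           \<bar>\<Lambda> \<phi>\<bar> \<le> C * S))"


section \<open>Ideal magnetohydrodynamics\<close>

definition time_dir :: spacetime where
  "time_dir = (0, 1)"

definition space_dir :: "3 \<Rightarrow> spacetime" where
  "space_dir i = (axis i 1, 0)"

definition ideal_MHD_weak_solution ::
  "real \<Rightarrow> (spacetime \<Rightarrow> real^3) \<Rightarrow> (spacetime \<Rightarrow> real^3) \<Rightarrow> bool" where
  "ideal_MHD_weak_solution T u B \<longleftrightarrow>
     torus_L2_loc T u \<and> torus_L2_loc T B \<and>
     (\<exists>p. spacetime_distribution T p \<and>
       (let R = regular_distr (torus_cell \<times> {0<..<T}) in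
        \<forall>\<phi>\<in>spacetime_tests T.
          (\<forall>i. deriv_distr time_dir (R (\<lambda>z. u z $ i)) \<phi>
               + div_distr space_dir (\<lambda>j. R (\<lambda>z. u z $ i * u z $ j - B z $ i * B z $ j)) \<phi>
               + deriv_distr (space_dir i) p \<phi> = 0) \<and>
          (\<forall>i. deriv_distr time_dir (R (\<lambda>z. B z $ i)) \<phi>
               + curl_distr space_dir (\<lambda>j. R (\<lambda>z. cross3 (B z) (u z) $ j)) i \<phi> = 0) \<and>
          div_distr space_dir (\<lambda>j. R (\<lambda>z. u z $ j)) \<phi> = 0 \<and>
          div_distr space_dir (\<lambda>j. R (\<lambda>z. B z $ j)) \<phi> = 0))"

end

theory Submission
  imports Defs
begin

text \<open>
  In the Elsasser variables \<open>z\<^sup>+ = u + B\<close>, \<open>z\<^sup>- = u - B\<close> the fields \<open>z\<^sup>- = (V\<^sub>1, V\<^sub>2, 0)(x\<^sub>1, x\<^sub>2)\<close>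
  and \<open>z\<^sup>+ = (0, 0, F(x\<^sub>1, x\<^sub>2, t))\<close> solve ideal MHD without pressure as soon as \<open>V\<close> is divergence
  free and \<open>F\<close> is transported by \<open>V\<close>. No convex integration is needed: for a bounded planar
  shear flow \<open>V\<close> whose channels have fat Cantor sets as walls, the autonomous transport equation has
  bounded weak solutions \<open>F\<close> that appear on one Cantor dust and disappear on another one, with a
  freely prescribed time profile. Tiny cells of this kind are superposed until \<open>\<integral>F\<^sup>2\<close> equals a
  given positive continuous function of time. One such family in a square (and one with the roles of
  \<open>z\<^sup>+\<close> and \<open>z\<^sup>-\<close> exchanged in a second square) realises \<open>e + w\<close> and \<open>e - w\<close>; neither
  carries magnetic helicity. The helicity \<open>h\<close> sits in a strip where \<open>u = B\<close> is a stationary shear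
  flow of energy \<open>64 \<bar>h\<bar>\<close>. The vector potential of least \<open>L\<^sup>2\<close> norm is
  obtained by minimisation over smooth gradients.
\<close>

text \<open>A Lipschitz divergence-free flow preserves the integral of F^2, so a prescribed profile
  needs a field that lets mass stop. In the plane this can happen when the stream function maps a
  set where the velocity vanishes onto levels of positive measure. Here it is A(x) + 2 B(y), with A
  and B measuring length outside the walls. On a Cantor set whose gaps shrink like 4^-n, A takes the
  values with base 4 digits 0 and 1, while 2 B takes those with digits 0 and 2. Up to double
  expansions each number has one such decomposition, so levels in an interval of length 1 are
  matched with points of a dust of area 1, and length with area. Two dusts with the same range of
  levels are thereby matched with each other.

  The walls are rough, so Green's formula is proved for continuous coefficients first. Conservation
  of mass forces the density on a dust to be a time primitive of the travelling density; this is the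
  reason for oscillating profiles. Helicity vanishes because F has zero integral on horizontal lines
  and is orthogonal to the stream function.\<close>

abbreviation Bor :: "('a::topological_space \<Rightarrow> 'b::topological_space) set" where
  "Bor \<equiv> borel_measurable borel"

abbreviation cont :: "('a::topological_space \<Rightarrow> 'b::topological_space) \<Rightarrow> bool" where
  "cont f \<equiv> continuous_on UNIV f"

abbreviation ind :: "'a set \<Rightarrow> 'a \<Rightarrow> real" where
  "ind \<equiv> indicat_real"

type_synonym plane = "real \<times> real"

lemmas set_int_def = set_lebesgue_integral_def
lemmas Bor_contI = borel_measurable_continuous_onI
lemmas int_cong = Bochner_Integration.integral_cong
lemmas int_mono = Bochner_Integration.integral_mono

section \<open>A fat Cantor set\<close>

text \<open>Binary digits read in base 4.\<close>

fun sp :: "nat \<Rightarrow> nat" where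
  "sp n = (if n = 0 then 0 else 4 * sp (n div 2) + n mod 2)"

declare sp.simps [simp del]

lemma sp_0 [simp]: "sp 0 = 0"
  by (subst sp.simps) simp

lemma sp_double [simp]: "sp (2 * i) = 4 * sp i"
  by (cases "i = 0") (simp, subst sp.simps, simp)

lemma sp_double1 [simp]: "sp (Suc (2 * i)) = Suc (4 * sp i)"
  by (subst sp.simps) simp

lemma sp_Suc_ge: "sp i + 1 \<le> sp (Suc i)"
proof (induction i rule: less_induct)
  case (less i)
  show ?case
  proof (cases "even i")
   case True
   then obtain k where "i = 2 * k" by (elim evenE)
   thus ?thesis by simp
  next
   case False
   then obtain k where k: "i = Suc (2 * k)" by (metis oddE Suc_eq_plus1)
   hence "sp k + 1 \<le> sp (Suc k)" using less by auto
   moreover have "sp (Suc i) = 4 * sp (Suc k)"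
    using sp_double[of "Suc k"] k by simp
   ultimately show ?thesis using k by simp
  qed
qed

lemma sp_mono: "i \<le> j \<Longrightarrow> sp i \<le> sp j"
  by (rule lift_Suc_mono_le[of sp]) (use sp_Suc_ge in \<open>auto intro: Suc_leD\<close>)

lemma sp_pow: "sp (2 ^ n * i) = 4 ^ n * sp i"
proof (induction n)
  case (Suc n)
  have "sp (2 ^ Suc n * i) = 4 * sp (2 ^ n * i)" using sp_double[of "2 ^ n * i"] by (simp only: power_Suc mult.assoc)
  thus ?case using Suc by simp
qed simp

lemma sp_1 [simp]: "sp (Suc 0) = 1"
  using sp_double1[of 0] by simp

lemma sp_pow1: "sp (2 ^ n) = 4 ^ n"
  using sp_pow[of n 1] by simp

text \<open>The extreme case has n digits 1 and the value \<open>(4 ^ n - 1) / 3\<close>. This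
  bounds the total gap length by 1/3 and leaves room for \<open>sp i + 2 * sp j\<close> below
  \<open>4 ^ n\<close>.\<close>

lemma sp_bound: "i < 2 ^ n \<Longrightarrow> 3 * sp i < 4 ^ n"
proof (induction n arbitrary: i)
  case (Suc n)
  obtain k d where k: "i = 2 * k + d" "d < 2"
   by (metis mod_less_divisor mult_div_mod_eq pos2)
  hence "k < 2 ^ n" using Suc.prems by simp
  hence "3 * sp k < 4 ^ n" using Suc.IH by blast
  moreover have "sp i \<le> 4 * sp k + 1" using k by (cases "d = 0") (auto simp: less_2_cases_iff)
  ultimately show ?case by simp
qed simp

text \<open>Deinterleaving of base-4 digits: \<open>m = sp (ev m) + 2 * sp (od m)\<close>.\<close>

fun ev :: "nat \<Rightarrow> nat" where
  "ev m = (if m = 0 then 0 else 2 * ev (m div 4) + m mod 2)"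

fun od :: "nat \<Rightarrow> nat" where
  "od m = (if m = 0 then 0 else 2 * od (m div 4) + (m mod 4) div 2)"

declare ev.simps [simp del] od.simps [simp del]

lemma ev_0 [simp]: "ev 0 = 0" and od_0 [simp]: "od 0 = 0"
  by (simp_all add: ev.simps od.simps)

lemma ev_step: "ev m = 2 * ev (m div 4) + m mod 2"
  by (cases "m = 0") (simp, rule ev.simps[THEN trans], simp)

lemma od_step: "od m = 2 * od (m div 4) + (m mod 4) div 2"
  by (cases "m = 0") (simp, rule od.simps[THEN trans], simp)

lemma sp_double_add: "d < 2 \<Longrightarrow> sp (2 * i + d) = 4 * sp i + d"
  by (auto simp: less_2_cases_iff)

lemma ev_od_sp: "sp (ev m) + 2 * sp (od m) = m"
proof (induction m rule: less_induct)
  case (less m)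
  show ?case
  proof (cases "m = 0")
   case False
   hence "sp (ev (m div 4)) + 2 * sp (od (m div 4)) = m div 4" using less by auto
   moreover have "sp (ev m) = 4 * sp (ev (m div 4)) + m mod 2"
    by (subst ev_step) (rule sp_double_add, simp)
   moreover have "sp (od m) = 4 * sp (od (m div 4)) + (m mod 4) div 2"
    by (subst od_step) (rule sp_double_add, simp)
   moreover have "m mod 4 = m mod 2 + 2 * ((m mod 4) div 2)"
    by presburger
   moreover have "4 * (m div 4) + m mod 4 = m" by simp
   ultimately show ?thesis by linarith
  qed simp
qed

lemma ev_sp: "ev (sp i + 2 * sp j) = i \<and> od (sp i + 2 * sp j) = j"
proof (induction "i + j" arbitrary: i j rule: less_induct)
  case less
  show ?case
  proof (cases "i + j = 0")
   case False
   obtain k d where k: "i = 2 * k + d" "d < 2" by (metis mod_less_divisor mult_div_mod_eq pos2)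
   obtain l e where l: "j = 2 * l + e" "e < 2" by (metis mod_less_divisor mult_div_mod_eq pos2)
   have "k + l < i + j" using False k l by auto
   hence IH: "ev (sp k + 2 * sp l) = k" "od (sp k + 2 * sp l) = l" using less by auto
   have eq: "sp i + 2 * sp j = 4 * (sp k + 2 * sp l) + (d + 2 * e)"
    using k l sp_double_add by simp
   have "d + 2 * e < 4" using k l by linarith
   hence "(sp i + 2 * sp j) div 4 = sp k + 2 * sp l" "(sp i + 2 * sp j) mod 4 = d + 2 * e"
    unfolding eq by (simp_all only: mod_mult_self4 div_mult_self4 mod_less div_less numeral_neq_zero not_False_eq_True mult.commute[of 4] div_mult_self3 mod_mult_self3 add_0_right)
   moreover have "(sp i + 2 * sp j) mod 2 = d" unfolding eq using k by presburger
   ultimately show ?thesis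
    using k l IH by (subst ev_step, subst od_step) auto
  qed simp
qed

lemma ev_od_less: assumes "m < 4 ^ n" shows "ev m < 2 ^ n" "od m < 2 ^ n"
proof -
  have "sp (ev m) < 4 ^ n" "sp (od m) < 4 ^ n" using ev_od_sp[of m] assms by linarith+
  thus "ev m < 2 ^ n" "od m < 2 ^ n"
   using sp_mono[of "2 ^ n"] sp_pow1[of n] by (metis not_less)+
qed

text \<open>Numbers the \<open>2 ^ n\<close> by \<open>2 ^ n\<close> pieces of a dust by the
  \<open>4 ^ n\<close> level bands of the stream function: the sum over bands in
  \<open>core_n\<close> becomes a Riemann sum over the product set.\<close>

lemma ev_od_bij: "bij_betw (\<lambda>m. (ev m, od m)) {..<4 ^ n} ({..<2 ^ n} \<times> {..<2 ^ n})"
proof (rule bij_betw_byWitness[where f' = "\<lambda>(i, j). sp i + 2 * sp j"])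
  show "(\<lambda>(i, j). sp i + 2 * sp j) ` ({..<2 ^ n} \<times> {..<2 ^ n}) \<subseteq> {..<4 ^ n}"
  proof clarsimp
   fix i j :: nat assume "i < 2 ^ n" "j < 2 ^ n"
   thus "sp i + 2 * sp j < 4 ^ n" using sp_bound[of i n] sp_bound[of j n] by linarith
  qed
qed (auto simp: ev_od_sp ev_sp ev_od_less)

text \<open>Left end points of the blocks of the \<open>n\<close>-th stage: the Cantor set has measure
  \<open>i / 2 ^ n\<close> to the left of \<open>xp n i\<close>, and the gaps there have total length \<open>sp i / 4 ^ n\<close>.\<close>

definition xp :: "nat \<Rightarrow> nat \<Rightarrow> real" where
  "xp n i = real i / 2 ^ n + real (sp i) / 4 ^ n"

lemma xp_0 [simp]: "xp n 0 = 0" by (simp add: xp_def)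

lemma xp_pow: "xp (k + n) (2 ^ k * i) = xp n i"
  by (simp add: xp_def sp_pow power_add)

lemma xp_end [simp]: "xp n (2 ^ n) = 2"
  by (simp add: xp_def sp_pow1)

lemma xp_Suc_ge: "xp n i + 1 / 2 ^ n + 1 / 4 ^ n \<le> xp n (Suc i)"
proof -
  have "real (sp i) + 1 \<le> real (sp (Suc i))" using sp_Suc_ge[of i] by linarith
  hence "(real (sp i) + 1) / 4 ^ n \<le> real (sp (Suc i)) / 4 ^ n"
   by (rule divide_right_mono) simp
  thus ?thesis by (simp add: xp_def add_divide_distrib)
qed

lemma xp_mono: "i \<le> j \<Longrightarrow> xp n i \<le> xp n j"
proof (rule lift_Suc_mono_le[of "xp n"])
  fix k
  have "0 \<le> 1 / (2::real) ^ n" "0 \<le> 1 / (4::real) ^ n" by simp_all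
  thus "xp n k \<le> xp n (Suc k)" using xp_Suc_ge[of n k] by linarith
qed

lemma xp_nonneg: "0 \<le> xp n i" by (simp add: xp_def)

lemma xp_le: "i \<le> 2 ^ n \<Longrightarrow> xp n i \<le> 2"
  using xp_mono[of i "2 ^ n" n] by simp

lemma xp_less: assumes "i < 2 ^ n" shows "xp n i + 1 / 2 ^ n + 1 / (3 * 4 ^ n) \<le> 4 / 3"
proof -
  have "3 * sp i + 1 \<le> 4 ^ n" using sp_bound[OF assms] by simp
  hence "3 * real (sp i) + 1 \<le> 4 ^ n" by (metis (mono_tags) of_nat_1 of_nat_add of_nat_le_iff of_nat_mult of_nat_numeral of_nat_power)
  hence 1: "(3 * real (sp i) + 1) / 4 ^ n \<le> 1" by (simp add: divide_le_eq)
  have "real i + 1 \<le> 2 ^ n" using assms by (metis Suc_eq_plus1 Suc_leI of_nat_1 of_nat_add of_nat_le_iff of_nat_numeral of_nat_power)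
  hence 2: "(real i + 1) / 2 ^ n \<le> 1" by (simp add: divide_le_eq)
  have "xp n i + 1 / 2 ^ n + 1 / (3 * 4 ^ n) = (real i + 1) / 2 ^ n + ((3 * real (sp i) + 1) / 4 ^ n) / 3"
   by (simp add: xp_def add_divide_distrib)
  also have "\<dots> \<le> 1 + 1 / 3" using 1 2 by (intro add_mono divide_right_mono) auto
  finally show ?thesis by simp
qed

text \<open>The length is the Cantor measure \<open>1 / 2 ^ n\<close> of the piece plus the gaps
  inside it, a geometric series with sum \<open>1 / (3 * 4 ^ n)\<close>. What is left of
  \<open>1 / 4 ^ n\<close> separates the block from the next one, see
  \<open>xp_Suc_ge\<close>.\<close>

definition blk :: "nat \<Rightarrow> nat \<Rightarrow> real set" where
  "blk n i = {xp n i..xp n i + 1 / 2 ^ n + 1 / (3 * 4 ^ n)}"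

lemma blk_even: "blk (Suc n) (2 * i) \<subseteq> blk n i"
proof -
  have "1 / 2 ^ Suc n \<le> (1 / 2 ^ n :: real)" "1 / (3 * 4 ^ Suc n) \<le> (1 / (3 * 4 ^ n) :: real)"
   by (simp_all add: field_simps)
  moreover have "xp (Suc n) (2 * i) = xp n i" using xp_pow[of 1 n i] by simp
  ultimately show ?thesis unfolding blk_def by auto
qed

lemma blk_odd: "blk (Suc n) (Suc (2 * i)) \<subseteq> blk n i"
proof -
  define u v where "u = (1 / 2 ^ n :: real)" and "v = (1 / 4 ^ n :: real)"
  have e: "1 / 2 ^ Suc n = u / 2" "1 / (3 * 4 ^ Suc n) = v / 12" "1 / 2 ^ n = u" "1 / (3 * 4 ^ n) = v / 3"
   by (simp_all add: u_def v_def)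
  have "xp (Suc n) (Suc (2 * i)) = xp n i + u / 2 + v / 4"
   using sp_double1[of i] by (simp only: xp_def u_def v_def) (simp add: field_simps)
  moreover have "0 \<le> u" "0 \<le> v" by (simp_all add: u_def v_def)
  ultimately show ?thesis unfolding blk_def atLeastatMost_subset_iff e by simp
qed

definition Cn :: "nat \<Rightarrow> real set" where "Cn n = (\<Union>i<2 ^ n. blk n i)"

definition cantor :: "real set" where "cantor = (\<Inter>n. Cn n)"

lemma Cn_Suc: "Cn (Suc n) \<subseteq> Cn n"
proof -
  have "blk (Suc n) i \<subseteq> blk n (i div 2)" for i
  proof (cases "even i")
   case True thus ?thesis using blk_even[of n "i div 2"] by simp
  next
   case False thus ?thesis using blk_odd[of n "i div 2"] by (simp add: odd_two_times_div_two_succ)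
  qed
  moreover have "i div 2 < 2 ^ n" if "i < 2 ^ Suc n" for i :: nat using that by (simp add: less_mult_imp_div_less mult.commute)
  ultimately show ?thesis unfolding Cn_def by (fastforce simp: subset_eq)
qed

lemma decseq_Cn: "decseq Cn"
  by (rule decseq_SucI) (rule Cn_Suc)

lemma compact_Cn: "compact (Cn n)"
  unfolding Cn_def blk_def by (intro compact_UN) auto

lemma closed_cantor: "closed cantor"
  unfolding cantor_def using compact_Cn by (intro closed_INT) (auto intro: compact_imp_closed)

lemma cantor_bounds: "cantor \<subseteq> {0..4/3}"
proof -
  have "cantor \<subseteq> Cn 0" by (auto simp: cantor_def)
  also have "\<dots> \<subseteq> {0..4/3}" by (simp add: Cn_def blk_def xp_def)
  finally show ?thesis .
qed

lemma blk_ordered: "blk n i \<subseteq> {xp n i..<xp n (Suc i)}"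
proof -
  have "1 / (3 * 4 ^ n) < (1 / 4 ^ n :: real)" by (simp add: field_simps)
  thus ?thesis using xp_Suc_ge[of n i] unfolding blk_def by auto
qed

text \<open>The next end point can be far away, since \<open>sp\<close> jumps when a binary carry
  occurs. The Cantor points before it still lie in the short block i, because distinct blocks are
  ordered.\<close>

lemma cantor_near: assumes "x \<in> cantor" "xp n i \<le> x" "x < xp n (Suc i)"
  shows "x \<le> xp n i + 2 / 2 ^ n"
proof -
  obtain k where k: "k < 2 ^ n" "x \<in> blk n k" using assms by (auto simp: cantor_def Cn_def)
  have xk: "xp n k \<le> x" "x < xp n (Suc k)" using blk_ordered k by fastforce+
  have "k = i"
  proof (rule ccontr)
   assume "k \<noteq> i"
   then consider "Suc k \<le> i" | "Suc i \<le> k" by linarith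
   thus False using xp_mono[of _ _ n] xk assms(2,3) by (meson leD le_less_trans less_le_trans order.trans)
  qed
  hence "x \<le> xp n i + 1 / 2 ^ n + 1 / (3 * 4 ^ n)" using k by (simp add: blk_def)
  also have "1 / (3 * 4 ^ n) \<le> (1 / 2 ^ n :: real)"
   by (intro divide_left_mono) (auto intro: order_trans[OF power_mono[of 2 4]])
  finally show ?thesis by simp
qed

lemma Cn_inter: assumes "k \<le> 2 ^ N" shows "Cn N \<inter> {0..<xp N k} = (\<Union>i<k. blk N i)"
proof (intro equalityI subsetI)
  fix x assume x: "x \<in> Cn N \<inter> {0..<xp N k}"
  then obtain i where i: "x \<in> blk N i" by (auto simp: Cn_def)
  hence "xp N i < xp N k" using x by (auto simp: blk_def)
  hence "i < k" using xp_mono[of k i N] by (meson leD leI)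
  thus "x \<in> (\<Union>i<k. blk N i)" using i by auto
next
  fix x assume "x \<in> (\<Union>i<k. blk N i)"
  then obtain i where i: "i < k" "x \<in> blk N i" by auto
  hence "xp N i \<le> x" "x < xp N (Suc i)" using blk_ordered by fastforce+
  moreover have "xp N (Suc i) \<le> xp N k" using i by (intro xp_mono) auto
  ultimately show "x \<in> Cn N \<inter> {0..<xp N k}" using i assms xp_nonneg[of N i] unfolding Cn_def by auto
qed

lemma measure_Cn: assumes "k \<le> 2 ^ N"
  shows "measure lborel (Cn N \<inter> {0..<xp N k}) = real k * (1 / 2 ^ N + 1 / (3 * 4 ^ N))"
proof -
  have disj: "disjoint_family_on (blk N) {..<k}"
  proof (unfold disjoint_family_on_def, intro ballI impI)
   fix i j :: nat assume "i \<noteq> j"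
   then consider "Suc i \<le> j" | "Suc j \<le> i" by linarith
   thus "blk N i \<inter> blk N j = {}"
   proof cases
    case 1 thus ?thesis using blk_ordered[of N i] blk_ordered[of N j] xp_mono[of "Suc i" j N] by fastforce
   next
    case 2 thus ?thesis using blk_ordered[of N i] blk_ordered[of N j] xp_mono[of "Suc j" i N] by fastforce
   qed
  qed
  have "measure lborel (\<Union>i<k. blk N i) = (\<Sum>i<k. measure lborel (blk N i))"
   by (rule measure_finite_Union[OF _ _ disj]) (auto simp: blk_def)
  also have "\<dots> = (\<Sum>i<k. 1 / 2 ^ N + 1 / (3 * 4 ^ N))"
   by (intro sum.cong) (auto simp: blk_def)
  finally show ?thesis using Cn_inter[OF assms] by simp
qed

text \<open>At stage \<open>k + n\<close> the point \<open>xp n i\<close> is the left end point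
  number \<open>2 ^ k * i\<close>, so \<open>measure_Cn\<close> applies. The excess of the blocks
  over the Cantor set halves from one stage to the next and vanishes in the limit.\<close>

lemma measure_cantor: assumes "i \<le> 2 ^ n"
  shows "measure lborel (cantor \<inter> {0..<xp n i}) = real i / 2 ^ n"
proof -
  let ?A = "\<lambda>k. Cn (k + n) \<inter> {0..<xp n i}"
  have "(\<lambda>k. measure lborel (?A k)) \<longlonglongrightarrow> measure lborel (\<Inter>k. ?A k)"
  proof (rule Lim_measure_decseq)
   show "range ?A \<subseteq> sets lborel" using borel_compact[OF compact_Cn] by auto
   show "decseq ?A"
    using Cn_Suc by (intro decseq_SucI) auto
   show "emeasure lborel (?A k) \<noteq> \<infinity>" for k
    using emeasure_bounded_finite[of "?A k"] compact_Cn[of "k + n"]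
    by (simp add: bounded_Int compact_imp_bounded)
  qed
  moreover have "(\<Inter>k. ?A k) = cantor \<inter> {0..<xp n i}"
  proof -
   have "(\<Inter>k. Cn (k + n)) = cantor"
    unfolding cantor_def using decseq_Cn
    by (auto simp: decseq_def) (meson le_add1 subsetD)
   thus ?thesis by auto
  qed
  moreover have "(\<lambda>k. measure lborel (?A k)) \<longlonglongrightarrow> real i / 2 ^ n"
  proof -
   have "measure lborel (?A k) = real i / 2 ^ n + real i / (3 * 2 ^ n * 4 ^ n) * 2 ^ n* (1/2) ^ k" for k
   proof -
    have "2 ^ k * i \<le> 2 ^ (k + n)" using assms by (simp add: power_add)
    from measure_Cn[OF this] have "measure lborel (?A k) = real (2 ^ k * i) * (1 / 2 ^ (k + n) + 1 / (3 * 4 ^ (k + n)))"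
     by (simp only: xp_pow)
    also have "\<dots> = real i / 2 ^ n + real i / (3 * 4 ^ n) * (2 ^ k / 4 ^ k)"
     by (simp add: power_add field_simps)
    also have "(2 ^ k / 4 ^ k :: real) = (1/2) ^ k" by (simp flip: power_divide)
    finally show ?thesis by simp
   qed
   moreover have "(\<lambda>k. real i / 2 ^ n + real i / (3 * 2 ^ n * 4 ^ n) * 2 ^ n * (1/2) ^ k) \<longlonglongrightarrow> real i / 2 ^ n + real i / (3 * 2 ^ n * 4 ^ n) * 2 ^ n * 0"
    by (intro tendsto_intros LIMSEQ_realpow_zero) auto
   ultimately show ?thesis by simp
  qed
  ultimately show ?thesis using LIMSEQ_unique by fastforce
qed

section \<open>Green's formula for shear flows with rough walls\<close>

lemma integrable_bdd:
  fixes f :: "'a::euclidean_space \<Rightarrow> real"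
  assumes "f \<in> Bor" "\<And>x. \<bar>f x\<bar> \<le> K" "bounded S" "\<And>x. x \<notin> S \<Longrightarrow> f x = 0"
  shows "integrable lborel f"
proof -
  obtain a where a: "S \<subseteq> cbox (-a) a" using bounded_subset_cbox_symmetric[OF assms(3)] by blast
  show ?thesis
   by (rule integrableI_bounded_set[where A="cbox (-a) a" and B=K])
    (use assms a in \<open>auto simp: emeasure_lborel_cbox_eq\<close>)
qed

lemma fubini_xy:
  fixes f :: "'a::euclidean_space \<times> 'b::euclidean_space \<Rightarrow> real"
  assumes "integrable lborel f"
  shows "(LINT p|lborel. f p) = (LINT x|lborel. LINT y|lborel. f (x, y))"
   and "(LINT p|lborel. f p) = (LINT y|lborel. LINT x|lborel. f (x, y))"
proof -
  have f: "integrable (lborel \<Otimes>\<^sub>M lborel) f" using assms by (simp only: lborel_prod)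
  show "(LINT p|lborel. f p) = (LINT x|lborel. LINT y|lborel. f (x, y))"
   using lborel_pair.integral_fst'[OF f] by (simp only: lborel_prod)
  have "integrable (lborel \<Otimes>\<^sub>M lborel) (\<lambda>(x, y). f (x, y))" using f by simp
  from lborel_pair.integral_snd[OF this]
  show "(LINT p|lborel. f p) = (LINT y|lborel. LINT x|lborel. f (x, y))"
   by (simp add: lborel_prod)
qed

lemma borel_param_integral:
  fixes h :: "'a::second_countable_topology \<times> 'b::euclidean_space \<Rightarrow> real"
  assumes "h \<in> Bor"
  shows "(\<lambda>p. LINT u|lborel. h (p, u)) \<in> Bor"
proof -
  have h: "h \<in> borel_measurable (borel \<Otimes>\<^sub>M borel)" using assms by (simp add: borel_prod)
  have "sets (borel \<Otimes>\<^sub>M borel :: ('a \<times> 'b) measure) = sets (borel \<Otimes>\<^sub>M lborel)"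
   by (intro sets_pair_measure_cong) auto
  from measurable_cong_sets[OF this refl] show ?thesis
   using h by (intro lborel.borel_measurable_lebesgue_integral) (simp add: case_prod_unfold)
qed

text \<open>A C^1 test function of x, y and time with named partial derivatives. Periodic smooth
  test functions enter through \<open>slice_test3\<close>, which freezes the third space
  coordinate.\<close>

definition test3 :: "(real \<times> real \<times> real \<Rightarrow> real) \<Rightarrow> (real \<times> real \<times> real \<Rightarrow> real) \<Rightarrow>
   (real \<times> real \<times> real \<Rightarrow> real) \<Rightarrow> (real \<times> real \<times> real \<Rightarrow> real) \<Rightarrow> bool" where
  "test3 ph phx phy pht \<longleftrightarrow>
   (\<forall>p. (ph has_derivative (\<lambda>(a, b, c). a * phx p + b * phy p + c * pht p)) (at p)) \<and>
   cont phx \<and> cont phy \<and> cont pht"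

lemma test3_continuous: "test3 ph phx phy pht \<Longrightarrow> cont ph"
  unfolding test3_def continuous_on_eq_continuous_within by (blast intro: has_derivative_continuous)

lemma test3_chain:
  assumes "test3 ph phx phy pht"
   "(X has_real_derivative X') (at u within S)" "(Y has_real_derivative Y') (at u within S)"
   "(Z has_real_derivative Z') (at u within S)"
  shows "((\<lambda>u. ph (X u, Y u, Z u)) has_real_derivative
   (X' * phx (X u, Y u, Z u) + Y' * phy (X u, Y u, Z u) + Z' * pht (X u, Y u, Z u))) (at u within S)"
proof -
  have d: "(ph has_derivative (\<lambda>(a, b, c). a * phx (X u, Y u, Z u) + b * phy (X u, Y u, Z u) + c * pht (X u, Y u, Z u)))
    (at (X u, Y u, Z u))"
   using assms(1) by (auto simp: test3_def)
  have "((\<lambda>u. (X u, Y u, Z u)) has_derivative (\<lambda>h. (X' * h, Y' * h, Z' * h))) (at u within S)"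
   using assms(2-4) unfolding has_field_derivative_def by (intro has_derivative_Pair)
  from has_derivative_compose[OF this d] show ?thesis
   unfolding has_field_derivative_def by (rule has_derivative_eq_rhs) (auto simp: algebra_simps)
qed

definition prim :: "(real \<Rightarrow> real) \<Rightarrow> real \<Rightarrow> real" where
  "prim f x = (LBINT u:{0..x}. f u)"

lemma prim_continuous_deriv:
  assumes "cont f" "0 \<le> x0" "x \<in> {x0..x1}"
  shows "(prim f has_real_derivative f x) (at x within {x0..x1})"
proof -
  have c: "continuous_on S f" for S using assms(1) continuous_on_subset by blast
  have "prim f = (\<lambda>u. integral {0..u} f)"
   unfolding prim_def by (intro ext set_borel_integral_eq_integral borel_integrable_atLeastAtMost' c)
  moreover have "((\<lambda>u. integral {0..u} f) has_vector_derivative f x) (at x within {0..x1})"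
   using assms by (intro integral_has_vector_derivative c) auto
  ultimately have "(prim f has_vector_derivative f x) (at x within {0..x1})"
   by simp
  hence "(prim f has_vector_derivative f x) (at x within {x0..x1})"
   by (rule has_vector_derivative_within_subset) (use assms in auto)
  thus ?thesis by (simp add: has_real_derivative_iff_has_vector_derivative)
qed

lemma set_integrable_bdd:
  fixes f :: "real \<Rightarrow> real"
  assumes "f \<in> Bor" "\<And>x. \<bar>f x\<bar> \<le> K" "S \<in> sets borel" "bounded S"
  shows "set_integrable lborel S f"
  unfolding set_integrable_def
proof (rule integrable_bdd[where K=K and S=S])
  show "\<bar>ind S x *\<^sub>R f x\<bar> \<le> K" for x
   using assms(2)[of x] by (auto simp: indicator_def)
qed (use assms in auto)

lemma prim_diff:
  assumes "f \<in> Bor" "\<And>x. \<bar>f x\<bar> \<le> K" "0 \<le> x" "x \<le> y"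
  shows "prim f y - prim f x = (LBINT u:{x<..y}. f u)"
proof -
  have "{0..y} = {0..x} \<union> {x<..y}" using assms by auto
  moreover have "(LBINT u:{0..x} \<union> {x<..y}. f u) = (LBINT u:{0..x}. f u) + (LBINT u:{x<..y}. f u)"
   by (rule set_integral_Un) (auto intro!: set_integrable_bdd assms)
  ultimately show ?thesis unfolding prim_def by simp
qed

lemma prim_lipschitz:
  assumes "f \<in> Bor" "\<And>x. \<bar>f x\<bar> \<le> K" "0 \<le> x" "x \<le> y"
  shows "\<bar>prim f y - prim f x\<bar> \<le> K * (y - x)"
proof -
  have K: "0 \<le> K" using assms(2)[of 0] by linarith
  have "\<bar>LBINT u:{x<..y}. f u\<bar> \<le> (LBINT u:{x<..y}. K)"
   unfolding set_int_def
  proof (rule integral_abs_bound[THEN order_trans], rule integral_mono)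
   show "integrable lborel (\<lambda>u. \<bar>ind {x<..y} u *\<^sub>R f u\<bar>)"
    using set_integrable_bdd[OF assms(1,2), of "{x<..y}"] by (intro integrable_abs) (simp add: set_integrable_def)
   show "integrable lborel (\<lambda>u. ind {x<..y} u *\<^sub>R K)"
    using set_integrable_bdd[of "\<lambda>_. K" K "{x<..y}"] K by (simp add: set_integrable_def)
   show "\<bar>ind {x<..y} u *\<^sub>R f u\<bar> \<le> ind {x<..y} u *\<^sub>R K" for u
    using assms(2)[of u] by (auto simp: indicator_def)
  qed
  also have "\<dots> = K * (y - x)" using assms(4) by (simp add: set_int_def)
  finally show ?thesis using prim_diff[OF assms] by simp
qed

lemma prim_neg: "x < 0 \<Longrightarrow> prim f x = 0"
  by (simp add: prim_def set_int_def)

lemma prim_0: "prim f 0 = 0"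
proof -
  have "AE u in lborel. ind {0..0} u *\<^sub>R f u = 0"
   using AE_lborel_singleton[of 0] by eventually_elim (auto simp: indicator_def)
  thus ?thesis unfolding prim_def set_int_def
   by (rule integral_eq_zero_AE)
qed

lemma prim_continuous:
  assumes "f \<in> Bor" "\<And>x. \<bar>f x\<bar> \<le> K"
  shows "cont (prim f)"
proof -
  have K: "0 \<le> K" using assms(2)[of 0] by linarith
  have "\<bar>prim f y - prim f x\<bar> \<le> K * (y - x)" if "x \<le> y" for x y
  proof (cases "0 \<le> x")
   case True thus ?thesis using prim_lipschitz[OF assms] that by blast
  next
   case False
   show ?thesis
   proof (cases "0 \<le> y")
    case True
    have "\<bar>prim f y - prim f 0\<bar> \<le> K * (y - 0)" using prim_lipschitz[OF assms] True by blast
    also have "\<dots> \<le> K * (y - x)" using False K by (intro mult_left_mono) auto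
    finally show ?thesis using False by (simp add: prim_neg prim_0)
   next
    case False thus ?thesis using that K by (simp add: prim_neg)
   qed
  qed
  hence "K-lipschitz_on UNIV (prim f)"
  proof (intro lipschitz_onI)
   fix x y :: real
   assume "\<And>x y. x \<le> y \<Longrightarrow> \<bar>prim f y - prim f x\<bar> \<le> K * (y - x)"
   from this[of x y] this[of y x] show "dist (prim f x) (prim f y) \<le> K * dist x y"
    by (cases "x \<le> y") (simp_all add: dist_real_def abs_minus_commute)
  qed (rule K)
  thus ?thesis by (rule lipschitz_on_continuous_on)
qed

lemma prim_bounds:
  assumes "f \<in> Bor" "\<And>x. f x \<in> {0..1}" "0 \<le> x"
  shows "prim f x \<in> {0..x}"
proof -
  have "\<bar>f x\<bar> \<le> 1" for x using assms(2)[of x] by auto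
  from prim_lipschitz[OF assms(1) this, of 0 x] have "prim f x \<le> x" using assms(3) by (simp add: prim_0)
  moreover have "0 \<le> prim f x" unfolding prim_def set_int_def
   using assms(2) by (intro integral_nonneg_AE) auto
  ultimately show ?thesis by simp
qed

text \<open>\<open>dtr\<close> is the derivative of \<open>(x, y) \<mapsto> ph (x, y, s + \<tau>)\<close> along the shear flow \<open>(2 b y, - a x)\<close>,
  where \<open>\<tau> = (x - A x) / 2 - y\<close> and \<open>A\<close> is the primitive of \<open>a\<close>. If \<open>a\<close> and \<open>b\<close> are 0 or 1,
  then \<open>\<tau>\<close> is a travel time except where both vanish.\<close>

definition dtr where
  "dtr a b phx phy pht x y (q :: real \<times> real \<times> real) =
   2 * b y * (phx q + (1 - a x) / 2 * pht q) - a x * (phy q - pht q :: real)" for a b :: "real \<Rightarrow> real"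

definition pos :: "(real \<Rightarrow> real) \<Rightarrow> real \<Rightarrow> real \<Rightarrow> real \<Rightarrow> real \<times> real \<times> real" where
  "pos A s x y = (x, y, s + (x - A x) / 2 - y)"

lemma set_integral_rect:
  fixes f :: "plane \<Rightarrow> real"
  assumes "continuous_on ({x0..x1} \<times> {y0..y1}) f"
  shows "(LINT p:{x0..x1} \<times> {y0..y1}|lborel. f p) = (LBINT y:{y0..y1}. LBINT x:{x0..x1}. f (x, y))"
   and "(LINT p:{x0..x1} \<times> {y0..y1}|lborel. f p) = (LBINT x:{x0..x1}. LBINT y:{y0..y1}. f (x, y))"
proof -
  have i: "integrable lborel (\<lambda>p. ind ({x0..x1} \<times> {y0..y1}) p *\<^sub>R f p)"
   by (intro borel_integrable_compact compact_Times compact_Icc assms)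
  show "(LINT p:{x0..x1} \<times> {y0..y1}|lborel. f p) = (LBINT y:{y0..y1}. LBINT x:{x0..x1}. f (x, y))"
   unfolding set_int_def fubini_xy(2)[OF i]
  proof (rule int_cong[OF refl])
   fix y
   show "(LBINT x. ind ({x0..x1} \<times> {y0..y1}) (x, y) *\<^sub>R f (x, y)) =
    ind {y0..y1} y *\<^sub>R (LBINT x. ind {x0..x1} x *\<^sub>R f (x, y))"
    unfolding real_scaleR_def integral_mult_right_zero[symmetric]
    by (rule int_cong[OF refl]) (simp add: indicator_times)
  qed
  show "(LINT p:{x0..x1} \<times> {y0..y1}|lborel. f p) = (LBINT x:{x0..x1}. LBINT y:{y0..y1}. f (x, y))"
   unfolding set_int_def fubini_xy(1)[OF i]
  proof (rule int_cong[OF refl])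
   fix x
   show "(LBINT y. ind ({x0..x1} \<times> {y0..y1}) (x, y) *\<^sub>R f (x, y)) =
    ind {x0..x1} x *\<^sub>R (LBINT y. ind {y0..y1} y *\<^sub>R f (x, y))"
    unfolding real_scaleR_def integral_mult_right_zero[symmetric]
    by (rule int_cong[OF refl]) (simp add: indicator_times)
  qed
qed

text \<open>\<open>A x + 2 * B y\<close> is constant along the field
  \<open>(2 * b y, - a x)\<close>, so the terms with \<open>g'\<close> cancel in
  \<open>2 * b y * Tx - a x * Ty\<close>. What remains is the derivative of the test function, and
  the fundamental theorem is applied in x to one term and in y to the other. The factor g later
  selects a band of streamlines.\<close>

lemma green_smooth:
  fixes a b g g' :: "real \<Rightarrow> real" and s :: real
  assumes t3: "test3 ph phx phy pht" and ab: "cont a" "cont b"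
   and g: "\<And>h. (g has_real_derivative g' h) (at h)" "cont g'"
   and x: "0 \<le> x0" "x0 \<le> x1" and y: "0 \<le> y0" "y0 \<le> y1"
  defines "A \<equiv> prim a" and "B \<equiv> prim b"
  defines "Th \<equiv> \<lambda>x y. g (A x + 2 * B y) * ph (pos A s x y)"
  shows "(LINT p:{x0..x1} \<times> {y0..y1}|lborel. g (A (fst p) + 2 * B (snd p)) *
    dtr a b phx phy pht (fst p) (snd p) (pos A s (fst p) (snd p))) =
   (LBINT y:{y0..y1}. 2 * b y * (Th x1 y - Th x0 y)) - (LBINT x:{x0..x1}. a x * (Th x y1 - Th x y0))"
proof -
  let ?X = "{x0..x1}" and ?Y = "{y0..y1}"
  note cph = test3_continuous[OF t3]
  have cph': "cont phx" "cont phy" "cont pht" using t3 by (auto simp: test3_def)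
  have dA: "(A has_real_derivative a x) (at x within ?X)" if "x \<in> ?X" for x
   unfolding A_def by (rule prim_continuous_deriv) (use ab x that in auto)
  have dB: "(B has_real_derivative b y) (at y within ?Y)" if "y \<in> ?Y" for y
   unfolding B_def by (rule prim_continuous_deriv) (use ab y that in auto)
  have cA: "continuous_on ?X A" by (rule DERIV_continuous_on) (rule dA)
  have cB: "continuous_on ?Y B" by (rule DERIV_continuous_on) (rule dB)
  have cg: "cont g" by (rule DERIV_continuous_on) (rule g(1))
  define Tx where "Tx = (\<lambda>x y. g' (A x + 2 * B y) * a x * ph (pos A s x y) +
    g (A x + 2 * B y) * (phx (pos A s x y) + (1 - a x) / 2 * pht (pos A s x y)))"
  define Ty where "Ty = (\<lambda>x y. g' (A x + 2 * B y) * (2 * b y) * ph (pos A s x y) +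
    g (A x + 2 * B y) * (phy (pos A s x y) - pht (pos A s x y)))"
  have gd: "((\<lambda>u. g (f u)) has_real_derivative g' (f u) * f') (at u within S)"
   if "(f has_real_derivative f') (at u within S)" for f f' u S
   by (rule DERIV_chain2[OF g(1) that])
  have dx: "((\<lambda>x. Th x y) has_real_derivative Tx x y) (at x within ?X)" if "x \<in> ?X" for x y
  proof -
   have 1: "((\<lambda>x. A x + 2 * B y) has_real_derivative a x) (at x within ?X)"
    by (auto intro!: derivative_eq_intros dA[OF that])
   have 2: "((\<lambda>x. s + (x - A x) / 2 - y) has_real_derivative (1 - a x) / 2) (at x within ?X)"
    by (auto intro!: derivative_eq_intros dA[OF that])
   show ?thesis
    unfolding Th_def Tx_def pos_def
    by (rule DERIV_cong[OF DERIV_mult[OF gd[OF 1] test3_chain[OF t3 DERIV_ident DERIV_const 2]]])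
     (simp add: algebra_simps)
  qed
  have dy: "((\<lambda>y. Th x y) has_real_derivative Ty x y) (at y within ?Y)" if "y \<in> ?Y" for x y
  proof -
   have 1: "((\<lambda>y. A x + 2 * B y) has_real_derivative 2 * b y) (at y within ?Y)"
    by (auto intro!: derivative_eq_intros dB[OF that])
   have 2: "((\<lambda>y. s + (x - A x) / 2 - y) has_real_derivative - 1) (at y within ?Y)"
    by (auto intro!: derivative_eq_intros)
   show ?thesis
    unfolding Th_def Ty_def pos_def
    by (rule DERIV_cong[OF DERIV_mult[OF gd[OF 1] test3_chain[OF t3 DERIV_const DERIV_ident 2]]])
     (simp add: algebra_simps)
  qed
  have proj: "continuous_on (?X \<times> ?Y) (\<lambda>p. A (fst p))" "continuous_on (?X \<times> ?Y) (\<lambda>p. B (snd p))"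
   "continuous_on (?X \<times> ?Y) (\<lambda>p. a (fst p))" "continuous_on (?X \<times> ?Y) (\<lambda>p. b (snd p))"
   by (auto intro!: continuous_on_compose2[OF cA] continuous_on_compose2[OF cB]
     continuous_on_compose2[OF ab(1)] continuous_on_compose2[OF ab(2)] continuous_intros)
  have cpos: "continuous_on (?X \<times> ?Y) (\<lambda>p. pos A s (fst p) (snd p))"
   unfolding pos_def by (intro continuous_intros proj; simp)
  note comp = continuous_on_compose2[OF cg _ subset_UNIV] continuous_on_compose2[OF g(2) _ subset_UNIV]
   continuous_on_compose2[OF cph cpos subset_UNIV] continuous_on_compose2[OF cph'(1) cpos subset_UNIV]
   continuous_on_compose2[OF cph'(2) cpos subset_UNIV] continuous_on_compose2[OF cph'(3) cpos subset_UNIV]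
  have cTx: "continuous_on (?X \<times> ?Y) (\<lambda>p. Tx (fst p) (snd p))"
   and cTy: "continuous_on (?X \<times> ?Y) (\<lambda>p. Ty (fst p) (snd p))"
   unfolding Tx_def Ty_def by (intro continuous_intros proj comp; simp)+
  have cPx: "continuous_on (?X \<times> ?Y) (\<lambda>p. 2 * b (snd p) * Tx (fst p) (snd p))"
   and cPy: "continuous_on (?X \<times> ?Y) (\<lambda>p. a (fst p) * Ty (fst p) (snd p))"
   by (intro continuous_intros proj cTx cTy)+
  have sx: "continuous_on ?X (\<lambda>x. Tx x y)" if "y \<in> ?Y" for y
   using continuous_on_compose2[OF cTx, of ?X "\<lambda>x. (x, y)"] that by (simp add: image_subset_iff continuous_on_Pair)
  have sy: "continuous_on ?Y (\<lambda>y. Ty x y)" if "x \<in> ?X" for x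
   using continuous_on_compose2[OF cTy, of ?Y "\<lambda>y. (x, y)"] that by (simp add: image_subset_iff continuous_on_Pair)
  have Fx: "(LBINT x:?X. Tx x y) = Th x1 y - Th x0 y" if "y \<in> ?Y" for y
   unfolding set_int_def using dx that x sx
   by (intro integral_FTC_atLeastAtMost) (auto simp: has_real_derivative_iff_has_vector_derivative)
  have Fy: "(LBINT y:?Y. Ty x y) = Th x y1 - Th x y0" if "x \<in> ?X" for x
   unfolding set_int_def using dy that y sy
   by (intro integral_FTC_atLeastAtMost) (auto simp: has_real_derivative_iff_has_vector_derivative)
  have int: "set_integrable lborel (?X \<times> ?Y) f" if "continuous_on (?X \<times> ?Y) f" for f :: "plane \<Rightarrow> real"
   unfolding set_integrable_def by (intro borel_integrable_compact compact_Times compact_Icc that)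
  have "(LINT p:?X \<times> ?Y|lborel. g (A (fst p) + 2 * B (snd p)) *
    dtr a b phx phy pht (fst p) (snd p) (pos A s (fst p) (snd p))) =
   (LINT p:?X \<times> ?Y|lborel. 2 * b (snd p) * Tx (fst p) (snd p) - a (fst p) * Ty (fst p) (snd p))"
   by (rule arg_cong[where f="\<lambda>f. set_lebesgue_integral lborel _ f"])
    (auto simp: dtr_def Tx_def Ty_def algebra_simps)
  also have "\<dots> = (LINT p:?X \<times> ?Y|lborel. 2 * b (snd p) * Tx (fst p) (snd p)) -
    (LINT p:?X \<times> ?Y|lborel. a (fst p) * Ty (fst p) (snd p))"
   by (rule set_integral_diff(2)[OF int int]) (rule cPx cPy)+
  also have "(LINT p:?X \<times> ?Y|lborel. 2 * b (snd p) * Tx (fst p) (snd p)) =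
    (LBINT y:?Y. LBINT x:?X. 2 * b y * Tx x y)"
   using set_integral_rect(1)[OF cPx] by simp
  also have "\<dots> = (LBINT y:?Y. 2 * b y * (Th x1 y - Th x0 y))"
   by (rule set_lebesgue_integral_cong) (auto simp: Fx)
  also have "(LINT p:?X \<times> ?Y|lborel. a (fst p) * Ty (fst p) (snd p)) =
    (LBINT x:?X. LBINT y:?Y. a x * Ty x y)"
   using set_integral_rect(2)[OF cPy] by simp
  also have "\<dots> = (LBINT x:?X. a x * (Th x y1 - Th x y0))"
   by (rule set_lebesgue_integral_cong) (auto simp: Fy)
  finally show ?thesis .
qed

lemma dct_bdd:
  fixes f :: "nat \<Rightarrow> 'a::euclidean_space \<Rightarrow> real"
  assumes "\<And>k. f k \<in> Bor" "g \<in> Bor"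
   and S: "S \<in> sets borel" "bounded S"
   and "\<And>k x. x \<in> S \<Longrightarrow> \<bar>f k x\<bar> \<le> K" "\<And>x. x \<in> S \<Longrightarrow> (\<lambda>k. f k x) \<longlonglongrightarrow> g x"
  shows "(\<lambda>k. LINT x:S|lborel. f k x) \<longlonglongrightarrow> (LINT x:S|lborel. g x)"
  unfolding set_int_def
proof (rule integral_dominated_convergence[where w="\<lambda>x. ind S x * \<bar>K\<bar>"])
  show "integrable lborel (\<lambda>x. ind S x * \<bar>K\<bar>)"
   using S by (intro integrable_bdd[where K="\<bar>K\<bar>" and S=S]) (auto simp: indicator_def)
  show "AE x in lborel. (\<lambda>k. ind S x *\<^sub>R f k x) \<longlonglongrightarrow> ind S x *\<^sub>R g x"
   using assms(6) by (intro AE_I2) (auto simp: indicator_def)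
  show "AE x in lborel. norm (ind S x *\<^sub>R f k x) \<le> ind S x * \<bar>K\<bar>" for k
   using assms(5)[of _ k] by (intro AE_I2) (force simp: indicator_def)
qed (use assms in auto)

definition gleft where
  "gleft g a b phx phy pht s x0 x1 y0 y1 = (LINT p:{x0..x1} \<times> {y0..y1}|lborel.
    g (prim a (fst p) + 2 * prim b (snd p)) *
    dtr a b phx phy pht (fst p) (snd p) (pos (prim a) s (fst p) (snd p)) :: real)"

definition thet where
  "thet g a b ph s x y = g (prim a x + 2 * prim b y) * (ph (pos (prim a) s x y) :: real)"

definition gright where
  "gright g a b ph s x0 x1 y0 y1 =
   (LBINT y:{y0..y1}. 2 * b y * (thet g a b ph s x1 y - thet g a b ph s x0 y)) -
   (LBINT x:{x0..x1}. a x * (thet g a b ph s x y1 - thet g a b ph s x y0))"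

lemma pos_measurable [measurable]:
  assumes [measurable]: "A \<in> Bor"
  shows "(\<lambda>p. pos A s (fst p) (snd p)) \<in> Bor"
  unfolding pos_def by (simp flip: borel_prod)

lemma prim_measurable: "a \<in> Bor \<Longrightarrow> (\<And>x. a x \<in> {0..1}) \<Longrightarrow> prim a \<in> Bor"
proof (rule Bor_contI[OF prim_continuous[where K=1]])
  fix x assume "\<And>x. a x \<in> {0..1}"
  from this[of x] show "\<bar>a x\<bar> \<le> 1" by auto
qed

lemma test3_bounded:
  assumes "test3 ph phx phy pht" "compact Q"
  obtains M where "\<And>q. q \<in> Q \<Longrightarrow> \<bar>ph q\<bar> \<le> M \<and> \<bar>phx q\<bar> \<le> M \<and> \<bar>phy q\<bar> \<le> M \<and> \<bar>pht q\<bar> \<le> M" "0 \<le> M"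
proof -
  have b: "\<exists>M. \<forall>q\<in>Q. \<bar>f q\<bar> \<le> M" if "cont f" for f :: "real \<times> real \<times> real \<Rightarrow> real"
  proof -
   have "bounded (f ` Q)"
    by (intro compact_imp_bounded compact_continuous_image assms continuous_on_subset[OF that]) auto
   thus ?thesis by (auto simp: bounded_iff)
  qed
  obtain M1 M2 M3 M4 where "\<forall>q\<in>Q. \<bar>ph q\<bar> \<le> M1" "\<forall>q\<in>Q. \<bar>phx q\<bar> \<le> M2" "\<forall>q\<in>Q. \<bar>phy q\<bar> \<le> M3" "\<forall>q\<in>Q. \<bar>pht q\<bar> \<le> M4"
   using b[OF test3_continuous[OF assms(1)]] b[of phx] b[of phy] b[of pht] assms(1) unfolding test3_def by blast
  thus thesis
   by (intro that[of "\<bar>M1\<bar> + \<bar>M2\<bar> + \<bar>M3\<bar> + \<bar>M4\<bar>"]) fastforce+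
qed

lemma dtr_bound:
  assumes "\<bar>phx q\<bar> \<le> M" "\<bar>phy q\<bar> \<le> M" "\<bar>pht q\<bar> \<le> M" "a x \<in> {0..1}" "b y \<in> {0..1}"
  shows "\<bar>dtr a b phx phy pht x y q\<bar> \<le> 5 * M"
proof -
  have M: "0 \<le> M" using assms(1) by linarith
  have 1: "\<bar>(1 - a x) / 2 * pht q\<bar> \<le> 1 / 2 * M"
   unfolding abs_mult using assms by (intro mult_mono) auto
  have "\<bar>b y * (phx q + (1 - a x) / 2 * pht q)\<bar> \<le> 1 * (3 / 2 * M)"
   unfolding abs_mult
  proof (intro mult_mono)
   show "\<bar>phx q + (1 - a x) / 2 * pht q\<bar> \<le> 3 / 2 * M"
    using abs_triangle_ineq[of "phx q" "(1 - a x) / 2 * pht q"] assms(1) 1 by linarith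
  qed (use assms M in auto)
  moreover have "\<bar>a x * (phy q - pht q)\<bar> \<le> 1 * (2 * M)"
   unfolding abs_mult using assms M by (intro mult_mono) auto
  ultimately show ?thesis unfolding dtr_def by linarith
qed

lemma prim_tendsto:
  assumes "\<And>k. ak k \<in> Bor" "\<And>k x. ak k x \<in> {0..1}" "a \<in> Bor" "\<And>x. (\<lambda>k. ak k x) \<longlonglongrightarrow> a x"
  shows "(\<lambda>k. prim (ak k) x) \<longlonglongrightarrow> prim a x"
  unfolding prim_def by (rule dct_bdd[where K=1]) (use assms in \<open>auto simp: abs_le_iff intro: order_trans\<close>)

lemma pos_box:
  assumes "x \<in> {x0..x1}" "y \<in> {y0..y1}" "0 \<le> x0" "A x \<in> {0..x}"
  shows "pos A s x y \<in> {x0..x1} \<times> {y0..y1} \<times> {s - y1..s + x1 - y0}"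
proof -
  have "0 \<le> (x - A x) / 2" "(x - A x) / 2 \<le> x" using assms by auto
  moreover have "x \<le> x1" "y0 \<le> y" "y \<le> y1" using assms by auto
  ultimately have "s - y1 \<le> s + (x - A x) / 2 - y" "s + (x - A x) / 2 - y \<le> s + x1 - y0" by linarith+
  thus ?thesis using assms by (simp add: pos_def)
qed

lemma comp_measurable:
  assumes [measurable]: "a \<in> Bor" "b \<in> Bor" "g \<in> Bor"
   and r: "\<And>x. a x \<in> {0..1}" "\<And>x. b x \<in> {0..1}"
   and c [measurable]: "ph \<in> Bor" "phx \<in> Bor"
    "phy \<in> Bor" "pht \<in> Bor"
  shows "(\<lambda>p. g (prim a (fst p) + 2 * prim b (snd p)) *
    dtr a b phx phy pht (fst p) (snd p) (pos (prim a) s (fst p) (snd p))) \<in> Bor"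
   and "(\<lambda>y. 2 * b y * (thet g a b ph s x1 y - thet g a b ph s x0 y)) \<in> Bor"
   and "(\<lambda>x. a x * (thet g a b ph s x y1 - thet g a b ph s x y0)) \<in> Bor"
proof -
  have [measurable]: "prim a \<in> Bor" "prim b \<in> Bor"
   using prim_measurable r by auto
  have [measurable]: "(\<lambda>y. pos (prim a) s x y) \<in> Bor" for x
   unfolding pos_def by (simp flip: borel_prod)
  have [measurable]: "(\<lambda>x. pos (prim a) s x y) \<in> Bor" for y
   unfolding pos_def by (simp flip: borel_prod)
  have [measurable]: "(\<lambda>p. pos (prim a) s (fst p) (snd p)) \<in> borel \<rightarrow>\<^sub>M borel" by measurable
  have [measurable]: "fst \<in> borel \<rightarrow>\<^sub>M (borel :: real measure)" "snd \<in> borel \<rightarrow>\<^sub>M (borel :: real measure)"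
   using Bor_contI[OF continuous_on_fst[OF continuous_on_id]]
    Bor_contI[OF continuous_on_snd[OF continuous_on_id]] by simp_all
  show "(\<lambda>p. g (prim a (fst p) + 2 * prim b (snd p)) *
    dtr a b phx phy pht (fst p) (snd p) (pos (prim a) s (fst p) (snd p))) \<in> Bor"
   unfolding dtr_def by measurable
  show "(\<lambda>y. 2 * b y * (thet g a b ph s x1 y - thet g a b ph s x0 y)) \<in> Bor"
   unfolding thet_def by measurable
  show "(\<lambda>x. a x * (thet g a b ph s x y1 - thet g a b ph s x y0)) \<in> Bor"
   unfolding thet_def by measurable
qed

text \<open>The formula contains the coefficients only through their values and their primitives,
  never through derivatives. Bounded pointwise limits therefore pass through both sides by dominated
  convergence, which admits discontinuous a and b.\<close>

lemma green_measurable: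
  fixes a b g g' :: "real \<Rightarrow> real" and s :: real
  assumes t3: "test3 ph phx phy pht"
   and ak: "\<And>k. cont (ak k)" "\<And>k x. ak k x \<in> {0..1}" "\<And>x. (\<lambda>k. ak k x) \<longlonglongrightarrow> a x"
   and bk: "\<And>k. cont (bk k)" "\<And>k x. bk k x \<in> {0..1}" "\<And>x. (\<lambda>k. bk k x) \<longlonglongrightarrow> b x"
   and g: "\<And>h. (g has_real_derivative g' h) (at h)" "cont g'" "\<And>h. \<bar>g h\<bar> \<le> 1"
   and x: "0 \<le> x0" "x0 \<le> x1" and y: "0 \<le> y0" "y0 \<le> y1"
  shows "gleft g a b phx phy pht s x0 x1 y0 y1 = gright g a b ph s x0 x1 y0 y1"
proof -
  have mk: "ak k \<in> Bor" "bk k \<in> Bor" for k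
   using ak bk by (auto intro: Bor_contI)
  have m: "a \<in> Bor" "b \<in> Bor"
   by (rule borel_measurable_LIMSEQ_real[OF _ mk(1)], rule ak) (rule borel_measurable_LIMSEQ_real[OF _ mk(2)], rule bk)
  have r: "a x \<in> {0..1}" "b x \<in> {0..1}" for x
   using closed_sequentially[of "{0..1}" "\<lambda>k. ak k x" "a x"] closed_sequentially[of "{0..1}" "\<lambda>k. bk k x" "b x"]
    ak(2,3) bk(2,3) by blast+
  have cg: "cont g" by (rule DERIV_continuous_on) (rule g(1))
  have c: "cont ph" "cont phx" "cont phy" "cont pht"
   using t3 test3_continuous[OF t3] by (simp_all add: test3_def)
  note mm = Bor_contI[OF cg] Bor_contI[OF c(1)] Bor_contI[OF c(2)]
   Bor_contI[OF c(3)] Bor_contI[OF c(4)]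
  \<comment> \<open>\<open>prim\<close> stays between 0 and x for every coefficient with values in
    [0, 1], so this one compact box contains \<open>pos\<close> for all k and supplies a common
    bound.\<close>
  let ?Q = "{x0..x1} \<times> {y0..y1} \<times> {s - y1..s + x1 - y0}"
  obtain M where M: "\<And>q. q \<in> ?Q \<Longrightarrow> \<bar>ph q\<bar> \<le> M \<and> \<bar>phx q\<bar> \<le> M \<and> \<bar>phy q\<bar> \<le> M \<and> \<bar>pht q\<bar> \<le> M" "0 \<le> M"
   by (rule test3_bounded[OF t3 compact_Times[OF compact_Icc compact_Times[OF compact_Icc compact_Icc]]]) blast
  have A: "(\<lambda>k. prim (ak k) x) \<longlonglongrightarrow> prim a x" for x
   by (rule prim_tendsto[OF mk(1) ak(2) m(1) ak(3)])
  have B: "(\<lambda>k. prim (bk k) y) \<longlonglongrightarrow> prim b y" for y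
   by (rule prim_tendsto[OF mk(2) bk(2) m(2) bk(3)])
  have P: "(\<lambda>k. pos (prim (ak k)) s x y) \<longlonglongrightarrow> pos (prim a) s x y" for x y
   unfolding pos_def by (intro tendsto_intros A) simp
  have G: "(\<lambda>k. g (prim (ak k) x + 2 * prim (bk k) y)) \<longlonglongrightarrow> g (prim a x + 2 * prim b y)" for x y
   using cg by (intro isCont_tendsto_compose[of _ g] tendsto_intros A B) (simp add: continuous_on_eq_continuous_at)
  have F: "(\<lambda>k. f (pos (prim (ak k)) s x y)) \<longlonglongrightarrow> f (pos (prim a) s x y)" if "cont f" for x y and f :: "real \<times> real \<times> real \<Rightarrow> real"
   using that by (intro isCont_tendsto_compose[of _ f] P) (simp add: continuous_on_eq_continuous_at del: split_paired_All)
  have T: "(\<lambda>k. thet g (ak k) (bk k) ph s x y) \<longlonglongrightarrow> thet g a b ph s x y" for x y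
   unfolding thet_def by (intro tendsto_intros G F c)
  have box: "pos (prim (ak k)) s x y \<in> ?Q" if "x \<in> {x0..x1}" "y \<in> {y0..y1}" for x y k
   using that x by (intro pos_box prim_bounds mk ak) auto
  have Tb: "\<bar>thet g (ak k) (bk k) ph s x y\<bar> \<le> M" if "x \<in> {x0..x1}" "y \<in> {y0..y1}" for k x y
  proof -
   have "\<bar>thet g (ak k) (bk k) ph s x y\<bar> \<le> 1 * M"
    unfolding thet_def abs_mult using M(1)[OF box[OF that, of k]] M(2) by (intro mult_mono g) auto
   thus ?thesis by simp
  qed
  have L: "(\<lambda>k. gleft g (ak k) (bk k) phx phy pht s x0 x1 y0 y1) \<longlonglongrightarrow> gleft g a b phx phy pht s x0 x1 y0 y1"
   unfolding gleft_def
  proof (rule dct_bdd[where K="1 * (5 * M)"])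
   fix k and p :: "plane" assume p: "p \<in> {x0..x1} \<times> {y0..y1}"
   show "\<bar>g (prim (ak k) (fst p) + 2 * prim (bk k) (snd p)) *
    dtr (ak k) (bk k) phx phy pht (fst p) (snd p) (pos (prim (ak k)) s (fst p) (snd p))\<bar> \<le> 1 * (5 * M)"
    unfolding abs_mult using p M(1)[OF box[of "fst p" "snd p" k]]
    by (intro mult_mono g dtr_bound ak bk) auto
  next
   fix p :: "plane"
   show "(\<lambda>k. g (prim (ak k) (fst p) + 2 * prim (bk k) (snd p)) *
    dtr (ak k) (bk k) phx phy pht (fst p) (snd p) (pos (prim (ak k)) s (fst p) (snd p))) \<longlonglongrightarrow>
    g (prim a (fst p) + 2 * prim b (snd p)) *
    dtr a b phx phy pht (fst p) (snd p) (pos (prim a) s (fst p) (snd p))"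
    unfolding dtr_def by (intro tendsto_intros G F c ak bk) simp
  qed (rule comp_measurable(1)[OF mk mm(1) ak(2) bk(2) mm(2-5)] comp_measurable(1)[OF m mm(1) r mm(2-5)]
    borel_closed closed_Times closed_atLeastAtMost bounded_Times bounded_closed_interval)+
  have R: "(\<lambda>k. gright g (ak k) (bk k) ph s x0 x1 y0 y1) \<longlonglongrightarrow> gright g a b ph s x0 x1 y0 y1"
   unfolding gright_def
  proof (intro tendsto_diff dct_bdd[where K="2 * 1 * (2 * M)"])
   fix k y assume "y \<in> {y0..y1}"
   thus "\<bar>2 * bk k y * (thet g (ak k) (bk k) ph s x1 y - thet g (ak k) (bk k) ph s x0 y)\<bar> \<le> 2 * 1 * (2 * M)"
    unfolding abs_mult using Tb[of x1 y k] Tb[of x0 y k] x bk(2)[of k y] M(2) by (intro mult_mono) auto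
  next
   fix k x assume "x \<in> {x0..x1}"
   hence "\<bar>ak k x * (thet g (ak k) (bk k) ph s x y1 - thet g (ak k) (bk k) ph s x y0)\<bar> \<le> 1 * (2 * M)"
    unfolding abs_mult using Tb[of x y1 k] Tb[of x y0 k] y ak(2)[of k x] M(2) by (intro mult_mono) auto
   thus "\<bar>ak k x * (thet g (ak k) (bk k) ph s x y1 - thet g (ak k) (bk k) ph s x y0)\<bar> \<le> 2 * 1 * (2 * M)"
    using M(2) by linarith
  qed (rule comp_measurable(2,3)[OF mk mm(1) ak(2) bk(2) mm(2-5)] comp_measurable(2,3)[OF m mm(1) r mm(2-5)]
    borel_closed closed_atLeastAtMost bounded_closed_interval tendsto_mult tendsto_diff tendsto_const ak(3) bk(3) T)+
  have "gleft g (ak k) (bk k) phx phy pht s x0 x1 y0 y1 = gright g (ak k) (bk k) ph s x0 x1 y0 y1" for k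
   unfolding gleft_def gright_def thet_def by (rule green_smooth[OF t3 ak(1) bk(1) g(1,2) x y])
  thus ?thesis using LIMSEQ_unique L R by simp
qed

text \<open>Smooth approximation of the indicator of \<open>{h1..}\<close>; the summand 1 makes it converge at \<open>h1\<close> too.\<close>

definition logi :: "real \<Rightarrow> nat \<Rightarrow> real \<Rightarrow> real" where
  "logi h1 k h = 1 / (1 + exp (- (real k * (real k * (h - h1) + 1))))"

lemma logi_deriv:
  "(logi h1 k has_real_derivative real k * real k * exp (- (real k * (real k * (h - h1) + 1))) /
   (1 + exp (- (real k * (real k * (h - h1) + 1))))\<^sup>2) (at h)"
proof -
  have "1 + exp (- (real k * (real k * (h - h1) + 1))) \<noteq> 0"
   using exp_gt_zero[of "- (real k * (real k * (h - h1) + 1))"] by linarith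
  thus ?thesis unfolding logi_def
   by (auto intro!: derivative_eq_intros simp: power2_eq_square)
qed

lemma logi_tendsto: "(\<lambda>k. logi h1 k h) \<longlonglongrightarrow> ind {h1..} h"
proof (cases "h1 \<le> h")
  case True
  have "filterlim (\<lambda>k. real k * (real k * (h - h1) + 1)) at_top sequentially"
   by (rule filterlim_at_top_mono[OF filterlim_real_sequentially])
    (use True in \<open>auto intro!: always_eventually mult_nonneg_nonneg simp: distrib_left\<close>)
  hence "(\<lambda>k. exp (- (real k * (real k * (h - h1) + 1)))) \<longlonglongrightarrow> 0"
   by (intro filterlim_compose[OF exp_at_bot]) (simp add: filterlim_uminus_at_bot)
  hence "(\<lambda>k. logi h1 k h) \<longlonglongrightarrow> 1 / (1 + 0)"
   unfolding logi_def by (intro tendsto_intros) auto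
  thus ?thesis using True by simp
next
  case False
  have "\<forall>\<^sub>F k in sequentially. 2 / (h1 - h) \<le> real k"
   using filterlim_real_sequentially by (simp add: filterlim_at_top)
  hence "\<forall>\<^sub>F k in sequentially. real k \<le> - (real k * (real k * (h - h1) + 1))"
  proof eventually_elim
   case (elim k)
   hence "2 \<le> real k * (h1 - h)" using False by (simp add: field_simps)
   hence "real k * 1 \<le> real k * (real k * (h1 - h) - 1)" by (intro mult_left_mono) auto
   thus ?case by (simp add: algebra_simps)
  qed
  from filterlim_at_top_mono[OF filterlim_real_sequentially this]
  have "filterlim (\<lambda>k. exp (- (real k * (real k * (h - h1) + 1)))) at_top sequentially"
   by (rule filterlim_compose[OF exp_at_top])
  hence "filterlim (\<lambda>k. 1 + exp (- (real k * (real k * (h - h1) + 1)))) at_top sequentially"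
   by (intro filterlim_tendsto_add_at_top[OF tendsto_const])
  hence "(\<lambda>k. logi h1 k h) \<longlonglongrightarrow> 0"
   unfolding logi_def by (intro tendsto_divide_0[OF tendsto_const] filterlim_at_top_imp_at_infinity)
  thus ?thesis using False by simp
qed

lemma closed_indicator_approx:
  assumes "closed D" "D \<noteq> {}"
  shows "(\<lambda>k. min 1 (real k * infdist x D)) \<longlonglongrightarrow> 1 - ind D x"
proof (cases "x \<in> D")
  case True thus ?thesis by simp
next
  case False
  hence "infdist x D > 0" using assms infdist_pos_not_in_closed by blast
  hence "filterlim (\<lambda>k. real k * infdist x D) at_top sequentially"
   by (intro filterlim_at_top_mult_tendsto_pos[OF tendsto_const] filterlim_real_sequentially)
  hence "\<forall>\<^sub>F k in sequentially. 1 \<le> real k * infdist x D" by (simp add: filterlim_at_top)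
  hence "\<forall>\<^sub>F k in sequentially. min 1 (real k * infdist x D) = 1 - ind D x"
   by eventually_elim (use False in auto)
  thus ?thesis by (rule tendsto_eventually)
qed

text \<open>Indicators of complements of closed sets are limits of
  \<open>min 1 (real k * infdist x D)\<close>, and the sharp cut-off is a limit of logistic
  functions at every point. Nothing has to be known about the measure of level sets.\<close>

lemma green_halfline:
  fixes D1 D2 :: "real set" and s :: real
  assumes t3: "test3 ph phx phy pht" and D: "closed D1" "D1 \<noteq> {}" "closed D2" "D2 \<noteq> {}"
   and x: "0 \<le> x0" "x0 \<le> x1" and y: "0 \<le> y0" "y0 \<le> y1"
  defines "a \<equiv> \<lambda>x. 1 - ind D1 x" and "b \<equiv> \<lambda>x. 1 - ind D2 x"
  shows "gleft (ind {h1..}) a b phx phy pht s x0 x1 y0 y1 = gright (ind {h1..}) a b ph s x0 x1 y0 y1"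
proof -
  have eq: "gleft (logi h1 k) a b phx phy pht s x0 x1 y0 y1 = gright (logi h1 k) a b ph s x0 x1 y0 y1" for k
  proof (rule green_measurable[OF t3, where ak="\<lambda>k x. min 1 (real k * infdist x D1)" and bk="\<lambda>k x. min 1 (real k * infdist x D2)",
     OF _ _ _ _ _ _ logi_deriv])
   show "(\<lambda>k. min 1 (real k * infdist x D1)) \<longlonglongrightarrow> a x" "(\<lambda>k. min 1 (real k * infdist x D2)) \<longlonglongrightarrow> b x" for x
    unfolding a_def b_def by (intro closed_indicator_approx D)+
   have nz: "1 + exp z \<noteq> 0" for z :: real using exp_gt_zero[of z] by linarith
   show "cont (\<lambda>h. real k * real k * exp (- (real k * (real k * (h - h1) + 1))) /
   (1 + exp (- (real k * (real k * (h - h1) + 1))))\<^sup>2)"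
    by (intro continuous_intros ballI power_not_zero) (rule nz)
   show "\<bar>logi h1 k h\<bar> \<le> 1" for h
    unfolding logi_def by (simp add: abs_of_pos add_pos_pos)
  qed (simp_all add: x y continuous_intros infdist_nonneg)
  have m: "a \<in> Bor" "b \<in> Bor"
   unfolding a_def b_def using borel_closed[OF D(1)] borel_closed[OF D(3)] by simp_all
  have r: "a x \<in> {0..1}" "b x \<in> {0..1}" for x by (auto simp: a_def b_def indicator_def)
  have c: "cont ph" "cont phx" "cont phy" "cont pht"
   using t3 test3_continuous[OF t3] by (simp_all add: test3_def)
  note mm = Bor_contI[OF c(1)] Bor_contI[OF c(2)]
   Bor_contI[OF c(3)] Bor_contI[OF c(4)]
  have ml: "logi h1 k \<in> Bor" for k
   by (rule Bor_contI, rule DERIV_continuous_on, rule logi_deriv)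
  have mi: "ind {h1..} \<in> Bor" by auto
  have lb: "\<bar>logi h1 k h\<bar> \<le> 1" for k h
   unfolding logi_def by (simp add: abs_of_pos add_pos_pos)
  let ?Q = "{x0..x1} \<times> {y0..y1} \<times> {s - y1..s + x1 - y0}"
  obtain M where M: "\<And>q. q \<in> ?Q \<Longrightarrow> \<bar>ph q\<bar> \<le> M \<and> \<bar>phx q\<bar> \<le> M \<and> \<bar>phy q\<bar> \<le> M \<and> \<bar>pht q\<bar> \<le> M" "0 \<le> M"
   by (rule test3_bounded[OF t3 compact_Times[OF compact_Icc compact_Times[OF compact_Icc compact_Icc]]]) blast
  have box: "pos (prim a) s x y \<in> ?Q" if "x \<in> {x0..x1}" "y \<in> {y0..y1}" for x y
   using that x by (intro pos_box prim_bounds m r) auto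
  have T: "(\<lambda>k. thet (logi h1 k) a b ph s x y) \<longlonglongrightarrow> thet (ind {h1..}) a b ph s x y" for x y
   unfolding thet_def by (intro tendsto_intros logi_tendsto)
  have Tb: "\<bar>thet (logi h1 k) a b ph s x y\<bar> \<le> M" if "x \<in> {x0..x1}" "y \<in> {y0..y1}" for k x y
  proof -
   have "\<bar>thet (logi h1 k) a b ph s x y\<bar> \<le> 1 * M"
    unfolding thet_def abs_mult using M(1)[OF box[OF that]] M(2) by (intro mult_mono lb) auto
   thus ?thesis by simp
  qed
  have L: "(\<lambda>k. gleft (logi h1 k) a b phx phy pht s x0 x1 y0 y1) \<longlonglongrightarrow> gleft (ind {h1..}) a b phx phy pht s x0 x1 y0 y1"
   unfolding gleft_def
  proof (rule dct_bdd[where K="1 * (5 * M)"])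
   fix k and p :: "plane" assume p: "p \<in> {x0..x1} \<times> {y0..y1}"
   show "\<bar>logi h1 k (prim a (fst p) + 2 * prim b (snd p)) *
    dtr a b phx phy pht (fst p) (snd p) (pos (prim a) s (fst p) (snd p))\<bar> \<le> 1 * (5 * M)"
    unfolding abs_mult using p M(1)[OF box[of "fst p" "snd p"]]
    by (intro mult_mono lb dtr_bound r) auto
  qed (rule comp_measurable(1)[OF m ml r mm] comp_measurable(1)[OF m mi r mm]
    borel_closed closed_Times closed_atLeastAtMost bounded_Times bounded_closed_interval tendsto_mult_right logi_tendsto)+
  have R: "(\<lambda>k. gright (logi h1 k) a b ph s x0 x1 y0 y1) \<longlonglongrightarrow> gright (ind {h1..}) a b ph s x0 x1 y0 y1"
   unfolding gright_def
  proof (intro tendsto_diff dct_bdd[where K="2 * 1 * (2 * M)"])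
   fix k y assume "y \<in> {y0..y1}"
   thus "\<bar>2 * b y * (thet (logi h1 k) a b ph s x1 y - thet (logi h1 k) a b ph s x0 y)\<bar> \<le> 2 * 1 * (2 * M)"
    unfolding abs_mult using Tb[of x1 y k] Tb[of x0 y k] x r(2)[of y] M(2) by (intro mult_mono) auto
  next
   fix k x assume "x \<in> {x0..x1}"
   hence "\<bar>a x * (thet (logi h1 k) a b ph s x y1 - thet (logi h1 k) a b ph s x y0)\<bar> \<le> 1 * (2 * M)"
    unfolding abs_mult using Tb[of x y1 k] Tb[of x y0 k] y r(1)[of x] M(2) by (intro mult_mono) auto
   thus "\<bar>a x * (thet (logi h1 k) a b ph s x y1 - thet (logi h1 k) a b ph s x y0)\<bar> \<le> 2 * 1 * (2 * M)"
    using M(2) by linarith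
  qed (rule comp_measurable(2,3)[OF m ml r mm] comp_measurable(2,3)[OF m mi r mm]
    borel_closed closed_atLeastAtMost bounded_closed_interval tendsto_mult tendsto_diff tendsto_const T)+
  show ?thesis by (rule LIMSEQ_unique[OF L[unfolded eq] R])
qed

section \<open>A flow from one Cantor dust to another\<close>

lemma measure_shift:
  assumes "S \<in> sets (borel :: real measure)"
  shows "measure lborel ((+) a ` S) = measure lborel S"
proof -
  have S: "(+) a ` S \<in> sets borel"
  proof -
   have "(+) a ` S = (\<lambda>x. x - a) -` S \<inter> space borel" by (force simp: image_iff)
   thus ?thesis using assms measurable_sets[of "\<lambda>x. x - a" borel borel S] by simp
  qed
  have "measure lborel ((+) a ` S) = measure (distr lborel borel ((+) a)) ((+) a ` S)"
   by (simp only: lborel_distr_plus)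
  also have "\<dots> = measure lborel ((+) a -` ((+) a ` S) \<inter> space lborel)"
   using S by (subst measure_distr) auto
  also have "(+) a -` ((+) a ` S) \<inter> space lborel = S" by auto
  finally show ?thesis .
qed

lemma prim_compl:
  assumes "D \<in> sets borel" "0 \<le> x"
  shows "prim (\<lambda>u. 1 - ind D u) x = x - measure lborel (D \<inter> {0..<x})"
proof -
  have f: "emeasure lborel (D \<inter> {0..<x}) < \<infinity>"
   by (rule emeasure_bounded_finite) (simp add: bounded_Int)
  have "prim (\<lambda>u. 1 - ind D u) x = (LBINT u. ind {0..x} u - ind (D \<inter> {0..<x}) u)"
   unfolding prim_def set_int_def
  proof (rule integral_cong_AE)
   show "AE u in lborel. ind {0..x} u *\<^sub>R (1 - ind D u) = ind {0..x} u - ind (D \<inter> {0..<x}) u"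
    using AE_lborel_singleton[of x] by eventually_elim (auto simp: indicator_def)
  qed (use assms in auto)
  also have "\<dots> = (LBINT u. ind {0..x} u) - (LBINT u. ind (D \<inter> {0..<x}) u)"
   by (rule Bochner_Integration.integral_diff) (use assms f in auto)
  also have "\<dots> = x - measure lborel (D \<inter> {0..<x})" using assms by simp
  finally show ?thesis .
qed

text \<open>The copies are placed so that both dusts see the same levels:
  \<open>AA 1 + 2 * BB 3 = 1 + 4\<close> at the corner of the upper left one and
  \<open>AA 4 + 2 * BB 1 = 3 + 2\<close> at the corner of the lower right one.\<close>

definition C1 where "C1 = (+) 1 ` cantor \<union> (+) 4 ` cantor"
definition C2 where "C2 = (+) 1 ` cantor \<union> (+) 3 ` cantor"

lemma closed_shift: "closed ((+) (a::real) ` cantor)"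
  by (rule closed_translation) (rule closed_cantor)

lemma zero_cantor: "0 \<in> cantor"
proof -
  have "0 \<in> blk n 0" for n by (simp add: blk_def)
  hence "0 \<in> Cn n" for n unfolding Cn_def by (intro UN_I[of 0]) auto
  thus ?thesis by (simp add: cantor_def)
qed

lemma C1_closed: "closed C1" "C1 \<noteq> {}"
  unfolding C1_def by (rule closed_Un[OF closed_shift closed_shift], use zero_cantor in auto)

lemma C2_closed: "closed C2" "C2 \<noteq> {}"
  unfolding C2_def by (rule closed_Un[OF closed_shift closed_shift], use zero_cantor in auto)

abbreviation ca :: "real \<Rightarrow> real" where "ca x \<equiv> 1 - ind C1 x"
abbreviation cb :: "real \<Rightarrow> real" where "cb x \<equiv> 1 - ind C2 x"

definition AA :: "real \<Rightarrow> real" where "AA = prim (\<lambda>x. ca x)"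
definition BB :: "real \<Rightarrow> real" where "BB = prim (\<lambda>x. cb x)"

lemma C_sets [measurable]: "C1 \<in> sets borel" "C2 \<in> sets borel" "cantor \<in> sets borel"
  by (rule borel_closed, rule C1_closed C2_closed closed_cantor)+

lemma shift_sets [measurable]: "(+) (a::real) ` cantor \<in> sets borel"
  using closed_shift by (rule borel_closed)

lemma shift_part: "(+) a ` cantor \<inter> {a..<a + x} = (+) a ` (cantor \<inter> {0..<x})" for a :: real
proof (rule set_eqI)
  fix y
  have im: "y \<in> (+) a ` S \<longleftrightarrow> y - a \<in> S" for S by (force simp: image_iff)
  show "y \<in> (+) a ` cantor \<inter> {a..<a + x} \<longleftrightarrow> y \<in> (+) a ` (cantor \<inter> {0..<x})"
   unfolding Int_iff im by auto
qed

lemma two_copies_measure: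
  assumes "i \<le> 2 ^ n" "2 \<le> d" "0 \<le> c"
  defines "D \<equiv> (+) c ` cantor \<union> (+) (c + d) ` cantor"
  shows "measure lborel (D \<inter> {0..<c + xp n i}) = real i / 2 ^ n"
   and "measure lborel (D \<inter> {0..<c + d + xp n i}) = 1 + real i / 2 ^ n"
proof -
  have b: "x \<in> cantor \<Longrightarrow> 0 \<le> x \<and> x < 2" for x using cantor_bounds by force
  have x2: "xp n i \<le> 2" "0 \<le> xp n i" using xp_le[OF assms(1)] xp_nonneg by auto
  have D: "x \<in> D \<longleftrightarrow> x - c \<in> cantor \<or> x - (c + d) \<in> cantor" for x
   unfolding D_def by (force simp: image_iff)
  have im: "x \<in> (+) a ` S \<longleftrightarrow> x - a \<in> S" for x a :: real and S by (force simp: image_iff)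
  have "D \<inter> {0..<c + xp n i} = (+) c ` (cantor \<inter> {0..<xp n i})"
  proof (rule set_eqI)
   fix x
   show "x \<in> D \<inter> {0..<c + xp n i} \<longleftrightarrow> x \<in> (+) c ` (cantor \<inter> {0..<xp n i})"
    unfolding im Int_iff D using b[of "x - c"] b[of "x - (c + d)"] x2 assms(2,3) by auto
  qed
  thus "measure lborel (D \<inter> {0..<c + xp n i}) = real i / 2 ^ n"
   using measure_shift[of "cantor \<inter> {0..<xp n i}" c] measure_cantor[OF assms(1)] by simp
  have "D \<inter> {0..<c + d + xp n i} = (+) c ` (cantor \<inter> {0..<2}) \<union> (+) (c + d) ` (cantor \<inter> {0..<xp n i})"
  proof (rule set_eqI)
   fix x
   show "x \<in> D \<inter> {0..<c + d + xp n i} \<longleftrightarrow> x \<in> (+) c ` (cantor \<inter> {0..<2}) \<union> (+) (c + d) ` (cantor \<inter> {0..<xp n i})"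
    unfolding im Int_iff Un_iff D using b[of "x - c"] b[of "x - (c + d)"] x2 assms(2,3) by auto
  qed
  moreover have "measure lborel ((+) c ` (cantor \<inter> {0..<2}) \<union> (+) (c + d) ` (cantor \<inter> {0..<xp n i})) =
   measure lborel ((+) c ` (cantor \<inter> {0..<2})) + measure lborel ((+) (c + d) ` (cantor \<inter> {0..<xp n i}))"
  proof (rule measure_Union)
   show "emeasure lborel ((+) c ` (cantor \<inter> {0..<2})) \<noteq> \<infinity>"
    "emeasure lborel ((+) (c + d) ` (cantor \<inter> {0..<xp n i})) \<noteq> \<infinity>"
    using emeasure_bounded_finite[of "(+) c ` (cantor \<inter> {0..<2})"] emeasure_bounded_finite[of "(+) (c + d) ` (cantor \<inter> {0..<xp n i})"]
    by (simp_all add: bounded_translation bounded_Int less_top)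
   show "(+) c ` (cantor \<inter> {0..<2}) \<inter> (+) (c + d) ` (cantor \<inter> {0..<xp n i}) = {}"
   proof (rule equals0I)
    fix x assume "x \<in> (+) c ` (cantor \<inter> {0..<2}) \<inter> (+) (c + d) ` (cantor \<inter> {0..<xp n i})"
    hence "x - c < 2" "0 \<le> x - (c + d)" unfolding Int_iff im by auto
    thus False using assms(2) by linarith
   qed
  qed (simp_all flip: shift_part)
  ultimately show "measure lborel (D \<inter> {0..<c + d + xp n i}) = 1 + real i / 2 ^ n"
   using measure_shift[of "cantor \<inter> {0..<xp n i}" "c + d"] measure_cantor[OF assms(1)]
    measure_shift[of "cantor \<inter> {0..<2}" c] measure_cantor[of 1 0] xp_end[of 0] by simp
qed

text \<open>\<open>AA\<close> measures length outside the walls. Of \<open>xp n i\<close> the Cantor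
  part \<open>i / 2 ^ n\<close> is removed and the gap part \<open>sp i / 4 ^ n\<close> survives;
  passing a complete copy of the Cantor set costs one more unit.\<close>

lemma AA_val:
  assumes "i \<le> 2 ^ n"
  shows "AA (1 + xp n i) = 1 + real (sp i) / 4 ^ n" "AA (4 + xp n i) = 3 + real (sp i) / 4 ^ n"
  using two_copies_measure[OF assms, of 3 1] xp_nonneg[of n i]
  unfolding AA_def by (simp_all add: prim_compl C1_def[symmetric]) (simp_all add: xp_def)

lemma BB_val:
  assumes "i \<le> 2 ^ n"
  shows "BB (1 + xp n i) = 1 + real (sp i) / 4 ^ n" "BB (3 + xp n i) = 2 + real (sp i) / 4 ^ n"
  using two_copies_measure[OF assms, of 2 1] xp_nonneg[of n i]
  unfolding BB_def by (simp_all add: prim_compl C2_def[symmetric]) (simp_all add: xp_def)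

lemma c_props: "(\<lambda>x. ca x) \<in> Bor" "(\<lambda>x. cb x) \<in> Bor"
   "ca x \<in> {0..1}" "cb x \<in> {0..1}" "\<bar>ca x\<bar> \<le> 1" "\<bar>cb x\<bar> \<le> 1"
  by (auto simp: indicator_def)

lemma AB_cont: "cont AA" "cont BB"
  unfolding AA_def BB_def by (rule prim_continuous[where K=1]; simp add: c_props)+

lemma AB_meas [measurable]: "AA \<in> Bor" "BB \<in> Bor"
  using AB_cont by (auto intro: Bor_contI)

section \<open>Level sets of monotone primitives\<close>

lemma prim_mono_lip:
  assumes "f \<in> Bor" "\<And>x. f x \<in> {0..1}" "0 \<le> x" "x \<le> y"
  shows "prim f x \<le> prim f y" "prim f y \<le> prim f x + (y - x)"
proof -
  have f: "\<bar>f x\<bar> \<le> 1" for x using assms(2)[of x] by auto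
  show "prim f y \<le> prim f x + (y - x)" using prim_lipschitz[OF assms(1) f assms(3,4)] by (simp add: abs_le_iff algebra_simps)
  have "0 \<le> (LBINT u:{x<..y}. f u)" unfolding set_int_def
   using assms(2) by (intro integral_nonneg_AE) auto
  thus "prim f x \<le> prim f y" using prim_diff[OF assms(1) f assms(3,4)] by linarith
qed

lemma AA_mono: "0 \<le> x \<Longrightarrow> x \<le> y \<Longrightarrow> AA x \<le> AA y" and AA_lip: "0 \<le> x \<Longrightarrow> x \<le> y \<Longrightarrow> AA y \<le> AA x + (y - x)"
  unfolding AA_def by (rule prim_mono_lip; simp add: c_props)+

lemma BB_mono: "0 \<le> x \<Longrightarrow> x \<le> y \<Longrightarrow> BB x \<le> BB y" and BB_lip: "0 \<le> x \<Longrightarrow> x \<le> y \<Longrightarrow> BB y \<le> BB x + (y - x)"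
  unfolding BB_def by (rule prim_mono_lip; simp add: c_props)+

text \<open>\<open>prim f\<close> may be constant on intervals, so a level can have many solutions.
  The least one is taken, since only for it is \<open>c \<le> prim f y\<close> equivalent to
  \<open>z \<le> y\<close>.\<close>

lemma prim_level:
  assumes f: "f \<in> Bor" "\<And>x. f x \<in> {0..1}" and y: "0 \<le> y0" "y0 \<le> y1"
   and c: "prim f y0 \<le> c" "c \<le> prim f y1"
  obtains z where "z \<in> {y0..y1}" "prim f z = c" "\<And>y. y \<in> {y0..y1} \<Longrightarrow> c \<le> prim f y \<longleftrightarrow> z \<le> y"
proof -
  have ct: "continuous_on {y0..y1} (prim f)"
  proof (rule continuous_on_subset[OF prim_continuous[where K=1]])
   show "\<bar>f x\<bar> \<le> 1" for x using f(2)[of x] by auto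
  qed (use f in auto)
  define Z where "Z = {y0..y1} \<inter> prim f -` {c..}"
  have Z: "closed Z" "y1 \<in> Z" "bdd_below Z"
   unfolding Z_def using continuous_on_closed_vimage[of "{y0..y1}" "prim f"] ct c y by (auto simp: Int_commute)
  define z where "z = Inf Z"
  have zZ: "z \<in> Z" unfolding z_def using Z by (intro closed_contains_Inf) auto
  obtain w where w: "w \<in> {y0..y1}" "prim f w = c"
   using IVT'[of "prim f" y0 c y1] c y ct by auto
  hence "w \<in> Z" by (auto simp: Z_def)
  hence "z \<le> w" unfolding z_def using Z by (intro cInf_lower)
  hence "prim f z \<le> c" using prim_mono_lip(1)[OF f, of z w] w zZ y by (auto simp: Z_def)
  hence eq: "prim f z = c" using zZ by (auto simp: Z_def)
  show thesis
  proof (rule that[of z])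
   show "z \<in> {y0..y1}" using zZ by (auto simp: Z_def)
   show "prim f z = c" by (rule eq)
   fix y assume yy: "y \<in> {y0..y1}"
   show "c \<le> prim f y \<longleftrightarrow> z \<le> y"
   proof
    assume "c \<le> prim f y"
    hence "y \<in> Z" using yy by (auto simp: Z_def)
    thus "z \<le> y" unfolding z_def using Z by (intro cInf_lower)
   next
    assume "z \<le> y"
    thus "c \<le> prim f y" using prim_mono_lip(1)[OF f, of z y] eq zZ y yy by (auto simp: Z_def)
   qed
  qed
qed

text \<open>Change of variables by the monotone function \<open>prim f\<close>: the set where it
  lies between c and d is an interval up to its end points, and the integral of f over it is the
  increment of the primitive.\<close>

lemma prim_mass:
  assumes f: "f \<in> Bor" "\<And>x. f x \<in> {0..1}" and y: "0 \<le> y0" "y0 \<le> y1"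
   and c: "prim f y0 \<le> c" "c \<le> d" "d \<le> prim f y1"
  shows "(LBINT y:{y0..y1}. ind {c..<d} (prim f y) * f y) = d - c"
proof -
  have ab: "\<bar>f x\<bar> \<le> 1" for x using f(2)[of x] by auto
  obtain u where u: "u \<in> {y0..y1}" "prim f u = c" "\<And>y. y \<in> {y0..y1} \<Longrightarrow> c \<le> prim f y \<longleftrightarrow> u \<le> y"
   by (rule prim_level[OF f y c(1) order.trans[OF c(2,3)]]) blast
  obtain v where v: "v \<in> {y0..y1}" "prim f v = d" "\<And>y. y \<in> {y0..y1} \<Longrightarrow> d \<le> prim f y \<longleftrightarrow> v \<le> y"
   by (rule prim_level[OF f y order.trans[OF c(1,2)] c(3)]) blast
  have uv: "u \<le> v" using u v c by auto
  have "(LBINT y:{y0..y1}. ind {c..<d} (prim f y) * f y) = (LBINT y:{u<..v}. f y)"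
   unfolding set_int_def
  proof (rule integral_cong_AE)
   show "AE y in lborel. ind {y0..y1} y *\<^sub>R (ind {c..<d} (prim f y) * f y) = ind {u<..v} y *\<^sub>R f y"
    using AE_lborel_singleton[of u] AE_lborel_singleton[of v]
   proof eventually_elim
    case (elim y)
    show ?case
    proof (cases "y \<in> {y0..y1}")
     case True
     hence "prim f y \<in> {c..<d} \<longleftrightarrow> y \<in> {u<..v}" using u(3)[OF True] v(3)[OF True] elim by auto
     thus ?thesis using True by (auto simp: indicator_def)
    next
     case False
     hence "y \<notin> {u<..v}" using u(1) v(1) by auto
     hence "ind {u<..v} y = 0" by (rule indicator_simps(2))
     moreover have "ind {y0..y1} y = 0" using False by (rule indicator_simps(2))
     ultimately show ?thesis by (simp only: scaleR_zero_left)
    qed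
   qed
   have [measurable]: "prim f \<in> Bor" using f by (rule prim_measurable)
   have [measurable]: "f \<in> Bor" by (rule f)
   show "(\<lambda>y. ind {y0..y1} y *\<^sub>R (ind {c..<d} (prim f y) * f y)) \<in> borel_measurable lborel" by measurable
   show "(\<lambda>y. ind {u<..v} y *\<^sub>R f y) \<in> borel_measurable lborel" by measurable
  qed
  also have "\<dots> = d - c" using prim_diff[OF f(1) ab, of u v] uv u v y by auto
  finally show ?thesis .
qed

text \<open>A nonnegative weight with equal mass on a subinterval and on the whole interval vanishes
  almost everywhere outside the subinterval. Only the values of \<Phi> close to v are then
  seen.\<close>

lemma weighted_near:
  fixes w \<Phi> :: "real \<Rightarrow> real"
  assumes w: "w \<in> Bor" "\<And>y. 0 \<le> w y" "\<And>y. w y \<le> K"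
   and \<Phi>: "\<Phi> \<in> Bor" "\<And>y. y \<in> {y0..y1} \<Longrightarrow> \<bar>\<Phi> y\<bar> \<le> M"
   and I: "{c..d} \<subseteq> {y0..y1}" "(LBINT y:{c..d}. w y) = m" "(LBINT y:{y0..y1}. w y) = m"
   and near: "\<And>y. y \<in> {c..d} \<Longrightarrow> \<bar>\<Phi> y - v\<bar> \<le> om"
  shows "\<bar>(LBINT y:{y0..y1}. w y * \<Phi> y) - m * v\<bar> \<le> om * m"
proof -
  note [measurable] = w(1) \<Phi>(1)
  have wK: "\<bar>w y\<bar> \<le> K" for y using w(2,3)[of y] by auto
  have i0: "integrable lborel (\<lambda>y. ind S y * w y)" if "S \<in> sets borel" "bounded S" for S
   using set_integrable_bdd[OF w(1) wK that] by (simp add: set_integrable_def)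
  have "(LBINT y. ind {y0..y1} y * w y - ind {c..d} y * w y) = 0"
   using I(2,3) by (subst Bochner_Integration.integral_diff) (auto intro!: i0 simp: set_int_def)
  moreover have "0 \<le> ind {y0..y1} y * w y - ind {c..d} y * w y" for y
   using I(1) w(2)[of y] by (auto simp: indicator_def)
  ultimately have ae: "AE y in lborel. ind {y0..y1} y * w y - ind {c..d} y * w y = 0"
   by (subst (asm) integral_nonneg_eq_0_iff_AE) (auto intro!: i0)
  have K: "0 \<le> K" using w(2,3)[of 0] by linarith
  have ic: "integrable lborel (\<lambda>y. ind {c..d} y * (w y * (\<Phi> y - v)))"
  proof (rule integrable_bdd[where K="K * \<bar>om\<bar>" and S="{c..d}"])
   show "\<bar>ind {c..d} y * (w y * (\<Phi> y - v))\<bar> \<le> K * \<bar>om\<bar>" for y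
   proof (cases "y \<in> {c..d}")
    case True
    hence "\<bar>\<Phi> y - v\<bar> \<le> \<bar>om\<bar>" using near by fastforce
    thus ?thesis using True wK[of y] K by (auto simp: abs_mult intro!: mult_mono)
   qed (use K in simp)
  qed auto
  have "(LBINT y:{y0..y1}. w y * \<Phi> y) = (LBINT y. ind {c..d} y * (w y * (\<Phi> y - v)) + v * (ind {c..d} y * w y))"
   unfolding set_int_def
   by (rule integral_cong_AE, measurable, use ae in eventually_elim) (auto simp: algebra_simps)
  also have "\<dots> = (LBINT y. ind {c..d} y * (w y * (\<Phi> y - v))) + v * m"
   using I(2) i0[of "{c..d}"] by (subst Bochner_Integration.integral_add[OF ic]) (auto simp: set_int_def)
  finally have "\<bar>(LBINT y:{y0..y1}. w y * \<Phi> y) - m * v\<bar> = \<bar>LBINT y. ind {c..d} y * (w y * (\<Phi> y - v))\<bar>"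
   by simp
  also have "\<dots> \<le> (LBINT y. om * (ind {c..d} y * w y))"
  proof (rule integral_abs_bound[THEN order_trans], rule integral_mono)
   show "\<bar>ind {c..d} y * (w y * (\<Phi> y - v))\<bar> \<le> om * (ind {c..d} y * w y)" for y
   proof (cases "y \<in> {c..d}")
    case True
    have "w y * \<bar>\<Phi> y - v\<bar> \<le> w y * om" by (intro mult_left_mono near[OF True] w)
    thus ?thesis using True w(2)[of y] by (simp add: abs_mult mult.commute)
   qed simp
  qed (use i0[of "{c..d}"] ic in auto)
  also have "\<dots> = om * m" using I(2) by (simp add: set_int_def)
  finally show ?thesis .
qed

section \<open>Green's formula on a band of streamlines\<close>

definition HH :: "plane \<Rightarrow> real" where "HH p = AA (fst p) + 2 * BB (snd p)"

definition DT where
  "DT phx phy pht s p = dtr (\<lambda>x. ca x) (\<lambda>x. cb x) phx phy pht (fst p) (snd p) (pos AA s (fst p) (snd p))"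

definition PH :: "(real \<times> real \<times> real \<Rightarrow> real) \<Rightarrow> real \<Rightarrow> plane \<Rightarrow> real" where
  "PH ph s p = ph (pos AA s (fst p) (snd p))"

lemma fst_snd_meas [measurable]: "fst \<in> borel \<rightarrow>\<^sub>M (borel :: real measure)" "snd \<in> borel \<rightarrow>\<^sub>M (borel :: real measure)"
  using Bor_contI[OF continuous_on_fst[OF continuous_on_id]]
    Bor_contI[OF continuous_on_snd[OF continuous_on_id]] by simp_all

lemma HH_meas [measurable]: "HH \<in> Bor"
  unfolding HH_def by measurable

lemma posAA_cont: "cont (\<lambda>p. pos AA s (fst p) (snd p))"
  unfolding pos_def by (intro continuous_intros continuous_on_compose2[OF AB_cont(1)]) auto

lemma PH_cont: "cont ph \<Longrightarrow> cont (PH ph s)"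
  unfolding PH_def[abs_def] by (rule continuous_on_compose2[OF _ posAA_cont]) auto

lemma DT_alt: "DT phx phy pht s p =
   2 * cb (snd p) * (PH phx s p + (1 - ca (fst p)) / 2 * PH pht s p) - ca (fst p) * (PH phy s p - PH pht s p)"
  by (simp add: DT_def dtr_def PH_def)

lemma test3_meas:
  assumes "test3 ph phx phy pht"
  shows "PH ph s \<in> Bor" "DT phx phy pht s \<in> Bor"
proof -
  show "PH ph s \<in> Bor"
   by (rule Bor_contI[OF PH_cont[OF test3_continuous[OF assms]]])
  have [measurable]: "PH phx s \<in> Bor" "PH phy s \<in> Bor" "PH pht s \<in> Bor"
   using assms unfolding test3_def by (auto intro!: Bor_contI PH_cont)
  show "DT phx phy pht s \<in> Bor" unfolding DT_alt[abs_def] by measurable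
qed

lemma PH_bounded:
  assumes "cont ph" "compact S"
  obtains M where "\<And>p. p \<in> S \<Longrightarrow> \<bar>PH ph s p\<bar> \<le> M" "0 \<le> M"
proof -
  have "bounded (PH ph s ` S)"
   by (intro compact_imp_bounded compact_continuous_image assms continuous_on_subset[OF PH_cont[OF assms(1)]]) auto
  then obtain M where "\<forall>x\<in>PH ph s ` S. \<bar>x\<bar> \<le> M" by (auto simp: bounded_iff)
  thus thesis by (intro that[of "\<bar>M\<bar>"]) (auto intro: order_trans)
qed

lemma DT_bounded:
  assumes "test3 ph phx phy pht" "compact S"
  obtains M where "\<And>p. p \<in> S \<Longrightarrow> \<bar>DT phx phy pht s p\<bar> \<le> M" "0 \<le> M"
proof -
  have c: "cont phx" "cont phy" "cont pht" using assms by (simp_all add: test3_def)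
  obtain M1 where M1: "\<And>p. p \<in> S \<Longrightarrow> \<bar>PH phx s p\<bar> \<le> M1" "0 \<le> M1" by (rule PH_bounded[OF c(1) assms(2)]) blast
  obtain M2 where M2: "\<And>p. p \<in> S \<Longrightarrow> \<bar>PH phy s p\<bar> \<le> M2" "0 \<le> M2" by (rule PH_bounded[OF c(2) assms(2)]) blast
  obtain M3 where M3: "\<And>p. p \<in> S \<Longrightarrow> \<bar>PH pht s p\<bar> \<le> M3" "0 \<le> M3" by (rule PH_bounded[OF c(3) assms(2)]) blast
  show thesis
  proof (rule that[of "5 * (M1 + M2 + M3)"])
   fix p assume p: "p \<in> S"
   show "\<bar>DT phx phy pht s p\<bar> \<le> 5 * (M1 + M2 + M3)"
    unfolding DT_def using M1(1)[OF p] M2(1)[OF p] M3(1)[OF p] M1(2) M2(2) M3(2) c_props(3,4)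
    by (intro dtr_bound) (auto simp: PH_def)
  qed (use M1 M2 M3 in simp)
qed

lemma set_integrable_mult_bdd:
  fixes f g :: "'a::euclidean_space \<Rightarrow> real"
  assumes [measurable]: "f \<in> Bor" "g \<in> Bor" "S \<in> sets borel"
   and "bounded S" "\<And>p. \<bar>g p\<bar> \<le> K" "\<And>p. p \<in> S \<Longrightarrow> \<bar>f p\<bar> \<le> M"
  shows "set_integrable lborel S (\<lambda>p. g p * f p)"
  unfolding set_integrable_def
proof (rule integrable_bdd[where K="\<bar>K\<bar> * \<bar>M\<bar>" and S=S])
  show "\<bar>ind S x *\<^sub>R (g x * f x)\<bar> \<le> \<bar>K\<bar> * \<bar>M\<bar>" for x
  proof (cases "x \<in> S")
   case True
   have "\<bar>g x\<bar> \<le> \<bar>K\<bar>" "\<bar>f x\<bar> \<le> \<bar>M\<bar>" using assms(5)[of x] assms(6)[OF True] by linarith+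
   hence "\<bar>g x\<bar> * \<bar>f x\<bar> \<le> \<bar>K\<bar> * \<bar>M\<bar>" by (intro mult_mono) auto
   thus ?thesis using True by (simp add: abs_mult)
  qed simp
qed (use assms in auto)

text \<open>The band is the difference of two half-lines of levels. The lower edge lies below the
  band and the upper edge above it, so the band is crossed only by the vertical edges, and the flux
  through the horizontal ones cancels in the difference.\<close>

lemma green_band:
  assumes t3: "test3 ph phx phy pht" and x: "0 \<le> x0" "x0 \<le> x1" and y: "0 \<le> y0" "y0 \<le> y1" and h: "h1 \<le> h2"
   and edge: "\<And>x. x \<in> {x0..x1} \<Longrightarrow> HH (x, y0) < h1" "\<And>x. x \<in> {x0..x1} \<Longrightarrow> h2 \<le> HH (x, y1)"
  shows "(LINT p:{x0..x1} \<times> {y0..y1}|lborel. ind {h1..<h2} (HH p) * DT phx phy pht s p) =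
   (LBINT y:{y0..y1}. (2 * cb y * ind {h1..<h2} (HH (x1, y))) * PH ph s (x1, y)) -
   (LBINT y:{y0..y1}. (2 * cb y * ind {h1..<h2} (HH (x0, y))) * PH ph s (x0, y))"
proof -
  let ?R = "{x0..x1} \<times> {y0..y1}"
  note [measurable] = test3_meas[OF t3]
  have [measurable]: "?R \<in> sets borel" by (intro borel_closed closed_Times closed_atLeastAtMost)
  have cR: "compact ?R" by (intro compact_Times compact_Icc)
  obtain M where M: "\<And>p. p \<in> ?R \<Longrightarrow> \<bar>DT phx phy pht s p\<bar> \<le> M" "0 \<le> M" by (rule DT_bounded[OF t3 cR]) blast
  obtain N where N: "\<And>p. p \<in> ?R \<Longrightarrow> \<bar>PH ph s p\<bar> \<le> N" "0 \<le> N" by (rule PH_bounded[OF test3_continuous[OF t3] cR]) blast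
  have split: "ind {h1..<h2} z = ind {h1..} z - ind {h2..} z" for z
   using h by (auto simp: indicator_def)
  have i: "set_integrable lborel ?R (\<lambda>p. ind {h..} (HH p) * DT phx phy pht s p)" for h
   by (rule set_integrable_mult_bdd[where K=1, OF _ _ _ compact_imp_bounded[OF cR] _ M(1)]) (auto simp: indicator_def)
  have gl: "(LINT p:?R|lborel. ind {h..} (HH p) * DT phx phy pht s p) =
   gright (ind {h..}) (\<lambda>x. ca x) (\<lambda>x. cb x) ph s x0 x1 y0 y1" for h
   using green_halfline[OF t3 C1_closed C2_closed x y, of h s]
   unfolding gleft_def DT_def HH_def AA_def BB_def .
  have Pm: "(\<lambda>y. PH ph s (x, y)) \<in> Bor" "(\<lambda>y. HH (x, y)) \<in> Bor"
   "(\<lambda>y. PH ph s (y, x)) \<in> Bor" "(\<lambda>y. HH (y, x)) \<in> Bor"  for x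
   using measurable_compose[of "\<lambda>y. (x, y)" borel borel "PH ph s" borel] measurable_compose[of "\<lambda>y. (x, y)" borel borel HH borel]
    measurable_compose[of "\<lambda>y. (y, x)" borel borel "PH ph s" borel] measurable_compose[of "\<lambda>y. (y, x)" borel borel HH borel]
   by (simp_all add: Bor_contI continuous_on_Pair)
  note [measurable] = Pm
  have iy: "set_integrable lborel {y0..y1} (\<lambda>y. (2 * cb y * ind S (HH (x, y))) * PH ph s (x, y))"
   if "x \<in> {x0..x1}" "S \<in> sets borel" for x S
   by (rule set_integrable_mult_bdd[where K=2 and M=N]) (use N(1) that in \<open>auto simp: indicator_def\<close>)
  have ix: "set_integrable lborel {x0..x1} (\<lambda>x. (ca x * ind S (HH (x, y))) * PH ph s (x, y))"
   if "y \<in> {y0..y1}" "S \<in> sets borel" for y S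
   by (rule set_integrable_mult_bdd[where K=1 and M=N]) (use N(1) that in \<open>auto simp: indicator_def\<close>)
  define E where "E h x = (LBINT y:{y0..y1}. (2 * cb y * ind {h..} (HH (x, y))) * PH ph s (x, y))" for h x
  define E' where "E' h y = (LBINT x:{x0..x1}. (ca x * ind {h..} (HH (x, y))) * PH ph s (x, y))" for h y
  have gr: "gright (ind {h..}) (\<lambda>x. ca x) (\<lambda>x. cb x) ph s x0 x1 y0 y1 = (E h x1 - E h x0) - (E' h y1 - E' h y0)" for h
  proof -
   have 1: "x0 \<in> {x0..x1}" "x1 \<in> {x0..x1}" "y0 \<in> {y0..y1}" "y1 \<in> {y0..y1}" using x y by auto
   have S: "{h..} \<in> sets borel" by simp
   show ?thesis
    unfolding gright_def E_def E'_def thet_def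
     set_integral_diff(2)[OF iy[OF 1(2) S] iy[OF 1(1) S], symmetric] set_integral_diff(2)[OF ix[OF 1(4) S] ix[OF 1(3) S], symmetric]
    by (simp add: HH_def PH_def AA_def BB_def algebra_simps)
  qed
  \<comment> \<open>On the lower edge both indicators vanish, on the upper edge both are 1.\<close>
  have E'0: "E' h1 y0 = E' h2 y0"
   unfolding E'_def by (rule set_lebesgue_integral_cong) (use edge(1) h in \<open>force simp: indicator_def\<close>)+
  have E'1: "E' h1 y1 = E' h2 y1"
   unfolding E'_def by (rule set_lebesgue_integral_cong) (use edge(2) h in \<open>force simp: indicator_def\<close>)+
  have EE: "(LBINT y:{y0..y1}. (2 * cb y * ind {h1..<h2} (HH (x, y))) * PH ph s (x, y)) = E h1 x - E h2 x"
   if "x \<in> {x0..x1}" for x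
   unfolding E_def split
   by (subst set_integral_diff(2)[OF iy iy, symmetric]) (use that in \<open>auto simp: algebra_simps\<close>)
  have "(LINT p:?R|lborel. ind {h1..<h2} (HH p) * DT phx phy pht s p) =
   (LINT p:?R|lborel. ind {h1..} (HH p) * DT phx phy pht s p) - (LINT p:?R|lborel. ind {h2..} (HH p) * DT phx phy pht s p)"
   unfolding split by (subst set_integral_diff(2)[OF i i, symmetric]) (simp add: algebra_simps)
  thus ?thesis using EE[of x1] EE[of x0] x E'0 E'1 unfolding gl gr by simp
qed

text \<open>On the vertical line with \<open>AA x = \<alpha> + sp (ev m) / 4 ^ n\<close>, band m
  prescribes \<open>BB y\<close> up to \<open>1 / (2 * 4 ^ n)\<close>, starting from
  \<open>\<beta> + sp (od m) / 4 ^ n\<close>. By \<open>prim_mass\<close> the weight has mass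
  \<open>1 / 4 ^ n\<close>, and it sits within \<open>2 / 2 ^ n\<close> above the Cantor end point
  with index \<open>od m\<close>.\<close>

lemma edge_estimate:
  assumes t3: "test3 ph phx phy pht" and m: "m < 4 ^ n" and yb: "0 \<le> yb" "yb \<le> 3"
   and Ax: "AA x = \<alpha> + real (sp (ev m)) / 4 ^ n"
   and By: "\<And>k. k \<le> 2 ^ n \<Longrightarrow> BB (yb + xp n k) = \<beta> + real (sp k) / 4 ^ n" and ab: "\<alpha> + 2 * \<beta> = 5"
   and near: "\<And>y. y \<in> {yb + xp n (od m)..yb + xp n (od m) + 2 / 2 ^ n} \<Longrightarrow> \<bar>PH ph s (x, y) - v\<bar> \<le> om"
  shows "\<bar>(LBINT y:{0..6}. (2 * cb y * ind {5 + real m / 4 ^ n..<5 + (real m + 1) / 4 ^ n} (HH (x, y))) * PH ph s (x, y))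
    - v / 4 ^ n\<bar> \<le> om / 4 ^ n"
proof -
  define j where "j = od m"
  have j: "j < 2 ^ n" using ev_od_less[OF m] by (simp add: j_def)
  define c where "c = \<beta> + real (sp j) / 4 ^ n"
  define d where "d = c + 1 / (2 * 4 ^ n)"
  define y0 where "y0 = yb + xp n j"
  define y1 where "y1 = yb + xp n j + 2 / 2 ^ n"
  define w where "w y = 2 * cb y * ind {5 + real m / 4 ^ n..<5 + (real m + 1) / 4 ^ n} (HH (x, y))" for y
  have cd: "c \<le> d" by (simp add: d_def)
  have rm: "real m = real (sp (ev m)) + 2 * real (sp j)"
   using ev_od_sp[of m] unfolding j_def by (metis of_nat_add of_nat_mult of_nat_numeral)
  \<comment> \<open>The part \<open>sp (ev m)\<close> of m cancels against \<open>AA x\<close>; the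
    width of the band is halved because \<open>HH\<close> contains \<open>2 * BB\<close>.\<close>
  have H: "HH (x, y) \<in> {5 + real m / 4 ^ n..<5 + (real m + 1) / 4 ^ n} \<longleftrightarrow> BB y \<in> {c..<d}" for y
  proof -
   have "HH (x, y) = (5 - 2 * \<beta>) + real (sp (ev m)) / 4 ^ n + 2 * BB y"
    using ab by (simp add: HH_def Ax)
   moreover have "real m / 4 ^ n = real (sp (ev m)) / 4 ^ n + 2 * (real (sp j) / 4 ^ n)"
    unfolding rm by (simp add: add_divide_distrib)
   moreover have "(real m + 1) / 4 ^ n = real m / 4 ^ n + 2 * (1 / (2 * 4 ^ n))"
    by (simp add: add_divide_distrib)
   ultimately have "5 + real m / 4 ^ n \<le> HH (x, y) \<longleftrightarrow> c \<le> BB y" "HH (x, y) < 5 + (real m + 1) / 4 ^ n \<longleftrightarrow> BB y < d"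
    unfolding c_def d_def by (intro iffI; linarith)+
   thus ?thesis by (simp only: atLeastLessThan_iff)
  qed
  have w: "w y = 2 * (ind {c..<d} (BB y) * cb y)" for y
   unfolding w_def indicator_def H by simp
  have B0: "BB y0 = c" using By[of j] j by (simp add: y0_def c_def)
  have y0p: "0 \<le> y0" using yb xp_nonneg[of n j] by (simp add: y0_def)
  define u where "u = (1 / 2 ^ n :: real)"
  define q where "q = (1 / 4 ^ n :: real)"
  have uq: "0 \<le> q" "q \<le> u" "u \<le> 1"
   unfolding u_def q_def by (auto intro!: divide_left_mono power_mono)
  have xpS: "xp n (Suc j) - xp n j = u + (real (sp (Suc j)) - real (sp j)) * q"
   by (simp add: xp_def u_def q_def field_simps)
  have sps: "real (sp (Suc j)) \<ge> real (sp j) + 1" using sp_Suc_ge[of j] by linarith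
  \<comment> \<open>A point at which \<open>BB\<close> has reached d. The lower bound comes from
    going back from the next end point, where \<open>BB\<close> is known, with Lipschitz constant 1;
    this works however large the jump of \<open>sp\<close> is.\<close>
  define y' where "y' = yb + xp n j + u + q / 2"
  have y'1: "y' \<le> y1" using uq by (simp add: y'_def y1_def u_def[symmetric] mult.commute[of 2]) (simp add: u_def)
  have "q * 1 \<le> q * (real (sp (Suc j)) - real (sp j))" using sps uq by (intro mult_left_mono) auto
  hence y'S: "y' \<le> yb + xp n (Suc j)" using xpS uq unfolding y'_def by (simp add: mult.commute)
  have y'p: "y0 \<le> y'" using uq by (simp add: y'_def y0_def)
  have "BB (yb + xp n (Suc j)) \<le> BB y' + (yb + xp n (Suc j) - y')"
   using y'S y'p y0p by (intro BB_lip) auto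
  moreover have "BB (yb + xp n (Suc j)) = \<beta> + real (sp (Suc j)) * q" using By[of "Suc j"] j by (simp add: q_def)
  ultimately have "BB y' \<ge> \<beta> + real (sp (Suc j)) * q - (xp n (Suc j) - xp n j - u - q / 2)"
   unfolding y'_def by linarith
  hence "BB y' \<ge> \<beta> + real (sp j) * q + q / 2" unfolding xpS by (simp add: algebra_simps)
  hence By': "d \<le> BB y'" by (simp add: d_def c_def q_def)
  have y16: "y1 \<le> 6"
  proof -
   have "xp n j + u \<le> 4 / 3" using xp_less[OF j] unfolding u_def by (smt (verit) divide_nonneg_nonneg zero_le_power)
   moreover have "2 / 2 ^ n = 2 * u" by (simp add: u_def)
   ultimately show ?thesis using yb uq unfolding y1_def by linarith
  qed
  have B1: "d \<le> BB y1" using By' BB_mono[of y' y1] y'1 y'p y0p by linarith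
  have B6: "d \<le> BB 6" using B1 BB_mono[of y1 6] y16 y'1 y'p y0p by linarith
  have BB0: "BB 0 \<le> c" using BB_mono[of 0 y0] y0p B0 by simp
  have y01: "y0 \<le> y1" using y'1 y'p by simp
  have mass1: "(LBINT y:{y0..y1}. w y) = 1 / 4 ^ n"
   unfolding w set_integral_mult_right
   using prim_mass[OF c_props(2,4) y0p y01, of c d] B0 B1 cd by (simp add: BB_def d_def)
  have mass2: "(LBINT y:{0..6}. w y) = 1 / 4 ^ n"
   unfolding w set_integral_mult_right
   using prim_mass[OF c_props(2,4), of 0 6 c d] BB0 B6 cd by (simp add: BB_def d_def)
  have Pm: "(\<lambda>y. PH ph s (x, y)) \<in> Bor"
   using measurable_compose[of "\<lambda>y. (x, y)" borel borel "PH ph s" borel] test3_meas(1)[OF t3]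
   by (simp add: Bor_contI continuous_on_Pair)
  obtain N where N: "\<And>p. p \<in> {x..x} \<times> {0..6} \<Longrightarrow> \<bar>PH ph s p\<bar> \<le> N" "0 \<le> N"
   by (rule PH_bounded[OF test3_continuous[OF t3] compact_Times[OF compact_Icc compact_Icc]]) blast
  have wm: "w \<in> Bor" unfolding w by measurable
  have "\<bar>(LBINT y:{0..6}. w y * PH ph s (x, y)) - 1 / 4 ^ n * v\<bar> \<le> om * (1 / 4 ^ n)"
  proof (rule weighted_near[OF wm _ _ Pm _ _ mass1 mass2, where K=2 and M=N])
   show "0 \<le> w y" "w y \<le> 2" for y unfolding w by (auto simp: indicator_def)
   show "{y0..y1} \<subseteq> {0..6}" using y0p y16 by auto
   show "\<bar>PH ph s (x, y)\<bar> \<le> N" if "y \<in> {0..6}" for y using N(1)[of "(x, y)"] that by auto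
   show "\<bar>PH ph s (x, y) - v\<bar> \<le> om" if "y \<in> {y0..y1}" for y
    using near that unfolding y0_def y1_def j_def by blast
  qed
  thus ?thesis unfolding w_def by simp
qed

section \<open>Riemann sums over a Cantor dust\<close>

lemma measure_shift_ivl:
  assumes "i < 2 ^ n"
  shows "measure lborel ((+) a ` (cantor \<inter> {xp n i..<xp n (Suc i)})) = 1 / 2 ^ n"
proof -
  have fin: "emeasure lborel (cantor \<inter> {0..<xp n (Suc i)}) \<noteq> \<infinity>"
   using emeasure_bounded_finite[of "cantor \<inter> {0..<xp n (Suc i)}"] by (simp add: bounded_Int less_top)
  have "cantor \<inter> {xp n i..<xp n (Suc i)} = (cantor \<inter> {0..<xp n (Suc i)}) - (cantor \<inter> {0..<xp n i})"
   using xp_nonneg[of n i] by auto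
  moreover have "measure lborel ((cantor \<inter> {0..<xp n (Suc i)}) - (cantor \<inter> {0..<xp n i})) = 1 / 2 ^ n"
   using xp_mono[of i "Suc i" n] measure_cantor[of i n] measure_cantor[of "Suc i" n] assms
   by (subst measure_Diff[OF fin]) (auto simp: add_divide_distrib)
  ultimately show ?thesis using measure_shift[of "cantor \<inter> {xp n i..<xp n (Suc i)}" a] by simp
qed

definition piece :: "nat \<Rightarrow> real \<Rightarrow> nat \<Rightarrow> real set" where
  "piece n a i = (+) a ` (cantor \<inter> {xp n i..<xp n (Suc i)})"

lemma piece_iff: "x \<in> piece n a i \<longleftrightarrow> x - a \<in> cantor \<and> xp n i \<le> x - a \<and> x - a < xp n (Suc i)"
  unfolding piece_def by (force simp: image_iff)

lemma piece_alt: "piece n a i = (+) a ` cantor \<inter> {a + xp n i..<a + xp n (Suc i)}"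
proof (rule set_eqI)
  fix y
  have im: "y \<in> (+) a ` S \<longleftrightarrow> y - a \<in> S" for S by (force simp: image_iff)
  show "y \<in> piece n a i \<longleftrightarrow> y \<in> (+) a ` cantor \<inter> {a + xp n i..<a + xp n (Suc i)}"
   unfolding piece_iff Int_iff im by auto
qed

lemma piece_sets [measurable]: "piece n a i \<in> sets borel"
  unfolding piece_alt by measurable

lemma piece_disjoint: "i \<noteq> j \<Longrightarrow> piece n a i \<inter> piece n a j = {}"
proof (induction i j rule: linorder_wlog)
  case (le i j)
  hence "xp n (Suc i) \<le> xp n j" by (intro xp_mono) auto
  thus ?case by (force simp: piece_iff)
qed auto

lemma piece_cover: "(+) a ` cantor = (\<Union>i<2 ^ n. piece n a i)"
proof (rule set_eqI)
  fix y
  have im: "y \<in> (+) a ` cantor \<longleftrightarrow> y - a \<in> cantor" by (force simp: image_iff)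
  show "y \<in> (+) a ` cantor \<longleftrightarrow> y \<in> (\<Union>i<2 ^ n. piece n a i)"
  proof
   assume "y \<in> (+) a ` cantor"
   hence c: "y - a \<in> cantor" by (simp only: im)
   hence "y - a \<in> Cn n" by (auto simp: cantor_def)
   then obtain i where "i < 2 ^ n" "y - a \<in> blk n i" by (auto simp: Cn_def)
   thus "y \<in> (\<Union>i<2 ^ n. piece n a i)" using c blk_ordered[of n i] unfolding UN_iff piece_iff by fastforce
  qed (auto simp: im piece_iff)
qed

lemma piece_near: "x \<in> piece n a i \<Longrightarrow> x \<in> {a + xp n i..a + xp n i + 2 / 2 ^ n}"
  using cantor_near[of "x - a" n i] by (auto simp: piece_iff)

text \<open>The \<open>4 ^ n\<close> products of pieces have area \<open>1 / 4 ^ n\<close> each and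
  lie in squares of side \<open>2 / 2 ^ n\<close> with known lower left corners. The integral
  differs from the sum over corners by at most the oscillation of \<Phi>.\<close>

lemma block_estimate:
  fixes \<Phi> :: "plane \<Rightarrow> real"
  assumes \<Phi>: "cont \<Phi>"
   and near: "\<And>i j x y. i < 2 ^ n \<Longrightarrow> j < 2 ^ n \<Longrightarrow> x \<in> {a + xp n i..a + xp n i + 2 / 2 ^ n} \<Longrightarrow>
    y \<in> {b + xp n j..b + xp n j + 2 / 2 ^ n} \<Longrightarrow> \<bar>\<Phi> (x, y) - \<Phi> (a + xp n i, b + xp n j)\<bar> \<le> om"
  shows "\<bar>(LINT p:(+) a ` cantor \<times> (+) b ` cantor|lborel. \<Phi> p) -
   (\<Sum>(i, j)\<in>{..<2 ^ n} \<times> {..<2 ^ n}. \<Phi> (a + xp n i, b + xp n j) / 4 ^ n)\<bar> \<le> om"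
proof -
  let ?I = "{..<2 ^ n} \<times> {..<2 ^ n} :: (nat \<times> nat) set"
  define P where "P ij = piece n a (fst ij) \<times> piece n b (snd ij)" for ij
  have [measurable]: "\<Phi> \<in> Bor" using \<Phi> by (rule Bor_contI)
  have Ps: "P ij \<in> sets borel" for ij unfolding P_def
   by (metis borel_prod pair_measureI piece_sets)
  have bC: "bounded ((+) c ` cantor)" for c :: real
   by (intro bounded_translation bounded_subset[OF _ cantor_bounds]) simp
  have K: "(+) a ` cantor \<times> (+) b ` cantor = (\<Union>ij\<in>?I. P ij)"
   unfolding piece_cover[of a n] piece_cover[of b n] P_def by auto
  have Pb: "bounded (P ij)" for ij
   unfolding P_def piece_alt by (intro bounded_Times bounded_Int) (simp_all add: bC)
  have int: "set_integrable lborel (P ij) f" if "cont f" for ij and f :: "plane \<Rightarrow> real"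
  proof -
   obtain r where r: "P ij \<subseteq> cbox (-r) r" using bounded_subset_cbox_symmetric[OF Pb] by blast
   have "set_integrable lborel (cbox (-r) r) f" unfolding set_integrable_def
    by (intro borel_integrable_compact compact_cbox continuous_on_subset[OF that]) auto
   thus ?thesis by (rule set_integrable_subset) (use r Ps in auto)
  qed
  have disj: "disjoint_family_on P ?I"
   unfolding disjoint_family_on_def
  proof (intro ballI impI)
   fix x y :: "nat \<times> nat" assume "x \<noteq> y"
   then consider "fst x \<noteq> fst y" | "snd x \<noteq> snd y" by (auto simp: prod_eq_iff)
   thus "P x \<inter> P y = {}"
    unfolding P_def Times_Int_Times using piece_disjoint by cases auto
  qed
  have mP: "measure lborel (P ij) = 1 / 4 ^ n" if "ij \<in> ?I" for ij
  proof -
   have "measure (lborel \<Otimes>\<^sub>M lborel) (piece n a (fst ij) \<times> piece n b (snd ij)) =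
     measure lborel (piece n a (fst ij)) * measure lborel (piece n b (snd ij))"
    by (simp add: measure_def lborel.emeasure_pair_measure_Times enn2real_mult)
   thus ?thesis using that measure_shift_ivl[of "fst ij" n a] measure_shift_ivl[of "snd ij" n b]
    by (auto simp: P_def lborel_prod piece_def power_mult_distrib[symmetric] mem_Times_iff)
  qed
  have one: "\<bar>(LINT p:P ij|lborel. \<Phi> p) - \<Phi> (a + xp n (fst ij), b + xp n (snd ij)) / 4 ^ n\<bar> \<le> om / 4 ^ n"
   if ij: "ij \<in> ?I" for ij
  proof -
   define v where "v = \<Phi> (a + xp n (fst ij), b + xp n (snd ij))"
   have i1: "set_integrable lborel (P ij) (\<lambda>_. c)" for c :: real by (rule int) simp
   have "(LINT p:P ij|lborel. v) = v / 4 ^ n" using mP[OF ij] by (simp add: set_int_def)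
   hence "(LINT p:P ij|lborel. \<Phi> p) - v / 4 ^ n = (LINT p:P ij|lborel. \<Phi> p - v)"
    by (simp add: set_integral_diff(2)[OF int[OF \<Phi>] i1])
   also have "\<bar>\<dots>\<bar> \<le> (LINT p:P ij|lborel. om)"
    unfolding set_int_def
   proof (rule integral_abs_bound[THEN order_trans], rule integral_mono)
    show "\<bar>ind (P ij) p *\<^sub>R (\<Phi> p - v)\<bar> \<le> ind (P ij) p *\<^sub>R om" for p
    proof (cases "p \<in> P ij")
     case True
     hence "fst p \<in> piece n a (fst ij)" "snd p \<in> piece n b (snd ij)" by (auto simp: P_def)
     hence "\<bar>\<Phi> (fst p, snd p) - v\<bar> \<le> om" using ij unfolding v_def
      by (intro near piece_near) auto
     thus ?thesis using True by simp
    qed simp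
    have "set_integrable lborel (P ij) (\<lambda>p. \<Phi> p - v)" by (rule int) (intro continuous_intros \<Phi>)
    thus "integrable lborel (\<lambda>p. \<bar>ind (P ij) p *\<^sub>R (\<Phi> p - v)\<bar>)"
     unfolding set_integrable_def by (rule integrable_abs)
    show "integrable lborel (\<lambda>p. ind (P ij) p *\<^sub>R om)" using i1 unfolding set_integrable_def .
   qed
   also have "\<dots> = om / 4 ^ n" using mP[OF ij] by (simp add: set_int_def)
   finally show ?thesis unfolding v_def .
  qed
  have "(LINT p:(+) a ` cantor \<times> (+) b ` cantor|lborel. \<Phi> p) = (\<Sum>ij\<in>?I. LINT p:P ij|lborel. \<Phi> p)"
   unfolding K by (rule set_integral_finite_Union) (use disj int[OF \<Phi>] Ps in auto)
  hence "\<bar>(LINT p:(+) a ` cantor \<times> (+) b ` cantor|lborel. \<Phi> p) -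
   (\<Sum>(i, j)\<in>?I. \<Phi> (a + xp n i, b + xp n j) / 4 ^ n)\<bar> =
   \<bar>\<Sum>ij\<in>?I. (LINT p:P ij|lborel. \<Phi> p) - \<Phi> (a + xp n (fst ij), b + xp n (snd ij)) / 4 ^ n\<bar>"
   by (simp add: sum_subtractf case_prod_unfold)
  also have "\<dots> \<le> (\<Sum>ij\<in>?I. om / 4 ^ n)"
   by (rule sum_abs[THEN order_trans], rule sum_mono) (rule one)
  also have "\<dots> = om" by (simp add: card_cartesian_product power_mult_distrib[symmetric])
  finally show ?thesis .
qed

text \<open>\<open>HH\<close> is the stream function. The streamline of level \<open>h\<close> in \<open>{5..<6}\<close> meets the dust
  \<open>(1 + C) \<times> (3 + C)\<close> over \<open>lim xi n h\<close> and the dust \<open>(4 + C) \<times> (1 + C)\<close> 3 units further right: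
  the base 4 digits of \<open>h - 5\<close> are split into the binary digits of the two Cantor coordinates.
  \<open>btw\<close> is the part of the streamlines between the two dusts.\<close>

definition xi :: "nat \<Rightarrow> real \<Rightarrow> real" where
  "xi n h = 1 + xp n (ev (nat \<lfloor>4 ^ n * (h - 5)\<rfloor>))"

lemma xi_mono: assumes "5 \<le> h" shows "xi n h \<le> xi (Suc n) h"
proof -
  define z where "z = h - 5"
  have z: "0 \<le> z" using assms by (simp add: z_def)
  define k where "k = nat \<lfloor>4 ^ Suc n * z\<rfloor>"
  have "k div 4 = nat \<lfloor>4 ^ n * z\<rfloor>"
  proof -
   have "\<lfloor>4 ^ n * z\<rfloor> = \<lfloor>4 ^ Suc n * z / real_of_int 4\<rfloor>" by simp
   also have "\<dots> = \<lfloor>4 ^ Suc n * z\<rfloor> div 4" by (rule floor_divide_real_eq_div) simp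
   finally show ?thesis unfolding k_def using z by (simp add: nat_div_distrib)
  qed
  hence "ev k = 2 * ev (nat \<lfloor>4 ^ n * z\<rfloor>) + k mod 2" by (subst ev_step) simp
  hence "xp (Suc n) (2 * ev (nat \<lfloor>4 ^ n * z\<rfloor>)) \<le> xp (Suc n) (ev k)" by (intro xp_mono) simp
  thus ?thesis using xp_pow[of 1 n "ev (nat \<lfloor>4 ^ n * z\<rfloor>)"] unfolding xi_def k_def z_def by simp
qed

definition btw_n :: "nat \<Rightarrow> plane set" where
  "btw_n n = {p. HH p \<in> {5..<6} \<and> fst p \<in> {xi n (HH p)..xi n (HH p) + 3}}"

definition btw :: "plane set" where
  "btw = {p. HH p \<in> {5..<6} \<and> (\<forall>n. xi n (HH p) \<le> fst p) \<and> (\<exists>n. fst p \<le> xi n (HH p) + 3)}"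

text \<open>\<open>xi n\<close> increases with n: a lower inequality that fails keeps failing, an
  upper inequality once true stays true. This is why \<open>btw\<close> has a universal quantifier
  on the left and an existential one on the right, and why the indicators converge at every
  point.\<close>

lemma btw_limit: "(\<lambda>n. ind (btw_n n) p) \<longlonglongrightarrow> ind btw p"
proof (cases "HH p \<in> {5..<6}")
  case True
  have mono: "xi n (HH p) \<le> xi m (HH p)" if "n \<le> m" for n m
   by (rule lift_Suc_mono_le[of "\<lambda>n. xi n (HH p)"]) (use True xi_mono that in auto)
  have "\<forall>\<^sub>F n in sequentially. ind (btw_n n) p = ind btw p"
  proof (cases "\<forall>n. xi n (HH p) \<le> fst p")
   case 1: True
   show ?thesis
   proof (cases "\<exists>n. fst p \<le> xi n (HH p) + 3")
    case 2: True
    then obtain N where N: "fst p \<le> xi N (HH p) + 3" by blast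
    show ?thesis unfolding eventually_sequentially
    proof (intro exI[of _ N] allI impI)
     fix n assume "N \<le> n"
     hence "p \<in> btw_n n" using mono[of N n] N 1 True unfolding btw_n_def by fastforce
     moreover have "p \<in> btw" using 1 2 True by (simp add: btw_def)
     ultimately show "ind (btw_n n) p = ind btw p" by simp
    qed
   next
    case False
    hence "p \<notin> btw_n n" "p \<notin> btw" for n by (auto simp: btw_n_def btw_def)
    thus ?thesis by simp
   qed
  next
   case False
   then obtain N where N: "fst p < xi N (HH p)" by (auto simp: not_le)
   have nb: "p \<notin> btw" using False by (auto simp: btw_def)
   show ?thesis unfolding eventually_sequentially
   proof (intro exI[of _ N] allI impI)
    fix n assume "N \<le> n"
    hence "p \<notin> btw_n n" using mono[of N n] N unfolding btw_n_def by fastforce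
    thus "ind (btw_n n) p = ind btw p" using nb by simp
   qed
  qed
  thus ?thesis by (rule tendsto_eventually)
next
  case False
  hence "p \<notin> btw_n n" "p \<notin> btw" for n by (auto simp: btw_n_def btw_def)
  thus ?thesis by simp
qed

text \<open>A level lies in exactly one band, numbered by the integer part of
  \<open>4 ^ n * (h - 5)\<close>. On a band the left end \<open>xi n h\<close> is constant, so
  \<open>btw_n n\<close> splits into strips to which \<open>green_band\<close> applies.\<close>

lemma btw_n_sum: "ind (btw_n n) p = (\<Sum>m<4 ^ n. ind {5 + real m / 4 ^ n..<5 + (real m + 1) / 4 ^ n} (HH p) *
   ind {1 + xp n (ev m)..4 + xp n (ev m)} (fst p))"
proof -
  define k where "k = nat \<lfloor>4 ^ n * (HH p - 5)\<rfloor>"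
  have J: "HH p \<in> {5 + real m / 4 ^ n..<5 + (real m + 1) / 4 ^ n} \<longleftrightarrow> 5 \<le> HH p \<and> m = k" for m
  proof -
   have "HH p \<in> {5 + real m / 4 ^ n..<5 + (real m + 1) / 4 ^ n} \<longleftrightarrow> real m \<le> 4 ^ n * (HH p - 5) \<and> 4 ^ n * (HH p - 5) < real m + 1"
    by (simp add: field_simps)
   also have "\<dots> \<longleftrightarrow> \<lfloor>4 ^ n * (HH p - 5)\<rfloor> = int m" by (simp add: floor_eq_iff)
   also have "\<dots> \<longleftrightarrow> 5 \<le> HH p \<and> m = k"
   proof
    assume a: "\<lfloor>4 ^ n * (HH p - 5)\<rfloor> = int m"
    hence "0 \<le> 4 ^ n * (HH p - 5)" by (metis of_nat_0_le_iff zero_le_floor)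
    hence "5 \<le> HH p" by (intro leI notI) (use mult_pos_neg[of "4 ^ n" "HH p - 5"] in simp)
    thus "5 \<le> HH p \<and> m = k" using a by (simp add: k_def)
   next
    assume "5 \<le> HH p \<and> m = k"
    thus "\<lfloor>4 ^ n * (HH p - 5)\<rfloor> = int m" by (simp add: k_def)
   qed
   finally show ?thesis .
  qed
  have k6: "k < 4 ^ n \<longleftrightarrow> HH p < 6" if "5 \<le> HH p"
  proof -
   have "k < 4 ^ n \<longleftrightarrow> \<lfloor>4 ^ n * (HH p - 5)\<rfloor> < int (4 ^ n)" unfolding k_def using that by (simp add: nat_less_iff)
   also have "\<dots> \<longleftrightarrow> 4 ^ n * (HH p - 5) < 4 ^ n * 1" by (simp add: floor_less_iff)
   also have "\<dots> \<longleftrightarrow> HH p < 6" by (subst mult_less_cancel_left_pos) auto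
   finally show ?thesis .
  qed
  have "(\<Sum>m<4 ^ n. ind {5 + real m / 4 ^ n..<5 + (real m + 1) / 4 ^ n} (HH p) *
   ind {1 + xp n (ev m)..4 + xp n (ev m)} (fst p)) =
   (\<Sum>m<4 ^ n. if m = k then (if 5 \<le> HH p then ind {1 + xp n (ev k)..4 + xp n (ev k)} (fst p) else 0) else 0)"
  proof (intro sum.cong refl)
   fix m
   have "ind {5 + real m / 4 ^ n..<5 + (real m + 1) / 4 ^ n} (HH p) = (if 5 \<le> HH p \<and> m = k then 1 else 0)"
    by (simp only: indicator_def J of_bool_def)
   thus "ind {5 + real m / 4 ^ n..<5 + (real m + 1) / 4 ^ n} (HH p) * ind {1 + xp n (ev m)..4 + xp n (ev m)} (fst p) =
    (if m = k then (if 5 \<le> HH p then ind {1 + xp n (ev k)..4 + xp n (ev k)} (fst p) else 0) else 0)"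
    by (simp del: indicator_simps)
  qed
  also have "\<dots> = (if k < 4 ^ n then (if 5 \<le> HH p then ind {1 + xp n (ev k)..4 + xp n (ev k)} (fst p) else 0) else 0)"
   by (simp add: sum.delta)
  also have "\<dots> = ind (btw_n n) p"
   using k6 by (auto simp: btw_n_def xi_def k_def indicator_def)
  finally show ?thesis by simp
qed


lemma btw_n_meas [measurable]: "btw_n n \<in> sets borel"
proof -
  have "ind (btw_n n) \<in> Bor"
   unfolding btw_n_sum[abs_def] by measurable
  thus ?thesis by (simp add: borel_measurable_indicator_iff)
qed

lemma btw_meas [measurable]: "btw \<in> sets borel"
proof -
  have "ind btw \<in> Bor"
   by (rule borel_measurable_LIMSEQ_real[OF btw_limit]) simp
  thus ?thesis by (simp add: borel_measurable_indicator_iff)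
qed

text \<open>Each band contributes its outflow at \<open>4 + xp n (ev m)\<close> minus its inflow at
  \<open>1 + xp n (ev m)\<close>. Two edges and two dusts are each approximated with error om, which
  gives the factor 4.\<close>

lemma core_n:
  assumes t3: "test3 ph phx phy pht"
   and near: "\<And>p q. p \<in> {0..8} \<times> {0..8} \<Longrightarrow> q \<in> {0..8} \<times> {0..8} \<Longrightarrow> \<bar>fst p - fst q\<bar> \<le> 2 / 2 ^ n \<Longrightarrow>
    \<bar>snd p - snd q\<bar> \<le> 2 / 2 ^ n \<Longrightarrow> \<bar>PH ph s p - PH ph s q\<bar> \<le> om"
  shows "\<bar>(LINT p:{0..6} \<times> {0..6}|lborel. ind (btw_n n) p * DT phx phy pht s p) -
   ((LINT p:(+) 4 ` cantor \<times> (+) 1 ` cantor|lborel. PH ph s p) -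
    (LINT p:(+) 1 ` cantor \<times> (+) 3 ` cantor|lborel. PH ph s p))\<bar> \<le> 4 * om"
proof -
  let ?Q = "{0..6} \<times> {0..6} :: plane set"
  note [measurable] = test3_meas[OF t3]
  define J where "J m = {5 + real m / 4 ^ n..<5 + (real m + 1) / 4 ^ n}" for m
  define X where "X m = xp n (ev m)" for m
  define Y where "Y m = xp n (od m)" for m
  have X: "0 \<le> X m" "X m \<le> 4/3" and Y: "0 \<le> Y m" "Y m \<le> 4/3" if "m < 4 ^ n" for m
   using xp_nonneg xp_less[OF ev_od_less(1)[OF that]] xp_less[OF ev_od_less(2)[OF that]] unfolding X_def Y_def
   by (auto intro: order_trans[rotated] simp: add.assoc)
  obtain M where M: "\<And>p. p \<in> ?Q \<Longrightarrow> \<bar>DT phx phy pht s p\<bar> \<le> M" "0 \<le> M"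
   by (rule DT_bounded[OF t3 compact_Times[OF compact_Icc compact_Icc]]) blast
  have Qb: "?Q \<in> sets borel" "bounded ?Q"
   by (intro borel_closed closed_Times closed_atLeastAtMost) (intro bounded_Times bounded_closed_interval)
  have int: "set_integrable lborel ?Q (\<lambda>p. (ind (J m) (HH p) * ind {1 + X m..4 + X m} (fst p)) * DT phx phy pht s p)" for m
   by (rule set_integrable_mult_bdd[where K=1, OF _ _ Qb _ M(1)]) (auto simp: indicator_def J_def)
  have "(LINT p:?Q|lborel. ind (btw_n n) p * DT phx phy pht s p) =
   (LINT p:?Q|lborel. \<Sum>m<4 ^ n. (ind (J m) (HH p) * ind {1 + X m..4 + X m} (fst p)) * DT phx phy pht s p)"
   unfolding btw_n_sum J_def X_def sum_distrib_right ..
  also have "\<dots> = (\<Sum>m<4 ^ n. LINT p:?Q|lborel. (ind (J m) (HH p) * ind {1 + X m..4 + X m} (fst p)) * DT phx phy pht s p)"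
   unfolding set_int_def scaleR_sum_right
   by (rule Bochner_Integration.integral_sum) (use int in \<open>simp add: set_integrable_def\<close>)
  also have "\<dots> = (\<Sum>m<4 ^ n. (LBINT y:{0..6}. (2 * cb y * ind (J m) (HH (4 + X m, y))) * PH ph s (4 + X m, y)) -
   (LBINT y:{0..6}. (2 * cb y * ind (J m) (HH (1 + X m, y))) * PH ph s (1 + X m, y)))"
  proof (rule sum.cong[OF refl])
   fix m :: nat assume "m \<in> {..<4 ^ n}"
   hence m: "m < 4 ^ n" by simp
   note XX = X[OF m]
   have e: "ev m \<le> 2 ^ n" using ev_od_less(1)[OF m] by simp
   have s1: "real (sp (ev m)) / 4 ^ n \<le> 1 / 3"
   proof -
    have "3 * sp (ev m) < 4 ^ n" using sp_bound[OF ev_od_less(1)[OF m]] .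
    hence "3 * real (sp (ev m)) \<le> 4 ^ n" by (metis less_imp_le of_nat_le_iff of_nat_mult of_nat_numeral of_nat_power)
    thus ?thesis by (simp add: divide_le_eq)
   qed
   \<comment> \<open>All bands have levels between 5 and 6. On the lower edge \<open>HH\<close> is
     less than 4, on the upper edge at least \<open>1 + 2 * 3\<close>.\<close>
   have edge1: "HH (x, 0) < 5 + real m / 4 ^ n" if "x \<in> {1 + X m..4 + X m}" for x
   proof -
    have "AA x \<le> AA (4 + X m)" using that XX by (intro AA_mono) auto
    also have "\<dots> = 3 + real (sp (ev m)) / 4 ^ n" using AA_val(2)[OF e] by (simp add: X_def)
    finally have "AA x < 4" using s1 by linarith
    moreover have "BB 0 = 0" by (simp add: BB_def prim_0)
    moreover have "0 \<le> real m / 4 ^ n" by simp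
    ultimately show ?thesis unfolding HH_def fst_conv snd_conv by linarith
   qed
   have edge2: "5 + (real m + 1) / 4 ^ n \<le> HH (x, 6)" if "x \<in> {1 + X m..4 + X m}" for x
   proof -
    have "AA 1 \<le> AA x" using that XX by (intro AA_mono) auto
    hence "1 \<le> AA x" using AA_val(1)[of 0 0] by simp
    moreover have "BB (3 + xp 0 1) \<le> BB 6" using xp_end[of 0] by (intro BB_mono) auto
    hence "3 \<le> BB 6" using BB_val(2)[of 1 0] by simp
    moreover have "real m + 1 \<le> 4 ^ n" using m by (metis Suc_eq_plus1 Suc_leI of_nat_1 of_nat_add of_nat_le_iff of_nat_numeral of_nat_power)
    hence "(real m + 1) / 4 ^ n \<le> 1" by (simp add: divide_le_eq)
    ultimately show ?thesis unfolding HH_def fst_conv snd_conv by linarith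
   qed
   have "(LINT p:?Q|lborel. (ind (J m) (HH p) * ind {1 + X m..4 + X m} (fst p)) * DT phx phy pht s p) =
     (LINT p:{1 + X m..4 + X m} \<times> {0..6}|lborel. ind (J m) (HH p) * DT phx phy pht s p)"
    unfolding set_int_def using XX
    by (intro int_cong refl) (auto simp: indicator_def)
   also have "\<dots> = (LBINT y:{0..6}. (2 * cb y * ind (J m) (HH (4 + X m, y))) * PH ph s (4 + X m, y)) -
   (LBINT y:{0..6}. (2 * cb y * ind (J m) (HH (1 + X m, y))) * PH ph s (1 + X m, y))"
    unfolding J_def using XX edge1 edge2
    by (intro green_band[OF t3]) (auto simp: divide_right_mono)
   finally show "(LINT p:?Q|lborel. (ind (J m) (HH p) * ind {1 + X m..4 + X m} (fst p)) * DT phx phy pht s p) = \<dots>" .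
  qed
  finally have main: "(LINT p:?Q|lborel. ind (btw_n n) p * DT phx phy pht s p) =
   (\<Sum>m<4 ^ n. (LBINT y:{0..6}. (2 * cb y * ind (J m) (HH (4 + X m, y))) * PH ph s (4 + X m, y))) -
   (\<Sum>m<4 ^ n. (LBINT y:{0..6}. (2 * cb y * ind (J m) (HH (1 + X m, y))) * PH ph s (1 + X m, y)))"
   by (simp add: sum_subtractf)
  have u1: "2 / 2 ^ n \<le> (2 :: real)" by (simp add: divide_le_eq)
  have edge: "\<bar>(\<Sum>m<4 ^ n. (LBINT y:{0..6}. (2 * cb y * ind (J m) (HH (c + X m, y))) * PH ph s (c + X m, y))) -
    (\<Sum>m<4 ^ n. PH ph s (c + X m, d + Y m) / 4 ^ n)\<bar> \<le> om"
   if c: "(c = 4 \<and> d = 1) \<or> (c = 1 \<and> d = 3)" for c d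
  proof -
   have "\<bar>(LBINT y:{0..6}. (2 * cb y * ind (J m) (HH (c + X m, y))) * PH ph s (c + X m, y)) -
     PH ph s (c + X m, d + Y m) / 4 ^ n\<bar> \<le> om / 4 ^ n" if m: "m < 4 ^ n" for m
    unfolding J_def
   proof (rule edge_estimate[OF t3 m, where yb=d and \<alpha>="if c = 4 then 3 else 1" and \<beta>="if c = 4 then 1 else 2"])
    show "AA (c + X m) = (if c = 4 then 3 else 1) + real (sp (ev m)) / 4 ^ n"
     using AA_val[OF less_imp_le[OF ev_od_less(1)[OF m]]] c by (auto simp: X_def)
    show "BB (d + xp n k) = (if c = 4 then 1 else 2) + real (sp k) / 4 ^ n" if "k \<le> 2 ^ n" for k
     using BB_val[OF that] c by auto
    fix y assume y: "y \<in> {d + xp n (od m)..d + xp n (od m) + 2 / 2 ^ n}"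
    show "\<bar>PH ph s (c + X m, y) - PH ph s (c + X m, d + Y m)\<bar> \<le> om"
     using y X[OF m] Y[OF m] c u1 by (intro near) (auto simp: Y_def)
   qed (use c in auto)
   hence "\<bar>\<Sum>m<4 ^ n. (LBINT y:{0..6}. (2 * cb y * ind (J m) (HH (c + X m, y))) * PH ph s (c + X m, y)) -
     PH ph s (c + X m, d + Y m) / 4 ^ n\<bar> \<le> (\<Sum>m<(4::nat) ^ n. om / 4 ^ n)"
    by (intro sum_abs[THEN order_trans] sum_mono) auto
   thus ?thesis by (simp add: sum_subtractf)
  qed
  have blk: "\<bar>(LINT p:(+) c ` cantor \<times> (+) d ` cantor|lborel. PH ph s p) - (\<Sum>m<4 ^ n. PH ph s (c + X m, d + Y m) / 4 ^ n)\<bar> \<le> om"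
   if c: "(c = 4 \<and> d = 1) \<or> (c = 1 \<and> d = 3)" for c d
  proof -
   have "(\<Sum>m<4 ^ n. PH ph s (c + X m, d + Y m) / 4 ^ n) = (\<Sum>(i, j)\<in>{..<2 ^ n} \<times> {..<2 ^ n}. PH ph s (c + xp n i, d + xp n j) / 4 ^ n)"
    unfolding X_def Y_def
    using sum.reindex_bij_betw[OF ev_od_bij[of n], of "\<lambda>(i, j). PH ph s (c + xp n i, d + xp n j) / 4 ^ n"] by simp
   moreover have "\<bar>(LINT p:(+) c ` cantor \<times> (+) d ` cantor|lborel. PH ph s p) -
    (\<Sum>(i, j)\<in>{..<2 ^ n} \<times> {..<2 ^ n}. PH ph s (c + xp n i, d + xp n j) / 4 ^ n)\<bar> \<le> om"
   proof (rule block_estimate[OF PH_cont[OF test3_continuous[OF t3]]])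
    fix i j :: nat and x y assume i: "i < 2 ^ n" and j: "j < 2 ^ n" and x: "x \<in> {c + xp n i..c + xp n i + 2 / 2 ^ n}"
     and y: "y \<in> {d + xp n j..d + xp n j + 2 / 2 ^ n}"
    have "xp n i \<le> 2" "xp n j \<le> 2" using xp_le i j by (simp_all add: less_imp_le)
    thus "\<bar>PH ph s (x, y) - PH ph s (c + xp n i, d + xp n j)\<bar> \<le> om"
     using x y c u1 xp_nonneg[of n i] xp_nonneg[of n j] by (intro near) auto
   qed
   ultimately show ?thesis by simp
  qed
  have c1: "(4 = (4::real) \<and> 1 = (1::real)) \<or> (4 = (1::real) \<and> 1 = (3::real))"
   and c2: "(1 = (4::real) \<and> 3 = (1::real)) \<or> (1 = (1::real) \<and> 3 = (3::real))" by simp_all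
  show ?thesis unfolding main using edge[OF c1] edge[OF c2] blk[OF c1] blk[OF c2] by linarith
qed

text \<open>The limit of \<open>core_n\<close>, with om made small by uniform continuity. For a test
  function without time it says that the field cut off to the segments between the dusts has one
  dust as source and the other as sink, with density 1 on each.\<close>

lemma core_identity:
  assumes t3: "test3 ph phx phy pht"
  shows "(LINT p:{0..6} \<times> {0..6}|lborel. ind btw p * DT phx phy pht s p) =
   (LINT p:(+) 4 ` cantor \<times> (+) 1 ` cantor|lborel. PH ph s p) -
    (LINT p:(+) 1 ` cantor \<times> (+) 3 ` cantor|lborel. PH ph s p)" (is "_ = ?R")
proof -
  let ?Q = "{0..6} \<times> {0..6} :: plane set"
  note [measurable] = test3_meas[OF t3]
  let ?L = "\<lambda>n. LINT p:?Q|lborel. ind (btw_n n) p * DT phx phy pht s p"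
  obtain M where M: "\<And>p. p \<in> ?Q \<Longrightarrow> \<bar>DT phx phy pht s p\<bar> \<le> M" "0 \<le> M"
   by (rule DT_bounded[OF t3 compact_Times[OF compact_Icc compact_Icc]]) blast
  have Qb: "?Q \<in> sets borel" "bounded ?Q"
   by (intro borel_closed closed_Times closed_atLeastAtMost) (intro bounded_Times bounded_closed_interval)
  have "?L \<longlonglongrightarrow> (LINT p:?Q|lborel. ind btw p * DT phx phy pht s p)"
  proof (rule dct_bdd[OF _ _ Qb, where K=M])
   fix k and p :: "plane" assume "p \<in> ?Q"
   thus "\<bar>ind (btw_n k) p * DT phx phy pht s p\<bar> \<le> M"
    using M(1)[of p] M(2) by (auto simp: indicator_def)
  qed (measurable, rule tendsto_mult_right, rule btw_limit)
  moreover have "?L \<longlonglongrightarrow> ?R"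
  proof (rule LIMSEQ_I)
   fix r :: real assume r: "0 < r"
   have "uniformly_continuous_on ({0..8} \<times> {0..8}) (PH ph s)"
    by (intro compact_uniformly_continuous compact_Times compact_Icc continuous_on_subset[OF PH_cont[OF test3_continuous[OF t3]]]) auto
   then obtain d where d: "0 < d" "\<And>p q. p \<in> {0..8} \<times> {0..8} \<Longrightarrow> q \<in> {0..8} \<times> {0..8} \<Longrightarrow> dist q p < d \<Longrightarrow>
     dist (PH ph s q) (PH ph s p) < r / 8"
    unfolding uniformly_continuous_on_def using r by (elim allE[of _ "r / 8"]) auto
   obtain N where N: "(1 / 2) ^ N < d / 8" using real_arch_pow_inv[of "d / 8" "1 / 2"] d(1) by auto
   show "\<exists>no. \<forall>n\<ge>no. norm (?L n - ?R) < r"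
   proof (intro exI[of _ N] allI impI)
    fix n assume "N \<le> n"
    hence "(1 / 2) ^ n \<le> (1 / 2 :: real) ^ N" by (intro power_decreasing) auto
    moreover have "2 / 2 ^ n = 2 * (1 / 2 :: real) ^ n" by (simp add: power_divide)
    ultimately have small: "2 / 2 ^ n < d / 4" using N by linarith
    have "\<bar>?L n - ?R\<bar> \<le> 4 * (r / 8)"
    proof (rule core_n[OF t3])
     fix p q :: "plane"
     assume p: "p \<in> {0..8} \<times> {0..8}" "q \<in> {0..8} \<times> {0..8}" "\<bar>fst p - fst q\<bar> \<le> 2 / 2 ^ n" "\<bar>snd p - snd q\<bar> \<le> 2 / 2 ^ n"
     have "dist q p \<le> \<bar>fst p - fst q\<bar> + \<bar>snd p - snd q\<bar>"
      using sqrt_sum_squares_le_sum_abs[of "dist (fst q) (fst p)" "dist (snd q) (snd p)"]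
      by (simp add: dist_prod_def dist_real_def abs_minus_commute)
     hence "dist q p < d" using p small d by linarith
     thus "\<bar>PH ph s p - PH ph s q\<bar> \<le> r / 8" using d(2)[OF p(1,2)] by (simp add: dist_real_def abs_minus_commute)
    qed
    thus "norm (?L n - ?R) < r" using r by simp
   qed
  qed
  ultimately show ?thesis by (rule LIMSEQ_unique)
qed

text \<open>\<open>V\<close> is divergence free with stream function \<open>G\<close>, and \<open>F\<close> is a weak solution of the
  transport equation of \<open>V\<close> for all times.\<close>

definition wave :: "plane set \<Rightarrow> (plane \<Rightarrow> real) \<Rightarrow> (plane \<Rightarrow> real) \<Rightarrow>
   (plane \<Rightarrow> real \<Rightarrow> real) \<Rightarrow> (plane \<Rightarrow> real) \<Rightarrow> bool" where
  "wave S V1 V2 F G \<longleftrightarrow>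
   S \<in> sets borel \<and> bounded S \<and>
   V1 \<in> Bor \<and> V2 \<in> Bor \<and> G \<in> Bor \<and>
   (\<lambda>z. F (fst z) (snd z)) \<in> Bor \<and>
   (\<forall>p. p \<notin> S \<longrightarrow> V1 p = 0 \<and> V2 p = 0 \<and> G p = 0 \<and> (\<forall>t. F p t = 0)) \<and>
   (\<exists>K. \<forall>p t. \<bar>V1 p\<bar> \<le> K \<and> \<bar>V2 p\<bar> \<le> K \<and> \<bar>G p\<bar> \<le> K \<and> \<bar>F p t\<bar> \<le> K) \<and>
   (\<forall>x y. G (x, y) = (LBINT u:{..y}. V1 (x, u))) \<and> (\<forall>x. (LBINT u. V1 (x, u)) = 0) \<and>
   (\<forall>x y. G (x, y) = - (LBINT u:{..x}. V2 (u, y))) \<and> (\<forall>y. (LBINT u. V2 (u, y)) = 0) \<and>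
   (\<forall>ph phx phy pht a b. test3 ph phx phy pht \<longrightarrow> (\<forall>x y t. t \<notin> {a..b} \<longrightarrow> ph (x, y, t) = 0) \<longrightarrow>
     (LINT p|lborel. LINT t|lborel. F p t * (pht (fst p, snd p, t) + V1 p * phx (fst p, snd p, t) + V2 p * phy (fst p, snd p, t))) = 0)"

section \<open>A closed vortex carrying the dusts\<close>

definition sg :: "real \<Rightarrow> real" where "sg u = (if 0 \<le> u then 1 else -1)"

lemma sg_meas [measurable]: "sg \<in> Bor"
  unfolding sg_def[abs_def] by measurable

text \<open>On a coordinate line the velocity is an odd profile cut off at a level, so its primitive
  is an even cone and its total integral is zero. Used on vertical lines with
  \<open>c = (6 - AA \<bar>x\<bar>) / 2\<close> and on horizontal ones with
  \<open>c = 6 - 2 * BB \<bar>y\<bar>\<close>; a negative c gives the zero profile.\<close>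

lemma cone_integral:
  fixes f :: "real \<Rightarrow> real"
  assumes f: "f \<in> Bor" "\<And>x. f x \<in> {0..1}" and Y: "0 \<le> Y" "c \<le> prim f Y"
  defines "v \<equiv> \<lambda>u. if prim f \<bar>u\<bar> < c then sg u * f \<bar>u\<bar> else 0"
  shows "(LBINT u:{..y}. v u) = - max 0 (c - prim f \<bar>y\<bar>)" and "(LBINT u. v u) = 0"
   and "Y \<le> \<bar>u\<bar> \<Longrightarrow> v u = 0"
proof -
  have ab: "\<bar>f x\<bar> \<le> 1" for x using f(2)[of x] by auto
  note [measurable] = f(1) prim_measurable[OF f]
  have P0: "0 \<le> prim f x" if "0 \<le> x" for x using prim_bounds[OF f that] by simp
  show vY: "v u = 0" if "Y \<le> \<bar>u\<bar>" for u
   using prim_mono_lip(1)[OF f Y(1) that] Y unfolding v_def by auto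
  have "(LBINT u:{..y}. v u) = - max 0 (c - prim f \<bar>y\<bar>) \<and> (LBINT u. v u) = 0"
  proof (cases "0 \<le> c")
   case False
   have "\<not> prim f \<bar>u\<bar> < c" for u using P0[OF abs_ge_zero, of u] False by linarith
   hence "v = (\<lambda>u. 0)" unfolding v_def by simp
   thus ?thesis using False P0[of "\<bar>y\<bar>"] by (auto simp: max_def set_int_def)
  next
   case True
   have c0: "prim f 0 \<le> c" using True by (simp add: prim_0)
   obtain z where z: "z \<in> {0..Y}" "prim f z = c" "\<And>y. y \<in> {0..Y} \<Longrightarrow> c \<le> prim f y \<longleftrightarrow> z \<le> y"
    by (rule prim_level[OF f order.refl Y(1) c0 Y(2)]) blast
   have lt: "prim f w < c \<longleftrightarrow> w < z" if "0 \<le> w" for w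
   proof (cases "w \<le> Y")
    case True thus ?thesis using z(3)[of w] that by (simp add: not_le[symmetric])
   next
    case False
    hence "prim f Y \<le> prim f w" using prim_mono_lip(1)[OF f Y(1)] by auto
    thus ?thesis using False z(1) Y by simp
   qed
   have v: "v u = ind {0..<z} u * f u - ind {0<..<z} (- u) * f (- u)" for u
   proof (cases "0 \<le> u")
    case True
    thus ?thesis unfolding v_def lt[OF abs_ge_zero] by (simp add: sg_def indicator_def)
   next
    case False
    thus ?thesis unfolding v_def lt[OF abs_ge_zero] by (simp add: sg_def indicator_def)
   qed
   have zp: "0 \<le> z" using z(1) by simp
   have int: "integrable lborel (\<lambda>u. ind S u * f u)" if "S \<in> sets borel" "bounded S" for S
    using set_integrable_bdd[OF f(1) ab that] unfolding set_integrable_def real_scaleR_def .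
   have seg: "(LBINT u. ind S u * f u) = prim f d - prim f c" if "0 \<le> c" "c \<le> d" "S - {c, d} = {c<..<d}" "S \<in> sets borel" for S c d
   proof -
    have "(LBINT u. ind S u * f u) = (LBINT u. ind {c<..d} u * f u)"
    proof (rule integral_cong_AE)
     show "AE u in lborel. ind S u * f u = ind {c<..d} u * f u"
      using AE_lborel_singleton[of c] AE_lborel_singleton[of d]
     proof eventually_elim
      case (elim u)
      have "u \<in> S - {c, d} \<longleftrightarrow> u \<in> {c<..<d}" unfolding that(3) ..
      hence "u \<in> S \<longleftrightarrow> u \<in> {c<..d}" using elim by auto
      thus ?case by (simp add: indicator_def)
     qed
    qed (use that in auto)
    thus ?thesis using prim_diff[OF f(1) ab that(1,2)] by (simp add: set_int_def)
   qed
   have refl: "(LBINT u. g (- u)) = (LBINT u. g u)" for g :: "real \<Rightarrow> real"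
    using lborel_integral_real_affine[of "-1" g 0] by simp
   have intr: "integrable lborel (\<lambda>u. g (- u))" if "integrable lborel g" for g :: "real \<Rightarrow> real"
    using lborel_integrable_real_affine[OF that, of "-1" 0] by simp
   have tot: "(LBINT u. ind T u * v u) = (LBINT u. ind (T \<inter> {0..<z}) u * f u) - (LBINT u. ind (uminus -` T \<inter> {0<..<z}) u * f u)"
    if T: "T \<in> sets borel" for T
   proof -
    have T': "uminus -` T \<in> sets borel" using measurable_sets[of uminus borel borel T] T by simp
    have i2: "integrable lborel (\<lambda>u. ind (uminus -` T \<inter> {0<..<z}) u * f u)"
     using T' by (intro int) auto
    have "(LBINT u. ind T u * v u) = (LBINT u. ind (T \<inter> {0..<z}) u * f u - ind (uminus -` T \<inter> {0<..<z}) (-u) * f (-u))"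
     by (rule int_cong) (auto simp: v indicator_def)
    also have "\<dots> = (LBINT u. ind (T \<inter> {0..<z}) u * f u) - (LBINT u. ind (uminus -` T \<inter> {0<..<z}) (-u) * f (-u))"
     by (rule Bochner_Integration.integral_diff) (use T in \<open>auto intro!: int intr[OF i2]\<close>)
    finally show ?thesis using refl[of "\<lambda>u. ind (uminus -` T \<inter> {0<..<z}) u * f u"] by simp
   qed
   have s1: "(LBINT u. ind {0..<z} u * f u) = prim f z - prim f 0"
    by (rule seg) (use zp in auto)
   have s2: "(LBINT u. ind {0<..<z} u * f u) = prim f z - prim f 0"
    by (rule seg) (use zp in auto)
   have U: "(UNIV :: real set) \<in> sets borel" by simp
   have "(LBINT u. v u) = (LBINT u. ind UNIV u * v u)" by simp
   also have "\<dots> = (prim f z - prim f 0) - (prim f z - prim f 0)"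
    unfolding tot[OF U] by (simp add: s1 s2)
   finally have A: "(LBINT u. v u) = 0" by simp
   have "(LBINT u:{..y}. v u) = (LBINT u. ind {..y} u * v u)" by (simp add: set_int_def)
   also have "\<dots> = - max 0 (c - prim f \<bar>y\<bar>)"
   proof (cases "0 \<le> y")
    case True
    have 1: "uminus -` {..y} \<inter> {0<..<z} = {0<..<z}" using True by auto
    have 2: "({..y} \<inter> {0..<z}) - {0, min y z} = {0<..<min y z}" using True zp by auto
    have "(LBINT u. ind {..y} u * v u) = (prim f (min y z) - prim f 0) - (prim f z - prim f 0)"
     unfolding tot[OF borel_closed[OF closed_atMost]] 1
     using seg[of 0 "min y z" "{..y} \<inter> {0..<z}", OF _ _ 2] True zp s2 by simp
    thus ?thesis using True lt[OF True] z(2) by (auto simp: min_def max_def)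
   next
    case False
    have 1: "{..y} \<inter> {0..<z} = {}" using False by auto
    show ?thesis
    proof (cases "- y \<le> z")
     case True
     have 2: "(uminus -` {..y} \<inter> {0<..<z}) - {- y, z} = {- y<..<z}" using False by auto
     have "(LBINT u. ind {..y} u * v u) = - (prim f z - prim f (- y))"
      unfolding tot[OF borel_closed[OF closed_atMost]] 1
      using seg[of "- y" z "uminus -` {..y} \<inter> {0<..<z}", OF _ _ 2] True False measurable_sets[of uminus borel borel "{..y}"] by simp
     moreover have "prim f (- y) \<le> c" using prim_mono_lip(1)[OF f, of "- y" z] True False z by simp
     ultimately show ?thesis using False z by simp
    next
     case F2: False
     hence "uminus -` {..y} \<inter> {0<..<z} = {}" by auto
     hence "(LBINT u. ind {..y} u * v u) = 0" unfolding tot[OF borel_closed[OF closed_atMost]] 1 by simp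
     thus ?thesis using F2 False lt[of "- y"] by (simp add: max_def)
    qed
   qed
   finally show ?thesis using A by simp
  qed
  thus "(LBINT u:{..y}. v u) = - max 0 (c - prim f \<bar>y\<bar>)" and "(LBINT u. v u) = 0" by auto
qed

text \<open>Reflection in both axes closes the streamlines around the origin, so that cutting at
  level 6 leaves a divergence-free field of compact support. The levels from 5 to 6 that meet the
  dusts form the outermost shell; \<open>LR\<close> and \<open>UL\<close> lie in the first
  quadrant.\<close>

definition Hb :: "plane \<Rightarrow> real" where "Hb p = AA \<bar>fst p\<bar> + 2 * BB \<bar>snd p\<bar>"
definition Vb1 :: "plane \<Rightarrow> real" where "Vb1 p = (if Hb p < 6 then 2 * sg (snd p) * cb \<bar>snd p\<bar> else 0)"
definition Vb2 :: "plane \<Rightarrow> real" where "Vb2 p = (if Hb p < 6 then - sg (fst p) * ca \<bar>fst p\<bar> else 0)"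
definition Gb :: "plane \<Rightarrow> real" where "Gb p = - max 0 (6 - Hb p)"

lemma AA8: "AA 8 = 6" and BB5: "BB 5 = 3"
proof -
  have b: "x \<in> cantor \<Longrightarrow> x < 2" for x using cantor_bounds by force
  have "C1 \<inter> {0..<8} = C1 \<inter> {0..<6}" unfolding C1_def using b by fastforce
  hence "AA 8 = 8 - measure lborel (C1 \<inter> {0..<6})" unfolding AA_def by (simp add: prim_compl)
  moreover have "AA 6 = 6 - measure lborel (C1 \<inter> {0..<6})" unfolding AA_def by (simp add: prim_compl)
  moreover have "AA 6 = 4" using AA_val(2)[of 1 0] xp_end[of 0] by simp
  ultimately show "AA 8 = 6" by linarith
  show "BB 5 = 3" using BB_val(2)[of 1 0] xp_end[of 0] by simp
qed

lemma AA_nonneg: "0 \<le> x \<Longrightarrow> 0 \<le> AA x" and BB_nonneg: "0 \<le> x \<Longrightarrow> 0 \<le> BB x"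
  using prim_bounds[OF c_props(1,3), of x] prim_bounds[OF c_props(2,4), of x] by (auto simp: AA_def BB_def)

lemma Hb_cont: "cont Hb"
  unfolding Hb_def by (intro continuous_intros continuous_on_compose2[OF AB_cont(1)] continuous_on_compose2[OF AB_cont(2)]) auto

lemma Hb_meas [measurable]: "Hb \<in> Bor"
  using Hb_cont by (rule Bor_contI)

lemma Vb_meas [measurable]: "Vb1 \<in> Bor" "Vb2 \<in> Bor" "Gb \<in> Bor"
  unfolding Vb1_def[abs_def] Vb2_def[abs_def] Gb_def[abs_def] by measurable

lemma Hb_big: assumes "p \<notin> {-8<..<8} \<times> {-8<..<8}" shows "6 \<le> Hb p"
proof -
  have n: "0 \<le> AA \<bar>fst p\<bar>" "0 \<le> BB \<bar>snd p\<bar>" by (simp_all add: AA_nonneg BB_nonneg)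
  have "8 \<le> \<bar>fst p\<bar> \<or> 8 \<le> \<bar>snd p\<bar>" using assms by (cases p) auto
  thus ?thesis
  proof
   assume "8 \<le> \<bar>fst p\<bar>" hence "AA 8 \<le> AA \<bar>fst p\<bar>" by (intro AA_mono) auto
   thus ?thesis using n by (simp add: AA8 Hb_def)
  next
   assume "8 \<le> \<bar>snd p\<bar>" hence "BB 5 \<le> BB \<bar>snd p\<bar>" by (intro BB_mono) auto
   thus ?thesis using n by (simp add: BB5 Hb_def)
  qed
qed

lemma Vb_bound: "\<bar>Vb1 p\<bar> \<le> 2" "\<bar>Vb2 p\<bar> \<le> 1" "\<bar>Gb p\<bar> \<le> 6"
proof -
  have n: "0 \<le> Hb p" by (simp add: Hb_def AA_nonneg BB_nonneg)
  show "\<bar>Vb1 p\<bar> \<le> 2" "\<bar>Vb2 p\<bar> \<le> 1" "\<bar>Gb p\<bar> \<le> 6"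
   using n by (auto simp: Vb1_def Vb2_def Gb_def sg_def indicator_def)
qed

lemma Gb_integrals:
  shows "Gb (x, y) = (LBINT u:{..y}. Vb1 (x, u))" "(LBINT u. Vb1 (x, u)) = 0"
   "Gb (x, y) = - (LBINT u:{..x}. Vb2 (u, y))" "(LBINT u. Vb2 (u, y)) = 0"
proof -
  define c where "c = (6 - AA \<bar>x\<bar>) / 2"
  have c3: "c \<le> prim (\<lambda>u. cb u) 5" using BB5 AA_nonneg[of "\<bar>x\<bar>"] by (simp add: c_def BB_def)
  have V1: "Vb1 (x, u) = 2 * (if prim (\<lambda>u. cb u) \<bar>u\<bar> < c then sg u * cb \<bar>u\<bar> else 0)" for u
   unfolding c_def by (auto simp: Vb1_def Hb_def BB_def)
  note I1 = cone_integral[OF c_props(2,4) _ c3]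
  show "Gb (x, y) = (LBINT u:{..y}. Vb1 (x, u))" "(LBINT u. Vb1 (x, u)) = 0"
   unfolding V1 using I1(1)[of y] I1(2) by (auto simp: Gb_def Hb_def c_def BB_def max_def field_simps)
  define d where "d = 6 - 2 * BB \<bar>y\<bar>"
  have d8: "d \<le> prim (\<lambda>u. ca u) 8" using AA8 BB_nonneg[of "\<bar>y\<bar>"] by (simp add: d_def AA_def)
  have V2: "Vb2 (u, y) = - (if prim (\<lambda>u. ca u) \<bar>u\<bar> < d then sg u * ca \<bar>u\<bar> else 0)" for u
   unfolding d_def by (auto simp: Vb2_def Hb_def AA_def)
  note I2 = cone_integral[OF c_props(1,3) _ d8]
  have neg: "(LBINT u:S. - g u) = - (LBINT u:S. g u)" for S and g :: "real \<Rightarrow> real"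
   by (simp add: set_int_def)
  show "Gb (x, y) = - (LBINT u:{..x}. Vb2 (u, y))" "(LBINT u. Vb2 (u, y)) = 0"
   unfolding V2 neg using I2(1)[of x] I2(2) by (auto simp: Gb_def Hb_def d_def AA_def max_def)
qed

lemma fst_snd_borel [measurable]:
  "fst \<in> (borel :: ('a::second_countable_topology \<times> 'b::second_countable_topology) measure) \<rightarrow>\<^sub>M borel"
  "snd \<in> (borel :: ('a::second_countable_topology \<times> 'b::second_countable_topology) measure) \<rightarrow>\<^sub>M borel"
  using Bor_contI[OF continuous_on_fst[OF continuous_on_id]]
    Bor_contI[OF continuous_on_snd[OF continuous_on_id]] by simp_all

lemma test3_supp:
  assumes t3: "test3 ph phx phy pht" and z: "\<And>x y t. t \<notin> {a..b} \<Longrightarrow> ph (x, y, t) = 0" and t: "t \<notin> {a..b}"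
  shows "phx (x, y, t) = 0" "phy (x, y, t) = 0" "pht (x, y, t) = 0"
proof -
  have "((\<lambda>u. ph (u, y, t)) has_real_derivative (1 * phx (x, y, t) + 0 * phy (x, y, t) + 0 * pht (x, y, t))) (at x)"
   by (rule test3_chain[OF t3]) (auto intro!: derivative_eq_intros)
  moreover have "((\<lambda>u. ph (u, y, t)) has_real_derivative 0) (at x)" using z[OF t] by simp
  ultimately show "phx (x, y, t) = 0" using DERIV_unique by fastforce
  have "((\<lambda>u. ph (x, u, t)) has_real_derivative (0 * phx (x, y, t) + 1 * phy (x, y, t) + 0 * pht (x, y, t))) (at y)"
   by (rule test3_chain[OF t3]) (auto intro!: derivative_eq_intros)
  moreover have "((\<lambda>u. ph (x, u, t)) has_real_derivative 0) (at y)" using z[OF t] by simp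
  ultimately show "phy (x, y, t) = 0" using DERIV_unique by fastforce
  have "((\<lambda>u. ph (x, y, u)) has_real_derivative (0 * phx (x, y, t) + 0 * phy (x, y, t) + 1 * pht (x, y, t))) (at t)"
   by (rule test3_chain[OF t3]) (auto intro!: derivative_eq_intros)
  moreover have "((\<lambda>u. ph (x, y, u)) has_real_derivative 0) (at t)"
  proof (rule has_field_derivative_transform_within_open[of "\<lambda>_. 0" 0 t "- {a..b}"])
   show "open (- {a..b})" by (rule open_Compl[OF closed_atLeastAtMost])
  qed (use t z in auto)
  ultimately show "pht (x, y, t) = 0" using DERIV_unique by fastforce
qed

text \<open>Both dusts lie in \<open>C1 \<times> C2\<close>, where the flow vanishes; the mass that travels in between appears
  and disappears there.\<close>

definition tau :: "plane \<Rightarrow> real" where "tau p = (fst p - AA (fst p)) / 2 - snd p"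
definition Nset :: "plane set" where "Nset = btw \<inter> ({0..6} \<times> {0..6}) - C1 \<times> C2"
definition LR :: "plane set" where "LR = (+) 4 ` cantor \<times> (+) 1 ` cantor"
definition UL :: "plane set" where "UL = (+) 1 ` cantor \<times> (+) 3 ` cantor"
definition kap :: "plane \<Rightarrow> real" where "kap p = indicator LR p - indicator UL p"
definition Fb :: "(real \<Rightarrow> real) \<Rightarrow> (real \<Rightarrow> real) \<Rightarrow> plane \<Rightarrow> real \<Rightarrow> real" where
  "Fb r R p t = indicator Nset p * r (t - tau p) + kap p * R (t - tau p)"

lemma LR_UL_sets [measurable]: "LR \<in> sets borel" "UL \<in> sets borel" "C1 \<times> C2 \<in> sets borel" "Nset \<in> sets borel"
proof -
  have *: "A \<times> B \<in> sets borel" if "closed A" "closed B" for A B :: "real set"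
   using that by (intro borel_closed closed_Times)
  show "LR \<in> sets borel" "UL \<in> sets borel" "C1 \<times> C2 \<in> sets borel"
   unfolding LR_def UL_def by (intro * closed_shift C1_closed C2_closed)+
  thus "Nset \<in> sets borel"
   unfolding Nset_def using *[OF closed_atLeastAtMost closed_atLeastAtMost] by auto
qed

lemma tau_meas [measurable]: "tau \<in> Bor" unfolding tau_def[abs_def] by measurable
lemma kap_meas [measurable]: "kap \<in> Bor" unfolding kap_def[abs_def] by measurable

lemma LR_UL_sub: "LR \<subseteq> {0..6} \<times> {0..6}" "UL \<subseteq> {0..6} \<times> {0..6}" "LR \<subseteq> C1 \<times> C2" "UL \<subseteq> C1 \<times> C2" "LR \<inter> UL = {}"
proof -
  have b: "(+) a ` cantor \<subseteq> {a..a + 4/3}" for a :: real using cantor_bounds by fastforce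
  show "LR \<subseteq> {0..6} \<times> {0..6}" "UL \<subseteq> {0..6} \<times> {0..6}"
   unfolding LR_def UL_def using b[of 1] b[of 3] b[of 4] by (force simp: subset_eq)+
  show "LR \<subseteq> C1 \<times> C2" "UL \<subseteq> C1 \<times> C2" unfolding LR_def UL_def C1_def C2_def by auto
  show "LR \<inter> UL = {}" unfolding LR_def UL_def using b[of 1] b[of 4] by (fastforce simp: subset_eq)
qed

lemma tau_bound: assumes "p \<in> {0..6} \<times> {0..6}" shows "tau p \<in> {-6..6}"
proof -
  have "0 \<le> AA (fst p)" "AA (fst p) \<le> fst p"
   using prim_bounds[OF c_props(1,3), of "fst p"] assms by (auto simp: AA_def mem_Times_iff)
  hence "0 \<le> (fst p - AA (fst p)) / 2" "(fst p - AA (fst p)) / 2 \<le> fst p" using assms by (auto simp: mem_Times_iff)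
  thus ?thesis using assms unfolding tau_def mem_Times_iff atLeastAtMost_iff by (intro conjI) linarith+
qed

lemma kap_bound: "\<bar>kap p\<bar> \<le> 1"
  using LR_UL_sub(5) by (auto simp: kap_def indicator_def)

lemma pos_tau: "pos AA s (fst p) (snd p) = (fst p, snd p, s + tau p)"
  by (simp add: pos_def tau_def)

lemma kap_V: "kap p * Vb1 p = 0" "kap p * Vb2 p = 0"
proof -
  have "kap p = 0" if "p \<notin> C1 \<times> C2" using that LR_UL_sub(3,4) unfolding kap_def by (auto simp: indicator_def)
  moreover have "Vb1 p = 0 \<and> Vb2 p = 0" if "kap p \<noteq> 0"
  proof -
   have "p \<in> LR \<or> p \<in> UL" using that by (auto simp: kap_def indicator_def)
   hence "p \<in> {0..6} \<times> {0..6}" "p \<in> C1 \<times> C2" using LR_UL_sub by auto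
   thus ?thesis by (auto simp: Vb1_def Vb2_def)
  qed
  ultimately show "kap p * Vb1 p = 0" "kap p * Vb2 p = 0" by auto
qed

text \<open>Between the dusts \<open>tau\<close> advances at unit rate along the flow where at least
  one of \<open>ca\<close>, \<open>cb\<close> is 1, and not at all where both vanish. Removing
  \<open>C1 \<times> C2\<close> from \<open>Nset\<close> takes out the points at which a profile
  depending on \<open>t - tau p\<close> would not be transported; the right side does not notice,
  since \<open>DT\<close> is zero there.\<close>

lemma N_DT:
  "ind Nset p * (PH pht s p + Vb1 p * PH phx s p + Vb2 p * PH phy s p) =
   ind ({0..6} \<times> {0..6}) p * (ind btw p * DT phx phy pht s p)"
proof (cases "p \<in> btw \<inter> ({0..6} \<times> {0..6})")
  case True
  hence p: "0 \<le> fst p" "0 \<le> snd p" "HH p < 6" by (auto simp: btw_def mem_Times_iff)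
  hence V: "Vb1 p = 2 * cb (snd p)" "Vb2 p = - ca (fst p)" by (auto simp: Vb1_def Vb2_def Hb_def HH_def sg_def)
  show ?thesis
  proof (cases "p \<in> C1 \<times> C2")
   case True
   thus ?thesis unfolding DT_alt Nset_def by (auto simp: indicator_def)
  next
   case False
   hence "fst p \<notin> C1 \<or> snd p \<notin> C2" by (auto simp: mem_Times_iff)
   thus ?thesis unfolding DT_alt V using True False by (auto simp: indicator_def Nset_def)
  qed
next
  case False
  thus ?thesis by (auto simp: Nset_def indicator_def)
qed

lemma integral_shift: "(LINT t|lborel. f t) = (LINT s|lborel. f (s + c :: real) :: real)"
  using lborel_integral_real_affine[of 1 f c] by (simp add: add.commute)

lemma ibp_shift:
  fixes r R ps ps' :: "real \<Rightarrow> real"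
  assumes r: "r \<in> Bor" "\<And>t. \<bar>r t\<bar> \<le> K" and R: "\<And>t. (R has_real_derivative r t) (at t)" "\<And>t. \<bar>R t\<bar> \<le> K"
   and ps: "\<And>t. (ps has_real_derivative ps' t) (at t)" "cont ps'" "\<And>t. t \<notin> {a..b} \<Longrightarrow> ps t = 0" "\<And>t. t \<notin> {a..b} \<Longrightarrow> ps' t = 0"
  shows "(LINT t|lborel. r (t - c) * ps t) = - (LINT t|lborel. R (t - c) * ps' t)"
proof -
  define l u where "l = min a b - 1" and "u = max a b + 1"
  have lu: "l \<le> u" by (simp add: l_def u_def)
  have out: "u \<notin> {a..b}" "l \<notin> {a..b}" by (auto simp: l_def u_def)
  have cps: "cont ps" by (rule DERIV_continuous_on) (rule ps(1))
  note [measurable] = Bor_contI[OF cps] Bor_contI[OF ps(2)]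
   Bor_contI[OF DERIV_continuous_on[OF R(1)]] r(1)
  have bd: "\<exists>M. \<forall>t. \<bar>f t\<bar> \<le> M" if "cont f" "\<And>t. t \<notin> {a..b} \<Longrightarrow> f t = 0" for f :: "real \<Rightarrow> real"
  proof -
   have "bounded (f ` {a..b})"
    by (intro compact_imp_bounded compact_continuous_image compact_Icc continuous_on_subset[OF that(1)]) auto
   then obtain M where "\<forall>x\<in>f ` {a..b}. \<bar>x\<bar> \<le> M" by (auto simp: bounded_iff)
   hence "\<bar>f t\<bar> \<le> \<bar>M\<bar>" for t using that(2)[of t] by (cases "t \<in> {a..b}") force+
   thus ?thesis by blast
  qed
  obtain M where M: "\<And>t. \<bar>ps t\<bar> \<le> M" using bd[OF cps ps(3)] by blast
  obtain M' where M': "\<And>t. \<bar>ps' t\<bar> \<le> M'" using bd[OF ps(2,4)] by blast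
  have K: "0 \<le> K" using r(2)[of 0] by linarith
  have i1: "integrable lborel (\<lambda>t. r (t - c) * ps t)"
  proof (rule integrable_bdd[where K="K * M" and S="{a..b}"])
   show "\<bar>r (t - c) * ps t\<bar> \<le> K * M" for t unfolding abs_mult using r M K by (intro mult_mono) auto
  qed (use ps in auto)
  have i2: "integrable lborel (\<lambda>t. R (t - c) * ps' t)"
  proof (rule integrable_bdd[where K="K * M'" and S="{a..b}"])
   show "\<bar>R (t - c) * ps' t\<bar> \<le> K * M'" for t unfolding abs_mult using R M' K by (intro mult_mono) auto
  qed (use ps in auto)
  have "((\<lambda>t. r (t - c) * ps t + R (t - c) * ps' t) has_integral (R (u - c) * ps u - R (l - c) * ps l)) {l..u}"
  proof (rule fundamental_theorem_of_calculus[OF lu])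
   fix t
   have "((\<lambda>t. R (t - c)) has_real_derivative r (t - c)) (at t)"
    using DERIV_shift[of R "r (t - c)" t "- c"] R(1)[of "t - c"] by simp
   from DERIV_mult[OF this ps(1)[of t]]
   show "((\<lambda>t. R (t - c) * ps t) has_vector_derivative r (t - c) * ps t + R (t - c) * ps' t) (at t within {l..u})"
    by (simp add: has_real_derivative_iff_has_vector_derivative algebra_simps has_vector_derivative_at_within)
  qed
  moreover have "ps u = 0" "ps l = 0" using ps(3)[OF out(1)] ps(3)[OF out(2)] .
  ultimately have "((\<lambda>t. r (t - c) * ps t + R (t - c) * ps' t) has_integral 0) {l..u}" by simp
  hence "((\<lambda>t. r (t - c) * ps t + R (t - c) * ps' t) has_integral 0) UNIV"
  proof (rule has_integral_on_superset)
   fix t assume "t \<notin> {l..u}"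
   hence "t \<notin> {a..b}" by (auto simp: l_def u_def)
   thus "r (t - c) * ps t + R (t - c) * ps' t = 0" using ps(3,4)[of t] by simp
  qed simp
  moreover have "((\<lambda>t. r (t - c) * ps t + R (t - c) * ps' t) has_integral (LINT t|lborel. r (t - c) * ps t + R (t - c) * ps' t)) UNIV"
   by (rule has_integral_integral_lborel) (rule Bochner_Integration.integrable_add[OF i1 i2])
  ultimately have "(LINT t|lborel. r (t - c) * ps t + R (t - c) * ps' t) = 0" by (rule has_integral_unique[symmetric])
  thus ?thesis using Bochner_Integration.integral_add[OF i1 i2] by simp
qed

text \<open>After the substitution \<open>t = s + tau p\<close> the travelling part is
  \<open>r s\<close> times the left side of \<open>core_identity\<close>, hence a difference of
  integrals over the dusts. Integration by parts in s moves the derivative to the test function and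
  replaces r by R, which cancels exactly the stationary part on the dusts.\<close>

lemma base_transport:
  assumes r: "r \<in> Bor" "\<And>t. \<bar>r t\<bar> \<le> K" and R: "\<And>t. (R has_real_derivative r t) (at t)" "\<And>t. \<bar>R t\<bar> \<le> K"
   and t3: "test3 ph phx phy pht" and z: "\<And>x y t. t \<notin> {a..b} \<Longrightarrow> ph (x, y, t) = 0"
  shows "(LINT p|lborel. LINT t|lborel. Fb r R p t * (pht (fst p, snd p, t) + Vb1 p * phx (fst p, snd p, t) + Vb2 p * phy (fst p, snd p, t))) = 0"
proof -
  have c: "cont ph" "cont phx" "cont phy" "cont pht"
   using t3 test3_continuous[OF t3] by (simp_all add: test3_def)
  have zz: "ph (x, y, t) = 0" "phx (x, y, t) = 0" "phy (x, y, t) = 0" "pht (x, y, t) = 0" if t: "t \<notin> {a..b}" for x y t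
   by (rule z[OF t]) (rule test3_supp[OF t3 z t]; assumption)+
  note [measurable] = c[THEN Bor_contI] r(1) Bor_contI[OF DERIV_continuous_on[OF R(1)]]
  let ?Q = "{0..6} \<times> {0..6} :: plane set"
  let ?B = "{0..6} \<times> {0..6} \<times> {a..b} :: (real \<times> real \<times> real) set"
  obtain M where M: "\<And>q. q \<in> ?B \<Longrightarrow> \<bar>ph q\<bar> \<le> M \<and> \<bar>phx q\<bar> \<le> M \<and> \<bar>phy q\<bar> \<le> M \<and> \<bar>pht q\<bar> \<le> M" "0 \<le> M"
   by (rule test3_bounded[OF t3 compact_Times[OF compact_Icc compact_Times[OF compact_Icc compact_Icc]]]) blast
  have M': "\<bar>ph (fst p, snd p, t)\<bar> \<le> M \<and> \<bar>phx (fst p, snd p, t)\<bar> \<le> M \<and> \<bar>phy (fst p, snd p, t)\<bar> \<le> M \<and> \<bar>pht (fst p, snd p, t)\<bar> \<le> M"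
   if "p \<in> ?Q" for p t
  proof (cases "t \<in> {a..b}")
   case True thus ?thesis using that M(1)[of "(fst p, snd p, t)"] by (simp add: mem_Times_iff)
  next
   case False thus ?thesis using zz[OF False] M(2) by simp
  qed
  have K: "0 \<le> K" using r(2)[of 0] by linarith
  define D where "D p t = pht (fst p, snd p, t) + Vb1 p * phx (fst p, snd p, t) + Vb2 p * phy (fst p, snd p, t)" for p t
  have D0: "D p t = 0" if "t \<notin> {a..b}" for p t using zz[OF that] by (simp add: D_def)
  have DM: "\<bar>D p t\<bar> \<le> 4 * M" if "p \<in> ?Q" for p t
  proof -
   have "\<bar>Vb1 p * phx (fst p, snd p, t)\<bar> \<le> 2 * M" "\<bar>Vb2 p * phy (fst p, snd p, t)\<bar> \<le> 1 * M"
    unfolding abs_mult using M'[OF that] M(2) Vb_bound[of p] by (intro mult_mono; simp)+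
   thus ?thesis using M'[OF that, of t] unfolding D_def by linarith
  qed
  have Dm [measurable]: "(\<lambda>z. D (fst z) (h z)) \<in> Bor" if [measurable]: "h \<in> Bor"
   for h :: "plane \<times> real \<Rightarrow> real"
   unfolding D_def by measurable
  have NQ: "p \<notin> ?Q \<Longrightarrow> p \<notin> Nset" "p \<notin> ?Q \<Longrightarrow> kap p = 0" for p
   using LR_UL_sub by (auto simp: Nset_def kap_def indicator_def)
  define f1 where "f1 z = ind Nset (fst z) * r (snd z - tau (fst z)) * D (fst z) (snd z)" for z
  define f2 where "f2 z = kap (fst z) * R (snd z - tau (fst z)) * pht (fst (fst z), snd (fst z), snd z)" for z
  define g1 where "g1 z = ind Nset (fst z) * r (snd z) * D (fst z) (snd z + tau (fst z))" for z
  define g2 where "g2 z = r (snd z) * (kap (fst z) * ph (fst (fst z), snd (fst z), snd z + tau (fst z)))" for z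
  \<comment> \<open>\<open>tau\<close> is bounded by 6 on the square, so the shifted functions need
    a time interval longer by 6 at both ends.\<close>
  let ?S1 = "?Q \<times> {a..b}" and ?S2 = "?Q \<times> {a - 6..b + 6}"
  have bS: "bounded ?S1" "bounded ?S2" by (intro bounded_Times bounded_closed_interval)+
  have ind1: "\<bar>ind A q * x\<bar> \<le> \<bar>x\<bar>" for A x and q :: "plane" by (simp add: indicator_def)
  have kp: "\<bar>kap q * x\<bar> \<le> \<bar>x\<bar>" for q x unfolding abs_mult using kap_bound[of q] by (simp add: mult_left_le_one_le)
  have i1: "integrable lborel f1"
  proof (rule integrable_bdd[OF _ _ bS(1), where K="K * (4 * M)"])
   show "\<bar>f1 z\<bar> \<le> K * (4 * M)" for z
   proof (cases "fst z \<in> ?Q")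
    case True
    have "\<bar>f1 z\<bar> \<le> \<bar>r (snd z - tau (fst z)) * D (fst z) (snd z)\<bar>" unfolding f1_def mult.assoc by (rule ind1)
    also have "\<dots> \<le> K * (4 * M)" unfolding abs_mult using r K DM[OF True] M by (intro mult_mono) auto
    finally show ?thesis .
   next
    case False thus ?thesis using NQ(1)[OF False] K M by (simp add: f1_def)
   qed
   show "f1 z = 0" if "z \<notin> ?S1" for z
    using that NQ(1)[of "fst z"] D0[of "snd z"] by (cases "fst z \<in> ?Q") (auto simp: f1_def mem_Times_iff)
  qed (unfold f1_def[abs_def], measurable)
  have i2: "integrable lborel f2"
  proof (rule integrable_bdd[OF _ _ bS(1), where K="K * M"])
   show "\<bar>f2 z\<bar> \<le> K * M" for z
   proof (cases "fst z \<in> ?Q")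
    case True
    have "\<bar>f2 z\<bar> \<le> \<bar>R (snd z - tau (fst z)) * pht (fst (fst z), snd (fst z), snd z)\<bar>" unfolding f2_def mult.assoc by (rule kp)
    also have "\<dots> \<le> K * M" unfolding abs_mult using R K M'[OF True] M by (intro mult_mono) auto
    finally show ?thesis .
   next
    case False thus ?thesis using NQ(2)[OF False] K M by (simp add: f2_def)
   qed
   show "f2 z = 0" if "z \<notin> ?S1" for z
    using that NQ(2)[of "fst z"] zz(4)[of "snd z"] by (cases "fst z \<in> ?Q") (auto simp: f2_def mem_Times_iff)
  qed (unfold f2_def[abs_def], measurable)
  have out: "snd z + tau (fst z) \<notin> {a..b}" if "z \<notin> ?S2" "fst z \<in> ?Q" for z
   using that tau_bound[OF that(2)] by (auto simp: mem_Times_iff)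
  have j1: "integrable lborel g1"
  proof (rule integrable_bdd[OF _ _ bS(2), where K="K * (4 * M)"])
   show "\<bar>g1 z\<bar> \<le> K * (4 * M)" for z
   proof (cases "fst z \<in> ?Q")
    case True
    have "\<bar>g1 z\<bar> \<le> \<bar>r (snd z) * D (fst z) (snd z + tau (fst z))\<bar>" unfolding g1_def mult.assoc by (rule ind1)
    also have "\<dots> \<le> K * (4 * M)" unfolding abs_mult using r K DM[OF True] M by (intro mult_mono) auto
    finally show ?thesis .
   next
    case False thus ?thesis using NQ(1)[OF False] K M by (simp add: g1_def)
   qed
   show "g1 z = 0" if "z \<notin> ?S2" for z
    using that NQ(1)[of "fst z"] D0[OF out[OF that]] by (cases "fst z \<in> ?Q") (simp_all add: g1_def)
  qed (unfold g1_def[abs_def], measurable)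
  have j2: "integrable lborel g2"
  proof (rule integrable_bdd[OF _ _ bS(2), where K="K * M"])
   show "\<bar>g2 z\<bar> \<le> K * M" for z
   proof (cases "fst z \<in> ?Q")
    case True
    have "\<bar>g2 z\<bar> = \<bar>r (snd z)\<bar> * \<bar>kap (fst z) * ph (fst (fst z), snd (fst z), snd z + tau (fst z))\<bar>" unfolding g2_def by (rule abs_mult)
    also have "\<dots> \<le> K * M" using r K M'[OF True] M kp by (intro mult_mono) (auto intro: order_trans[OF kp])
    finally show ?thesis .
   next
    case False thus ?thesis using NQ(2)[OF False] K M by (simp add: g2_def)
   qed
   show "g2 z = 0" if "z \<notin> ?S2" for z
    using that NQ(2)[of "fst z"] zz(1)[OF out[OF that]] by (cases "fst z \<in> ?Q") (simp_all add: g2_def)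
  qed (unfold g2_def[abs_def], measurable)
  have "(LINT p|lborel. LINT t|lborel. Fb r R p t * D p t) = (LINT p|lborel. LINT t|lborel. f1 (p, t) + f2 (p, t))"
  proof (intro int_cong refl)
   fix p t
   show "Fb r R p t * D p t = f1 (p, t) + f2 (p, t)"
    using kap_V[of p] by (cases "kap p = 0") (simp_all add: Fb_def f1_def f2_def D_def algebra_simps)
  qed
  also have "\<dots> = (LINT z|lborel. f1 z) + (LINT z|lborel. f2 z)"
   using fubini_xy(1)[OF Bochner_Integration.integrable_add[OF i1 i2]] Bochner_Integration.integral_add[OF i1 i2] by simp
  also have "(LINT z|lborel. f1 z) = (LINT p|lborel. LINT t|lborel. f1 (p, t))" by (rule fubini_xy(1)[OF i1])
  also have "\<dots> = (LINT p|lborel. LINT s|lborel. g1 (p, s))"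
  proof (rule int_cong[OF refl])
   fix p show "(LINT t|lborel. f1 (p, t)) = (LINT s|lborel. g1 (p, s))"
    using integral_shift[of "\<lambda>t. f1 (p, t)" "tau p"] by (simp add: f1_def g1_def)
  qed
  also have "\<dots> = (LINT s|lborel. LINT p|lborel. g1 (p, s))" using fubini_xy[OF j1] by simp
  also have "\<dots> = (LINT s|lborel. LINT p|lborel. g2 (p, s))"
  proof (rule int_cong[OF refl])
   fix s
   have "(LINT p|lborel. g1 (p, s)) = r s * (LINT p|lborel. ind Nset p * D p (s + tau p))"
    unfolding g1_def by (subst integral_mult_right_zero[symmetric]) (simp add: mult.commute mult.left_commute)
   also have "(LINT p|lborel. ind Nset p * D p (s + tau p)) = (LINT p:?Q|lborel. ind btw p * DT phx phy pht s p)"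
    unfolding set_int_def real_scaleR_def N_DT[symmetric]
    by (simp add: D_def PH_def pos_tau)
   \<comment> \<open>The point at which the geometry of the Cantor sets enters.\<close>
   also have "\<dots> = (LINT p:LR|lborel. PH ph s p) - (LINT p:UL|lborel. PH ph s p)"
    unfolding LR_def UL_def by (rule core_identity[OF t3])
   also have "\<dots> = (LINT p|lborel. kap p * ph (fst p, snd p, s + tau p))"
   proof -
    have i: "integrable lborel (\<lambda>p. ind T p *\<^sub>R PH ph s p)" if "T \<in> sets borel" "T \<subseteq> ?Q" for T
    proof (rule integrable_bdd[where K=M and S="?Q"])
     note [measurable] = test3_meas(1)[OF t3] that(1)
     show "(\<lambda>p. ind T p *\<^sub>R PH ph s p) \<in> Bor" by measurable
     show "\<bar>ind T p *\<^sub>R PH ph s p\<bar> \<le> M" for p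
      using that(2) M'[of p "s + tau p"] M(2) by (cases "p \<in> T") (auto simp: PH_def pos_tau)
     show "bounded ?Q" by (intro bounded_Times bounded_closed_interval)
     show "ind T p *\<^sub>R PH ph s p = 0" if "p \<notin> ?Q" for p
     proof -
      have "p \<notin> T" using that \<open>T \<subseteq> ?Q\<close> by blast
      thus ?thesis by simp
     qed
    qed
    show ?thesis unfolding set_int_def
     by (subst Bochner_Integration.integral_diff[OF i i, symmetric])
      (auto simp: LR_UL_sub kap_def PH_def pos_tau left_diff_distrib)
   qed
   also have "r s * \<dots> = (LINT p|lborel. g2 (p, s))" unfolding g2_def by simp
   finally show "(LINT p|lborel. g1 (p, s)) = (LINT p|lborel. g2 (p, s))" .
  qed
  also have "\<dots> = (LINT p|lborel. LINT s|lborel. g2 (p, s))" using fubini_xy[OF j2] by simp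
  also have "\<dots> = (LINT p|lborel. - (LINT t|lborel. f2 (p, t)))"
  proof (rule int_cong[OF refl])
   fix p
   have "(LINT s|lborel. g2 (p, s)) = kap p * (LINT s|lborel. r s * ph (fst p, snd p, s + tau p))"
    unfolding g2_def by (subst integral_mult_right_zero[symmetric]) (simp add: mult.left_commute)
   also have "(LINT s|lborel. r s * ph (fst p, snd p, s + tau p)) = (LINT t|lborel. r (t - tau p) * ph (fst p, snd p, t))"
    using integral_shift[of "\<lambda>t. r (t - tau p) * ph (fst p, snd p, t)" "tau p"] by simp
   also have "\<dots> = - (LINT t|lborel. R (t - tau p) * pht (fst p, snd p, t))"
   proof (rule ibp_shift[OF r R])
    show "((\<lambda>t. ph (fst p, snd p, t)) has_real_derivative pht (fst p, snd p, t)) (at t)" for t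
     using test3_chain[OF t3 DERIV_const DERIV_const DERIV_ident] by simp
    show "cont (\<lambda>t. pht (fst p, snd p, t))"
     by (rule continuous_on_compose2[OF c(4)]) (auto intro!: continuous_intros)
   qed (use zz in auto)
   also have "kap p * \<dots> = - (LINT t|lborel. f2 (p, t))"
    unfolding f2_def by (simp add: mult.assoc)
   finally show "(LINT s|lborel. g2 (p, s)) = - (LINT t|lborel. f2 (p, t))" .
  qed
  also have "\<dots> = - (LINT z|lborel. f2 z)" using fubini_xy(1)[OF i2] by simp
  finally show ?thesis unfolding D_def by simp
qed

lemma base_wave:
  assumes r: "r \<in> Bor" "\<And>t. \<bar>r t\<bar> \<le> K" and R: "\<And>t. (R has_real_derivative r t) (at t)" "\<And>t. \<bar>R t\<bar> \<le> K"
  shows "wave ({-8<..<8} \<times> {-8<..<8}) Vb1 Vb2 (Fb r R) Gb"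
  unfolding wave_def
proof (intro conjI allI impI)
  note [measurable] = r(1) Bor_contI[OF DERIV_continuous_on[OF R(1)]]
  show "{-8<..<8} \<times> {-8<..<8} \<in> sets (borel :: plane measure)" by (intro borel_open open_Times open_greaterThanLessThan)
  show "bounded ({-8<..<8} \<times> {-8<..<8} :: plane set)" by (intro bounded_Times) simp_all
  show "(\<lambda>z. Fb r R (fst z) (snd z)) \<in> Bor" unfolding Fb_def by measurable
  have K: "0 \<le> K" using r(2)[of 0] by linarith
  have "\<bar>Fb r R p t\<bar> \<le> 2 * K" for p t
  proof -
   have "\<bar>ind Nset p * r (t - tau p)\<bar> \<le> 1 * K" "\<bar>kap p * R (t - tau p)\<bar> \<le> 1 * K"
    unfolding abs_mult using r(2)[of "t - tau p"] R(2)[of "t - tau p"] K kap_bound[of p] by (intro mult_mono; simp)+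
   thus ?thesis unfolding Fb_def by linarith
  qed
  hence "\<bar>Vb1 p\<bar> \<le> 6 + 2 * K \<and> \<bar>Vb2 p\<bar> \<le> 6 + 2 * K \<and> \<bar>Gb p\<bar> \<le> 6 + 2 * K \<and> \<bar>Fb r R p t\<bar> \<le> 6 + 2 * K" for p t
   using Vb_bound[of p] K by (smt (verit))
  thus "\<exists>K. \<forall>p t. \<bar>Vb1 p\<bar> \<le> K \<and> \<bar>Vb2 p\<bar> \<le> K \<and> \<bar>Gb p\<bar> \<le> K \<and> \<bar>Fb r R p t\<bar> \<le> K" by blast
  fix p :: "plane" and t assume p: "p \<notin> {-8<..<8} \<times> {-8<..<8}"
  hence "6 \<le> Hb p" by (rule Hb_big)
  thus "Vb1 p = 0" "Vb2 p = 0" "Gb p = 0" by (simp_all add: Vb1_def Vb2_def Gb_def)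
  have "p \<notin> {0..6} \<times> {0..6}" using p by (auto simp: mem_Times_iff)
  thus "Fb r R p t = 0" using LR_UL_sub(1,2) unfolding Fb_def kap_def Nset_def by (auto simp: indicator_def)
next
  fix ph phx phy pht a b assume "test3 ph phx phy pht" "\<forall>x y t. t \<notin> {a..b} \<longrightarrow> ph (x, y, t) = 0"
  thus "(LINT p|lborel. LINT t|lborel. Fb r R p t * (pht (fst p, snd p, t) + Vb1 p * phx (fst p, snd p, t) + Vb2 p * phy (fst p, snd p, t))) = 0"
   using base_transport[OF r R, of ph phx phy pht a b] by blast
qed (simp_all add: Vb_meas Gb_integrals[symmetric] Gb_integrals(2,4) minus_equation_iff[of _ "Gb _"])

section \<open>Scaling and superposition\<close>

lemma int_affine2:
  fixes g :: "plane \<Rightarrow> real"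
  assumes [measurable]: "g \<in> Bor" and l: "0 < l"
  shows "(LINT p|lborel. g p) = l\<^sup>2 * (LINT p|lborel. g (c + l * fst p, d + l * snd p))"
proof -
  have "(LINT p|lborel. g p) = (LINT p|density (distr lborel borel (\<lambda>x. (c, d) + l *\<^sub>R x)) (\<lambda>_. ennreal (\<bar>l\<bar> ^ DIM(plane))). g p)"
   using lborel_affine[of l "(c, d)"] l by simp
  also have "\<dots> = (LINT p|distr lborel borel (\<lambda>x. (c, d) + l *\<^sub>R x). \<bar>l\<bar> ^ DIM(plane) *\<^sub>R g p)"
   by (rule integral_density) auto
  also have "\<dots> = (LINT p|lborel. \<bar>l\<bar> ^ DIM(plane) *\<^sub>R g ((c, d) + l *\<^sub>R p))"
   by (rule integral_distr) auto
  finally show ?thesis using l by (simp add: scaleR_prod_def power2_eq_square)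
qed

definition aff :: "real \<Rightarrow> real \<Rightarrow> real \<Rightarrow> plane \<Rightarrow> plane" where
  "aff c d l p = ((fst p - c) / l, (snd p - d) / l)"

lemma aff_meas [measurable]: "aff c d l \<in> borel \<rightarrow>\<^sub>M borel"
  unfolding aff_def[abs_def] by measurable

lemma aff_inv: "0 < l \<Longrightarrow> aff c d l (c + l * x, d + l * y) = (x, y)"
  by (simp add: aff_def)

lemma int_aff:
  fixes g :: "plane \<Rightarrow> real"
  assumes [measurable]: "g \<in> Bor" and l: "0 < l"
  shows "(LINT p|lborel. g (aff c d l p)) = l\<^sup>2 * (LINT p|lborel. g p)"
  using int_affine2[of "\<lambda>p. g (aff c d l p)" l c d] l by (simp add: aff_inv)

lemma int_affine1:
  fixes f :: "real \<Rightarrow> real"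
  assumes l: "0 < l"
  shows "(LBINT u. f ((u - d) / l)) = l * (LBINT u. f u)"
   and "(LBINT u:{..y}. f ((u - d) / l)) = l * (LBINT u:{..(y - d) / l}. f u)"
proof -
  show "(LBINT u. f ((u - d) / l)) = l * (LBINT u. f u)"
   using lborel_integral_real_affine[of l "\<lambda>u. f ((u - d) / l)" d] l by simp
  have "ind {..y} (d + l * x) = ind {..(y - d) / l} x" for x
   using l by (auto simp: indicator_def field_simps)
  thus "(LBINT u:{..y}. f ((u - d) / l)) = l * (LBINT u:{..(y - d) / l}. f u)"
   unfolding set_int_def
   using lborel_integral_real_affine[of l "\<lambda>u. ind {..y} u *\<^sub>R f ((u - d) / l)" d] l by simp
qed

lemma test3_scale:
  fixes c d l m :: real
  assumes "test3 ph phx phy pht"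
  defines "h \<equiv> \<lambda>p. (c + l * fst p, d + l * fst (snd p), snd (snd p) / m)"
  shows "test3 (\<lambda>p. ph (h p)) (\<lambda>p. l * phx (h p)) (\<lambda>p. l * phy (h p)) (\<lambda>p. pht (h p) / m)"
proof -
  have c: "cont h" unfolding h_def divide_inverse by (intro continuous_intros)
  have t3: "(ph has_derivative (\<lambda>(a, b, c). a * phx p + b * phy p + c * pht p)) (at p)"
   "cont phx" "cont phy" "cont pht" for p
   using assms(1) unfolding test3_def by blast+
  have "(h has_derivative (\<lambda>v. (l * fst v, l * fst (snd v), snd (snd v) / m))) (at p)" for p
   unfolding h_def by (auto intro!: derivative_eq_intros simp: divide_inverse)
  from has_derivative_compose[OF this t3(1)]
  have "((\<lambda>p. ph (h p)) has_derivative (\<lambda>(a, b, e). a * (l * phx (h p)) + b * (l * phy (h p)) + e * (pht (h p) / m))) (at p)" for p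
   by (rule has_derivative_eq_rhs) (auto simp: algebra_simps)
  thus ?thesis unfolding test3_def divide_inverse
   by (auto simp: divide_inverse intro!: continuous_intros continuous_on_compose2[OF t3(2) c] continuous_on_compose2[OF t3(3) c] continuous_on_compose2[OF t3(4) c])
qed

text \<open>Space is scaled by l and time by 1/m, so velocities carry \<open>l * m\<close> and the
  stream function one more l. The amplitude k of F is free because the transport equation is linear
  in F.\<close>

lemma wave_scale:
  fixes c d l m :: real
  assumes w: "wave S V1 V2 F G" and l: "0 < l" and m: "0 < m"
  defines "T \<equiv> aff c d l"
  shows "wave {p. T p \<in> S} (\<lambda>p. l * m * V1 (T p)) (\<lambda>p. l * m * V2 (T p)) (\<lambda>p t. k * F (T p) (m * t)) (\<lambda>p. l * l * m * G (T p))"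
proof -
  have w1: "S \<in> sets borel" "bounded S" and [measurable]: "V1 \<in> Bor" "V2 \<in> Bor" "G \<in> Bor"
   "(\<lambda>z. F (fst z) (snd z)) \<in> Bor"
   and w2: "\<And>p. p \<notin> S \<Longrightarrow> V1 p = 0 \<and> V2 p = 0 \<and> G p = 0 \<and> (\<forall>t. F p t = 0)"
   and w4: "\<And>x y. G (x, y) = (LBINT u:{..y}. V1 (x, u))" "\<And>x. (LBINT u. V1 (x, u)) = 0"
    "\<And>x y. G (x, y) = - (LBINT u:{..x}. V2 (u, y))" "\<And>y. (LBINT u. V2 (u, y)) = 0"
   using w unfolding wave_def by blast+
  obtain K where K: "\<And>p t. \<bar>V1 p\<bar> \<le> K \<and> \<bar>V2 p\<bar> \<le> K \<and> \<bar>G p\<bar> \<le> K \<and> \<bar>F p t\<bar> \<le> K"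
   using w unfolding wave_def by blast
  have w5: "(LINT p|lborel. LINT t|lborel. F p t * (pht (fst p, snd p, t) + V1 p * phx (fst p, snd p, t) + V2 p * phy (fst p, snd p, t))) = 0"
   if "test3 ph phx phy pht" "\<And>x y t. t \<notin> {a..b} \<Longrightarrow> ph (x, y, t) = 0" for ph phx phy pht a b
   using w that unfolding wave_def by blast
  have K0: "0 \<le> K" using K[of "(0, 0)" 0] by linarith
  have [measurable]: "T \<in> borel \<rightarrow>\<^sub>M borel" unfolding T_def by measurable
  have lm: "0 < l * m" using l m by simp
  show ?thesis unfolding wave_def
  proof (intro conjI allI impI)
   have "{p. T p \<in> S} = T -` S \<inter> space borel" by auto
   thus "{p. T p \<in> S} \<in> sets borel" using w1(1) measurable_sets[of T borel borel S] by simp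
   obtain B where B: "\<And>p. p \<in> S \<Longrightarrow> norm p \<le> B" using w1(2) by (auto simp: bounded_iff)
   show "bounded {p. T p \<in> S}"
   proof (rule boundedI[where B="norm (c, d) + l * B"])
    fix p assume "p \<in> {p. T p \<in> S}"
    hence "norm (T p) \<le> B" using B by simp
    moreover have "(c, d) + l *\<^sub>R T p = p" using l by (simp add: T_def aff_def prod_eq_iff)
    moreover have "norm ((c, d) + l *\<^sub>R T p) \<le> norm (c, d) + l * norm (T p)"
     using norm_triangle_ineq[of "(c, d)" "l *\<^sub>R T p"] l by simp
    moreover have "l * norm (T p) \<le> l * B" using \<open>norm (T p) \<le> B\<close> l by (intro mult_left_mono) auto
    ultimately show "norm p \<le> norm (c, d) + l * B" by simp
   qed
   show "(\<lambda>p. l * m * V1 (T p)) \<in> Bor" "(\<lambda>p. l * m * V2 (T p)) \<in> Bor"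
    "(\<lambda>p. l * l * m * G (T p)) \<in> Bor" by measurable
   have "(\<lambda>z. F (fst (T (fst z), m * snd z)) (snd (T (fst z), m * snd z))) \<in> Bor"
    by (rule measurable_compose[of "\<lambda>z. (T (fst z), m * snd z)"]) measurable
   hence [measurable]: "(\<lambda>z. F (T (fst z)) (m * snd z)) \<in> Bor" by simp
   show "(\<lambda>z. k * F (T (fst z)) (m * snd z)) \<in> Bor" by measurable
   fix p t assume "p \<notin> {p. T p \<in> S}"
   hence "T p \<notin> S" by simp
   from w2[OF this] show "l * m * V1 (T p) = 0" "l * m * V2 (T p) = 0" "l * l * m * G (T p) = 0" "k * F (T p) (m * t) = 0" by simp_all
  next
   define K' where "K' = (l * m + l * l * m + \<bar>k\<bar>) * K"
   have p: "0 \<le> l * m * K" "0 \<le> l * l * m * K" "0 \<le> \<bar>k\<bar> * K" using l m K0 by simp_all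
   have "\<bar>l * m * V1 (T p)\<bar> \<le> K' \<and> \<bar>l * m * V2 (T p)\<bar> \<le> K' \<and> \<bar>l * l * m * G (T p)\<bar> \<le> K' \<and> \<bar>k * F (T p) (m * t)\<bar> \<le> K'" for p t
   proof -
    note Kp = K[of "T p" "m * t"]
    have "\<bar>l * m * V1 (T p)\<bar> \<le> l * m * K" "\<bar>l * m * V2 (T p)\<bar> \<le> l * m * K"
     unfolding abs_mult[of "l * m"] abs_of_pos[OF lm] using Kp lm by (auto intro!: mult_left_mono)
    moreover have "\<bar>l * l * m * G (T p)\<bar> \<le> l * l * m * K"
     unfolding abs_mult[of "l * l * m"] using Kp l m by (auto simp: abs_of_pos intro!: mult_left_mono)
    moreover have "\<bar>k * F (T p) (m * t)\<bar> \<le> \<bar>k\<bar> * K"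
     unfolding abs_mult using Kp by (auto intro!: mult_left_mono)
    ultimately show ?thesis using p unfolding K'_def distrib_right by linarith
   qed
   thus "\<exists>K. \<forall>p t. \<bar>l * m * V1 (T p)\<bar> \<le> K \<and> \<bar>l * m * V2 (T p)\<bar> \<le> K \<and> \<bar>l * l * m * G (T p)\<bar> \<le> K \<and> \<bar>k * F (T p) (m * t)\<bar> \<le> K" by blast
  next
   fix x y :: real
   have T: "T (x, u) = ((x - c) / l, (u - d) / l)" "T (u, y) = ((u - c) / l, (y - d) / l)" for u
    by (simp_all add: T_def aff_def)
   have sm: "(LBINT u:A. a * f u) = a * (LBINT u:A. f u)" for a :: real and f :: "real \<Rightarrow> real" and A :: "real set" by simp
   show "l * l * m * G (T (x, y)) = (LBINT u:{..y}. l * m * V1 (T (x, u)))"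
    unfolding T(1) sm int_affine1(2)[OF l, where f="\<lambda>u. V1 ((x - c) / l, u)"] w4(1)[symmetric] by simp
   show "(LBINT u. l * m * V1 (T (x, u))) = 0"
    unfolding T(1) integral_mult_right_zero int_affine1(1)[OF l, where f="\<lambda>u. V1 ((x - c) / l, u)"] w4(2) by simp
   show "l * l * m * G (T (x, y)) = - (LBINT u:{..x}. l * m * V2 (T (u, y)))"
    unfolding T(2) sm int_affine1(2)[OF l, where f="\<lambda>u. V2 (u, (y - d) / l)"] using w4(3)[of "(x - c) / l" "(y - d) / l"]
    by (simp add: T_def aff_def)
   show "(LBINT u. l * m * V2 (T (u, y))) = 0"
    unfolding T(2) integral_mult_right_zero int_affine1(1)[OF l, where f="\<lambda>u. V2 (u, (y - d) / l)"] w4(4) by simp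
  next
   fix ph phx phy pht a b assume t3: "test3 ph phx phy pht" and z: "\<forall>x y t. t \<notin> {a..b} \<longrightarrow> ph (x, y, t) = 0"
   have cc: "cont phx" "cont phy" "cont pht" using t3 by (simp_all add: test3_def)
   note [measurable] = cc[THEN Bor_contI]
   define h where "h p = (c + l * fst p, d + l * fst (snd p), snd (snd p) / m)" for p :: "real \<times> real \<times> real"
   define J where "J p = (LINT t|lborel. F p t * (pht (h (fst p, snd p, t)) / m + V1 p * (l * phx (h (fst p, snd p, t))) + V2 p * (l * phy (h (fst p, snd p, t)))))" for p
   have t3': "test3 (\<lambda>p. ph (h p)) (\<lambda>p. l * phx (h p)) (\<lambda>p. l * phy (h p)) (\<lambda>p. pht (h p) / m)"
    using test3_scale[OF t3, of c l d m] unfolding h_def .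
   have "(LINT p|lborel. J p) = 0"
    unfolding J_def
   proof (rule w5[OF t3', of "m * a" "m * b"])
    fix x y t assume "t \<notin> {m * a..m * b}"
    hence "t / m \<notin> {a..b}" using m by (auto simp: field_simps)
    thus "ph (h (x, y, t)) = 0" using z by (simp add: h_def)
   qed
   have inner: "(LINT t|lborel. k * F (T p) (m * t) * (pht (fst p, snd p, t) + l * m * V1 (T p) * phx (fst p, snd p, t) + l * m * V2 (T p) * phy (fst p, snd p, t)))
    = k * J (T p)" for p
   proof -
    have hT: "h (fst (T p), snd (T p), t) = (fst p, snd p, t / m)" for t
     using l by (simp add: h_def T_def aff_def)
    have "(LINT t|lborel. k * F (T p) (m * t) * (pht (fst p, snd p, t) + l * m * V1 (T p) * phx (fst p, snd p, t) + l * m * V2 (T p) * phy (fst p, snd p, t)))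
     = (1 / m) * (LINT t|lborel. k * F (T p) t * (pht (fst p, snd p, t / m) + l * m * V1 (T p) * phx (fst p, snd p, t / m) + l * m * V2 (T p) * phy (fst p, snd p, t / m)))"
     using lborel_integral_real_affine[of "1 / m" "\<lambda>t. k * F (T p) (m * t) * (pht (fst p, snd p, t) + l * m * V1 (T p) * phx (fst p, snd p, t) + l * m * V2 (T p) * phy (fst p, snd p, t))" 0] m
     by simp
    also have "\<dots> = k * J (T p)"
     unfolding J_def hT integral_mult_right_zero[symmetric]
     using m by (intro int_cong refl) (simp add: field_simps)
    finally show ?thesis .
   qed
   have [measurable]: "h \<in> borel \<rightarrow>\<^sub>M borel" unfolding h_def[abs_def] by measurable
   have Jm [measurable]: "J \<in> Bor"
   proof -
    have "(\<lambda>z. F (fst z) (snd z) * (pht (h (fst (fst z), snd (fst z), snd z)) / m + V1 (fst z) * (l * phx (h (fst (fst z), snd (fst z), snd z)))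
     + V2 (fst z) * (l * phy (h (fst (fst z), snd (fst z), snd z))))) \<in> Bor"
     by measurable
    from borel_param_integral[OF this] show ?thesis unfolding J_def[abs_def] fst_conv snd_conv .
   qed
   have "(LINT p|lborel. k * J (T p)) = k * (l\<^sup>2 * (LINT p|lborel. J p))"
    unfolding T_def integral_mult_right_zero int_aff[OF Jm l] ..
   thus "(LINT p|lborel. LINT t|lborel. k * F (T p) (m * t) * (pht (fst p, snd p, t) + l * m * V1 (T p) * phx (fst p, snd p, t) + l * m * V2 (T p) * phy (fst p, snd p, t))) = 0"
    unfolding inner using \<open>(LINT p|lborel. J p) = 0\<close> by simp
  qed
qed

lemma suminf_single: "(\<And>k. k \<noteq> n \<Longrightarrow> f k = 0) \<Longrightarrow> (\<Sum>k. f k) = f n" for f :: "nat \<Rightarrow> real"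
  using suminf_finite[of "{n}" f] by auto

lemma disj_other: "disjoint_family S \<Longrightarrow> p \<in> S n \<Longrightarrow> k \<noteq> n \<Longrightarrow> p \<notin> S k"
  unfolding disjoint_family_on_def by blast

lemma disj_suminf:
  fixes f :: "nat \<Rightarrow> 'a \<Rightarrow> real"
  assumes d: "disjoint_family S" and z: "\<And>n p. p \<notin> S n \<Longrightarrow> f n p = 0"
  shows "p \<in> S n \<Longrightarrow> (\<Sum>k. f k p) = f n p" and "p \<notin> (\<Union>n. S n) \<Longrightarrow> (\<Sum>k. f k p) = 0"
proof -
  assume p: "p \<in> S n"
  show "(\<Sum>k. f k p) = f n p"
  proof (rule suminf_single)
   fix k assume "k \<noteq> n"
   thus "f k p = 0" using disj_other[OF d p] z by blast
  qed
next
  assume "p \<notin> (\<Union>n. S n)"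
  hence "f k p = 0" for k using z[of p k] by blast
  thus "(\<Sum>k. f k p) = 0" by simp
qed

lemma disj_suminf_bound:
  fixes f :: "nat \<Rightarrow> 'a \<Rightarrow> real"
  assumes d: "disjoint_family S" and z: "\<And>n p. p \<notin> S n \<Longrightarrow> f n p = 0" and K: "\<And>n p. \<bar>f n p\<bar> \<le> K"
  shows "\<bar>\<Sum>k. f k p\<bar> \<le> K" "\<bar>\<Sum>k<N. f k p\<bar> \<le> K" "(\<lambda>N. \<Sum>k<N. f k p) \<longlonglongrightarrow> (\<Sum>k. f k p)"
proof -
  have K0: "0 \<le> K" using K[of 0 p] by linarith
  have "\<exists>n. \<forall>k. k \<noteq> n \<longrightarrow> f k p = 0"
  proof (cases "\<exists>n. p \<in> S n")
   case True
   then obtain n where n: "p \<in> S n" ..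
   hence "\<forall>k. k \<noteq> n \<longrightarrow> f k p = 0" using disj_other[OF d n] z[of p] by blast
   thus ?thesis ..
  next
   case False
   hence "\<forall>k. k \<noteq> 0 \<longrightarrow> f k p = 0" using z[of p] by blast
   thus ?thesis ..
  qed
  then obtain n where n: "\<And>k. k \<noteq> n \<Longrightarrow> f k p = 0" by blast
  have s: "(\<Sum>k. f k p) = f n p" by (rule suminf_single) (rule n)
  thus "\<bar>\<Sum>k. f k p\<bar> \<le> K" using K by simp
  have fin: "(\<Sum>k<N. f k p) = (if n < N then f n p else 0)" for N
  proof -
   have "(\<Sum>k<N. f k p) = (\<Sum>k<N. if k = n then f n p else 0)" by (rule sum.cong) (use n in auto)
   thus ?thesis by simp
  qed
  thus "\<bar>\<Sum>k<N. f k p\<bar> \<le> K" using K K0 by simp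
  have "\<forall>\<^sub>F N in sequentially. (\<Sum>k<N. f k p) = (\<Sum>k. f k p)"
   unfolding fin s eventually_sequentially by (intro exI[of _ "Suc n"]) auto
  thus "(\<lambda>N. \<Sum>k<N. f k p) \<longlonglongrightarrow> (\<Sum>k. f k p)" by (rule tendsto_eventually)
qed

text \<open>At each point at most one term is nonzero, so the partial sums obey the same bound K as
  the terms and dominated convergence applies on the bounded union.\<close>

lemma integral_disj_sums:
  fixes f :: "nat \<Rightarrow> 'a::euclidean_space \<Rightarrow> real"
  assumes [measurable]: "\<And>n. f n \<in> Bor"
   and d: "disjoint_family S" and z: "\<And>n p. p \<notin> S n \<Longrightarrow> f n p = 0" and K: "\<And>n p. \<bar>f n p\<bar> \<le> K"
   and b: "bounded (\<Union>n. S n)"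
  shows "(\<lambda>n. LINT p|lborel. f n p) sums (LINT p|lborel. (\<Sum>n. f n p))"
proof -
  obtain a where a: "(\<Union>n. S n) \<subseteq> cbox (-a) a" using bounded_subset_cbox_symmetric[OF b] by blast
  note B = disj_suminf_bound[of S f, OF d z K]
  have i: "integrable lborel (f n)" for n
   by (rule integrable_bdd[OF _ K b]) (use z in auto)
  have "(\<lambda>N. LINT p|lborel. (\<Sum>n<N. f n p)) \<longlonglongrightarrow> (LINT p|lborel. (\<Sum>n. f n p))"
  proof (rule integral_dominated_convergence[where w="\<lambda>x. ind (cbox (-a) a) x * K"])
   have "0 \<le> K" using K[of 0 0] by linarith
   thus "integrable lborel (\<lambda>x. ind (cbox (-a) a) x * K)"
    by (intro integrable_bdd[where K=K and S="cbox (-a) a"]) (auto simp: indicator_def)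
   show "AE x in lborel. norm (\<Sum>n<N. f n x) \<le> ind (cbox (-a) a) x * K" for N
   proof (intro AE_I2)
    fix x
    show "norm (\<Sum>n<N. f n x) \<le> ind (cbox (-a) a) x * K"
    proof (cases "x \<in> cbox (-a) a")
     case True thus ?thesis using B(2)[where N=N and p=x] by simp
    next
     case False
     hence "f n x = 0" for n using z[of x n] a by blast
     thus ?thesis by (simp add: False)
    qed
   qed
   show "AE x in lborel. (\<lambda>N. \<Sum>n<N. f n x) \<longlonglongrightarrow> (\<Sum>n. f n x)" using B(3) by (intro AE_I2)
  qed measurable
  moreover have "(LINT p|lborel. (\<Sum>n<N. f n p)) = (\<Sum>n<N. LINT p|lborel. f n p)" for N
   by (rule Bochner_Integration.integral_sum) (rule i)
  ultimately show ?thesis unfolding sums_def by simp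
qed

text \<open>Disjoint supports make the products in the weak equation diagonal: F of one wave never
  meets V of another. The bound common to all n becomes the bound of the superposition.\<close>

lemma wave_suminf:
  assumes w: "\<And>n. wave (S n) (V1 n) (V2 n) (F n) (G n)" and d: "disjoint_family S" and b: "bounded (\<Union>n. S n)"
   and K: "\<And>n p t. \<bar>V1 n p\<bar> \<le> K \<and> \<bar>V2 n p\<bar> \<le> K \<and> \<bar>G n p\<bar> \<le> K \<and> \<bar>F n p t\<bar> \<le> K"
  shows "wave (\<Union>n. S n) (\<lambda>p. \<Sum>n. V1 n p) (\<lambda>p. \<Sum>n. V2 n p) (\<lambda>p t. \<Sum>n. F n p t) (\<lambda>p. \<Sum>n. G n p)"
proof -
  have w1: "S n \<in> sets borel" and w0 [measurable]: "V1 n \<in> Bor" "V2 n \<in> Bor" "G n \<in> Bor"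
   "(\<lambda>z. F n (fst z) (snd z)) \<in> Bor"
   and w2: "\<And>p. p \<notin> S n \<Longrightarrow> V1 n p = 0 \<and> V2 n p = 0 \<and> G n p = 0 \<and> (\<forall>t. F n p t = 0)"
   and w4: "\<And>x y. G n (x, y) = (LBINT u:{..y}. V1 n (x, u))" "\<And>x. (LBINT u. V1 n (x, u)) = 0"
    "\<And>x y. G n (x, y) = - (LBINT u:{..x}. V2 n (u, y))" "\<And>y. (LBINT u. V2 n (u, y)) = 0" for n
   using w[of n] unfolding wave_def by blast+
  have w5: "(LINT p|lborel. LINT t|lborel. F n p t * (pht (fst p, snd p, t) + V1 n p * phx (fst p, snd p, t) + V2 n p * phy (fst p, snd p, t))) = 0"
   if "test3 ph phx phy pht" "\<forall>x y t. t \<notin> {a..b} \<longrightarrow> ph (x, y, t) = 0" for ph phx phy pht a b n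
   using w[of n] that unfolding wave_def by blast
  have z: "p \<notin> S n \<Longrightarrow> V1 n p = 0" "p \<notin> S n \<Longrightarrow> V2 n p = 0" "p \<notin> S n \<Longrightarrow> G n p = 0" "p \<notin> S n \<Longrightarrow> F n p t = 0" for n p t
   using w2 by blast+
  have K0: "0 \<le> K" using K[of 0 0 0] by linarith
  obtain a0 where a0: "(\<Union>n. S n) \<subseteq> cbox (-a0) a0" using bounded_subset_cbox_symmetric[OF b] by blast
  have sec: "disjoint_family (\<lambda>n. {u. (x, u) \<in> S n})" "disjoint_family (\<lambda>n. {u. (u, x) \<in> S n})"
   "bounded (\<Union>n. {u. (x, u) \<in> S n})" "bounded (\<Union>n. {u. (u, x) \<in> S n})" for x
  proof -
   show "disjoint_family (\<lambda>n. {u. (x, u) \<in> S n})" "disjoint_family (\<lambda>n. {u. (u, x) \<in> S n})"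
    using d unfolding disjoint_family_on_def by blast+
   have "(\<Union>n. {u. (x, u) \<in> S n}) \<subseteq> snd ` (\<Union>n. S n)" "(\<Union>n. {u. (u, x) \<in> S n}) \<subseteq> fst ` (\<Union>n. S n)" by force+
   thus "bounded (\<Union>n. {u. (x, u) \<in> S n})" "bounded (\<Union>n. {u. (u, x) \<in> S n})"
    using bounded_fst[OF b] bounded_snd[OF b] bounded_subset by blast+
  qed
  have secm [measurable]: "(\<lambda>u. V1 n (x, u)) \<in> Bor" "(\<lambda>u. V2 n (u, x)) \<in> Bor" for x n
   using measurable_compose[of "\<lambda>u. (x, u)" borel borel "V1 n" borel] measurable_compose[of "\<lambda>u. (u, x)" borel borel "V2 n" borel] by simp_all
  have line1: "(LBINT u:A. \<Sum>n. V1 n (x, u)) = (\<Sum>n. LBINT u:A. V1 n (x, u))" if [measurable]: "A \<in> sets borel" for A x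
  proof -
   have "(\<lambda>n. LBINT u. ind A u * V1 n (x, u)) sums (LBINT u. \<Sum>n. ind A u * V1 n (x, u))"
   proof (rule integral_disj_sums[OF _ sec(1)[of x] _ _ sec(3)[of x]])
    show "\<bar>ind A u * V1 n (x, u)\<bar> \<le> K" for n u using K[of n "(x, u)" 0] K0 by (auto simp: indicator_def)
   qed (use z in auto)
   moreover have "(\<Sum>n. ind A u * V1 n (x, u)) = ind A u * (\<Sum>n. V1 n (x, u))" for u
    by (cases "u \<in> A") simp_all
   ultimately show ?thesis unfolding set_int_def by (simp add: sums_iff)
  qed
  have line2: "(LBINT u:A. \<Sum>n. V2 n (u, y)) = (\<Sum>n. LBINT u:A. V2 n (u, y))" if [measurable]: "A \<in> sets borel" for A y
  proof -
   have "(\<lambda>n. LBINT u. ind A u * V2 n (u, y)) sums (LBINT u. \<Sum>n. ind A u * V2 n (u, y))"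
   proof (rule integral_disj_sums[OF _ sec(2)[of y] _ _ sec(4)[of y]])
    show "\<bar>ind A u * V2 n (u, y)\<bar> \<le> K" for n u using K[of n "(u, y)" 0] K0 by (auto simp: indicator_def)
   qed (use z in auto)
   moreover have "(\<Sum>n. ind A u * V2 n (u, y)) = ind A u * (\<Sum>n. V2 n (u, y))" for u
    by (cases "u \<in> A") simp_all
   ultimately show ?thesis unfolding set_int_def by (simp add: sums_iff)
  qed
  show ?thesis unfolding wave_def
  proof (intro conjI allI impI)
   show "(\<Union>n. S n) \<in> sets borel" using w1 by auto
   show "bounded (\<Union>n. S n)" by (rule b)
   show "(\<lambda>p. \<Sum>n. V1 n p) \<in> Bor" "(\<lambda>p. \<Sum>n. V2 n p) \<in> Bor"
    "(\<lambda>p. \<Sum>n. G n p) \<in> Bor" "(\<lambda>z. \<Sum>n. F n (fst z) (snd z)) \<in> Bor"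
    by (intro borel_measurable_suminf w0)+
   fix p t assume p: "p \<notin> (\<Union>n. S n)"
   show "(\<Sum>n. V1 n p) = 0" "(\<Sum>n. V2 n p) = 0" "(\<Sum>n. G n p) = 0" "(\<Sum>n. F n p t) = 0"
    using disj_suminf(2)[of S V1, OF d z(1) p] disj_suminf(2)[of S V2, OF d z(2) p] disj_suminf(2)[of S G, OF d z(3) p]
     disj_suminf(2)[of S "\<lambda>n p. F n p t", OF d z(4) p] by simp_all
  next
   have "\<bar>\<Sum>n. V1 n p\<bar> \<le> K \<and> \<bar>\<Sum>n. V2 n p\<bar> \<le> K \<and> \<bar>\<Sum>n. G n p\<bar> \<le> K \<and> \<bar>\<Sum>n. F n p t\<bar> \<le> K" for p t
   proof (intro conjI)
    show "\<bar>\<Sum>n. V1 n p\<bar> \<le> K" by (rule disj_suminf_bound(1)[of S V1, OF d z(1)]) (use K in auto)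
    show "\<bar>\<Sum>n. V2 n p\<bar> \<le> K" by (rule disj_suminf_bound(1)[of S V2, OF d z(2)]) (use K in auto)
    show "\<bar>\<Sum>n. G n p\<bar> \<le> K" by (rule disj_suminf_bound(1)[of S G, OF d z(3)]) (use K in auto)
    show "\<bar>\<Sum>n. F n p t\<bar> \<le> K" by (rule disj_suminf_bound(1)[of S "\<lambda>n p. F n p t", OF d z(4)]) (use K in auto)
   qed
   thus "\<exists>K. \<forall>p t. \<bar>\<Sum>n. V1 n p\<bar> \<le> K \<and> \<bar>\<Sum>n. V2 n p\<bar> \<le> K \<and> \<bar>\<Sum>n. G n p\<bar> \<le> K \<and> \<bar>\<Sum>n. F n p t\<bar> \<le> K" by blast
  next
   fix x y :: real
   show "(\<Sum>n. G n (x, y)) = (LBINT u:{..y}. \<Sum>n. V1 n (x, u))" using line1[of "{..y}" x] w4(1) by simp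
   show "(LBINT u. \<Sum>n. V1 n (x, u)) = 0" using line1[of UNIV x] w4(2) by (simp add: set_int_def)
   \<comment> \<open>\<open>suminf_minus\<close> needs summability; it holds because at most one
     \<open>G n\<close> is nonzero at \<open>(x, y)\<close>.\<close>
   have "(\<Sum>n. - (LBINT u:{..x}. V2 n (u, y))) = - (\<Sum>n. LBINT u:{..x}. V2 n (u, y))"
   proof (cases "summable (\<lambda>n. LBINT u:{..x}. V2 n (u, y))")
    case True thus ?thesis by (rule suminf_minus)
   next
    case False
    have "G n (x, y) = 0" if "(x, y) \<notin> S n" for n using z(3)[OF that] .
    hence "summable (\<lambda>n. G n (x, y))"
    proof -
     have "\<exists>N. \<forall>k. k \<noteq> N \<longrightarrow> G k (x, y) = 0"
     proof (cases "\<exists>n. (x, y) \<in> S n")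
      case True
      then obtain n where n: "(x, y) \<in> S n" ..
      hence "\<forall>k. k \<noteq> n \<longrightarrow> G k (x, y) = 0" using disj_other[OF d n] z(3) by blast
      thus ?thesis ..
     next
      case False
      hence "\<forall>k. k \<noteq> 0 \<longrightarrow> G k (x, y) = 0" using z(3) by blast
      thus ?thesis ..
     qed
     then obtain N where N: "\<And>k. k \<noteq> N \<Longrightarrow> G k (x, y) = 0" by blast
     show ?thesis by (rule summable_finite[of "{N}"]) (use N in auto)
    qed
    hence "summable (\<lambda>n. - G n (x, y))" by (rule summable_minus)
    thus ?thesis using False w4(3) by simp
   qed
   thus "(\<Sum>n. G n (x, y)) = - (LBINT u:{..x}. \<Sum>n. V2 n (u, y))" using line2[of "{..x}" y] w4(3) by simp
   show "(LBINT u. \<Sum>n. V2 n (u, y)) = 0" using line2[of UNIV y] w4(4) by (simp add: set_int_def)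
  next
   fix ph phx phy pht a b assume t3: "test3 ph phx phy pht" and zz: "\<forall>x y t. t \<notin> {a..b} \<longrightarrow> ph (x, y, t) = 0"
   have cc: "cont phx" "cont phy" "cont pht" using t3 by (simp_all add: test3_def)
   note [measurable] = cc[THEN Bor_contI]
   define J where "J n p = (LINT t|lborel. F n p t * (pht (fst p, snd p, t) + V1 n p * phx (fst p, snd p, t) + V2 n p * phy (fst p, snd p, t)))" for n p
   have Jm: "J n \<in> Bor" for n
   proof -
    have "(\<lambda>z. F n (fst z) (snd z) * (pht (fst (fst z), snd (fst z), snd z) + V1 n (fst z) * phx (fst (fst z), snd (fst z), snd z)
     + V2 n (fst z) * phy (fst (fst z), snd (fst z), snd z))) \<in> Bor"
     by measurable
    from borel_param_integral[OF this] show ?thesis unfolding J_def[abs_def] fst_conv snd_conv .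
   qed
   have Jz: "J n p = 0" if "p \<notin> S n" for n p using z(4)[OF that] by (simp add: J_def)
   let ?C = "{fst (-a0)..fst a0} \<times> {snd (-a0)..snd a0} \<times> {a..b}"
   obtain M where M: "\<And>q. q \<in> ?C \<Longrightarrow> \<bar>ph q\<bar> \<le> M \<and> \<bar>phx q\<bar> \<le> M \<and> \<bar>phy q\<bar> \<le> M \<and> \<bar>pht q\<bar> \<le> M" "0 \<le> M"
    by (rule test3_bounded[OF t3 compact_Times[OF compact_Icc compact_Times[OF compact_Icc compact_Icc]]]) blast
   have sup: "phx (x, y, t) = 0 \<and> phy (x, y, t) = 0 \<and> pht (x, y, t) = 0" if t: "t \<notin> {a..b}" for x y t
   proof -
    have "ph (x, y, t) = 0" if "t \<notin> {a..b}" for x y t using zz that by blast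
    from test3_supp[OF t3 this t] show ?thesis by blast
   qed
   have JK: "\<bar>J n p\<bar> \<le> K * (M + K * M + K * M) * \<bar>b - a\<bar>" for n p
   proof (cases "p \<in> S n")
    case False
    thus ?thesis using Jz K0 M(2) by simp
   next
    case True
    hence "p \<in> cbox (-a0) a0" using a0 by blast
    hence pq: "fst p \<in> {fst (-a0)..fst a0}" "snd p \<in> {snd (-a0)..snd a0}"
     by (cases p; cases a0; simp add: cbox_Pair_eq)+
    let ?f = "\<lambda>t. F n p t * (pht (fst p, snd p, t) + V1 n p * phx (fst p, snd p, t) + V2 n p * phy (fst p, snd p, t))"
    let ?L = "K * (M + K * M + K * M)"
    have fb: "\<bar>?f t\<bar> \<le> ind {a..b} t * ?L" for t
    proof (cases "t \<in> {a..b}")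
     case True
     hence m: "\<bar>phx (fst p, snd p, t)\<bar> \<le> M \<and> \<bar>phy (fst p, snd p, t)\<bar> \<le> M \<and> \<bar>pht (fst p, snd p, t)\<bar> \<le> M"
      using M(1)[of "(fst p, snd p, t)"] pq by simp
     have "\<bar>V1 n p * phx (fst p, snd p, t)\<bar> \<le> K * M" "\<bar>V2 n p * phy (fst p, snd p, t)\<bar> \<le> K * M"
      unfolding abs_mult using m K[of n p t] K0 by (intro mult_mono; simp)+
     hence "\<bar>pht (fst p, snd p, t) + V1 n p * phx (fst p, snd p, t) + V2 n p * phy (fst p, snd p, t)\<bar> \<le> M + K * M + K * M"
      using m by linarith
     hence "\<bar>?f t\<bar> \<le> ?L" unfolding abs_mult[of "F n p t"] using K[of n p t] K0 by (intro mult_mono) auto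
     thus ?thesis using True by simp
    next
     case False thus ?thesis using sup[OF False] by simp
    qed
    have i: "integrable lborel (\<lambda>t. ind {a..b} t * ?L)"
     using set_integrable_bdd[of "\<lambda>_. ?L" "?L" "{a..b}"] K0 M(2) by (simp add: set_integrable_def)
    have "\<bar>J n p\<bar> \<le> (LINT t|lborel. ind {a..b} t * ?L)"
     unfolding J_def
    proof (cases "integrable lborel ?f")
     case True
     show "\<bar>LINT t|lborel. ?f t\<bar> \<le> (LINT t|lborel. ind {a..b} t * ?L)"
      by (rule integral_abs_bound[THEN order_trans], rule integral_mono) (use True i fb in auto)
    next
     \<comment> \<open>A nonintegrable function has integral 0 by convention, so the estimate holds
       in this case as well.\<close>
     case False
     thus "\<bar>LINT t|lborel. ?f t\<bar> \<le> (LINT t|lborel. ind {a..b} t * ?L)"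
      using K0 M(2) by (simp add: not_integrable_integral_eq)
    qed
    also have "\<dots> \<le> ?L * \<bar>b - a\<bar>" using K0 M(2) by (cases "a \<le> b") (simp_all add: measure_def mult.commute)
    finally show ?thesis .
   qed
   have "(\<lambda>n. LINT p|lborel. J n p) sums (LINT p|lborel. (\<Sum>n. J n p))"
    by (rule integral_disj_sums[OF Jm d Jz JK b])
   moreover have "(LINT p|lborel. J n p) = 0" for n unfolding J_def by (rule w5[OF t3 zz])
   ultimately have J0: "(LINT p|lborel. (\<Sum>n. J n p)) = 0" using sums_unique2[OF sums_zero] by simp
   have "(LINT t|lborel. (\<Sum>n. F n p t) * (pht (fst p, snd p, t) + (\<Sum>n. V1 n p) * phx (fst p, snd p, t) + (\<Sum>n. V2 n p) * phy (fst p, snd p, t))) = (\<Sum>n. J n p)" for p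
   proof (cases "\<exists>n. p \<in> S n")
    case True
    then obtain n where n: "p \<in> S n" ..
    have "(\<Sum>n. F n p t) = F n p t" for t
     by (rule suminf_single) (use z(4) disj_other[OF d n] in blast)
    moreover have "(\<Sum>n. V1 n p) = V1 n p" "(\<Sum>n. V2 n p) = V2 n p" "(\<Sum>n. J n p) = J n p"
     using disj_suminf(1)[OF d z(1) n] disj_suminf(1)[OF d z(2) n] disj_suminf(1)[of S J, OF d Jz n] by auto
    ultimately show ?thesis by (simp add: J_def)
   next
    case False
    hence "J n p = 0" "F n p t = 0" for n t using Jz z(4) by blast+
    thus ?thesis by simp
   qed
   thus "(LINT p|lborel. LINT t|lborel. (\<Sum>n. F n p t) * (pht (fst p, snd p, t) + (\<Sum>n. V1 n p) * phx (fst p, snd p, t) + (\<Sum>n. V2 n p) * phy (fst p, snd p, t))) = 0"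
    using J0 by simp
  qed
qed

lemma wave_zero: "wave {} (\<lambda>p. 0) (\<lambda>p. 0) (\<lambda>p t. 0) (\<lambda>p. 0)"
  unfolding wave_def by (auto simp: set_int_def intro!: exI[of _ "0::real"])

section \<open>Energy of one cell\<close>

abbreviation sq8 :: "plane set" where "sq8 \<equiv> {-8<..<8} \<times> {-8<..<8}"

text \<open>Normalising constants of the unit cell: \<open>EV\<close> for the flow,
  \<open>AN\<close> for the area on which the density travels, \<open>AK\<close> for the area of the
  two dusts. Their values are never computed; \<open>EV\<close> and \<open>AN\<close> are divided by
  and must be positive.\<close>

definition EV :: real where "EV = (LINT p|lborel. (Vb1 p)\<^sup>2 + (Vb2 p)\<^sup>2)"
definition AN :: real where "AN = measure lborel Nset"
definition AK :: real where "AK = measure lborel (LR \<union> UL)"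

lemma cantor_range: "x \<in> (+) a ` cantor \<Longrightarrow> a \<le> x \<and> x \<le> a + 4 / 3" for a x :: real
  using cantor_bounds by fastforce

lemma sq8_bounded: "bounded sq8"
  by (intro bounded_Times) simp_all

lemma Vb_zero: "p \<notin> sq8 \<Longrightarrow> Vb1 p = 0 \<and> Vb2 p = 0 \<and> Gb p = 0"
  using Hb_big[of p] by (simp add: Vb1_def Vb2_def Gb_def)

text \<open>The open unit square lies to the left of all walls of \<open>C1\<close> and at levels
  below 3, so the second velocity component has modulus 1 there.\<close>

lemma EV_pos: "0 < EV"
proof -
  let ?U = "{0<..<1} \<times> {0<..<1} :: plane set"
  have i: "integrable lborel (\<lambda>p. (Vb1 p)\<^sup>2 + (Vb2 p)\<^sup>2)"
  proof (rule integrable_bdd[OF _ _ sq8_bounded, where K=5])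
   fix p
   have "(Vb1 p)\<^sup>2 \<le> 2\<^sup>2" "(Vb2 p)\<^sup>2 \<le> 1\<^sup>2" using abs_le_square_iff[of "Vb1 p" 2] abs_le_square_iff[of "Vb2 p" 1] Vb_bound[of p] by simp_all
   thus "\<bar>(Vb1 p)\<^sup>2 + (Vb2 p)\<^sup>2\<bar> \<le> 5" by simp
   show "(Vb1 p)\<^sup>2 + (Vb2 p)\<^sup>2 = 0" if "p \<notin> sq8" using Vb_zero[OF that] by simp
  qed measurable
  have U: "?U \<in> sets borel" "emeasure lborel ?U = 1"
  proof -
   show "?U \<in> sets borel" by (intro borel_open open_Times open_greaterThanLessThan)
   have "emeasure (lborel \<Otimes>\<^sub>M lborel) ?U = emeasure lborel {0<..<1::real} * emeasure lborel {0<..<1::real}"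
    by (rule lborel.emeasure_pair_measure_Times) auto
   thus "emeasure lborel ?U = 1" by (simp add: lborel_prod)
  qed
  have "1 = (LINT p|lborel. ind ?U p)" using U by (simp add: measure_def)
  also have "\<dots> \<le> EV" unfolding EV_def
  proof (rule integral_mono)
   show "integrable lborel (ind ?U)" using U by (intro integrable_real_indicator) auto
   fix p
   show "ind ?U p \<le> (Vb1 p)\<^sup>2 + (Vb2 p)\<^sup>2"
   proof (cases "p \<in> ?U")
    case True
    hence p: "0 < fst p" "fst p < 1" "0 < snd p" "snd p < 1" by (auto simp: mem_Times_iff)
    have "fst p \<notin> C1" using p cantor_range[of "fst p" 1] cantor_range[of "fst p" 4] unfolding C1_def by auto
    moreover have "AA (fst p) \<le> fst p" "BB (snd p) \<le> snd p"
     using prim_bounds[OF c_props(1,3), of "fst p"] prim_bounds[OF c_props(2,4), of "snd p"] p by (auto simp: AA_def BB_def)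
    ultimately have "(Vb2 p)\<^sup>2 = 1" using p by (simp add: Vb2_def Hb_def sg_def)
    thus ?thesis using True by simp
   qed simp
  qed (rule i)
  finally show ?thesis by simp
qed

lemma Nset_sub: "Nset \<subseteq> {0..6} \<times> {0..6}" by (auto simp: Nset_def)

lemma box6: "{0..6} \<times> {0..6} \<subseteq> (sq8 :: plane set)" by auto

lemma fin_meas: assumes "A \<subseteq> ({0..6} \<times> {0..6} :: plane set)" shows "emeasure lborel A < (\<infinity> :: ennreal)"
proof (rule emeasure_bounded_finite)
  have "bounded ({0..6} \<times> {0..6} :: plane set)" by (intro bounded_Times bounded_closed_interval)
  thus "bounded A" using assms by (rule bounded_subset)
qed

text \<open>Between the two copies, for x from 3 to 4, there are no walls of \<open>C1\<close>, and
  \<open>xi\<close> stays between 1 and 3, so points there with level between 5 and 6 are between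
  the dusts. They form an open set, nonempty by the intermediate value theorem.\<close>

lemma AN_pos: "0 < AN"
proof -
  define U where "U = ({3<..<4} \<times> {0<..<6}) \<inter> HH -` {5<..<6}"
  have cH: "cont HH" unfolding HH_def
   by (intro continuous_intros continuous_on_compose2[OF AB_cont(1)] continuous_on_compose2[OF AB_cont(2)]) auto
  have "open U" unfolding U_def
   by (intro open_Int open_Times open_greaterThanLessThan open_vimage[OF _ cH])
  have A3: "AA 3 = 2" "AA 4 = 3" using AA_val(1)[of 1 0] AA_val(2)[of 0 0] xp_end[of 0] by simp_all
  have B: "BB 1 = 1" "BB 3 = 2" using BB_val(1)[of 0 0] BB_val(2)[of 0 0] by simp_all
  obtain y where y: "1 \<le> y" "y \<le> 3" "BB y = 3 / 2"
   using IVT'[of BB 1 "3/2" 3] B continuous_on_subset[OF AB_cont(2)] by auto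
  have "AA (7/2) = 5 / 2" using AA_lip[of 3 "7/2"] AA_lip[of "7/2" 4] A3 by simp
  hence "(7/2, y) \<in> U" using y by (simp add: U_def HH_def)
  moreover have UN: "U \<subseteq> Nset"
  proof
   fix p assume p: "p \<in> U"
   hence f: "3 < fst p" "fst p < 4" "0 < snd p" "snd p < 6" and h: "5 < HH p" "HH p < 6" by (auto simp: U_def mem_Times_iff)
   have "fst p \<notin> C1" using f cantor_range[of "fst p" 1] cantor_range[of "fst p" 4] unfolding C1_def by auto
   moreover have "xi n (HH p) \<le> 3 \<and> 1 \<le> xi n (HH p)" for n
   proof -
    have "nat \<lfloor>4 ^ n * (HH p - 5)\<rfloor> < 4 ^ n"
     using h by (simp add: nat_less_iff floor_less_iff)
    hence "xp n (ev (nat \<lfloor>4 ^ n * (HH p - 5)\<rfloor>)) \<le> 2" using xp_le ev_od_less(1) less_imp_le by blast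
    thus ?thesis using xp_nonneg unfolding xi_def by simp
   qed
   hence "\<forall>n. xi n (HH p) \<le> fst p" "fst p \<le> xi 0 (HH p) + 3" using f by (smt (verit))+
   ultimately show "p \<in> Nset" using f h unfolding Nset_def btw_def by (auto simp: mem_Times_iff)
  qed
  obtain a b where ab: "cbox a b \<subseteq> U" "box a b \<noteq> {}"
   using open_contains_cbox[OF \<open>open U\<close> \<open>(7/2, y) \<in> U\<close>] by (metis empty_iff)
  have "emeasure lborel (cbox a b) \<le> emeasure lborel Nset"
   by (rule emeasure_mono) (use ab UN in auto)
  moreover have "0 < emeasure lborel (cbox a b)"
  proof -
   have "0 < measure lborel (cbox a b)" using ab(2) by (simp add: content_pos_lt_eq box_ne_empty)
   thus ?thesis by (simp add: measure_def enn2real_positive_iff)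
  qed
  ultimately have "0 < emeasure lborel Nset" by simp
  thus ?thesis unfolding AN_def measure_def using fin_meas[OF Nset_sub] by (simp add: enn2real_positive_iff)
qed

lemma Fb_sq: "(Fb r R p t)\<^sup>2 = ind Nset p * (r (t - tau p))\<^sup>2 + ind (LR \<union> UL) p * (R (t - tau p))\<^sup>2"
proof -
  have "Nset \<inter> (LR \<union> UL) = {}" using LR_UL_sub by (auto simp: Nset_def)
  thus ?thesis using LR_UL_sub(5) by (auto simp: Fb_def kap_def indicator_def)
qed

text \<open>Oscillation keeps the primitive \<open>osR\<close> small. The two phases are used on alternate rows of cells, so
  that the squares add up to the square of the amplitude.\<close>

definition osr :: "(real \<Rightarrow> real) \<Rightarrow> (real \<Rightarrow> real) \<Rightarrow> real \<Rightarrow> real \<Rightarrow> bool \<Rightarrow> real \<Rightarrow> real" where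
  "osr rh S de m q t = (if q then - rh (t / m) * sin (S (t / m) / de) else rh (t / m) * cos (S (t / m) / de))"

definition osR :: "(real \<Rightarrow> real) \<Rightarrow> real \<Rightarrow> real \<Rightarrow> bool \<Rightarrow> real \<Rightarrow> real" where
  "osR S de m q t = m * de * (if q then cos (S (t / m) / de) else sin (S (t / m) / de))"

text \<open>The phase is \<open>S / de\<close> with S a primitive of the amplitude \<open>rh\<close>
  itself. By the chain rule the oscillating profile then has an exact primitive, a sine or cosine of
  size \<open>m * de\<close>, whatever the shape of \<open>rh\<close>.\<close>

lemma os_wave:
  assumes rh: "cont rh" "\<And>t. \<bar>rh t\<bar> \<le> K" and S: "\<And>t. (S has_real_derivative rh t) (at t)" and d: "0 < de" "0 < m"
  shows "wave sq8 Vb1 Vb2 (Fb (osr rh S de m q) (osR S de m q)) Gb"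
proof (rule base_wave[where K="K + m * de"])
  have S': "((\<lambda>t. S (t / m) / de) has_real_derivative rh (t / m) / m / de) (at t)" for t
   using DERIV_cdivide[OF DERIV_chain2[OF S DERIV_cdivide[OF DERIV_ident]], of m de t] by simp
  have cS: "cont S" by (rule DERIV_continuous_on) (rule S)
  have [measurable]: "S \<in> Bor" "rh \<in> Bor"
   by (rule Bor_contI[OF cS] Bor_contI[OF rh(1)])+
  show "osr rh S de m q \<in> Bor" unfolding osr_def[abs_def] by measurable
  have K: "0 \<le> K" using rh(2)[of 0] by linarith
  have md: "0 < m * de" using d by simp
  have b: "\<bar>x * y\<bar> \<le> L" if "\<bar>x\<bar> \<le> L" "\<bar>y\<bar> \<le> 1" for x y L :: real
   unfolding abs_mult using mult_mono[OF that] that by simp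
  have "\<bar>osr rh S de m q t\<bar> \<le> K" for t
   using b[of "- rh (t / m)" K "sin (S (t / m) / de)"] b[of "rh (t / m)" K "cos (S (t / m) / de)"] rh(2)[of "t / m"]
   by (simp add: osr_def)
  thus "\<bar>osr rh S de m q t\<bar> \<le> K + m * de" for t using md by (rule order_trans[OF _ less_imp_le[OF less_add_same_cancel1[THEN iffD2]]])
  have "\<bar>osR S de m q t\<bar> \<le> m * de" for t
   unfolding osR_def by (rule b) (use md in auto)
  thus "\<bar>osR S de m q t\<bar> \<le> K + m * de" for t using K by (rule order_trans[OF _ le_add_same_cancel2[THEN iffD2]])
  show "(osR S de m q has_real_derivative osr rh S de m q t) (at t)" for t
   using DERIV_cmult[OF DERIV_fun_sin[OF S'], of "m * de" t] DERIV_cmult[OF DERIV_fun_cos[OF S'], of "m * de" t] d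
   by (cases q) (simp_all add: osR_def[abs_def] osr_def mult_ac)
qed

text \<open>The squares of sine and cosine add up to 1, so the sum over the two phases contains no
  oscillation: the travelling part leaves the slow amplitude \<open>rh\<close> at retarded times,
  the dusts leave the constant \<open>(m * de)\<^sup>2\<close>.\<close>

lemma os_energy:
  assumes [measurable]: "rh \<in> Bor" "S \<in> Bor"
   and K: "\<And>t. \<bar>rh t\<bar> \<le> K" and d: "0 < de" "0 < m"
  defines "e \<equiv> \<lambda>q t. LINT p|lborel. (Fb (osr rh S de m q) (osR S de m q) p (m * t))\<^sup>2"
  shows "e False t + e True t = (LINT p:Nset|lborel. (rh (t - tau p / m))\<^sup>2) + (m * de)\<^sup>2 * AK"
proof -
  have dv: "(m * t - tau p) / m = t - tau p / m" for p using d by (simp add: field_simps)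
  define r where "r q p = (osr rh S de m q (m * t - tau p))\<^sup>2" for q p
  define R where "R q p = (osR S de m q (m * t - tau p))\<^sup>2" for q p
  have [measurable]: "r q \<in> Bor" "R q \<in> Bor" for q
   unfolding r_def[abs_def] R_def[abs_def] osr_def osR_def by measurable
  have rs: "r False p + r True p = (rh (t - tau p / m))\<^sup>2" for p
   unfolding r_def osr_def dv by (simp add: power_mult_distrib flip: distrib_left)
  have Rs: "R False p + R True p = (m * de)\<^sup>2" for p
   unfolding R_def osR_def dv by (simp add: power_mult_distrib flip: distrib_left)
  have pos: "0 \<le> r q p" "0 \<le> R q p" for q p by (simp_all add: r_def R_def)
  have rb: "\<bar>r q p\<bar> \<le> K\<^sup>2" for q p
  proof -
   have "r q p \<le> (rh (t - tau p / m))\<^sup>2" using rs[of p] pos(1)[of True p] pos(1)[of False p] by (cases q; simp)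
   also have "\<dots> \<le> K\<^sup>2" using K[of "t - tau p / m"] by (metis abs_le_square_iff abs_ge_zero abs_of_nonneg order_trans)
   finally show ?thesis using pos by simp
  qed
  have Rb: "\<bar>R q p\<bar> \<le> (m * de)\<^sup>2" for q p
   using Rs[of p] pos(2)[of True p] pos(2)[of False p] by (cases q) auto
  have bN: "bounded Nset" "bounded (LR \<union> UL)"
  proof -
   have B: "bounded ({0..6} \<times> {0..6} :: plane set)" by (intro bounded_Times bounded_closed_interval)
   show "bounded Nset" "bounded (LR \<union> UL)"
    by (rule bounded_subset[OF B Nset_sub], rule bounded_subset[OF B Un_least[OF LR_UL_sub(1,2)]])
  qed
  have si: "set_integrable lborel A f"
   if "f \<in> Bor" "\<And>p. \<bar>f p\<bar> \<le> L" "A \<in> sets borel" "bounded A" for A L and f :: "plane \<Rightarrow> real"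
   unfolding set_integrable_def
  proof (rule integrable_bdd[OF _ _ that(4), where K="\<bar>L\<bar>"])
   show "\<bar>ind A x *\<^sub>R f x\<bar> \<le> \<bar>L\<bar>" for x using that(2)[of x] by (auto simp: indicator_def)
  qed (use that in auto)
  have iN: "set_integrable lborel Nset (r q)" for q by (rule si[OF _ rb]) (auto simp: bN)
  have iK: "set_integrable lborel (LR \<union> UL) (R q)" for q by (rule si[OF _ Rb _ bN(2)]) auto
  have e: "e q t = (LINT p:Nset|lborel. r q p) + (LINT p:LR \<union> UL|lborel. R q p)" for q
  proof -
   have "e q t = (LINT p|lborel. ind Nset p *\<^sub>R r q p + ind (LR \<union> UL) p *\<^sub>R R q p)"
    unfolding e_def Fb_sq r_def R_def by simp
   also have "\<dots> = (LINT p:Nset|lborel. r q p) + (LINT p:LR \<union> UL|lborel. R q p)"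
    unfolding set_int_def
    by (rule Bochner_Integration.integral_add) (use iN iK in \<open>simp_all add: set_integrable_def\<close>)
   finally show ?thesis .
  qed
  have "e False t + e True t = (LINT p:Nset|lborel. r False p + r True p) + (LINT p:LR \<union> UL|lborel. R False p + R True p)"
   unfolding e set_integral_add(2)[OF iN iN] set_integral_add(2)[OF iK iK] by simp
  thus ?thesis unfolding rs Rs AK_def by (simp add: set_int_def mult.commute)
qed

lemma wave_mono: "wave S V1 V2 F G \<Longrightarrow> S \<subseteq> S' \<Longrightarrow> S' \<in> sets borel \<Longrightarrow> bounded S' \<Longrightarrow> wave S' V1 V2 F G"
  unfolding wave_def by (elim conjE) (intro conjI; (assumption | blast)?)

lemma wave_props:
  assumes "wave S V1 V2 F G"
  shows "S \<in> sets borel" "bounded S" "V1 \<in> Bor" "V2 \<in> Bor" "G \<in> Bor"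
   "(\<lambda>z. F (fst z) (snd z)) \<in> Bor" "(\<lambda>p. F p t) \<in> Bor"
   "p \<notin> S \<Longrightarrow> V1 p = 0" "p \<notin> S \<Longrightarrow> V2 p = 0" "p \<notin> S \<Longrightarrow> G p = 0" "p \<notin> S \<Longrightarrow> F p t = 0"
   "\<exists>K. \<forall>p t. \<bar>V1 p\<bar> \<le> K \<and> \<bar>V2 p\<bar> \<le> K \<and> \<bar>G p\<bar> \<le> K \<and> \<bar>F p t\<bar> \<le> K"
proof -
  show *: "S \<in> sets borel" "bounded S" "V1 \<in> Bor" "V2 \<in> Bor" "G \<in> Bor"
   "(\<lambda>z. F (fst z) (snd z)) \<in> Bor"
   "p \<notin> S \<Longrightarrow> V1 p = 0" "p \<notin> S \<Longrightarrow> V2 p = 0" "p \<notin> S \<Longrightarrow> G p = 0" "p \<notin> S \<Longrightarrow> F p t = 0"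
   "\<exists>K. \<forall>p t. \<bar>V1 p\<bar> \<le> K \<and> \<bar>V2 p\<bar> \<le> K \<and> \<bar>G p\<bar> \<le> K \<and> \<bar>F p t\<bar> \<le> K"
   using assms unfolding wave_def by blast+
  show "(\<lambda>p. F p t) \<in> Bor"
   using measurable_compose[OF _ *(6), of "\<lambda>p. (p, t)" borel] by simp
qed

lemma disj_suminf_mult:
  fixes f g :: "nat \<Rightarrow> 'a \<Rightarrow> real"
  assumes d: "disjoint_family S" and z: "\<And>n p. p \<notin> S n \<Longrightarrow> f n p = 0" "\<And>n p. p \<notin> S n \<Longrightarrow> g n p = 0"
  shows "(\<Sum>n. f n p) * (\<Sum>n. g n p) = (\<Sum>n. f n p * g n p)"
proof (cases "\<exists>n. p \<in> S n")
  case True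
  then obtain n where n: "p \<in> S n" ..
  show ?thesis
   using disj_suminf(1)[of S f, OF d z(1) n] disj_suminf(1)[of S g, OF d z(2) n]
    disj_suminf(1)[of S "\<lambda>n p. f n p * g n p", OF d _ n] z by simp
next
  case False
  hence "f n p = 0" for n using z by blast
  thus ?thesis by simp
qed

lemma sums_bounded_range: "f sums s \<Longrightarrow> (\<And>n. P \<le> n \<Longrightarrow> f n = 0) \<Longrightarrow> s = (\<Sum>n<P. f n)" for f :: "nat \<Rightarrow> real"
  using sums_unique2[OF _ sums_finite[of "{..<P}" f]] by (simp add: not_less)

lemma sum_grid: "(\<Sum>n<M * M. h (n div M) (n mod M)) = (\<Sum>j<M. \<Sum>i<M. h j i)" for h :: "nat \<Rightarrow> nat \<Rightarrow> real"
proof -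
  have "(\<Sum>n<M * M. h (n div M) (n mod M)) = (\<Sum>j<M. \<Sum>n\<in>{j * M..<j * M + M}. h (n div M) (n mod M))"
   by (rule sum.nat_group[symmetric])
  also have "\<dots> = (\<Sum>j<M. \<Sum>i<M. h j i)"
  proof (rule sum.cong[OF refl])
   fix j
   have "(\<Sum>n\<in>{j * M..<j * M + M}. h (n div M) (n mod M)) = (\<Sum>i<M. h ((i + j * M) div M) ((i + j * M) mod M))"
    using sum.shift_bounds_nat_ivl[of "\<lambda>n. h (n div M) (n mod M)" 0 "j * M" M] by (simp add: atLeast0LessThan add.commute)
   also have "\<dots> = (\<Sum>i<M. h j i)" by (rule sum.cong) auto
   finally show "(\<Sum>n\<in>{j * M..<j * M + M}. h (n div M) (n mod M)) = (\<Sum>i<M. h j i)" .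
  qed
  finally show ?thesis .
qed

lemma sum_alternating: "(\<Sum>i<2 * N. (-1) ^ i) = (0 :: real)" "(\<Sum>j<2 * N. f (odd j)) = real N * (f False + f True :: real)"
  by (induction N) (simp_all add: algebra_simps)

text \<open>The signs alternate along each row, which makes the integrals of \<open>F\<close> over horizontal lines vanish.\<close>

lemma wave_grid:
  fixes c d l m :: real and W :: "bool \<Rightarrow> plane \<Rightarrow> real \<Rightarrow> real"
  assumes w: "\<And>q. wave sq8 Vb1 Vb2 (W q) Gb" and L: "\<And>q p t. (W q p t)\<^sup>2 \<le> L" and N: "0 < N" and l: "0 < l" and m: "0 < m"
  defines "M \<equiv> 2 * N"
  shows "\<exists>V1 V2 F G. wave ({c<..<c + 16 * l * real M} \<times> {d<..<d + 16 * l * real M}) V1 V2 F G \<and>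
   (LINT p|lborel. (V1 p)\<^sup>2 + (V2 p)\<^sup>2) = (real M)\<^sup>2 * (l * m)\<^sup>2 * l\<^sup>2 * EV \<and>
   (\<forall>p t. \<bar>V1 p\<bar> \<le> 2 * (l * m) \<and> \<bar>V2 p\<bar> \<le> 2 * (l * m) \<and> \<bar>G p\<bar> \<le> 6 * (l * l * m) \<and> (F p t)\<^sup>2 \<le> L) \<and>
   (\<forall>y t. (LBINT x. F (x, y) t) = 0) \<and> (\<forall>t. (LINT p|lborel. G p * F p t) = 0) \<and>
   (\<forall>t. (LINT p|lborel. (F p t)\<^sup>2) = (real M)\<^sup>2 / 2 * l\<^sup>2 *
     ((LINT p|lborel. (W False p (m * t))\<^sup>2) + (LINT p|lborel. (W True p (m * t))\<^sup>2)))"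
proof -
  have M: "0 < M" using N by (simp add: M_def)
  have sgn2: "((-1) ^ k)\<^sup>2 = (1 :: real)" for k :: nat by (induction k) simp_all
  have L0: "0 \<le> L" using L[of False "(0,0)" 0] by (rule order_trans[rotated]) simp
  have lm: "0 < l * m" using l m by simp
  define ci where "ci n = c + (2 * real (n mod M) + 1) * 8 * l" for n
  define dj where "dj n = d + (2 * real (n div M) + 1) * 8 * l" for n
  define T where "T n = aff (ci n) (dj n) l" for n
  define q where "q n = odd (n div M)" for n
  \<comment> \<open>Cell n stands in column \<open>n mod M\<close> and row \<open>n div M\<close>.
    Indices from \<open>M * M\<close> on get empty cells, so that the superposition lemma for
    sequences applies.\<close>
  define S where "S n = (if n < M * M then {p. T n p \<in> sq8} else {})" for n
  define V1 where "V1 n p = (if n < M * M then l * m * Vb1 (T n p) else 0)" for n p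
  define V2 where "V2 n p = (if n < M * M then l * m * Vb2 (T n p) else 0)" for n p
  define G where "G n p = (if n < M * M then l * l * m * Gb (T n p) else 0)" for n p
  define F where "F n p t = (if n < M * M then (-1) ^ (n mod M) * W (q n) (T n p) (m * t) else 0)" for n p t
  have wn: "wave (S n) (V1 n) (V2 n) (F n) (G n)" for n
  proof (cases "n < M * M")
   case True
   thus ?thesis
    using wave_scale[OF w[of "q n"] l m, of "ci n" "dj n" "(-1) ^ (n mod M)"]
    unfolding S_def[abs_def] V1_def[abs_def] V2_def[abs_def] G_def[abs_def] F_def[abs_def] T_def by simp
  next
   case False
   thus ?thesis using wave_zero unfolding S_def[abs_def] V1_def[abs_def] V2_def[abs_def] G_def[abs_def] F_def[abs_def] by simp
  qed
  have loc: "real (n mod M) * (16 * l) < fst p - c \<and> fst p - c < (real (n mod M) + 1) * (16 * l)"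
   "real (n div M) * (16 * l) < snd p - d \<and> snd p - d < (real (n div M) + 1) * (16 * l)" "n < M * M" if "p \<in> S n" for n p
  proof -
   show n: "n < M * M" using that by (auto simp: S_def split: if_splits)
   hence "-8 < (fst p - ci n) / l" "(fst p - ci n) / l < 8" "-8 < (snd p - dj n) / l" "(snd p - dj n) / l < 8"
    using that by (auto simp: S_def T_def aff_def)
   hence "-8 * l < fst p - ci n" "fst p - ci n < 8 * l" "-8 * l < snd p - dj n" "snd p - dj n < 8 * l"
    using l by (simp_all only: pos_less_divide_eq pos_divide_less_eq)
   thus "real (n mod M) * (16 * l) < fst p - c \<and> fst p - c < (real (n mod M) + 1) * (16 * l)"
    "real (n div M) * (16 * l) < snd p - d \<and> snd p - d < (real (n div M) + 1) * (16 * l)"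
    by (simp_all add: ci_def dj_def algebra_simps)
  qed
  have uniq: "a = b" if "real a * k < z" "z < (real a + 1) * k" "real b * k < z" "z < (real b + 1) * k" "0 < k" for a b :: nat and k z :: real
  proof -
   have "real a * k < (real b + 1) * k" "real b * k < (real a + 1) * k" using that by linarith+
   hence "real a < real b + 1" "real b < real a + 1" using that(5) by (simp_all only: mult_less_cancel_right_pos)
   thus ?thesis by linarith
  qed
  have disj: "disjoint_family S"
   unfolding disjoint_family_on_def
  proof (intro ballI impI, rule ccontr)
   fix n n' assume "n \<noteq> n'" "S n \<inter> S n' \<noteq> {}"
   then obtain p where p: "p \<in> S n" "p \<in> S n'" by blast
   have k: "0 < 16 * l" using l by simp
   have "n mod M = n' mod M" using uniq[OF _ _ _ _ k] loc(1)[OF p(1)] loc(1)[OF p(2)] by blast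
   moreover have "n div M = n' div M" using uniq[OF _ _ _ _ k] loc(2)[OF p(1)] loc(2)[OF p(2)] by blast
   ultimately have "n = n'" by (metis div_mult_mod_eq)
   thus False using \<open>n \<noteq> n'\<close> by simp
  qed
  let ?Sq = "{c<..<c + 16 * l * real M} \<times> {d<..<d + 16 * l * real M}"
  have sub: "(\<Union>n. S n) \<subseteq> ?Sq"
  proof
   fix p assume "p \<in> (\<Union>n. S n)"
   then obtain n where n: "p \<in> S n" by blast
   note ln = loc[OF n]
   have "n mod M + 1 \<le> M" using M by (simp add: Suc_leI)
   moreover have "n div M + 1 \<le> M" using ln(3) by (simp add: less_mult_imp_div_less Suc_leI)
   ultimately have "real (n mod M) + 1 \<le> real M" "real (n div M) + 1 \<le> real M" by linarith+
   hence "(real (n mod M) + 1) * (16 * l) \<le> real M * (16 * l)" "(real (n div M) + 1) * (16 * l) \<le> real M * (16 * l)"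
    using l by (intro mult_right_mono; simp)+
   moreover have "0 \<le> real (n mod M) * (16 * l)" "0 \<le> real (n div M) * (16 * l)" using l by simp_all
   ultimately have "0 < fst p - c" "fst p - c < real M * (16 * l)" "0 < snd p - d" "snd p - d < real M * (16 * l)"
    using ln(1,2) by linarith+
   thus "p \<in> ?Sq" by (simp add: mem_Times_iff algebra_simps)
  qed
  have Sqb: "?Sq \<in> sets borel" "bounded ?Sq"
   by (intro borel_open open_Times open_greaterThanLessThan) (intro bounded_Times; simp)
  have bd: "bounded (\<Union>n. S n)" by (rule bounded_subset[OF Sqb(2) sub])
  have b: "\<bar>V1 n p\<bar> \<le> 2 * (l * m)" "\<bar>V2 n p\<bar> \<le> 2 * (l * m)" "\<bar>G n p\<bar> \<le> 6 * (l * l * m)" "(F n p t)\<^sup>2 \<le> L" for n p t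
  proof -
   have llm: "0 < l * l * m" using l m by simp
   have "\<bar>l * m * Vb1 (T n p)\<bar> \<le> l * m * 2" "\<bar>l * m * Vb2 (T n p)\<bar> \<le> l * m * 2" "\<bar>l * l * m * Gb (T n p)\<bar> \<le> l * l * m * 6"
    unfolding abs_mult[of "l * m"] abs_mult[of "l * l * m"] abs_of_pos[OF lm] abs_of_pos[OF llm]
    using Vb_bound[of "T n p"] lm llm by (intro mult_left_mono; simp)+
   thus "\<bar>V1 n p\<bar> \<le> 2 * (l * m)" "\<bar>V2 n p\<bar> \<le> 2 * (l * m)" "\<bar>G n p\<bar> \<le> 6 * (l * l * m)"
    using lm llm unfolding V1_def V2_def G_def by (simp_all add: mult.commute)
   have "((-1) ^ (n mod M) * W (q n) (T n p) (m * t))\<^sup>2 = (W (q n) (T n p) (m * t))\<^sup>2" by (simp add: power_mult_distrib sgn2)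
   thus "(F n p t)\<^sup>2 \<le> L" using L[of "q n" "T n p" "m * t"] L0 unfolding F_def by simp
  qed
  have Fb: "\<bar>F n p t\<bar> \<le> sqrt L" for n p t using real_sqrt_le_mono[OF b(4)[of n p t]] by simp
  define K where "K = 2 * (l * m) + 6 * (l * l * m) + sqrt L"
  have Kp: "0 \<le> 2 * (l * m)" "0 \<le> 6 * (l * l * m)" "0 \<le> sqrt L" using l m L0 by simp_all
  have K: "\<bar>V1 n p\<bar> \<le> K \<and> \<bar>V2 n p\<bar> \<le> K \<and> \<bar>G n p\<bar> \<le> K \<and> \<bar>F n p t\<bar> \<le> K" for n p t
   using b(1-3)[of n p] Fb[of n p t] Kp unfolding K_def by linarith
  have z: "p \<notin> S n \<Longrightarrow> V1 n p = 0" "p \<notin> S n \<Longrightarrow> V2 n p = 0" "p \<notin> S n \<Longrightarrow> G n p = 0" "p \<notin> S n \<Longrightarrow> F n p t = 0" for n p t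
   using wave_props(8-11)[OF wn[of n]] by blast+
  have mV [measurable]: "V1 n \<in> Bor" "V2 n \<in> Bor" "G n \<in> Bor" "(\<lambda>p. F n p t) \<in> Bor" for n t
   using wave_props(3,4,5,7)[OF wn[of n]] by blast+
  note mW [measurable] = wave_props(7)[OF w]
  have wave: "wave ?Sq (\<lambda>p. \<Sum>n. V1 n p) (\<lambda>p. \<Sum>n. V2 n p) (\<lambda>p t. \<Sum>n. F n p t) (\<lambda>p. \<Sum>n. G n p)"
   by (rule wave_mono[OF wave_suminf[OF wn disj bd K] sub Sqb])
  have energyV: "(LINT p|lborel. (\<Sum>n. V1 n p)\<^sup>2 + (\<Sum>n. V2 n p)\<^sup>2) = (real M)\<^sup>2 * (l * m)\<^sup>2 * l\<^sup>2 * EV"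
  proof -
   have eq: "(\<Sum>n. V1 n p)\<^sup>2 + (\<Sum>n. V2 n p)\<^sup>2 = (\<Sum>n. (V1 n p)\<^sup>2 + (V2 n p)\<^sup>2)" for p
   proof (cases "\<exists>n. p \<in> S n")
    case True
    then obtain n where n: "p \<in> S n" ..
    show ?thesis using disj_suminf(1)[of S V1, OF disj z(1) n] disj_suminf(1)[of S V2, OF disj z(2) n]
     disj_suminf(1)[of S "\<lambda>n p. (V1 n p)\<^sup>2 + (V2 n p)\<^sup>2", OF disj _ n] z by simp
   next
    case False
    hence "V1 n p = 0" "V2 n p = 0" for n using z by blast+
    thus ?thesis by simp
   qed
   have "(\<lambda>n. LINT p|lborel. (V1 n p)\<^sup>2 + (V2 n p)\<^sup>2) sums (LINT p|lborel. (\<Sum>n. (V1 n p)\<^sup>2 + (V2 n p)\<^sup>2))"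
   proof (rule integral_disj_sums[OF _ disj _ _ bd])
    fix n p
    have "(V1 n p)\<^sup>2 \<le> (2 * (l * m))\<^sup>2" "(V2 n p)\<^sup>2 \<le> (2 * (l * m))\<^sup>2"
     using b(1,2)[of n p] Kp(1) abs_le_square_iff[of _ "2 * (l * m)"] by (simp_all only: abs_of_nonneg)
    thus "\<bar>(V1 n p)\<^sup>2 + (V2 n p)\<^sup>2\<bar> \<le> 2 * (2 * (l * m))\<^sup>2" by simp
   qed (use z in auto)
   hence "(LINT p|lborel. (\<Sum>n. (V1 n p)\<^sup>2 + (V2 n p)\<^sup>2)) = (\<Sum>n<M * M. LINT p|lborel. (V1 n p)\<^sup>2 + (V2 n p)\<^sup>2)"
    by (rule sums_bounded_range) (simp add: V1_def V2_def)
   also have "\<dots> = (\<Sum>n<M * M. (l * m)\<^sup>2 * (l\<^sup>2 * EV))"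
   proof (rule sum.cong[OF refl])
    fix n assume "n \<in> {..<M * M}"
    hence "(LINT p|lborel. (V1 n p)\<^sup>2 + (V2 n p)\<^sup>2) = (LINT p|lborel. (l * m)\<^sup>2 * ((Vb1 (aff (ci n) (dj n) l p))\<^sup>2 + (Vb2 (aff (ci n) (dj n) l p))\<^sup>2))"
     by (simp add: V1_def V2_def T_def power_mult_distrib distrib_left)
    also have "\<dots> = (l * m)\<^sup>2 * (l\<^sup>2 * EV)"
     unfolding integral_mult_right_zero EV_def using int_aff[of "\<lambda>p. (Vb1 p)\<^sup>2 + (Vb2 p)\<^sup>2" l "ci n" "dj n"] l by simp
    finally show "(LINT p|lborel. (V1 n p)\<^sup>2 + (V2 n p)\<^sup>2) = (l * m)\<^sup>2 * (l\<^sup>2 * EV)" .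
   qed
   finally show ?thesis unfolding eq by (simp add: power2_eq_square)
  qed
  have line: "(LBINT x. (\<Sum>n. F n (x, y) t)) = 0" for y t
  proof -
   define a where "a j = (LBINT x. W (odd j) (x, (y - (d + (2 * real j + 1) * 8 * l)) / l) (m * t))" for j :: nat
   have "(\<lambda>n. LBINT x. F n (x, y) t) sums (LBINT x. (\<Sum>n. F n (x, y) t))"
   proof (rule integral_disj_sums[where S="\<lambda>n. {x. (x, y) \<in> S n}"])
    show "disjoint_family (\<lambda>n. {x. (x, y) \<in> S n})" using disj unfolding disjoint_family_on_def by blast
    have "(\<Union>n. {x. (x, y) \<in> S n}) \<subseteq> fst ` (\<Union>n. S n)" by force
    thus "bounded (\<Union>n. {x. (x, y) \<in> S n})" using bounded_fst[OF bd] bounded_subset by blast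
    show "(\<lambda>x. F n (x, y) t) \<in> Bor" for n
     using measurable_compose[OF _ mV(4), of "\<lambda>x. (x, y)" borel] by simp
   qed (use z Fb in auto)
   hence "(LBINT x. (\<Sum>n. F n (x, y) t)) = (\<Sum>n<M * M. LBINT x. F n (x, y) t)"
    by (rule sums_bounded_range) (simp add: F_def)
   also have "\<dots> = (\<Sum>n<M * M. (-1) ^ (n mod M) * (l * a (n div M)))"
   proof (rule sum.cong[OF refl])
    fix n assume "n \<in> {..<M * M}"
    hence "(LBINT x. F n (x, y) t) = (LBINT x. (-1) ^ (n mod M) * W (q n) ((x - ci n) / l, (y - dj n) / l) (m * t))"
     by (simp add: F_def T_def aff_def)
    also have "\<dots> = (-1) ^ (n mod M) * (l * a (n div M))"
     unfolding integral_mult_right_zero a_def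
     using int_affine1(1)[OF l, where f="\<lambda>x. W (q n) (x, (y - dj n) / l) (m * t)" and d="ci n"] by (simp add: q_def dj_def)
    finally show "(LBINT x. F n (x, y) t) = (-1) ^ (n mod M) * (l * a (n div M))" .
   qed
   also have "\<dots> = (\<Sum>j<M. \<Sum>i<M. (-1) ^ i * (l * a j))" by (rule sum_grid)
   \<comment> \<open>Every row has the even number \<open>2 * N\<close> of cells, with alternating
     signs.\<close>
   also have "\<dots> = 0" by (simp add: sum_distrib_right[symmetric] M_def sum_alternating(1))
   finally show ?thesis .
  qed
  have GF: "(LINT p|lborel. (\<Sum>n. G n p) * (\<Sum>n. F n p t)) = 0" for t
  proof -
   define a where "a j = (LINT p|lborel. Gb p * W (odd j) p (m * t))" for j :: nat
   have "(\<lambda>n. LINT p|lborel. G n p * F n p t) sums (LINT p|lborel. (\<Sum>n. G n p * F n p t))"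
   proof (rule integral_disj_sums[OF _ disj _ _ bd])
    fix n p
    show "\<bar>G n p * F n p t\<bar> \<le> K * K" unfolding abs_mult using K[of n p t] by (intro mult_mono) auto
   qed (use z in auto)
   hence "(LINT p|lborel. (\<Sum>n. G n p * F n p t)) = (\<Sum>n<M * M. LINT p|lborel. G n p * F n p t)"
    by (rule sums_bounded_range) (simp add: F_def)
   also have "\<dots> = (\<Sum>n<M * M. (-1) ^ (n mod M) * (l * l * m * (l\<^sup>2 * a (n div M))))"
   proof (rule sum.cong[OF refl])
    fix n assume "n \<in> {..<M * M}"
    hence "(LINT p|lborel. G n p * F n p t) = (LINT p|lborel. ((-1) ^ (n mod M) * (l * l * m)) * (Gb (aff (ci n) (dj n) l p) * W (q n) (aff (ci n) (dj n) l p) (m * t)))"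
     by (simp add: F_def G_def T_def mult_ac)
    also have "\<dots> = (-1) ^ (n mod M) * (l * l * m * (l\<^sup>2 * a (n div M)))"
     unfolding integral_mult_right_zero a_def
     using int_aff[of "\<lambda>p. Gb p * W (q n) p (m * t)" l "ci n" "dj n"] l by (simp add: q_def)
    finally show "(LINT p|lborel. G n p * F n p t) = (-1) ^ (n mod M) * (l * l * m * (l\<^sup>2 * a (n div M)))" .
   qed
   also have "\<dots> = (\<Sum>j<M. \<Sum>i<M. (-1) ^ i * (l * l * m * (l\<^sup>2 * a j)))" by (rule sum_grid)
   also have "\<dots> = 0" by (simp add: sum_distrib_right[symmetric] M_def sum_alternating(1))
   finally have "(LINT p|lborel. (\<Sum>n. G n p * F n p t)) = 0" .
   moreover have "(\<Sum>n. G n p) * (\<Sum>n. F n p t) = (\<Sum>n. G n p * F n p t)" for p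
    by (rule disj_suminf_mult[OF disj z(3) z(4)])
   ultimately show ?thesis by simp
  qed
  have FF: "(LINT p|lborel. (\<Sum>n. F n p t)\<^sup>2) = (real M)\<^sup>2 / 2 * l\<^sup>2 *
     ((LINT p|lborel. (W False p (m * t))\<^sup>2) + (LINT p|lborel. (W True p (m * t))\<^sup>2))" for t
  proof -
   define a where "a q = (LINT p|lborel. (W q p (m * t))\<^sup>2)" for q
   have "(\<lambda>n. LINT p|lborel. F n p t * F n p t) sums (LINT p|lborel. (\<Sum>n. F n p t * F n p t))"
   proof (rule integral_disj_sums[OF _ disj _ _ bd])
    fix n p
    show "\<bar>F n p t * F n p t\<bar> \<le> K * K" unfolding abs_mult using K[of n p t] by (intro mult_mono) auto
   qed (use z in auto)
   hence "(LINT p|lborel. (\<Sum>n. F n p t * F n p t)) = (\<Sum>n<M * M. LINT p|lborel. F n p t * F n p t)"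
    by (rule sums_bounded_range) (simp add: F_def)
   also have "\<dots> = (\<Sum>n<M * M. l\<^sup>2 * a (odd (n div M)))"
   proof (rule sum.cong[OF refl])
    fix n assume "n \<in> {..<M * M}"
    hence "(LINT p|lborel. F n p t * F n p t) = (LINT p|lborel. (W (q n) (aff (ci n) (dj n) l p) (m * t))\<^sup>2)"
     by (simp add: F_def T_def power2_eq_square mult_ac flip: power_mult_distrib)
    also have "\<dots> = l\<^sup>2 * a (odd (n div M))"
     unfolding a_def using int_aff[of "\<lambda>p. (W (q n) p (m * t))\<^sup>2" l "ci n" "dj n"] l by (simp add: q_def)
    finally show "(LINT p|lborel. F n p t * F n p t) = l\<^sup>2 * a (odd (n div M))" .
   qed
   also have "\<dots> = (\<Sum>j<M. \<Sum>i<M. l\<^sup>2 * a (odd j))" by (rule sum_grid[of "\<lambda>j i. l\<^sup>2 * a (odd j)"])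
   also have "\<dots> = real M * l\<^sup>2 * (\<Sum>j<2 * N. a (odd j))" by (simp add: sum_distrib_left[symmetric] M_def mult_ac)
   also have "\<dots> = real M * l\<^sup>2 * (real N * (a False + a True))" by (simp only: sum_alternating(2))
   also have "\<dots> = (real M)\<^sup>2 / 2 * l\<^sup>2 * (a False + a True)" by (simp add: M_def power2_eq_square)
   finally have "(LINT p|lborel. (\<Sum>n. F n p t * F n p t)) = (real M)\<^sup>2 / 2 * l\<^sup>2 * (a False + a True)" .
   moreover have "(\<Sum>n. F n p t)\<^sup>2 = (\<Sum>n. F n p t * F n p t)" for p
    unfolding power2_eq_square by (rule disj_suminf_mult[OF disj z(4) z(4)])
   ultimately show ?thesis unfolding a_def by simp
  qed
  have bnd: "\<bar>\<Sum>n. V1 n p\<bar> \<le> 2 * (l * m) \<and> \<bar>\<Sum>n. V2 n p\<bar> \<le> 2 * (l * m) \<and> \<bar>\<Sum>n. G n p\<bar> \<le> 6 * (l * l * m) \<and> (\<Sum>n. F n p t)\<^sup>2 \<le> L" for p t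
  proof (intro conjI)
   show "\<bar>\<Sum>n. V1 n p\<bar> \<le> 2 * (l * m)" by (rule disj_suminf_bound(1)[of S V1, OF disj z(1) b(1)])
   show "\<bar>\<Sum>n. V2 n p\<bar> \<le> 2 * (l * m)" by (rule disj_suminf_bound(1)[of S V2, OF disj z(2) b(2)])
   show "\<bar>\<Sum>n. G n p\<bar> \<le> 6 * (l * l * m)" by (rule disj_suminf_bound(1)[of S G, OF disj z(3) b(3)])
   have "\<bar>\<Sum>n. F n p t\<bar> \<le> sqrt L" by (rule disj_suminf_bound(1)[of S "\<lambda>n p. F n p t", OF disj z(4) Fb])
   thus "(\<Sum>n. F n p t)\<^sup>2 \<le> L" by (rule sqrt_ge_absD)
  qed
  show ?thesis
   by (intro exI[of _ "\<lambda>p. \<Sum>n. V1 n p"] exI[of _ "\<lambda>p. \<Sum>n. V2 n p"] exI[of _ "\<lambda>p t. \<Sum>n. F n p t"] exI[of _ "\<lambda>p. \<Sum>n. G n p"]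
     conjI allI wave energyV line GF FF bnd[THEN conjunct1] bnd[THEN conjunct2, THEN conjunct1]
     bnd[THEN conjunct2, THEN conjunct2, THEN conjunct1] bnd[THEN conjunct2, THEN conjunct2, THEN conjunct2])
qed

section \<open>A block with almost the prescribed profile\<close>

lemma antiderivative_exists:
  fixes rh :: "real \<Rightarrow> real"
  assumes "cont rh"
  obtains S where "\<And>t. (S has_real_derivative rh t) (at t)"
proof -
  have "\<exists>F. \<forall>x :: real. -\<infinity> < ereal x \<longrightarrow> ereal x < \<infinity> \<longrightarrow> (F has_vector_derivative rh x) (at x)"
   by (rule einterval_antiderivative) (use assms in \<open>auto simp: continuous_on_eq_continuous_at\<close>)
  then obtain F where "\<And>x. (F has_vector_derivative rh x) (at x)" by auto
  thus thesis by (intro that[of F]) (simp add: has_real_derivative_iff_has_vector_derivative)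
qed

text \<open>The density at time t depends on the profile at the retarded times
  \<open>t - tau p / m\<close>, which can leave \<open>{0..T}\<close>; therefore the profile is
  extended by constants.\<close>

definition clamp_to :: "real \<Rightarrow> (real \<Rightarrow> real) \<Rightarrow> real \<Rightarrow> real" where
  "clamp_to T g t = g (max 0 (min T t))"

lemma clamp_to:
  assumes "0 \<le> T" "continuous_on {0..T} g"
  shows "cont (clamp_to T g)" "t \<in> {0..T} \<Longrightarrow> clamp_to T g t = g t"
   "\<And>e. 0 < e \<Longrightarrow> \<exists>et>0. \<forall>x y. \<bar>x - y\<bar> < et \<longrightarrow> \<bar>clamp_to T g x - clamp_to T g y\<bar> < e"
   "\<exists>s\<in>{0..T}. clamp_to T g t = g s"
proof -
  show "cont (clamp_to T g)"
   unfolding clamp_to_def[abs_def] using assms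
   by (intro continuous_on_compose2[OF assms(2)] continuous_intros) auto
  show "t \<in> {0..T} \<Longrightarrow> clamp_to T g t = g t" by (simp add: clamp_to_def)
  show "\<exists>s\<in>{0..T}. clamp_to T g t = g s" unfolding clamp_to_def using assms(1) by (intro bexI[of _ "max 0 (min T t)"]) auto
  fix e :: real assume e: "0 < e"
  have "uniformly_continuous_on {0..T} g" using assms(2) by (rule compact_uniformly_continuous) simp
  then obtain et where et: "0 < et" "\<And>x y. x \<in> {0..T} \<Longrightarrow> y \<in> {0..T} \<Longrightarrow> dist y x < et \<Longrightarrow> dist (g y) (g x) < e"
   unfolding uniformly_continuous_on_def using e by auto
  show "\<exists>et>0. \<forall>x y. \<bar>x - y\<bar> < et \<longrightarrow> \<bar>clamp_to T g x - clamp_to T g y\<bar> < e"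
  proof (intro exI[of _ et] conjI allI impI)
   fix x y :: real assume xy: "\<bar>x - y\<bar> < et"
   have "\<bar>max 0 (min T x) - max 0 (min T y)\<bar> \<le> \<bar>x - y\<bar>" by (auto simp: max_def min_def)
   thus "\<bar>clamp_to T g x - clamp_to T g y\<bar> < e"
    using et(2)[of "max 0 (min T y)" "max 0 (min T x)"] xy assms(1) by (simp add: clamp_to_def dist_real_def)
  qed (rule et(1))
qed

lemma Nset_avg:
  fixes f :: "plane \<Rightarrow> real"
  assumes [measurable]: "f \<in> Bor" and f: "\<And>p. p \<in> Nset \<Longrightarrow> \<bar>f p - v\<bar> \<le> om"
  shows "\<bar>(LINT p:Nset|lborel. f p) - AN * v\<bar> \<le> AN * om"
proof -
  have bN: "bounded Nset" by (rule bounded_subset[OF _ Nset_sub]) (intro bounded_Times bounded_closed_interval)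
  have ic: "set_integrable lborel Nset (\<lambda>_. a)" for a :: real
   unfolding set_integrable_def
   by (rule integrable_bdd[OF _ _ bN, where K="\<bar>a\<bar>"]) (auto simp: indicator_def)
  have ifv: "set_integrable lborel Nset (\<lambda>p. f p - v)"
   unfolding set_integrable_def
  proof (rule integrable_bdd[OF _ _ bN, where K="\<bar>om\<bar>"])
   show "\<bar>ind Nset p *\<^sub>R (f p - v)\<bar> \<le> \<bar>om\<bar>" for p using f[of p] by (auto simp: indicator_def)
  qed auto
  have vi: "(LINT p:Nset|lborel. a) = AN * a" for a by (simp add: set_int_def AN_def)
  have "(LINT p:Nset|lborel. f p) = (LINT p:Nset|lborel. (f p - v) + v)" by simp
  also have "\<dots> = (LINT p:Nset|lborel. f p - v) + AN * v" by (subst set_integral_add(2)[OF ifv ic]) (simp add: vi)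
  finally have "\<bar>(LINT p:Nset|lborel. f p) - AN * v\<bar> = \<bar>LINT p:Nset|lborel. f p - v\<bar>" by simp
  also have "\<dots> \<le> (LINT p:Nset|lborel. om)"
   unfolding set_int_def
  proof (rule integral_abs_bound[THEN order_trans], rule integral_mono)
   show "integrable lborel (\<lambda>p. \<bar>ind Nset p *\<^sub>R (f p - v)\<bar>)" using ifv unfolding set_integrable_def by (rule integrable_abs)
   show "integrable lborel (\<lambda>p. ind Nset p *\<^sub>R om)" using ic unfolding set_integrable_def .
   show "\<bar>ind Nset p *\<^sub>R (f p - v)\<bar> \<le> ind Nset p *\<^sub>R om" for p using f[of p] by (auto simp: indicator_def)
  qed
  finally show ?thesis unfolding vi .
qed

abbreviation osq :: "real \<Rightarrow> real \<Rightarrow> real \<Rightarrow> plane set" where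
  "osq c d w \<equiv> {c<..<c + w} \<times> {d<..<d + w}"

text \<open>The form is dictated by the superposition in \<open>profile_exists\<close>: the bounds
  on the flow do not grow as the width w shrinks, and the bound on F involves
  \<open>gm / w\<^sup>2\<close>, so it stays under control if the profiles decrease at least as fast
  as the areas.\<close>

definition block_ok :: "real \<Rightarrow> real \<Rightarrow> real \<Rightarrow> real \<Rightarrow> real \<Rightarrow> (real \<Rightarrow> real) \<Rightarrow>
   (plane \<Rightarrow> real) \<times> (plane \<Rightarrow> real) \<times> (plane \<Rightarrow> real \<Rightarrow> real) \<times> (plane \<Rightarrow> real) \<Rightarrow> bool" where
  "block_ok c d w e T g X \<longleftrightarrow> (case X of (V1, V2, F, G) \<Rightarrow>
   wave (osq c d w) V1 V2 F G \<and> (LINT p|lborel. (V1 p)\<^sup>2 + (V2 p)\<^sup>2) = e\<^sup>2 * w\<^sup>2 \<and>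
   (\<forall>p. \<bar>V1 p\<bar> \<le> 32 * e / sqrt EV \<and> \<bar>V2 p\<bar> \<le> 32 * e / sqrt EV \<and> \<bar>G p\<bar> \<le> 96 * w * e / sqrt EV) \<and>
   (\<forall>gm. (\<forall>t\<in>{0..T}. g t \<le> gm) \<longrightarrow> (\<forall>p t. (F p t)\<^sup>2 \<le> 448 * gm / (w\<^sup>2 * AN))) \<and>
   (\<forall>y t. (LBINT x. F (x, y) t) = 0) \<and> (\<forall>t. (LINT p|lborel. G p * F p t) = 0) \<and>
   continuous_on {0..T} (\<lambda>t. LINT p|lborel. (F p t)\<^sup>2) \<and>
   (\<forall>t\<in>{0..T}. 13 / 16 * g t \<le> (LINT p|lborel. (F p t)\<^sup>2) \<and> (LINT p|lborel. (F p t)\<^sup>2) \<le> 15 / 16 * g t))"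

text \<open>In a fine grid with fixed velocity scale the travel times are short, so the integral of
  \<open>F\<^sup>2\<close> at time t is 7/8 of \<open>g t\<close> up to two errors: the variation of
  g during the travel time and the energy on the dusts. Each is at most 1/32 of the minimum of g,
  which yields the factors 13/16 and 15/16.\<close>

lemma block_exists:
  fixes g :: "real \<Rightarrow> real" and c d w e T :: real
  assumes w: "0 < w" and e: "0 < e" and T: "0 \<le> T" and g: "continuous_on {0..T} g" "\<And>t. t \<in> {0..T} \<Longrightarrow> 0 < g t"
  shows "\<exists>X. block_ok c d w e T g X"
proof -
  have ne: "{0..T} \<noteq> {}" using T by simp
  obtain a where a: "a \<in> {0..T}" "\<And>t. t \<in> {0..T} \<Longrightarrow> g a \<le> g t"
   using continuous_attains_inf[OF compact_Icc ne g(1)] by blast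
  obtain b where b: "b \<in> {0..T}" "\<And>t. t \<in> {0..T} \<Longrightarrow> g t \<le> g b"
   using continuous_attains_sup[OF compact_Icc ne g(1)] by blast
  define gc where "gc = clamp_to T g"
  note gc = clamp_to[OF T g(1), folded gc_def]
  have gcb: "g a \<le> gc t" "gc t \<le> g b" for t
   using gc(4)[of t] a b by auto
  have ga: "0 < g a" using g(2) a(1) by blast
  \<comment> \<open>448 is 7/8 of 512: the grid contributes the factor
    \<open>w\<^sup>2 / 512\<close>, so this amplitude aims at the energy
    \<open>7 / 8 * g\<close>.\<close>
  define k where "k = 448 / (w\<^sup>2 * AN)"
  have k: "0 < k" using w AN_pos by (simp add: k_def)
  define rh where "rh t = sqrt (k * gc t)" for t
  have rh2: "(rh t)\<^sup>2 = k * gc t" for t using k ga gcb(1)[of t] unfolding rh_def by simp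
  define L where "L = k * g b"
  have Lrh: "(rh t)\<^sup>2 \<le> L" for t unfolding rh2 L_def using k gcb(2)[of t] by simp
  have crh: "cont rh" unfolding rh_def[abs_def] by (intro continuous_intros gc(1))
  have rhb: "\<bar>rh t\<bar> \<le> sqrt L" for t using real_sqrt_le_mono[OF Lrh[of t]] by simp
  obtain S where S: "\<And>t. (S has_real_derivative rh t) (at t)" using antiderivative_exists[OF crh] by blast
  obtain et where et: "0 < et" "\<And>x y. \<bar>x - y\<bar> < et \<Longrightarrow> \<bar>gc x - gc y\<bar> < g a / 32"
   using gc(3)[of "g a / 32"] ga by auto
  \<comment> \<open>Velocity scale. The grid multiplies the flow energy of the unit cell by
    \<open>w\<^sup>2 / 256\<close> times the square of this scale; the 16 compensates the
    256.\<close>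
  define ep where "ep = 16 * e / sqrt EV"
  have ep: "0 < ep" using e EV_pos by (simp add: ep_def)
  \<comment> \<open>With \<open>l * m = ep\<close> fixed, a finer grid means larger m. N makes the
    longest travel time \<open>6 / m\<close> smaller than the modulus of continuity et of the
    profile.\<close>
  obtain N :: nat where N: "6 * w / (32 * ep * et) < real N" using reals_Archimedean2 by blast
  have "0 < 6 * w / (32 * ep * et)" using w ep et(1) by simp
  hence N0: "0 < N" using N by linarith
  define l where "l = w / (16 * real (2 * N))"
  define m where "m = ep / l"
  have l: "0 < l" using w N0 by (simp add: l_def)
  have m: "0 < m" using l ep by (simp add: m_def)
  have lm: "l * m = ep" using l by (simp add: m_def)
  have side: "16 * l * real (2 * N) = w" using N0 by (simp add: l_def)
  have ml: "6 / m < et"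
  proof -
   have "m = 32 * ep * real N / w" using w N0 by (simp add: m_def l_def field_simps)
   moreover have "6 * w < real N * (32 * ep * et)" using N ep et(1) by (simp add: pos_divide_less_eq mult_ac)
   ultimately have "6 * w < (et * m) * w" using w by (simp add: mult_ac)
   hence "6 < et * m" using w by simp
   thus ?thesis using m by (simp add: pos_divide_less_eq)
  qed
  \<comment> \<open>The square of the amplitude on the dusts. The first bound keeps it below that of
    the travelling part, the second makes the energy on the dusts at most \<open>g a / 32\<close>;
    \<open>AK + 1\<close> avoids a division by zero.\<close>
  define Q where "Q = min (k * g a) (g a / 32 * 512 / (w\<^sup>2 * (AK + 1)))"
  have AK0: "0 \<le> AK" by (simp add: AK_def)
  have Q: "0 < Q" using k ga w AK0 by (simp add: Q_def)
  define de where "de = sqrt Q / m"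
  have de: "0 < de" using Q m by (simp add: de_def)
  have md: "(m * de)\<^sup>2 = Q" using m Q by (simp add: de_def)
  define W where "W q = Fb (osr rh S de m q) (osR S de m q)" for q
  have wW: "wave sq8 Vb1 Vb2 (W q) Gb" for q
   unfolding W_def by (rule os_wave[OF crh rhb S de m])
  have cos_sin: "(x * cos z)\<^sup>2 \<le> x\<^sup>2" "(x * sin z)\<^sup>2 \<le> x\<^sup>2" for x z :: real
  proof -
   have "(cos z)\<^sup>2 \<le> 1" "(sin z)\<^sup>2 \<le> 1" using sin_cos_squared_add[of z] zero_le_power2[of "sin z"] zero_le_power2[of "cos z"] by linarith+
   thus "(x * cos z)\<^sup>2 \<le> x\<^sup>2" "(x * sin z)\<^sup>2 \<le> x\<^sup>2"
    unfolding power_mult_distrib using mult_left_mono[of _ 1 "x\<^sup>2"] by simp_all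
  qed
  have WL: "(W q p t)\<^sup>2 \<le> L" for q p t
  proof -
   have 1: "(osr rh S de m q u)\<^sup>2 \<le> L" for u
    using cos_sin(1)[of "rh (u / m)" "S (u / m) / de"] cos_sin(2)[of "- rh (u / m)" "S (u / m) / de"] Lrh[of "u / m"] by (auto simp: osr_def)
   have "Q \<le> k * g a" by (simp add: Q_def)
   also have "\<dots> \<le> L" unfolding L_def using k a(2)[OF b(1)] by simp
   finally have 2: "(osR S de m q u)\<^sup>2 \<le> L" for u
    using cos_sin(1)[of "m * de" "S (u / m) / de"] cos_sin(2)[of "m * de" "S (u / m) / de"] md by (auto simp: osR_def)
   have "0 \<le> L" using Lrh[of 0] by (rule order_trans[rotated]) simp
   moreover have "Nset \<inter> (LR \<union> UL) = {}" using LR_UL_sub by (auto simp: Nset_def)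
   ultimately show ?thesis unfolding W_def Fb_sq using 1[of "t - tau p"] 2[of "t - tau p"] by (auto simp: indicator_def)
  qed
  obtain V1 V2 F G where X: "wave (osq c d w) V1 V2 F G"
   "(LINT p|lborel. (V1 p)\<^sup>2 + (V2 p)\<^sup>2) = (real (2 * N))\<^sup>2 * (l * m)\<^sup>2 * l\<^sup>2 * EV"
   "\<And>p t. \<bar>V1 p\<bar> \<le> 2 * (l * m) \<and> \<bar>V2 p\<bar> \<le> 2 * (l * m) \<and> \<bar>G p\<bar> \<le> 6 * (l * l * m) \<and> (F p t)\<^sup>2 \<le> L"
   "\<And>y t. (LBINT x. F (x, y) t) = 0" "\<And>t. (LINT p|lborel. G p * F p t) = 0"
   "\<And>t. (LINT p|lborel. (F p t)\<^sup>2) = (real (2 * N))\<^sup>2 / 2 * l\<^sup>2 *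
     ((LINT p|lborel. (W False p (m * t))\<^sup>2) + (LINT p|lborel. (W True p (m * t))\<^sup>2))"
   using wave_grid[where W=W, OF wW WL N0 l m, of c d] unfolding side by auto
  have lN: "(real (2 * N))\<^sup>2 * l\<^sup>2 = w\<^sup>2 / 256"
  proof -
   have "(16 * l * real (2 * N))\<^sup>2 = w\<^sup>2" by (simp only: side)
   thus ?thesis by (simp add: power_mult_distrib mult_ac)
  qed
  have V: "(LINT p|lborel. (V1 p)\<^sup>2 + (V2 p)\<^sup>2) = e\<^sup>2 * w\<^sup>2"
  proof -
   have "(real (2 * N))\<^sup>2 * (l * m)\<^sup>2 * l\<^sup>2 * EV = ((real (2 * N))\<^sup>2 * l\<^sup>2) * (ep\<^sup>2 * EV)" unfolding lm by simp
   also have "ep\<^sup>2 * EV = 256 * e\<^sup>2" using EV_pos by (simp add: ep_def power_divide power_mult_distrib)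
   finally show ?thesis unfolding X(2) lN by simp
  qed
  have lw: "l \<le> w"
  proof -
   have "l * 1 \<le> l * (16 * real (2 * N))" using l N0 by (intro mult_left_mono) auto
   thus ?thesis using side by (simp add: mult_ac)
  qed
  have Gb: "6 * (l * l * m) \<le> 96 * w * e / sqrt EV"
  proof -
   have "l * ep \<le> w * ep" using lw ep by simp
   thus ?thesis using lm by (simp add: ep_def mult.assoc)
  qed
  have meas [measurable]: "rh \<in> Bor" "S \<in> Bor" "gc \<in> Bor"
   by (rule Bor_contI[OF crh] Bor_contI[OF DERIV_continuous_on[OF S]] Bor_contI[OF gc(1)])+
  define I where "I t = (LINT p:Nset|lborel. gc (t - tau p / m))" for t
  have E: "(LINT p|lborel. (F p t)\<^sup>2) = 7 / (8 * AN) * I t + w\<^sup>2 / 512 * Q * AK" for t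
  proof -
   have "(LINT p|lborel. (F p t)\<^sup>2) = (w\<^sup>2 / 512) * ((LINT p:Nset|lborel. (rh (t - tau p / m))\<^sup>2) + (m * de)\<^sup>2 * AK)"
    unfolding X(6) W_def os_energy[OF meas(1,2) rhb de m] using lN by simp
   also have "(LINT p:Nset|lborel. (rh (t - tau p / m))\<^sup>2) = k * I t"
    unfolding rh2 I_def by simp
   finally have "(LINT p|lborel. (F p t)\<^sup>2) = w\<^sup>2 / 512 * k * I t + w\<^sup>2 / 512 * Q * AK"
    unfolding md by (simp only: distrib_left mult.assoc)
   moreover have "w\<^sup>2 / 512 * k = 7 / (8 * AN)" using w AN_pos by (simp add: k_def)
   ultimately show ?thesis by simp
  qed
  have It: "\<bar>I t - AN * gc t\<bar> \<le> AN * (g a / 32)" for t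
   unfolding I_def
  proof (rule Nset_avg)
   fix p assume "p \<in> Nset"
   hence "tau p \<in> {-6..6}" using Nset_sub tau_bound by blast
   hence "\<bar>tau p\<bar> / m \<le> 6 / m" using m by (intro divide_right_mono) auto
   hence "\<bar>(t - tau p / m) - t\<bar> < et" using ml m by simp
   thus "\<bar>gc (t - tau p / m) - gc t\<bar> \<le> g a / 32" using et(2) by (simp add: less_imp_le)
  qed measurable
  have Q2: "0 \<le> w\<^sup>2 / 512 * Q * AK" "w\<^sup>2 / 512 * Q * AK \<le> g a / 32"
  proof -
   show "0 \<le> w\<^sup>2 / 512 * Q * AK" using Q AK0 by simp
   have "Q \<le> g a / 32 * 512 / (w\<^sup>2 * (AK + 1))" by (simp add: Q_def)
   hence "Q * (w\<^sup>2 * (AK + 1)) \<le> g a / 32 * 512" using w AK0 by (simp add: pos_le_divide_eq)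
   moreover have "Q * (w\<^sup>2 * AK) \<le> Q * (w\<^sup>2 * (AK + 1))" using Q by (intro mult_left_mono) auto
   ultimately show "w\<^sup>2 / 512 * Q * AK \<le> g a / 32" by (simp add: mult_ac)
  qed
  have bounds: "13 / 16 * g t \<le> (LINT p|lborel. (F p t)\<^sup>2) \<and> (LINT p|lborel. (F p t)\<^sup>2) \<le> 15 / 16 * g t" if t: "t \<in> {0..T}" for t
  proof -
   have gt: "gc t = g t" by (rule gc(2)[OF t])
   have "\<bar>7 / (8 * AN) * (I t - AN * g t)\<bar> \<le> 7 / (8 * AN) * (AN * (g a / 32))"
    unfolding abs_mult using It[of t] AN_pos gt by (intro mult_mono) auto
   hence "\<bar>7 / (8 * AN) * I t - 7 / 8 * g t\<bar> \<le> 7 / 8 * (g a / 32)"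
    using AN_pos by (simp add: right_diff_distrib)
   thus ?thesis unfolding E using Q2 a(2)[OF t] ga by linarith
  qed
  have cI: "continuous_on {0..T} I"
   unfolding continuous_on_sequentially
  proof (intro allI ballI impI, elim conjE)
   fix x :: "nat \<Rightarrow> real" and t assume x: "x \<longlonglongrightarrow> t"
   have bN: "bounded Nset" by (rule bounded_subset[OF _ Nset_sub]) (intro bounded_Times bounded_closed_interval)
   have "(\<lambda>n. LINT p:Nset|lborel. gc (x n - tau p / m)) \<longlonglongrightarrow> (LINT p:Nset|lborel. gc (t - tau p / m))"
   proof (rule dct_bdd[OF _ _ _ bN, where K="g b"])
    show "\<bar>gc (x n - tau p / m)\<bar> \<le> g b" for n p using gcb[of "x n - tau p / m"] ga by linarith
    show "(\<lambda>n. gc (x n - tau p / m)) \<longlonglongrightarrow> gc (t - tau p / m)" for p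
     using gc(1) by (intro isCont_tendsto_compose[of _ gc] tendsto_intros x) (simp add: continuous_on_eq_continuous_at)
   qed measurable
   thus "(I \<circ> x) \<longlonglongrightarrow> I t" by (simp add: I_def comp_def)
  qed
  have cE: "continuous_on {0..T} (\<lambda>t. LINT p|lborel. (F p t)\<^sup>2)"
   unfolding E by (intro continuous_intros cI)
  have Fm: "(F p t)\<^sup>2 \<le> 448 * gm / (w\<^sup>2 * AN)" if "\<forall>t\<in>{0..T}. g t \<le> gm" for gm p t
  proof -
   have "g b \<le> gm" using that b(1) by blast
   hence "L \<le> k * gm" unfolding L_def using k by simp
   thus ?thesis using X(3)[of p t] by (simp add: k_def)
  qed
  have Vb: "\<bar>V1 p\<bar> \<le> 32 * e / sqrt EV \<and> \<bar>V2 p\<bar> \<le> 32 * e / sqrt EV \<and> \<bar>G p\<bar> \<le> 96 * w * e / sqrt EV" for p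
   using X(3)[of p 0] Gb unfolding lm by (simp add: ep_def)
  show ?thesis unfolding block_ok_def
   by (rule exI[of _ "(V1, V2, F, G)"]) (use X(1) V Vb Fm X(4,5) cE bounds in auto)
qed

text \<open>A block takes between 13/16 and 15/16 of the prescribed profile; the remainder is again a positive
  continuous profile and is given to the next, smaller block.\<close>

lemma profile_exists:
  fixes g :: "real \<Rightarrow> real" and c d \<nu> T :: real
  assumes T: "0 \<le> T" and g: "continuous_on {0..T} g" "\<And>t. t \<in> {0..T} \<Longrightarrow> 0 < g t" and \<nu>: "0 < \<nu>"
  shows "\<exists>V1 V2 F G. wave (osq c d (1/2)) V1 V2 F G \<and> (LINT p|lborel. (V1 p)\<^sup>2 + (V2 p)\<^sup>2) = \<nu> \<and>
   (\<forall>y t. (LBINT x. F (x, y) t) = 0) \<and> (\<forall>t. (LINT p|lborel. G p * F p t) = 0) \<and>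
   (\<forall>t\<in>{0..T}. (LINT p|lborel. (F p t)\<^sup>2) = g t)"
proof -
  \<comment> \<open>The areas of the squares are \<open>(1/4) ^ n / 16\<close> and sum to 1/12, and
    block n has flow energy \<open>e\<^sup>2 * (wd n)\<^sup>2\<close>.\<close>
  define e where "e = sqrt (12 * \<nu>)"
  have e: "0 < e" using \<nu> by (simp add: e_def)
  define wd where "wd n = (1/2 :: real) ^ (n + 2)" for n :: nat
  have wd: "0 < wd n" "wd n \<le> 1/4" for n by (simp_all add: wd_def power_le_one)
  define good where "good h \<longleftrightarrow> continuous_on {0..T} h \<and> (\<forall>t\<in>{0..T}. 0 < h t)" for h :: "real \<Rightarrow> real"
  \<comment> \<open>A choice function of the remaining profile h, since block n can be picked only
    when the previous blocks are known.\<close>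
  define X where "X n h = (SOME X. block_ok (c + wd n) d (wd n) e T h X)" for n h
  have X: "block_ok (c + wd n) d (wd n) e T h (X n h)" if "good h" for n h
   using someI_ex[OF block_exists[OF wd(1)[of n] e T, of h "c + wd n" d]] that unfolding X_def good_def by blast
  define En where "En n h t = (LINT p|lborel. (fst (snd (snd (X n h))) p t)\<^sup>2)" for n h t
  define gs where "gs = rec_nat g (\<lambda>n h t. h t - En n h t)"
  have gs: "gs 0 = g" "gs (Suc n) t = gs n t - En n (gs n) t" for n t by (simp_all add: gs_def)
  have En: "continuous_on {0..T} (En n h)" "t \<in> {0..T} \<Longrightarrow> 13 / 16 * h t \<le> En n h t \<and> En n h t \<le> 15 / 16 * h t" if "good h" for n h t
   using X[OF that, of n] unfolding block_ok_def En_def by (auto split: prod.splits)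
  have good: "good (gs n)" for n
  proof (induction n)
   case 0 thus ?case using g by (simp add: gs good_def)
  next
   case (Suc n)
   have "gs (Suc n) = (\<lambda>t. gs n t - En n (gs n) t)" using gs(2) by blast
   moreover have "continuous_on {0..T} (\<lambda>t. gs n t - En n (gs n) t)"
    using Suc En(1)[OF Suc] by (intro continuous_on_diff) (auto simp: good_def)
   moreover have "0 < gs n t - En n (gs n) t" if "t \<in> {0..T}" for t
    using En(2)[OF Suc that, of n] Suc that unfolding good_def by force
   ultimately show ?case by (simp add: good_def)
  qed
  have "{0..T} \<noteq> {}" using T by simp
  then obtain b where b: "b \<in> {0..T}" "\<And>t. t \<in> {0..T} \<Longrightarrow> g t \<le> g b"
   using continuous_attains_sup[OF compact_Icc _ g(1)] by blast
  have gb: "0 < g b" using g(2) b(1) by blast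
  have dec: "gs n t \<le> (3/16) ^ n * g b" if t: "t \<in> {0..T}" for n t
  proof (induction n)
   case 0 thus ?case using b(2)[OF t] by (simp add: gs)
  next
   case (Suc n)
   have "gs (Suc n) t \<le> 3 / 16 * gs n t" using En(2)[OF good t, of n n] by (simp add: gs)
   thus ?case using Suc by simp
  qed
  define V1 where "V1 n = fst (X n (gs n))" for n
  define V2 where "V2 n = fst (snd (X n (gs n)))" for n
  define F where "F n = fst (snd (snd (X n (gs n))))" for n
  define G where "G n = snd (snd (snd (X n (gs n))))" for n
  \<comment> \<open>Dyadic squares side by side: in x the n-th one occupies the interval from
    \<open>c + wd n\<close> to \<open>c + 2 * wd n\<close>.\<close>
  define S where "S n = osq (c + wd n) d (wd n)" for n
  have ok: "block_ok (c + wd n) d (wd n) e T (gs n) (V1 n, V2 n, F n, G n)" for n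
   using X[OF good, of n n] by (simp add: V1_def V2_def F_def G_def)
  have okw: "wave (S n) (V1 n) (V2 n) (F n) (G n)" "(LINT p|lborel. (V1 n p)\<^sup>2 + (V2 n p)\<^sup>2) = e\<^sup>2 * (wd n)\<^sup>2"
   "\<bar>V1 n p\<bar> \<le> 32 * e / sqrt EV" "\<bar>V2 n p\<bar> \<le> 32 * e / sqrt EV" "\<bar>G n p\<bar> \<le> 96 * wd n * e / sqrt EV"
   "(\<forall>t\<in>{0..T}. gs n t \<le> gm) \<Longrightarrow> (F n p t)\<^sup>2 \<le> 448 * gm / ((wd n)\<^sup>2 * AN)"
   "(LBINT x. F n (x, y) t) = 0" "(LINT p|lborel. G n p * F n p t) = 0" for n p t gm y
   using ok[of n] unfolding block_ok_def S_def by blast+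
  \<comment> \<open>7168 is 448 * 16. The remainders shrink by 3/16 per step, the areas only by 1/4,
    so the quotient that bounds \<open>F\<^sup>2\<close> shrinks as well. This is why each block has
    to take at least 3/4 of its profile.\<close>
  define L where "L = 7168 * g b / AN"
  have L: "0 < L" using gb AN_pos by (simp add: L_def)
  have FL: "(F n p t)\<^sup>2 \<le> L" for n p t
  proof -
   have "(F n p t)\<^sup>2 \<le> 448 * ((3/16) ^ n * g b) / ((wd n)\<^sup>2 * AN)" by (rule okw(6)) (use dec in blast)
   also have "\<dots> = L * (3/4) ^ n"
   proof -
    have "(wd n)\<^sup>2 = (1/4) ^ n / 16" unfolding wd_def by (simp add: power_add power_mult_distrib power_divide flip: power_mult) (simp add: power_mult mult.commute[of n])
    moreover have "(3/16 :: real) ^ n = (3/4) ^ n * (1/4) ^ n" by (simp flip: power_mult_distrib)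
    ultimately have "448 * ((3/16) ^ n * g b) / ((wd n)\<^sup>2 * AN) = 448 * ((3/4) ^ n * (1/4) ^ n * g b) / ((1/4) ^ n / 16 * AN)" by (simp only:)
    also have "\<dots> = L * (3/4) ^ n" using AN_pos by (simp add: L_def divide_simps)
    finally show ?thesis .
   qed
   also have "\<dots> \<le> L * 1" using L by (intro mult_left_mono) (auto simp: power_le_one)
   finally show ?thesis by simp
  qed
  have Fs: "\<bar>F n p t\<bar> \<le> sqrt L" for n p t using real_sqrt_le_mono[OF FL[of n p t]] by simp
  define K where "K = 96 * e / sqrt EV + sqrt L"
  have K0: "0 \<le> e / sqrt EV" "0 \<le> sqrt L" using e EV_pos L by simp_all
  have K: "\<bar>V1 n p\<bar> \<le> K \<and> \<bar>V2 n p\<bar> \<le> K \<and> \<bar>G n p\<bar> \<le> K \<and> \<bar>F n p t\<bar> \<le> K" for n p t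
  proof -
   have "96 * wd n * e / sqrt EV \<le> 96 * e / sqrt EV"
   proof -
    have "wd n * (e / sqrt EV) \<le> 1 * (e / sqrt EV)" using wd(2)[of n] K0 by (intro mult_right_mono) auto
    thus ?thesis by simp
   qed
   moreover have "32 * e / sqrt EV \<le> 96 * e / sqrt EV" using K0(1) by simp
   ultimately show ?thesis using okw(3-5)[of n p] Fs[of n p t] K0 unfolding K_def by linarith
  qed
  have disj: "disjoint_family S"
  proof (unfold disjoint_family_on_def, intro ballI impI)
   have lt: "S n \<inter> S k = {}" if "n < k" for n k
   proof -
    have "wd k \<le> (1/2) ^ (n + 3)" unfolding wd_def using that by (intro power_decreasing) auto
    hence "2 * wd k \<le> wd n" by (simp add: wd_def power_add power3_eq_cube power2_eq_square)
    thus ?thesis unfolding S_def by auto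
   qed
   fix n k :: nat assume "n \<noteq> k"
   then consider "n < k" | "k < n" by linarith
   thus "S n \<inter> S k = {}" using lt[of n k] lt[of k n] by cases auto
  qed
  have sub: "(\<Union>n. S n) \<subseteq> osq c d (1/2)"
  proof
   fix p assume "p \<in> (\<Union>n. S n)"
   then obtain n where "p \<in> S n" by blast
   thus "p \<in> osq c d (1/2)" unfolding S_def mem_Times_iff using wd[of n] by auto
  qed
  have Sq: "osq c d (1/2) \<in> sets borel" "bounded (osq c d (1/2))"
   by (intro borel_open open_Times open_greaterThanLessThan) (intro bounded_Times; simp)
  have bd: "bounded (\<Union>n. S n)" by (rule bounded_subset[OF Sq(2) sub])
  have z: "p \<notin> S n \<Longrightarrow> V1 n p = 0" "p \<notin> S n \<Longrightarrow> V2 n p = 0" "p \<notin> S n \<Longrightarrow> G n p = 0" "p \<notin> S n \<Longrightarrow> F n p t = 0" for n p t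
   using wave_props(8-11)[OF okw(1)[of n]] by blast+
  have mV [measurable]: "V1 n \<in> Bor" "V2 n \<in> Bor" "G n \<in> Bor" "(\<lambda>p. F n p t) \<in> Bor" for n t
   using wave_props(3,4,5,7)[OF okw(1)[of n]] by blast+
  have wv: "wave (osq c d (1/2)) (\<lambda>p. \<Sum>n. V1 n p) (\<lambda>p. \<Sum>n. V2 n p) (\<lambda>p t. \<Sum>n. F n p t) (\<lambda>p. \<Sum>n. G n p)"
   by (rule wave_mono[OF wave_suminf[OF okw(1) disj bd K] sub Sq])
  have mulK: "\<bar>x * y\<bar> \<le> K * K" if "\<bar>x\<bar> \<le> K" "\<bar>y\<bar> \<le> K" for x y
   unfolding abs_mult using that by (intro mult_mono) auto
  have VV: "(LINT p|lborel. (\<Sum>n. V1 n p)\<^sup>2 + (\<Sum>n. V2 n p)\<^sup>2) = \<nu>"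
  proof -
   have "(\<lambda>n. LINT p|lborel. V1 n p * V1 n p + V2 n p * V2 n p) sums (LINT p|lborel. (\<Sum>n. V1 n p * V1 n p + V2 n p * V2 n p))"
   proof (rule integral_disj_sums[OF _ disj _ _ bd])
    show "\<bar>V1 n p * V1 n p + V2 n p * V2 n p\<bar> \<le> K * K + K * K" for n p
     using mulK[of "V1 n p" "V1 n p"] mulK[of "V2 n p" "V2 n p"] K[of n p 0] by linarith
   qed (use z in auto)
   moreover have "(\<Sum>n. V1 n p * V1 n p + V2 n p * V2 n p) = (\<Sum>n. V1 n p)\<^sup>2 + (\<Sum>n. V2 n p)\<^sup>2" for p
   proof (cases "\<exists>n. p \<in> S n")
    case True
    then obtain n where n: "p \<in> S n" ..
    show ?thesis using disj_suminf(1)[of S V1, OF disj z(1) n] disj_suminf(1)[of S V2, OF disj z(2) n]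
     disj_suminf(1)[of S "\<lambda>n p. V1 n p * V1 n p + V2 n p * V2 n p", OF disj _ n] z by (simp add: power2_eq_square)
   next
    case False
    hence "V1 n p = 0" "V2 n p = 0" for n using z by blast+
    thus ?thesis by simp
   qed
   moreover have "(LINT p|lborel. V1 n p * V1 n p + V2 n p * V2 n p) = 12 * \<nu> / 16 * (1/4) ^ n" for n
   proof -
    have "(wd n)\<^sup>2 = (1/4) ^ n / 16" unfolding wd_def by (simp add: power_add power_mult_distrib power_divide flip: power_mult) (simp add: power_mult mult.commute[of n])
    thus ?thesis using okw(2)[of n] \<nu> by (simp add: power2_eq_square[symmetric] e_def)
   qed
   moreover have "(\<lambda>n. 12 * \<nu> / 16 * (1/4) ^ n) sums (12 * \<nu> / 16 * (1 / (1 - 1/4)))"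
    by (intro sums_mult geometric_sums) simp
   ultimately show ?thesis using sums_unique2 by fastforce
  qed
  have line: "(LBINT x. (\<Sum>n. F n (x, y) t)) = 0" for y t
  proof -
   have "(\<lambda>n. LBINT x. F n (x, y) t) sums (LBINT x. (\<Sum>n. F n (x, y) t))"
   proof (rule integral_disj_sums[where S="\<lambda>n. {x. (x, y) \<in> S n}"])
    show "disjoint_family (\<lambda>n. {x. (x, y) \<in> S n})" using disj unfolding disjoint_family_on_def by blast
    have "(\<Union>n. {x. (x, y) \<in> S n}) \<subseteq> fst ` (\<Union>n. S n)" by force
    thus "bounded (\<Union>n. {x. (x, y) \<in> S n})" using bounded_fst[OF bd] bounded_subset by blast
    show "(\<lambda>x. F n (x, y) t) \<in> Bor" for n
     using measurable_compose[OF _ mV(4), of "\<lambda>x. (x, y)" borel] by simp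
   qed (use z Fs in auto)
   thus ?thesis unfolding okw(7) using sums_unique2[OF sums_zero] by simp
  qed
  have GF: "(LINT p|lborel. (\<Sum>n. G n p) * (\<Sum>n. F n p t)) = 0" for t
  proof -
   have "(\<lambda>n. LINT p|lborel. G n p * F n p t) sums (LINT p|lborel. (\<Sum>n. G n p * F n p t))"
   proof (rule integral_disj_sums[OF _ disj _ _ bd])
    show "\<bar>G n p * F n p t\<bar> \<le> K * K" for n p by (rule mulK) (use K in blast)+
   qed (use z in auto)
   moreover have "(\<Sum>n. G n p) * (\<Sum>n. F n p t) = (\<Sum>n. G n p * F n p t)" for p
    by (rule disj_suminf_mult[OF disj z(3) z(4)])
   ultimately show ?thesis unfolding okw(8) using sums_unique2[OF sums_zero] by simp
  qed
  have FF: "(LINT p|lborel. (\<Sum>n. F n p t)\<^sup>2) = g t" if t: "t \<in> {0..T}" for t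
  proof -
   have "(\<lambda>n. LINT p|lborel. F n p t * F n p t) sums (LINT p|lborel. (\<Sum>n. F n p t * F n p t))"
   proof (rule integral_disj_sums[OF _ disj _ _ bd])
    show "\<bar>F n p t * F n p t\<bar> \<le> K * K" for n p by (rule mulK) (use K in blast)+
   qed (use z in auto)
   moreover have "(\<Sum>n. F n p t)\<^sup>2 = (\<Sum>n. F n p t * F n p t)" for p
    unfolding power2_eq_square by (rule disj_suminf_mult[OF disj z(4) z(4)])
   moreover have "(LINT p|lborel. F n p t * F n p t) = gs n t - gs (Suc n) t" for n
    using gs(2)[of n t] unfolding En_def F_def power2_eq_square by linarith
   moreover have "(\<lambda>n. gs n t - gs (Suc n) t) sums (gs 0 t - 0)"
   proof (rule telescope_sums')
    show "(\<lambda>n. gs n t) \<longlonglongrightarrow> 0"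
    proof (rule tendsto_sandwich[OF _ _ tendsto_const])
     have "(\<lambda>n. (3/16) ^ n * g b) \<longlonglongrightarrow> 0 * g b" by (intro tendsto_mult tendsto_const LIMSEQ_realpow_zero) auto
     thus "(\<lambda>n. (3/16) ^ n * g b) \<longlonglongrightarrow> 0" by simp
     show "\<forall>\<^sub>F n in sequentially. 0 \<le> gs n t"
     proof (intro always_eventually allI)
      fix n
      have "0 < gs n t" using good[of n] t unfolding good_def by blast
      thus "0 \<le> gs n t" by simp
     qed
     show "\<forall>\<^sub>F n in sequentially. gs n t \<le> (3/16) ^ n * g b" by (intro always_eventually allI dec[OF t])
    qed
   qed
   ultimately have "(\<lambda>n. gs n t - gs (Suc n) t) sums (LINT p|lborel. (\<Sum>n. F n p t)\<^sup>2)"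
    "(\<lambda>n. gs n t - gs (Suc n) t) sums (gs 0 t - 0)" by simp_all
   from sums_unique2[OF this] show ?thesis by (simp add: gs)
  qed
  show ?thesis
   by (intro exI[of _ "\<lambda>p. \<Sum>n. V1 n p"] exI[of _ "\<lambda>p. \<Sum>n. V2 n p"] exI[of _ "\<lambda>p t. \<Sum>n. F n p t"] exI[of _ "\<lambda>p. \<Sum>n. G n p"]
     conjI allI ballI wv VV line GF FF)
qed

section \<open>From the plane to the torus\<close>

text \<open>The cyclic order i, i + 1, i + 2 of the coordinates lets one formula serve all three
  directions and matches the cyclic form of the curl.\<close>

definition ins :: "3 \<Rightarrow> real \<Rightarrow> plane \<Rightarrow> real^3" where
  "ins i s p = (\<chi> j. if j = i then s else if j = i + 1 then fst p else snd p)"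

lemma cyclic3: "i + 1 \<noteq> i" "i + 2 \<noteq> i" "i + 2 \<noteq> i + 1" "UNIV = {i, i + 1, i + 2}" for i :: 3
proof -
  have ne: "i + 1 \<noteq> i" "i + 2 \<noteq> i" "i + 2 \<noteq> i + 1" by simp_all
  thus "i + 1 \<noteq> i" "i + 2 \<noteq> i" "i + 2 \<noteq> i + 1" .
  have "card {i, i + 1, i + 2} = card (UNIV :: 3 set)" using ne[THEN not_sym] by simp
  thus "UNIV = {i, i + 1, i + 2}" using card_subset_eq[OF finite subset_UNIV] by metis
qed

lemma ins_nth [simp]: "ins i s p $ i = s" "ins i s p $ (i + 1) = fst p" "ins i s p $ (i + 2) = snd p"
  using cyclic3[of i] by (simp_all add: ins_def)

lemma all3: "(\<forall>j. P j) \<longleftrightarrow> P i \<and> P (i + 1) \<and> P (i + 2)" for i :: 3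
proof
  assume *: "P i \<and> P (i + 1) \<and> P (i + 2)"
  show "\<forall>j. P j"
  proof
   fix j :: 3
   have "j \<in> {i, i + 1, i + 2}" using cyclic3(4)[of i] by auto
   thus "P j" using * by auto
  qed
qed simp

lemma ins_continuous: "cont (\<lambda>q. ins i (fst q) (snd q))"
proof -
  have "(\<lambda>q. ins i (fst q) (snd q)) = (\<lambda>q. \<chi> j. if j = i then fst q else if j = i + 1 then fst (snd q) else snd (snd q))"
   by (simp add: ins_def)
  moreover have "cont (\<lambda>q. if j = i then fst q else if j = i + 1 then fst (snd q) else snd (snd q))" for j :: 3 and q :: "real \<times> real \<times> real"
   by (cases "j = i"; cases "j = i + 1") (auto intro!: continuous_intros)
  ultimately show ?thesis by (simp only:) (rule continuous_on_vec_lambda)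
qed

lemma ins_borel [measurable]: "(\<lambda>q. ins i (fst q) (snd q)) \<in> Bor"
  by (rule Bor_contI[OF ins_continuous])

lemma emeasure_lborel_Times:
  fixes A :: "'a::euclidean_space set" and B :: "'b::euclidean_space set"
  assumes "A \<in> sets borel" "B \<in> sets borel"
  shows "emeasure lborel (A \<times> B) = emeasure lborel A * emeasure lborel B"
  using lborel.emeasure_pair_measure_Times[of A lborel B] assms by (simp add: lborel_prod)

text \<open>Lebesgue measure is determined by its values on boxes, whose preimages are boxes with
  permuted sides. This gives Fubini's theorem along any coordinate direction.\<close>

lemma distr_ins: "distr lborel borel (\<lambda>q. ins i (fst q) (snd q)) = lborel"
proof (rule lborel_eqI[symmetric])
  fix l u :: "real^3" assume lu: "\<And>b. b \<in> Basis \<Longrightarrow> l \<bullet> b \<le> u \<bullet> b"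
  have le: "l $ j \<le> u $ j" for j using lu[of "axis j 1"] by (simp add: axis_in_Basis_iff inner_axis)
  have pre: "(\<lambda>q. ins i (fst q) (snd q)) -` box l u =
    {l $ i<..<u $ i} \<times> {l $ (i + 1)<..<u $ (i + 1)} \<times> {l $ (i + 2)<..<u $ (i + 2)}"
   by (auto simp: mem_box_cart all3[of _ i])
  have "emeasure (distr lborel borel (\<lambda>q. ins i (fst q) (snd q))) (box l u) =
    emeasure lborel ({l $ i<..<u $ i} \<times> {l $ (i + 1)<..<u $ (i + 1)} \<times> {l $ (i + 2)<..<u $ (i + 2)})"
   by (subst emeasure_distr) (simp_all add: pre)
  also have "\<dots> = ennreal (u $ i - l $ i) * (ennreal (u $ (i + 1) - l $ (i + 1)) * ennreal (u $ (i + 2) - l $ (i + 2)))"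
   by (simp only: emeasure_lborel_Times[OF _ borel_open[OF open_Times]] emeasure_lborel_Times open_greaterThanLessThan borel_open emeasure_lborel_Ioo[OF le])
  also have "\<dots> = ennreal ((u $ i - l $ i) * ((u $ (i + 1) - l $ (i + 1)) * (u $ (i + 2) - l $ (i + 2))))"
   using le by (simp add: ennreal_mult)
  also have "(u $ i - l $ i) * ((u $ (i + 1) - l $ (i + 1)) * (u $ (i + 2) - l $ (i + 2))) = (\<Prod>j\<in>UNIV. u $ j - l $ j)"
   by (subst cyclic3(4)[of i]) (use cyclic3(1-3)[of i] in simp)
  also have "\<dots> = (\<Prod>b\<in>Basis. (u - l) \<bullet> b)"
  proof -
   have ne: "cbox l u \<noteq> {}" using lu by (simp add: box_ne_empty)
   thus ?thesis using content_cbox_cart[OF ne] content_cbox'[OF ne] by (simp add: inner_diff_left)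
  qed
  finally show "emeasure (distr lborel borel (\<lambda>q. ins i (fst q) (snd q))) (box l u) = (\<Prod>b\<in>Basis. (u - l) \<bullet> b)" .
qed simp

lemma cell_box:
  fixes f :: "real^3 \<Rightarrow> real"
  assumes [measurable]: "f \<in> Bor"
  shows "(LINT x:torus_cell|lborel. f x) = (LINT x:box 0 1|lborel. f x)"
proof -
  have eq: "emeasure lborel (box 0 (1::real^3)) = emeasure lborel (cbox 0 (1::real^3))"
   by (simp only: emeasure_lborel_cbox_eq emeasure_lborel_box_eq)
  have fin: "emeasure lborel (cbox 0 (1::real^3)) < \<infinity>" by (rule emeasure_lborel_cbox_finite)
  have "emeasure lborel (cbox 0 1 - box 0 (1::real^3)) = emeasure lborel (cbox 0 (1::real^3)) - emeasure lborel (box 0 (1::real^3))"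
   by (rule emeasure_Diff) (use fin eq box_subset_cbox[of 0 "1::real^3"] in simp_all)
  also have "\<dots> = 0" using fin eq by simp
  finally have "cbox 0 1 - box 0 (1::real^3) \<in> null_sets lborel" by (rule null_setsI) simp
  hence "AE x in lborel. x \<notin> cbox 0 1 - box 0 (1::real^3)" by (rule AE_not_in)
  hence "AE x in lborel. indicator (cbox 0 1) x *\<^sub>R f x = indicator (box 0 1) x *\<^sub>R f x"
  proof eventually_elim
   case (elim x)
   hence "x \<in> cbox 0 1 \<longleftrightarrow> x \<in> box 0 1" using box_subset_cbox[of 0 "1::real^3"] by blast
   thus ?case by (simp only: indicator_def)
  qed
  moreover have "(\<lambda>x. indicator A x *\<^sub>R f x) \<in> borel_measurable lborel" if "A \<in> sets borel" for A
   by (intro borel_measurable_scaleR borel_measurable_indicator) (use that assms in simp_all)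
  ultimately show ?thesis unfolding torus_cell_def set_int_def
   by (intro integral_cong_AE) (simp_all only: borel_closed[OF closed_cbox] borel_open[OF open_box])
qed

lemma int_ins:
  fixes f :: "real^3 \<Rightarrow> real"
  assumes f: "f \<in> Bor" and K: "\<And>x. x \<in> box 0 1 \<Longrightarrow> \<bar>f x\<bar> \<le> K"
  shows "(LINT x:torus_cell|lborel. f x) =
    (LINT p:{0<..<1}\<times>{0<..<1}|lborel. LINT s:{0<..<1}|lborel. f (ins i s p))"
   and "(LINT x:torus_cell|lborel. f x) =
    (LINT s:{0<..<1}|lborel. LINT p:{0<..<1}\<times>{0<..<1}|lborel. f (ins i s p))"
proof -
  let ?I = "{0<..<1::real}"
  define g where "g q = ind (?I \<times> ?I \<times> ?I) q * f (ins i (fst q) (snd q))" for q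
  have mI: "?I \<times> ?I \<times> ?I \<in> sets borel" by (intro borel_open open_Times open_greaterThanLessThan)
  have gm: "g \<in> Bor" unfolding g_def[abs_def]
   by (rule borel_measurable_times[OF borel_measurable_indicator[OF mI] measurable_compose[OF ins_borel f]])
  have box: "ins i (fst q) (snd q) \<in> box 0 1 \<longleftrightarrow> q \<in> ?I \<times> ?I \<times> ?I" for q
   by (auto simp: mem_box_cart all3[of _ i] mem_Times_iff)
  have "(\<chi> j. (1/2 :: real)) \<in> box 0 (1 :: real^3)" by (simp add: mem_box_cart)
  from K[OF this] have K0: "0 \<le> K" by linarith
  have gi: "integrable lborel g"
  proof (rule integrable_bdd[OF gm])
   show "\<bar>g q\<bar> \<le> K" for q using K[of "ins i (fst q) (snd q)"] K0 box[of q] by (auto simp: g_def indicator_def)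
   show "bounded (?I \<times> ?I \<times> ?I)" by (intro bounded_Times) simp_all
  qed (auto simp: g_def)
  have "(LINT x:torus_cell|lborel. f x) = (LINT x|distr lborel borel (\<lambda>q. ins i (fst q) (snd q)). ind (box 0 1) x * f x)"
   unfolding distr_ins using cell_box[OF f] by (simp add: set_int_def)
  also have "\<dots> = (LINT q|lborel. ind (box 0 1) (ins i (fst q) (snd q)) * f (ins i (fst q) (snd q)))"
  proof (rule integral_distr)
   show "(\<lambda>x. ind (box 0 1) x * f x) \<in> Bor"
    by (rule borel_measurable_times[OF borel_measurable_indicator[OF borel_open[OF open_box]] f])
   show "(\<lambda>q. ins i (fst q) (snd q)) \<in> lborel \<rightarrow>\<^sub>M borel" using ins_borel by simp
  qed
  also have "\<dots> = (LINT q|lborel. g q)" unfolding g_def by (intro int_cong) (auto simp: indicator_def box)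
  finally have *: "(LINT x:torus_cell|lborel. f x) = (LINT q|lborel. g q)" .
  have g: "g (s, p) = ind (?I \<times> ?I) p * (ind ?I s * f (ins i s p))"
   "g (s, p) = ind ?I s * (ind (?I \<times> ?I) p * f (ins i s p))" for s p
   by (auto simp: g_def indicator_def)
  show "(LINT x:torus_cell|lborel. f x) = (LINT p:?I\<times>?I|lborel. LINT s:?I|lborel. f (ins i s p))"
   unfolding * unfolding fubini_xy(2)[OF gi] set_int_def g(1) by simp
  show "(LINT x:torus_cell|lborel. f x) = (LINT s:?I|lborel. LINT p:?I\<times>?I|lborel. f (ins i s p))"
   unfolding * unfolding fubini_xy(1)[OF gi] set_int_def g(2) by simp
qed

section \<open>Smooth functions and their slices\<close>

abbreviation pd :: "'a::euclidean_space \<Rightarrow> ('a \<Rightarrow> real) \<Rightarrow> 'a \<Rightarrow> real" where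
  "pd v f \<equiv> \<lambda>z. frechet_derivative f (at z) v"

lemma iter_deriv_append: "iter_deriv us (iter_deriv vs f) = iter_deriv (us @ vs) f"
  by (induction us) simp_all

lemma smooth_pd: "smooth f \<Longrightarrow> smooth (pd v f)"
  unfolding smooth_def using iter_deriv_append[of _ "[v]" f] by simp

lemma smooth_has_derivative: "smooth f \<Longrightarrow> (f has_derivative frechet_derivative f (at z)) (at z)"
  unfolding smooth_def by (intro frechet_derivative_works[THEN iffD1]) (metis iter_deriv.simps(1))

lemma smooth_continuous: "smooth f \<Longrightarrow> continuous_on A f"
  by (intro continuous_at_imp_continuous_on ballI has_derivative_continuous[OF smooth_has_derivative])

lemma smooth_borel: "smooth f \<Longrightarrow> f \<in> Bor"
  by (rule Bor_contI[OF smooth_continuous])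

lemma smooth_line:
  assumes "smooth f"
  shows "((\<lambda>s. f (z + s *\<^sub>R v)) has_real_derivative pd v f (z + s *\<^sub>R v)) (at s)"
proof -
  have d: "((\<lambda>s. z + s *\<^sub>R v) has_derivative (\<lambda>h. h *\<^sub>R v)) (at s)"
   by (auto intro!: derivative_eq_intros)
  have "((\<lambda>s. f (z + s *\<^sub>R v)) has_derivative (\<lambda>h. frechet_derivative f (at (z + s *\<^sub>R v)) (h *\<^sub>R v))) (at s)"
   by (rule has_derivative_compose[OF d smooth_has_derivative[OF assms]])
  moreover have "(\<lambda>h. frechet_derivative f (at (z + s *\<^sub>R v)) (h *\<^sub>R v)) = (*) (pd v f (z + s *\<^sub>R v))"
   by (simp add: linear_scale[OF linear_frechet_derivative[OF differentiableI[OF smooth_has_derivative[OF assms]]]] mult.commute fun_eq_iff)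
  ultimately show ?thesis by (simp add: has_field_derivative_def)
qed

lemma smooth_line0: "smooth f \<Longrightarrow> ((\<lambda>s. f (z + s *\<^sub>R v)) has_real_derivative pd v f z) (at 0)"
  using smooth_line[of f z v 0] by simp

lemma pd_lincomb:
  assumes "\<And>z. f differentiable (at z)" "\<And>z. g differentiable (at z)"
  shows "pd v (\<lambda>z. a * f z + b * g z) = (\<lambda>z. a * pd v f z + b * pd v g z)"
proof
  fix z
  have "((\<lambda>z. a * f z + b * g z) has_derivative (\<lambda>h. a * frechet_derivative f (at z) h + b * frechet_derivative g (at z) h)) (at z)"
   by (intro has_derivative_add has_derivative_mult_right frechet_derivative_works[THEN iffD1] assms)
  from frechet_derivative_at[OF this] show "pd v (\<lambda>z. a * f z + b * g z) z = a * pd v f z + b * pd v g z" by metis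
qed

lemma iter_deriv_lincomb:
  assumes "smooth f" "smooth g"
  shows "iter_deriv vs (\<lambda>z. a * f z + b * g z) = (\<lambda>z. a * iter_deriv vs f z + b * iter_deriv vs g z)"
proof (induction vs)
  case (Cons v vs)
  show ?case unfolding iter_deriv.simps Cons
   by (rule pd_lincomb) (use assms in \<open>auto simp: smooth_def\<close>)
qed simp

lemma smooth_lincomb: "smooth f \<Longrightarrow> smooth g \<Longrightarrow> smooth (\<lambda>z. a * f z + b * g z)"
  unfolding smooth_def[of "\<lambda>z. a * f z + b * g z"] iter_deriv_lincomb
  by (intro allI differentiable_add differentiable_mult differentiable_const) (simp_all add: smooth_def)

lemma smooth_const: "smooth (\<lambda>z. c)"
proof -
  have "\<exists>d. iter_deriv vs (\<lambda>z. c) = (\<lambda>z. d)" for vs :: "'a list"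
  proof (induction vs)
   case (Cons v vs)
   then obtain d where "iter_deriv vs (\<lambda>z. c) = (\<lambda>z. d)" by blast
   thus ?case by (intro exI[of _ 0]) (simp add: frechet_derivative_const)
  qed auto
  thus ?thesis unfolding smooth_def by (metis differentiable_const)
qed

text \<open>Both mixed derivatives are limits of the same second difference, by applying the mean value
  theorem twice in either order.\<close>

lemma second_difference:
  assumes f: "smooth f" and r: "0 < r"
  obtains s t where "0 < s" "s < r" "0 < t" "t < r"
   "f (z + r *\<^sub>R v + r *\<^sub>R w) - f (z + r *\<^sub>R v) - f (z + r *\<^sub>R w) + f z = r * r * pd w (pd v f) (z + s *\<^sub>R v + t *\<^sub>R w)"
proof -
  define g where "g s = f ((z + r *\<^sub>R w) + s *\<^sub>R v) - f (z + s *\<^sub>R v)" for s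
  have "(g has_real_derivative pd v f ((z + r *\<^sub>R w) + s *\<^sub>R v) - pd v f (z + s *\<^sub>R v)) (at s)" for s
   unfolding g_def[abs_def] by (intro DERIV_diff smooth_line[OF f])
  then obtain s where s: "0 < s" "s < r" "g r - g 0 = (r - 0) * (pd v f ((z + r *\<^sub>R w) + s *\<^sub>R v) - pd v f (z + s *\<^sub>R v))"
   using MVT2[OF r, of g "\<lambda>s. pd v f ((z + r *\<^sub>R w) + s *\<^sub>R v) - pd v f (z + s *\<^sub>R v)"] by blast
  obtain t where t: "0 < t" "t < r" "pd v f ((z + s *\<^sub>R v) + r *\<^sub>R w) - pd v f ((z + s *\<^sub>R v) + 0 *\<^sub>R w) = (r - 0) * pd w (pd v f) ((z + s *\<^sub>R v) + t *\<^sub>R w)"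
   using MVT2[OF r, of "\<lambda>t. pd v f ((z + s *\<^sub>R v) + t *\<^sub>R w)" "\<lambda>t. pd w (pd v f) ((z + s *\<^sub>R v) + t *\<^sub>R w)"] smooth_line[OF smooth_pd[OF f]] by blast
  show ?thesis
   by (rule that[OF s(1,2) t(1,2)]) (use s(3) t(3) in \<open>simp add: g_def add_ac\<close>)
qed

lemma pd_commute:
  assumes f: "smooth f"
  shows "pd v (pd w f) z = pd w (pd v f) z"
proof -
  define q where "q n = (f (z + inverse (real (Suc n)) *\<^sub>R v + inverse (real (Suc n)) *\<^sub>R w) - f (z + inverse (real (Suc n)) *\<^sub>R v)
    - f (z + inverse (real (Suc n)) *\<^sub>R w) + f z) / (inverse (real (Suc n)))\<^sup>2" for n
  have lim: "q' \<longlonglongrightarrow> pd b (pd a f) z"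
   if q': "\<And>n. \<exists>s t. 0 < s \<and> s < inverse (real (Suc n)) \<and> 0 < t \<and> t < inverse (real (Suc n)) \<and> q' n = pd b (pd a f) (z + s *\<^sub>R a + t *\<^sub>R b)" for a b q'
  proof -
   obtain s t where st: "\<And>n. 0 < s n \<and> s n < inverse (real (Suc n)) \<and> 0 < t n \<and> t n < inverse (real (Suc n)) \<and> q' n = pd b (pd a f) (z + s n *\<^sub>R a + t n *\<^sub>R b)"
    using q' by metis
   have "s \<longlonglongrightarrow> 0" "t \<longlonglongrightarrow> 0"
    by (rule tendsto_sandwich[OF _ _ tendsto_const LIMSEQ_inverse_real_of_nat]; use st in \<open>auto intro!: always_eventually less_imp_le\<close>)+
   hence "(\<lambda>n. z + s n *\<^sub>R a + t n *\<^sub>R b) \<longlonglongrightarrow> z + 0 *\<^sub>R a + 0 *\<^sub>R b" by (intro tendsto_intros)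
   hence "(\<lambda>n. z + s n *\<^sub>R a + t n *\<^sub>R b) \<longlonglongrightarrow> z" by simp
   from continuous_on_tendsto_compose[OF smooth_continuous[OF smooth_pd[OF smooth_pd[OF f]], of UNIV] this]
   moreover have "q' = (\<lambda>n. pd b (pd a f) (z + s n *\<^sub>R a + t n *\<^sub>R b))" using st by blast
   ultimately show ?thesis by simp
  qed
  have "q \<longlonglongrightarrow> pd w (pd v f) z"
  proof (rule lim)
   fix n
   let ?r = "inverse (real (Suc n))"
   have r: "0 < ?r" by simp
   obtain s t where "0 < s" "s < ?r" "0 < t" "t < ?r"
   "f (z + ?r *\<^sub>R v + ?r *\<^sub>R w) - f (z + ?r *\<^sub>R v) - f (z + ?r *\<^sub>R w) + f z = ?r * ?r * pd w (pd v f) (z + s *\<^sub>R v + t *\<^sub>R w)"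
    by (rule second_difference[OF f r])
   moreover from this(5) have "q n = pd w (pd v f) (z + s *\<^sub>R v + t *\<^sub>R w)" unfolding q_def by (simp add: power2_eq_square del: of_nat_Suc)
   ultimately show "\<exists>s t. 0 < s \<and> s < ?r \<and> 0 < t \<and> t < ?r \<and> q n = pd w (pd v f) (z + s *\<^sub>R v + t *\<^sub>R w)" by blast
  qed
  moreover have "q \<longlonglongrightarrow> pd v (pd w f) z"
  proof (rule lim)
   fix n
   let ?r = "inverse (real (Suc n))"
   have r: "0 < ?r" by simp
   obtain s t where "0 < s" "s < ?r" "0 < t" "t < ?r"
   "f (z + ?r *\<^sub>R w + ?r *\<^sub>R v) - f (z + ?r *\<^sub>R w) - f (z + ?r *\<^sub>R v) + f z = ?r * ?r * pd v (pd w f) (z + s *\<^sub>R w + t *\<^sub>R v)"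
    by (rule second_difference[OF f r])
   moreover have "f (z + ?r *\<^sub>R v + ?r *\<^sub>R w) - f (z + ?r *\<^sub>R v) - f (z + ?r *\<^sub>R w) + f z =
     f (z + ?r *\<^sub>R w + ?r *\<^sub>R v) - f (z + ?r *\<^sub>R w) - f (z + ?r *\<^sub>R v) + f z" by (simp add: add_ac del: of_nat_Suc)
   ultimately have "q n = pd v (pd w f) (z + s *\<^sub>R w + t *\<^sub>R v)" unfolding q_def by (simp add: power2_eq_square del: of_nat_Suc)
   with \<open>0 < s\<close> \<open>s < ?r\<close> \<open>0 < t\<close> \<open>t < ?r\<close>
   show "\<exists>s t. 0 < s \<and> s < ?r \<and> 0 < t \<and> t < ?r \<and> q n = pd v (pd w f) (z + s *\<^sub>R w + t *\<^sub>R v)" by blast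
  qed
  ultimately show ?thesis using LIMSEQ_unique by blast
qed

lemma pd_periodic:
  assumes "ps \<in> torus_tests"
  shows "pd v ps \<in> torus_tests"
proof -
  have ps: "smooth ps" "\<And>x i. ps (x + axis i 1) = ps x" using assms by (auto simp: torus_tests_def periodic_def)
  have "pd v ps (x + axis i 1) = pd v ps x" for x i
  proof (rule DERIV_unique)
   show "((\<lambda>s. ps ((x + axis i 1) + s *\<^sub>R v)) has_real_derivative pd v ps (x + axis i 1)) (at 0)"
    by (rule smooth_line0[OF ps(1)])
   have "ps ((x + axis i 1) + s *\<^sub>R v) = ps (x + s *\<^sub>R v)" for s
    using ps(2)[of "x + s *\<^sub>R v" i] by (simp add: add_ac)
   thus "((\<lambda>s. ps ((x + axis i 1) + s *\<^sub>R v)) has_real_derivative pd v ps x) (at 0)"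
    using smooth_line0[OF ps(1), of x v] by simp
  qed
  thus ?thesis using smooth_pd[OF ps(1)] by (simp add: torus_tests_def periodic_def)
qed

lemma iter_deriv_slice:
  assumes "smooth ph"
  shows "iter_deriv vs (\<lambda>x. ph (x, t)) = (\<lambda>x. iter_deriv (map (\<lambda>v. (v, 0)) vs) ph (x, t))"
   and "(\<lambda>x. iter_deriv us ph (x, t)) differentiable (at x)"
proof -
  have d: "((\<lambda>x. iter_deriv us ph (x, t)) has_derivative (\<lambda>h. frechet_derivative (iter_deriv us ph) (at (x, t)) (h, 0))) (at x)" for us x
  proof (rule has_derivative_compose[of "\<lambda>x. (x, t)" "\<lambda>h. (h, 0)" x UNIV "iter_deriv us ph"])
   show "((\<lambda>x. (x, t)) has_derivative (\<lambda>h. (h, 0))) (at x)" by (auto intro!: derivative_eq_intros)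
   show "(iter_deriv us ph has_derivative frechet_derivative (iter_deriv us ph) (at (x, t))) (at (x, t))"
    using assms unfolding smooth_def by (intro frechet_derivative_works[THEN iffD1]) blast
  qed
  show "(\<lambda>x. iter_deriv us ph (x, t)) differentiable (at x)" using d by (rule differentiableI)
  show "iter_deriv vs (\<lambda>x. ph (x, t)) = (\<lambda>x. iter_deriv (map (\<lambda>v. (v, 0)) vs) ph (x, t))"
  proof (induction vs)
   case (Cons v vs)
   show ?case unfolding iter_deriv.simps list.map Cons frechet_derivative_at[OF d, symmetric] ..
  qed simp
qed

lemma spacetime_slice:
  assumes "ph \<in> spacetime_tests T"
  shows "(\<lambda>x. ph (x, t)) \<in> torus_tests" "pd v (\<lambda>x. ph (x, t)) x = pd (v, 0) ph (x, t)"
proof -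
  have ph: "smooth ph" "periodic (\<lambda>x. ph (x, t))" using assms by (auto simp: spacetime_tests_def tests_supported_in_def)
  show "(\<lambda>x. ph (x, t)) \<in> torus_tests"
   unfolding torus_tests_def using ph(2) iter_deriv_slice[OF ph(1)] by (simp add: smooth_def)
  show "pd v (\<lambda>x. ph (x, t)) x = pd (v, 0) ph (x, t)"
   using iter_deriv_slice(1)[OF ph(1), of "[v]" t] by (simp add: fun_eq_iff)
qed

section \<open>Integration by parts on the torus\<close>

lemma FTC_Ioo:
  assumes ab: "a \<le> b" and F: "\<And>s. (ps has_real_derivative ps' s) (at s)" "cont ps'"
  shows "(LBINT s:{a<..<b}. ps' s) = ps b - ps a" "(LBINT s:{a..<b}. ps' s) = ps b - ps a" "(LBINT s:{a<..b}. ps' s) = ps b - ps a"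
proof -
  have "(LBINT s:{a..b}. ps' s) = ps b - ps a" unfolding set_int_def
   by (rule integral_FTC_atLeastAtMost[OF ab])
    (use F in \<open>auto simp: has_real_derivative_iff_has_vector_derivative[symmetric] intro: has_field_derivative_at_within continuous_on_subset\<close>)
  moreover have "(LBINT s:{a<..<b}. ps' s) = (LBINT s:{a..b}. ps' s)" "(LBINT s:{a..<b}. ps' s) = (LBINT s:{a..b}. ps' s)"
   "(LBINT s:{a<..b}. ps' s) = (LBINT s:{a..b}. ps' s)"
   by (rule set_integral_discrete_difference[where X="{a, b}"]; force)+
  ultimately show "(LBINT s:{a<..<b}. ps' s) = ps b - ps a" "(LBINT s:{a..<b}. ps' s) = ps b - ps a" "(LBINT s:{a<..b}. ps' s) = ps b - ps a"
   by simp_all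
qed

lemma continuous_bound_Icc:
  assumes "cont (f :: real \<Rightarrow> real)"
  obtains K where "0 \<le> K" "\<And>s. s \<in> {a..b} \<Longrightarrow> \<bar>f s\<bar> \<le> K"
proof -
  have "bounded (f ` {a..b})"
   by (intro compact_imp_bounded compact_continuous_image continuous_on_subset[OF assms]) auto
  then obtain K where "\<forall>y\<in>f ` {a..b}. norm y \<le> K" unfolding bounded_iff ..
  hence "\<bar>f s\<bar> \<le> K" if "s \<in> {a..b}" for s using that by force
  thus ?thesis by (intro that[of "max 0 K"]) (auto simp: le_max_iff_disj)
qed

text \<open>\<gamma> is only bounded and measurable, so the product rule is replaced by Fubini's
  theorem on the triangle \<open>0 < u \<le> s < 1\<close>. The boundary terms vanish because ps has
  equal end values and \<gamma> has integral zero.\<close>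

lemma ibp_line:
  fixes \<gamma> \<Gamma> ps ps' :: "real \<Rightarrow> real"
  assumes \<gamma>: "\<gamma> \<in> Bor" "\<And>s. \<bar>\<gamma> s\<bar> \<le> K"
   and \<Gamma>: "\<And>s. s \<in> {0<..<1} \<Longrightarrow> \<Gamma> s = c + (LBINT u:{0<..s}. \<gamma> u)" "(LBINT u:{0<..<1}. \<gamma> u) = 0"
   and ps: "\<And>s. (ps has_real_derivative ps' s) (at s)" "cont ps'" "ps 1 = ps 0"
  shows "(LBINT s:{0<..<1}. \<Gamma> s * ps' s) = - (LBINT s:{0<..<1}. \<gamma> s * ps s)"
proof -
  obtain L where L: "0 \<le> L" "\<And>s. s \<in> {0..1} \<Longrightarrow> \<bar>ps' s\<bar> \<le> L" by (rule continuous_bound_Icc[OF ps(2)]) blast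
  have cont: "cont ps" using ps(1) by (intro continuous_at_imp_continuous_on ballI DERIV_isCont) blast
  obtain L' where L': "0 \<le> L'" "\<And>s. s \<in> {0..1} \<Longrightarrow> \<bar>ps s\<bar> \<le> L'" by (rule continuous_bound_Icc[OF cont]) blast
  note [measurable] = \<gamma>(1) Bor_contI[OF ps(2)] Bor_contI[OF cont]
  have K0: "0 \<le> K" using \<gamma>(2)[of 0] by linarith
  define D where "D = {q :: plane. 0 < snd q \<and> snd q \<le> fst q \<and> fst q < 1}"
  have D: "D \<in> sets borel" unfolding D_def by measurable
  define k where "k q = ind D q * (ps' (fst q) * \<gamma> (snd q))" for q
  have ki: "integrable lborel k"
  proof (rule integrable_bdd)
   have "(\<lambda>q :: plane. ps' (fst q) * \<gamma> (snd q)) \<in> Bor" by measurable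
   thus "k \<in> Bor" unfolding k_def[abs_def] by (rule borel_measurable_times[OF borel_measurable_indicator[OF D]])
   show "\<bar>k q\<bar> \<le> L * K" for q
   proof (cases "q \<in> D")
    case True
    thus ?thesis using L(2)[of "fst q"] \<gamma>(2) K0 L(1) by (auto simp: k_def D_def abs_mult intro!: mult_mono)
   qed (use K0 L(1) in \<open>simp add: k_def\<close>)
   show "bounded ({0..1::real} \<times> {0..1::real})" by (intro bounded_Times compact_imp_bounded[OF compact_Icc])
  qed (auto simp: k_def D_def indicator_def split: if_splits)
  have inti: "integrable lborel (\<lambda>s. ind {0<..<1} s * g s)"
   if "g \<in> Bor" "\<And>s. s \<in> {0..1} \<Longrightarrow> \<bar>g s\<bar> \<le> C" "0 \<le> C" for g :: "real \<Rightarrow> real" and C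
  proof (rule integrable_bdd)
   show "(\<lambda>s. ind {0<..<1} s * g s) \<in> Bor" by (intro borel_measurable_times borel_measurable_indicator that(1)) simp
   show "\<bar>ind {0<..<1} s * g s\<bar> \<le> C" for s using that(2,3) by (auto simp: indicator_def)
   show "bounded {0..1::real}" by (rule compact_imp_bounded[OF compact_Icc])
  qed auto
  have kL: "(LBINT u. k (s, u)) = ind {0<..<1} s * ((LBINT u:{0<..s}. \<gamma> u) * ps' s)" for s
  proof (cases "s \<in> {0<..<1}")
   case True
   hence "k (s, u) = ps' s * (ind {0<..s} u *\<^sub>R \<gamma> u)" for u by (auto simp: k_def D_def indicator_def)
   thus ?thesis using True by (simp add: set_int_def)
  next
   case False
   hence "k (s, u) = 0" for u by (auto simp: k_def D_def)
   thus ?thesis using False by simp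
  qed
  have kR: "(LBINT s. k (s, u)) = ind {0<..<1} u * (\<gamma> u * (ps 1 - ps u))" for u
  proof (cases "u \<in> {0<..<1}")
   case True
   hence "k (s, u) = \<gamma> u * (ind {u..<1} s *\<^sub>R ps' s)" for s by (auto simp: k_def D_def indicator_def)
   thus ?thesis using True FTC_Ioo(2)[OF _ ps(1,2), of u 1] by (simp add: set_int_def)
  next
   case False
   hence "k (s, u) = 0" for s by (auto simp: k_def D_def)
   thus ?thesis using False by simp
  qed
  have fub: "(LBINT s. ind {0<..<1} s * ((LBINT u:{0<..s}. \<gamma> u) * ps' s)) = (LBINT u. ind {0<..<1} u * (\<gamma> u * (ps 1 - ps u)))"
   using fubini_xy[OF ki] unfolding kL kR by simp
  have i1: "integrable lborel (\<lambda>s. ind {0<..<1} s * ((LBINT u:{0<..s}. \<gamma> u) * ps' s))"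
   using lborel_pair.integrable_fst'[of k] ki unfolding lborel_prod kL by blast
  have i2: "integrable lborel (\<lambda>s. ind {0<..<1} s * (c * ps' s))"
   by (rule inti[of _ "\<bar>c\<bar> * L"]) (use L in \<open>auto simp: abs_mult intro!: mult_left_mono\<close>)
  have i3: "integrable lborel (\<lambda>s. ind {0<..<1} s * (\<gamma> s * ps s))"
   by (rule inti[of _ "K * L'"]) (use L' \<gamma>(2) K0 in \<open>auto simp: abs_mult intro!: mult_mono\<close>)
  have i4: "integrable lborel (\<lambda>s. ind {0<..<1} s * \<gamma> s)"
   by (rule inti[of _ K]) (use \<gamma>(2) K0 in auto)
  have "(LBINT s:{0<..<1}. \<Gamma> s * ps' s) = (LBINT s. ind {0<..<1} s * (c * ps' s) + ind {0<..<1} s * ((LBINT u:{0<..s}. \<gamma> u) * ps' s))"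
   unfolding set_int_def[of _ "{0<..<1}"]
  proof (rule int_cong[OF refl])
   fix s
   show "ind {0<..<1} s *\<^sub>R (\<Gamma> s * ps' s) =
     ind {0<..<1} s * (c * ps' s) + ind {0<..<1} s * ((LBINT u:{0<..s}. \<gamma> u) * ps' s)"
    by (cases "s \<in> {0<..<1}") (simp_all add: \<Gamma>(1) distrib_right del: greaterThanLessThan_iff)
  qed
  also have "\<dots> = c * (LBINT s:{0<..<1}. ps' s) + (LBINT s. ind {0<..<1} s * ((LBINT u:{0<..s}. \<gamma> u) * ps' s))"
   unfolding Bochner_Integration.integral_add[OF i2 i1] by (simp add: set_int_def mult.left_commute[of _ c])
  also have "(LBINT s:{0<..<1}. ps' s) = 0" using FTC_Ioo(1)[OF _ ps(1,2), of 0 1] ps(3) by simp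
  also note fub
  also have "(LBINT u. ind {0<..<1} u * (\<gamma> u * (ps 1 - ps u))) = (LBINT u. ps 1 * (ind {0<..<1} u * \<gamma> u) - ind {0<..<1} u * (\<gamma> u * ps u))"
   by (intro int_cong) (auto simp: algebra_simps)
  also have "\<dots> = ps 1 * (LBINT u. ind {0<..<1} u * \<gamma> u) - (LBINT u. ind {0<..<1} u * (\<gamma> u * ps u))"
   by (subst Bochner_Integration.integral_diff) (use i3 i4 in simp_all)
  finally show ?thesis using \<Gamma>(2) by (simp add: set_int_def)
qed

lemma ins_line: "ins i s p = ins i 0 p + s *\<^sub>R axis i 1"
  unfolding vec_eq_iff all3[of _ i] using cyclic3[of i] by (simp add: axis_def)

lemma cell_bound:
  assumes "cont (f :: real^3 \<Rightarrow> real)"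
  obtains K where "\<And>x. x \<in> box 0 1 \<Longrightarrow> \<bar>f x\<bar> \<le> K"
proof -
  have "bounded (f ` cbox 0 1)"
   by (intro compact_imp_bounded compact_continuous_image continuous_on_subset[OF assms]) auto
  thus ?thesis using that box_subset_cbox[of 0 "1::real^3"] unfolding bounded_iff by (auto simp: image_iff Ball_def)
qed

lemma cell_ibp:
  fixes f g :: "real^3 \<Rightarrow> real"
  assumes f: "f \<in> Bor" "\<And>x. \<bar>f x\<bar> \<le> K" and g: "g \<in> Bor" "\<And>x. \<bar>g x\<bar> \<le> K"
   and fg: "\<And>p s. p \<in> {0<..<1} \<times> {0<..<1} \<Longrightarrow> s \<in> {0<..<1} \<Longrightarrow> f (ins i s p) = c p + (LBINT u:{0<..s}. g (ins i u p))"
    "\<And>p. p \<in> {0<..<1} \<times> {0<..<1} \<Longrightarrow> (LBINT u:{0<..<1}. g (ins i u p)) = 0"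
   and ps: "ps \<in> torus_tests"
  shows "(LINT x:torus_cell|lborel. f x * pd (axis i 1) ps x) = - (LINT x:torus_cell|lborel. g x * ps x)"
proof -
  have s: "smooth ps" and per: "\<And>x i. ps (x + axis i 1) = ps x" using ps by (auto simp: torus_tests_def periodic_def)
  obtain L where L: "\<And>x. x \<in> box 0 1 \<Longrightarrow> \<bar>ps x\<bar> \<le> L" by (rule cell_bound[OF smooth_continuous[OF s]]) blast
  obtain L' where L': "\<And>x. x \<in> box 0 1 \<Longrightarrow> \<bar>pd (axis i 1) ps x\<bar> \<le> L'" by (rule cell_bound[OF smooth_continuous[OF smooth_pd[OF s]]]) blast
  have K0: "0 \<le> K" using f(2)[of 0] by linarith
  have m1: "(\<lambda>x. f x * pd (axis i 1) ps x) \<in> Bor" by (rule borel_measurable_times[OF f(1) smooth_borel[OF smooth_pd[OF s]]])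
  have m2: "(\<lambda>x. g x * ps x) \<in> Bor" by (rule borel_measurable_times[OF g(1) smooth_borel[OF s]])
  have b1: "\<bar>f x * pd (axis i 1) ps x\<bar> \<le> K * L'" if "x \<in> box 0 1" for x
   unfolding abs_mult by (rule mult_mono) (use f(2) L'[OF that] K0 in auto)
  have b2: "\<bar>g x * ps x\<bar> \<le> K * L" if "x \<in> box 0 1" for x
   unfolding abs_mult by (rule mult_mono) (use g(2) L[OF that] K0 in auto)
  have line: "(LBINT s:{0<..<1}. f (ins i s p) * pd (axis i 1) ps (ins i s p)) = - (LBINT s:{0<..<1}. g (ins i s p) * ps (ins i s p))"
   if p: "p \<in> {0<..<1} \<times> {0<..<1}" for p
  proof (rule ibp_line[where K=K and c="c p"])
   show "(\<lambda>s. g (ins i s p)) \<in> Bor"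
    using measurable_compose[OF _ measurable_compose[OF ins_borel g(1)], of "\<lambda>s. (s, p)" borel] by simp
   show "((\<lambda>s. ps (ins i s p)) has_real_derivative pd (axis i 1) ps (ins i s p)) (at s)" for s
    using smooth_line[OF s, of "ins i 0 p" "axis i 1" s] by (simp only: ins_line[symmetric])
   show "cont (\<lambda>s. pd (axis i 1) ps (ins i s p))"
    using continuous_on_compose2[OF smooth_continuous[OF smooth_pd[OF s], of UNIV] continuous_on_compose2[OF ins_continuous, of UNIV "\<lambda>s. (s, p)"]]
    by (simp add: continuous_on_Pair continuous_on_id continuous_on_const)
   show "ps (ins i 1 p) = ps (ins i 0 p)" using per[of "ins i 0 p" i] ins_line[of i 1 p] by simp
  qed (use g(2) fg p in auto)
  have "(LINT x:torus_cell|lborel. f x * pd (axis i 1) ps x) = (LINT p:{0<..<1}\<times>{0<..<1}|lborel. LBINT s:{0<..<1}. f (ins i s p) * pd (axis i 1) ps (ins i s p))"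
   by (rule int_ins(1)[OF m1 b1])
  also have "\<dots> = (LINT p:{0<..<1}\<times>{0<..<1}|lborel. - (LBINT s:{0<..<1}. g (ins i s p) * ps (ins i s p)))"
   unfolding set_int_def[of _ "{0<..<1} \<times> {0<..<1}"]
   by (intro int_cong) (auto simp: line indicator_def)
  also have "\<dots> = - (LINT x:torus_cell|lborel. g x * ps x)"
   using int_ins(1)[OF m2 b2, of i] by (simp add: set_int_def[of _ "{0<..<1} \<times> {0<..<1}"])
  finally show ?thesis .
qed

definition per :: "(plane \<Rightarrow> real) \<Rightarrow> real^3 \<Rightarrow> real" where
  "per k x = k (frac (x $ 1), frac (x $ 2))"

lemma frac_borel: "(frac :: real \<Rightarrow> real) \<in> Bor"
  unfolding frac_def[abs_def] by (intro borel_measurable_diff borel_measurable_real_floor) simp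

lemma nth_borel: "(\<lambda>x :: real^3. x $ i) \<in> Bor"
  by (intro Bor_contI continuous_intros)

lemma frac_pair_borel: "(\<lambda>x :: real^3. (frac (x $ 1), frac (x $ 2))) \<in> Bor"
  by (intro borel_measurable_Pair measurable_compose[OF nth_borel frac_borel])

lemma per_borel: "k \<in> Bor \<Longrightarrow> per k \<in> Bor"
  unfolding per_def[abs_def] by (rule measurable_compose[OF frac_pair_borel])

lemma per_t_borel:
  assumes "(\<lambda>z. F (fst z) (snd z)) \<in> Bor"
  shows "(\<lambda>z :: spacetime. per (\<lambda>p. F p (snd z)) (fst z)) \<in> Bor"
proof -
  have f: "(fst :: spacetime \<Rightarrow> real^3) \<in> Bor" "(snd :: spacetime \<Rightarrow> real) \<in> Bor"
   by (intro Bor_contI continuous_on_fst continuous_on_snd continuous_on_id)+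
  have "(\<lambda>z :: spacetime. ((frac (fst z $ 1), frac (fst z $ 2)), snd z)) \<in> Bor"
   by (intro borel_measurable_Pair measurable_compose[OF measurable_compose[OF f(1) nth_borel] frac_borel] f(2))
  from measurable_compose[OF this assms] show ?thesis by (simp add: per_def)
qed

lemma frac_axis: "frac ((x + axis i 1) $ j) = frac (x $ j)" for x :: "real^3"
  by (cases "j = i") (simp_all add: axis_def frac_1_eq)

lemma per_periodic: "periodic (per k)"
  unfolding periodic_def per_def frac_axis by simp

lemma numeral_3_wrap: "(4 :: 3) = 1" "(5 :: 3) = 2"
  by simp_all

lemma ins1: "ins 1 s p $ 1 = s" "ins 1 s p $ 2 = fst p" "ins 1 s p $ 3 = snd p"
  using ins_nth[of 1 s p] by (simp_all only: one_add_one) (simp_all add: numeral_eq_Suc)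

lemma ins2: "ins 2 s p $ 2 = s" "ins 2 s p $ 3 = fst p" "ins 2 s p $ 1 = snd p"
  using ins_nth[of 2 s p] by (simp_all add: numeral_3_wrap)

lemma ins3: "ins 3 s p $ 3 = s" "ins 3 s p $ 1 = fst p" "ins 3 s p $ 2 = snd p"
  using ins_nth[of 3 s p] by (simp_all add: numeral_3_wrap)

lemma per_ins:
  assumes "s \<in> {0<..<1}" "p \<in> {0<..<1} \<times> {0<..<1}"
  shows "per k (ins 1 s p) = k (s, fst p)" "per k (ins 2 s p) = k (snd p, s)" "per k (ins 3 s p) = k p"
  using assms by (auto simp: per_def ins1 ins2 ins3 frac_eq_id)

lemma int_per:
  assumes "k \<in> Bor" "\<And>p. \<bar>k p\<bar> \<le> K"
  shows "(LINT x:torus_cell|lborel. per k x) = (LINT p:{0<..<1}\<times>{0<..<1}|lborel. k p)"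
proof -
  have "(LINT x:torus_cell|lborel. per k x) = (LINT p:{0<..<1}\<times>{0<..<1}|lborel. LINT s:{0<..<1}|lborel. per k (ins 3 s p))"
   by (rule int_ins(1)[OF per_borel[OF assms(1)], of K]) (simp add: per_def assms(2))
  also have "\<dots> = (LINT p:{0<..<1}\<times>{0<..<1}|lborel. k p)"
   unfolding set_int_def[of _ "{0<..<1} \<times> {0<..<1}"]
  proof (rule int_cong[OF refl])
   fix p :: "plane"
   have "(LBINT s:{0<..<1}. per k (ins 3 s p)) = (LBINT s:{0<..<1::real}. k p)" if "p \<in> {0<..<1} \<times> {0<..<1}"
   proof -
    have "ind {0<..<1} s *\<^sub>R per k (ins 3 s p) = ind {0<..<1} s *\<^sub>R k p" for s
     by (cases "s \<in> {0<..<1}") (simp_all add: per_ins(3)[OF _ that] del: greaterThanLessThan_iff)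
    thus ?thesis unfolding set_int_def by (simp only:)
   qed
   thus "ind ({0<..<1} \<times> {0<..<1}) p *\<^sub>R (LBINT s:{0<..<1}. per k (ins 3 s p)) = ind ({0<..<1} \<times> {0<..<1}) p *\<^sub>R k p"
    by (cases "p \<in> {0<..<1} \<times> {0<..<1}") (simp_all add: set_int_def)
  qed
  finally show ?thesis .
qed

lemma spacetime_bound:
  assumes "cont (f :: spacetime \<Rightarrow> real)"
  obtains K where "\<And>x t. x \<in> torus_cell \<Longrightarrow> t \<in> {0<..<T} \<Longrightarrow> \<bar>f (x, t)\<bar> \<le> K"
proof -
  have "bounded (f ` (cbox 0 1 \<times> {0..T}))"
   by (intro compact_imp_bounded compact_continuous_image continuous_on_subset[OF assms] compact_Times compact_Icc compact_cbox) auto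
  then obtain K where K: "\<forall>y\<in>f ` (cbox 0 1 \<times> {0..T}). norm y \<le> K" unfolding bounded_iff ..
  show ?thesis by (rule that[of K]) (use K in \<open>force simp: torus_cell_def\<close>)
qed

lemma spacetime_int:
  fixes f :: "spacetime \<Rightarrow> real" and T :: real
  assumes f: "f \<in> Bor" "\<And>x t. x \<in> torus_cell \<Longrightarrow> t \<in> {0<..<T} \<Longrightarrow> \<bar>f (x, t)\<bar> \<le> K"
  shows "set_integrable lborel (torus_cell \<times> {0<..<T}) f"
   and "(LINT z:torus_cell \<times> {0<..<T}|lborel. f z) = (LINT t:{0<..<T}|lborel. LINT x:torus_cell|lborel. f (x, t))"
   and "(LINT z:torus_cell \<times> {0<..<T}|lborel. f z) = (LINT x:torus_cell|lborel. LINT t:{0<..<T}|lborel. f (x, t))"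
proof -
  let ?D = "torus_cell \<times> {0<..<T}"
  have D: "?D \<in> sets borel" unfolding torus_cell_def by (intro borel_Times) auto
  have bd: "bounded ?D" unfolding torus_cell_def by (intro bounded_Times bounded_cbox) simp
  define g where "g z = ind ?D z *\<^sub>R f z" for z
  have gi: "integrable lborel g"
  proof (rule integrable_bdd[OF _ _ bd])
   show "g \<in> Bor" unfolding g_def[abs_def] by (rule borel_measurable_scaleR[OF borel_measurable_indicator[OF D] f(1)])
   show "\<bar>g z\<bar> \<le> max 0 K" for z using f(2)[of "fst z" "snd z"] by (cases z) (auto simp: g_def indicator_def le_max_iff_disj)
  qed (auto simp: g_def)
  thus "set_integrable lborel ?D f" unfolding g_def[abs_def] set_integrable_def .
  have g: "g (x, t) = ind torus_cell x *\<^sub>R (ind {0<..<T} t *\<^sub>R f (x, t))" "g (x, t) = ind {0<..<T} t *\<^sub>R (ind torus_cell x *\<^sub>R f (x, t))" for x t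
   by (auto simp: g_def indicator_def)
  have *: "(LINT z:?D|lborel. f z) = (LINT z|lborel. g z)" by (simp add: g_def set_int_def)
  show "(LINT z:?D|lborel. f z) = (LINT t:{0<..<T}|lborel. LINT x:torus_cell|lborel. f (x, t))"
   unfolding * unfolding fubini_xy(2)[OF gi] g(2) set_int_def by simp
  show "(LINT z:?D|lborel. f z) = (LINT x:torus_cell|lborel. LINT t:{0<..<T}|lborel. f (x, t))"
   unfolding * unfolding fubini_xy(1)[OF gi] g(1) set_int_def by simp
qed

section \<open>Bounded functions with weak derivatives on the torus\<close>

definition bm :: "('a::euclidean_space \<Rightarrow> real) \<Rightarrow> bool" where
  "bm f \<longleftrightarrow> f \<in> Bor \<and> (\<exists>K. \<forall>p. \<bar>f p\<bar> \<le> K)"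

lemma bmI: "f \<in> Bor \<Longrightarrow> (\<And>p. \<bar>f p\<bar> \<le> K) \<Longrightarrow> bm f"
  unfolding bm_def by blast

lemma bm_borel: "bm f \<Longrightarrow> f \<in> Bor"
  unfolding bm_def by blast

lemma bm_mult: assumes "bm f" "bm g" shows "bm (\<lambda>p. f p * g p)"
proof -
  obtain K L where "\<And>p. \<bar>f p\<bar> \<le> K" "\<And>p. \<bar>g p\<bar> \<le> L" using assms unfolding bm_def by blast
  moreover from this(1)[of undefined] have "0 \<le> K" by linarith
  ultimately have "\<bar>f p * g p\<bar> \<le> K * L" for p unfolding abs_mult by (intro mult_mono) auto
  thus ?thesis by (rule bmI[OF borel_measurable_times[OF bm_borel[OF assms(1)] bm_borel[OF assms(2)]]])
qed

lemma bm_const: "bm (\<lambda>p. c)"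
  by (rule bmI[of _ "\<bar>c\<bar>"]) auto

lemma bm_add: assumes "bm f" "bm g" shows "bm (\<lambda>p. f p + g p)"
proof -
  obtain K L where *: "\<And>p. \<bar>f p\<bar> \<le> K" "\<And>p. \<bar>g p\<bar> \<le> L" using assms unfolding bm_def by blast
  have "\<bar>f p + g p\<bar> \<le> K + L" for p using *[of p] by linarith
  thus ?thesis by (rule bmI[OF borel_measurable_add[OF bm_borel[OF assms(1)] bm_borel[OF assms(2)]]])
qed

lemma bm_cmult: "bm f \<Longrightarrow> bm (\<lambda>p. c * f p)"
  by (rule bm_mult[OF bm_const])

lemma bm_lincomb: "bm f \<Longrightarrow> bm g \<Longrightarrow> bm (\<lambda>p. a * f p + b * g p)"
  by (intro bm_add bm_cmult)

lemma bm_per: "bm k \<Longrightarrow> bm (per k)"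
  using per_borel[of k] unfolding bm_def per_def by blast

lemma bm_cell:
  assumes "bm f" "cont (ps :: real^3 \<Rightarrow> real)"
  shows "set_integrable lborel torus_cell (\<lambda>x. f x * ps x)"
proof -
  obtain K where K: "\<And>p. \<bar>f p\<bar> \<le> K" using assms unfolding bm_def by blast
  hence K0: "0 \<le> K" using K[of undefined] by linarith
  have "bounded (ps ` torus_cell)" unfolding torus_cell_def
   by (intro compact_imp_bounded compact_continuous_image continuous_on_subset[OF assms(2)]) auto
  then obtain L where L: "\<forall>y\<in>ps ` torus_cell. norm y \<le> L" unfolding bounded_iff ..
  have c: "torus_cell \<in> sets borel" "bounded torus_cell" by (simp_all add: torus_cell_def)
  show ?thesis unfolding set_integrable_def
  proof (rule integrable_bdd[OF _ _ c(2)])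
   show "(\<lambda>x. ind torus_cell x *\<^sub>R (f x * ps x)) \<in> Bor"
    by (intro borel_measurable_scaleR borel_measurable_times borel_measurable_indicator c bm_borel[OF assms(1)] Bor_contI[OF assms(2)])
   have "\<bar>f x * ps x\<bar> \<le> K * L" if "x \<in> torus_cell" for x
    unfolding abs_mult using K L K0 that by (intro mult_mono) auto
   thus "\<bar>ind torus_cell x *\<^sub>R (f x * ps x)\<bar> \<le> max 0 (K * L)" for x
    by (cases "x \<in> torus_cell") (auto simp: le_max_iff_disj)
  qed simp
qed

text \<open>The weak partial derivative on the torus, for functions of the first two coordinates.
  Potentials and fields are compared only through this relation, since the fields are
  discontinuous.\<close>

definition wd :: "3 \<Rightarrow> (plane \<Rightarrow> real) \<Rightarrow> (plane \<Rightarrow> real) \<Rightarrow> bool" where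
  "wd i k l \<longleftrightarrow> bm k \<and> bm l \<and> (\<forall>ps\<in>torus_tests.
   (LINT x:torus_cell|lborel. per k x * pd (axis i 1) ps x) = - (LINT x:torus_cell|lborel. per l x * ps x))"

lemma tests_continuous: "ps \<in> torus_tests \<Longrightarrow> cont ps" "ps \<in> torus_tests \<Longrightarrow> cont (pd v ps)"
  by (simp_all add: torus_tests_def smooth_continuous smooth_pd)

lemma cell_lincomb:
  assumes "bm k" "bm k'" "cont (ps :: real^3 \<Rightarrow> real)"
  shows "(LINT x:torus_cell|lborel. per (\<lambda>p. a * k p + b * k' p) x * ps x) =
   a * (LINT x:torus_cell|lborel. per k x * ps x) + b * (LINT x:torus_cell|lborel. per k' x * ps x)"
proof -
  have "per (\<lambda>p. a * k p + b * k' p) x * ps x = a * (per k x * ps x) + b * (per k' x * ps x)" for x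
   by (simp add: per_def algebra_simps)
  thus ?thesis using bm_cell[OF bm_per assms(3)] assms(1,2) by (simp add: set_integral_add)
qed

lemma wd_lincomb: "wd i k l \<Longrightarrow> wd i k' l' \<Longrightarrow> wd i (\<lambda>p. a * k p + b * k' p) (\<lambda>p. a * l p + b * l' p)"
  unfolding wd_def by (simp add: cell_lincomb tests_continuous bm_lincomb)

lemma wd_lines:
  assumes k: "bm k" "bm l"
   and "\<And>p s. p \<in> {0<..<1} \<times> {0<..<1} \<Longrightarrow> s \<in> {0<..<1} \<Longrightarrow> per k (ins i s p) = c p + (LBINT u:{0<..s}. g p u)"
    "\<And>p. p \<in> {0<..<1} \<times> {0<..<1} \<Longrightarrow> (LBINT u:{0<..<1}. g p u) = 0"
   and g: "\<And>p u. p \<in> {0<..<1} \<times> {0<..<1} \<Longrightarrow> u \<in> {0<..<1} \<Longrightarrow> per l (ins i u p) = g p u"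
  shows "wd i k l"
proof -
  obtain K L where "\<And>p. \<bar>k p\<bar> \<le> K" "\<And>p. \<bar>l p\<bar> \<le> L" using k unfolding bm_def by blast
  hence pb: "\<bar>per k x\<bar> \<le> max K L" "\<bar>per l x\<bar> \<le> max K L" for x by (simp_all add: per_def le_max_iff_disj)
  have cong: "(LBINT u:A. per l (ins i u p)) = (LBINT u:A. g p u)" if "A \<subseteq> {0<..<1}" "p \<in> {0<..<1} \<times> {0<..<1}" for A p
   unfolding set_int_def using that g by (intro int_cong) (auto simp: indicator_def)
  have "(LINT x:torus_cell|lborel. per k x * pd (axis i 1) ps x) = - (LINT x:torus_cell|lborel. per l x * ps x)" if "ps \<in> torus_tests" for ps
  proof (rule cell_ibp[OF per_borel[OF bm_borel[OF k(1)]] pb(1) per_borel[OF bm_borel[OF k(2)]] pb(2) _ _ that])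
   fix p :: "plane" assume p: "p \<in> {0<..<1} \<times> {0<..<1}"
   show "(LBINT u:{0<..<1}. per l (ins i u p)) = 0" using cong[OF order.refl p] assms(4)[OF p] by simp
   fix s :: real assume s: "s \<in> {0<..<1}"
   hence "{0<..s} \<subseteq> {0<..<1}" by auto
   from cong[OF this p] show "per k (ins i s p) = c p + (LBINT u:{0<..s}. per l (ins i u p))" using assms(3)[OF p s] by simp
  qed
  thus ?thesis using k by (simp add: wd_def)
qed

lemma wd_x_I:
  assumes b: "bm k" "bm l"
   and "\<And>x y. x \<in> {0<..<1} \<Longrightarrow> y \<in> {0<..<1} \<Longrightarrow> k (x, y) = c y + (LBINT u:{0<..x}. l (u, y))"
    "\<And>y. y \<in> {0<..<1} \<Longrightarrow> (LBINT u:{0<..<1}. l (u, y)) = 0"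
  shows "wd 1 k l"
  by (rule wd_lines[OF b, where c="\<lambda>p. c (fst p)" and g="\<lambda>p u. l (u, fst p)"])
   (use assms(3,4) in \<open>auto simp: per_ins\<close>)

lemma wd_y_I:
  assumes b: "bm k" "bm l"
   and "\<And>x y. x \<in> {0<..<1} \<Longrightarrow> y \<in> {0<..<1} \<Longrightarrow> k (x, y) = c x + (LBINT u:{0<..y}. l (x, u))"
    "\<And>x. x \<in> {0<..<1} \<Longrightarrow> (LBINT u:{0<..<1}. l (x, u)) = 0"
  shows "wd 2 k l"
  by (rule wd_lines[OF b, where c="\<lambda>p. c (snd p)" and g="\<lambda>p u. l (snd p, u)"])
   (use assms(3,4) in \<open>auto simp: per_ins\<close>)

lemma wd_z_I:
  assumes b: "bm k" "bm l" and "\<And>p. l p = 0"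
  shows "wd 3 k l"
  by (rule wd_lines[OF b, where c=k and g="\<lambda>p u. 0"])
   (use assms(3) in \<open>auto simp: per_ins set_int_def\<close>)

lemma halfline_eq:
  fixes f :: "real \<Rightarrow> real"
  assumes "\<And>u. u \<notin> {0<..<1} \<Longrightarrow> f u = 0"
  shows "(LBINT u:{..x}. f u) = (LBINT u:{0<..x}. f u)" "(LBINT u. f u) = (LBINT u:{0<..<1}. f u)"
  unfolding set_int_def
  by (intro int_cong; use assms in \<open>force simp: indicator_def\<close>)+

definition strip :: "(real \<Rightarrow> real) \<Rightarrow> plane \<Rightarrow> real" where
  "strip sm p = (if fst p \<in> {1/2<..<1} then sm (fst p) else 0)"

lemma strip_bm:
  assumes "cont sm"
  shows "bm (strip sm)"
proof -
  obtain K where K: "0 \<le> K" "\<And>s. s \<in> {1/2..1} \<Longrightarrow> \<bar>sm s\<bar> \<le> K" by (rule continuous_bound_Icc[OF assms]) blast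
  have "strip sm = (\<lambda>p. ind {1/2<..<1} (fst p) * sm (fst p))" by (auto simp: strip_def indicator_def)
  moreover have "(\<lambda>p :: plane. ind {1/2<..<1} (fst p) * sm (fst p)) \<in> Bor"
   using Bor_contI[OF assms] by measurable
  ultimately have "strip sm \<in> Bor" by simp
  thus ?thesis by (rule bmI[of _ K]) (use K in \<open>auto simp: strip_def\<close>)
qed

text \<open>The end values 0 make the extension by zero continuous across the boundary of the strip,
  so no surface term arises; in the second direction the function is constant.\<close>

lemma strip_wd:
  assumes sm: "\<And>s. (sm has_real_derivative sm' s) (at s)" "cont sm'" and z: "sm (1/2) = 0" "sm 1 = 0"
  shows "wd 1 (strip sm) (strip sm')" "wd 2 (strip sm) (\<lambda>_. 0)"
proof -
  have c: "cont sm" using sm(1) by (intro continuous_at_imp_continuous_on ballI DERIV_isCont) blast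
  have s: "(LBINT u:{0<..x}. strip sm' (u, y)) = strip sm (x, y)" if "x \<in> {0<..<1}" for x y
  proof (cases "1/2 < x")
   case True
   have "(LBINT u:{0<..x}. strip sm' (u, y)) = (LBINT u:{1/2<..x}. sm' u)"
    unfolding set_int_def by (intro int_cong) (use that in \<open>auto simp: indicator_def strip_def\<close>)
   thus ?thesis using FTC_Ioo(3)[OF _ sm, of "1/2" x] True that z by (simp add: strip_def)
  next
   case False
   have "(LBINT u:{0<..x}. strip sm' (u, y)) = (LBINT u:{0<..x}. 0)"
    unfolding set_int_def by (intro int_cong) (use False in \<open>auto simp: indicator_def strip_def\<close>)
   thus ?thesis using False by (simp add: strip_def set_int_def)
  qed
  have "(LBINT u:{0<..<1}. strip sm' (u, y)) = (LBINT u:{1/2<..<1}. sm' u)" for y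
   unfolding set_int_def by (intro int_cong) (auto simp: indicator_def strip_def)
  hence "(LBINT u:{0<..<1}. strip sm' (u, y)) = 0" for y using FTC_Ioo(1)[OF _ sm, of "1/2" 1] z by simp
  thus "wd 1 (strip sm) (strip sm')" by (intro wd_x_I[of _ _ "\<lambda>_. 0"] strip_bm c sm(2)) (simp_all add: s)
  show "wd 2 (strip sm) (\<lambda>_. 0)"
   by (rule wd_y_I[OF strip_bm[OF c] bm_const, of "\<lambda>x. strip sm (x, 0)"]) (simp_all add: strip_def set_int_def)
qed

text \<open>The second component of a vector potential whose curl has third component f.\<close>

definition xprim :: "(plane \<Rightarrow> real) \<Rightarrow> plane \<Rightarrow> real" where
  "xprim f p = (LBINT u:{..fst p}. f (u, snd p))"

lemma xprim_bm:
  assumes f: "f \<in> Bor" "\<And>p. \<bar>f p\<bar> \<le> K" "\<And>p. fst p \<notin> {0..1} \<Longrightarrow> f p = 0"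
  shows "bm (xprim f)"
proof (rule bmI[of _ K])
  define h where "h q = ind {q :: plane \<times> real. snd q \<le> fst (fst q)} q * f (snd q, snd (fst q))" for q
  have h: "h \<in> Bor"
  proof -
   have [measurable]: "(\<lambda>q :: plane \<times> real. f (snd q, snd (fst q))) \<in> Bor"
    by (rule measurable_compose[OF _ f(1)]) (intro Bor_contI continuous_intros)
   show ?thesis unfolding h_def[abs_def] by (intro borel_measurable_times borel_measurable_indicator) measurable
  qed
  have "(LINT u|lborel. h (p, u)) = xprim f p" for p
   unfolding xprim_def set_int_def by (intro int_cong) (auto simp: h_def indicator_def)
  with borel_param_integral[OF h] show "xprim f \<in> Bor" by (simp add: fun_eq_iff[symmetric] cong: measurable_cong)
  fix p
  have K0: "0 \<le> K" using f(2)[of undefined] by linarith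
  have m: "(\<lambda>u. ind {..fst p} u *\<^sub>R f (u, snd p)) \<in> Bor"
   by (intro borel_measurable_scaleR borel_measurable_indicator measurable_compose[OF _ f(1)]
     Bor_contI) (auto intro!: continuous_intros)
  have le: "\<bar>ind {..fst p} u *\<^sub>R f (u, snd p)\<bar> \<le> K * ind {0..1::real} u" for u
   using f(2)[of "(u, snd p)"] f(3)[of "(u, snd p)"] K0 by (auto simp: indicator_def)
  have "\<bar>xprim f p\<bar> \<le> (LINT u|lborel. \<bar>ind {..fst p} u *\<^sub>R f (u, snd p)\<bar>)"
   unfolding xprim_def set_int_def by (rule integral_abs_bound)
  also have "\<dots> \<le> (LINT u|lborel. K * ind {0..1::real} u)"
  proof (rule int_mono)
   show "integrable lborel (\<lambda>u. \<bar>ind {..fst p} u *\<^sub>R f (u, snd p)\<bar>)"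
    by (rule integrable_abs, rule integrable_bdd[OF m, of "K" "{0..1}"])
     (use f(2) f(3)[of "(_, snd p)"] K0 in \<open>auto simp: indicator_def\<close>)
   show "integrable lborel (\<lambda>u. K * ind {0..1::real} u)" by simp
  qed (rule le)
  also have "\<dots> = K" by simp
  finally show "\<bar>xprim f p\<bar> \<le> K" .
qed

lemma slice_borel:
  fixes f :: "plane \<Rightarrow> real"
  assumes "f \<in> Bor"
  shows "(\<lambda>u. f (u, y)) \<in> Bor"
  by (rule measurable_compose[OF _ assms]) (intro Bor_contI continuous_intros)

text \<open>By Fubini's theorem the adjoint of integration from the left is integration from the
  right. As V has zero integral on the line, its integral from the right is minus the one from the
  left, which is G.\<close>

lemma xprim_dual:
  fixes f V G :: "plane \<Rightarrow> real"
  assumes f: "f \<in> Bor" "\<And>p. \<bar>f p\<bar> \<le> K" "\<And>p. p \<notin> {0..1} \<times> {0..1} \<Longrightarrow> f p = 0"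
   and V: "V \<in> Bor" "\<And>p. \<bar>V p\<bar> \<le> K" "\<And>p. p \<notin> {0..1} \<times> {0..1} \<Longrightarrow> V p = 0"
   and G: "\<And>x y. G (x, y) = - (LBINT u:{..x}. V (u, y))" "\<And>y. (LBINT u. V (u, y)) = 0"
    "G \<in> Bor" "\<And>p. \<bar>G p\<bar> \<le> K"
  shows "(LINT p|lborel. xprim f p * V p) = (LINT p|lborel. G p * f p)"
proof -
  have K0: "0 \<le> K" using f(2)[of undefined] by linarith
  have bd: "bounded ({0..1::real} \<times> {0..1::real})" by (intro bounded_Times compact_imp_bounded[OF compact_Icc])
  have sub: "fst p \<notin> {0..1} \<Longrightarrow> f p = 0" for p using f(3)[of p] by (auto simp: mem_Times_iff)
  have bxV: "bm (\<lambda>p. xprim f p * V p)" by (rule bm_mult[OF xprim_bm[OF f(1,2) sub] bmI[OF V(1,2)]])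
  have i1: "integrable lborel (\<lambda>p. xprim f p * V p)"
  proof -
   obtain L where "\<And>p. \<bar>xprim f p * V p\<bar> \<le> L" using bxV unfolding bm_def by blast
   thus ?thesis by (rule integrable_bdd[OF bm_borel[OF bxV] _ bd]) (use V(3) in simp)
  qed
  have bGf: "bm (\<lambda>p. G p * f p)" by (rule bm_mult[OF bmI[OF G(3,4)] bmI[OF f(1,2)]])
  have i2: "integrable lborel (\<lambda>p. G p * f p)"
  proof -
   obtain L where "\<And>p. \<bar>G p * f p\<bar> \<le> L" using bGf unfolding bm_def by blast
   thus ?thesis by (rule integrable_bdd[OF bm_borel[OF bGf] _ bd]) (use f(3) in simp)
  qed
  have line: "(LINT x|lborel. xprim f (x, y) * V (x, y)) = (LINT u|lborel. G (u, y) * f (u, y))" for y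
  proof -
   define D where "D = {q :: plane. snd q \<le> fst q}"
   have D: "D \<in> sets borel" unfolding D_def by measurable
   define k where "k q = ind D q * (f (snd q, y) * V (fst q, y))" for q
   have z: "f (u, y) = 0" "V (u, y) = 0" if "u \<notin> {0..1}" for u using f(3)[of "(u, y)"] V(3)[of "(u, y)"] that by auto
   have ki: "integrable lborel k"
   proof (rule integrable_bdd[OF _ _ bd])
    have m: "(\<lambda>q :: plane. f (snd q, y) * V (fst q, y)) \<in> Bor"
     by (intro borel_measurable_times measurable_compose[OF _ f(1)] measurable_compose[OF _ V(1)] Bor_contI continuous_intros)
    show "k \<in> Bor" unfolding k_def[abs_def] by (rule borel_measurable_times[OF borel_measurable_indicator[OF D] m])
    have "\<bar>f (snd q, y) * V (fst q, y)\<bar> \<le> K * K" for q :: "plane" unfolding abs_mult using f(2) V(2) K0 by (intro mult_mono) auto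
    thus "\<bar>k q\<bar> \<le> K * K" for q using K0 by (auto simp: k_def indicator_def)
    show "k q = 0" if "q \<notin> {0..1} \<times> {0..1}" for q using that z[of "fst q"] z[of "snd q"] by (auto simp: k_def mem_Times_iff)
   qed
   have Vi: "integrable lborel (\<lambda>x. V (x, y))"
    by (rule integrable_bdd[OF slice_borel[OF V(1)] V(2) compact_imp_bounded[OF compact_Icc, of 0 1]]) (rule z(2))
   have kL: "(LINT u|lborel. k (x, u)) = xprim f (x, y) * V (x, y)" for x
   proof -
    have "k (x, u) = V (x, y) * (ind {..x} u *\<^sub>R f (u, y))" for u by (auto simp: k_def D_def indicator_def)
    thus ?thesis by (simp add: xprim_def set_int_def mult.commute)
   qed
   have kR: "(LINT x|lborel. k (x, u)) = G (u, y) * f (u, y)" for u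
   proof -
    have "k (x, u) = f (u, y) * (V (x, y) - ind {..<u} x *\<^sub>R V (x, y))" for x by (auto simp: k_def D_def indicator_def)
    hence "(LINT x|lborel. k (x, u)) = f (u, y) * ((LBINT x. V (x, y)) - (LBINT x:{..<u}. V (x, y)))"
     using Vi integrable_mult_indicator[OF _ Vi, of "{..<u}"] by (simp add: set_int_def)
    moreover have "(LBINT x:{..<u}. V (x, y)) = (LBINT x:{..u}. V (x, y))"
     by (rule set_integral_discrete_difference[where X="{u}"]) auto
    ultimately show ?thesis using G by simp
   qed
   show ?thesis using fubini_xy[OF ki] unfolding kL kR by simp
  qed
  show ?thesis unfolding fubini_xy(2)[OF i1] fubini_xy(2)[OF i2] line ..
qed

lemma cell_per_plane:
  assumes k: "bm k" "\<And>p. p \<notin> {0<..<1} \<times> {0<..<1} \<Longrightarrow> k p = 0"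
  shows "(LINT x:torus_cell|lborel. per k x) = (LINT p|lborel. k p)"
proof -
  obtain K where K: "\<And>p. \<bar>k p\<bar> \<le> K" using k(1) unfolding bm_def by blast
  have "ind ({0<..<1} \<times> {0<..<1}) p *\<^sub>R k p = k p" for p using k(2)[of p] by (auto simp: indicator_def)
  thus ?thesis using int_per[OF bm_borel[OF k(1)] K]
   by (simp only: set_int_def[of _ "{0<..<1} \<times> {0<..<1}"])
qed

lemma cell_per_strip:
  assumes sm: "\<And>s. (sm has_real_derivative sm' s) (at s)" "cont sm'"
  shows "(LINT x:torus_cell|lborel. per (strip sm') x) = sm 1 - sm (1/2)"
proof -
  obtain K where K: "\<And>p. \<bar>strip sm' p\<bar> \<le> K" using strip_bm[OF sm(2)] unfolding bm_def by blast
  let ?I = "{0<..<1::real}"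
  define k where "k p = ind (?I \<times> ?I) p *\<^sub>R strip sm' p" for p
  have k: "integrable lborel k"
  proof (rule integrable_bdd)
   show "k \<in> Bor" unfolding k_def[abs_def]
    by (intro borel_measurable_scaleR borel_measurable_indicator bm_borel[OF strip_bm[OF sm(2)]] borel_open open_Times open_greaterThanLessThan)
   show "\<bar>k p\<bar> \<le> max 0 K" for p using K[of p] by (auto simp: k_def indicator_def le_max_iff_disj)
   show "bounded ({0..1::real} \<times> {0..1::real})" by (intro bounded_Times compact_imp_bounded[OF compact_Icc])
  qed (auto simp: k_def indicator_def)
  have kx: "(LINT x|lborel. k (x, y)) = ind ?I y * (sm 1 - sm (1/2))" for y
  proof -
   have "k (x, y) = ind ?I y * (ind {1/2<..<1} x *\<^sub>R sm' x)" for x by (auto simp: k_def indicator_def strip_def)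
   hence "(LINT x|lborel. k (x, y)) = ind ?I y * (LBINT x:{1/2<..<1}. sm' x)" by (simp add: set_int_def)
   thus ?thesis using FTC_Ioo(1)[OF _ sm, of "1/2" 1] by simp
  qed
  have "(LINT x:torus_cell|lborel. per (strip sm') x) = (LINT p|lborel. k p)"
   using int_per[OF bm_borel[OF strip_bm[OF sm(2)]] K] by (simp only: set_int_def[of _ "?I \<times> ?I"] k_def)
  also have "\<dots> = (LINT y|lborel. ind ?I y * (sm 1 - sm (1/2)))" unfolding fubini_xy(2)[OF k] kx ..
  also have "\<dots> = sm 1 - sm (1/2)" by simp
  finally show ?thesis .
qed

text \<open>The stream function is a potential for the planar part and \<open>xprim\<close> of F one
  for the vertical component. Zero integrals on horizontal lines stop \<open>xprim\<close> from
  leaking out of the square to its right, so potentials of different squares do not overlap. The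
  last identity reduces both helicity terms to the integral of \<open>G * F\<close>.\<close>

lemma wave_pot:
  assumes w: "wave (osq c d r) V1 V2 F G" and sub: "osq c d r \<subseteq> {0<..<1} \<times> {0<..<1}"
   and line: "\<And>y. (LBINT x. F (x, y) t) = 0"
  shows "wd 2 G V1" "wd 1 G (\<lambda>p. - V2 p)" "wd 1 (xprim (\<lambda>p. F p t)) (\<lambda>p. F p t)"
   "p \<notin> osq c d r \<Longrightarrow> xprim (\<lambda>p. F p t) p = 0"
   "(LINT p|lborel. xprim (\<lambda>p. F p t) p * V2 p) = (LINT p|lborel. G p * F p t)"
proof -
  note wp = wave_props[OF w]
  obtain K where K: "\<And>p t. \<bar>V1 p\<bar> \<le> K \<and> \<bar>V2 p\<bar> \<le> K \<and> \<bar>G p\<bar> \<le> K \<and> \<bar>F p t\<bar> \<le> K" using wp(12) by blast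
  have G: "G (x, y) = (LBINT u:{..y}. V1 (x, u))" "(LBINT u. V1 (x, u)) = 0" "G (x, y) = - (LBINT u:{..x}. V2 (u, y))" "(LBINT u. V2 (u, y)) = 0" for x y
   using w unfolding wave_def by blast+
  have bV1: "bm V1" and bV2: "bm V2" and bG: "bm G" and bF: "bm (\<lambda>p. F p t)" and bV2': "bm (\<lambda>p. - V2 p)"
   using K bmI[OF wp(3), of K] bmI[OF wp(4), of K] bmI[OF wp(5), of K] bmI[OF wp(7), of t K] bmI[OF borel_measurable_uminus[OF wp(4)], of K] by simp_all
  have out: "p \<notin> osq c d r" if "fst p \<notin> {0<..<1} \<or> snd p \<notin> {0<..<1}" for p using sub that by (auto simp: mem_Times_iff)
  have z: "V1 (x, u) = 0" "V2 (u, x) = 0" "F (u, x) t = 0" if "u \<notin> {0<..<1}" for x u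
   using wp(8)[OF out, of "(x, u)"] wp(9)[OF out, of "(u, x)"] wp(11)[OF out, of "(u, x)"] that by simp_all
  show "wd 2 G V1"
   using halfline_eq[of "\<lambda>u. V1 (_, u)", OF z(1)] G(1,2) by (intro wd_y_I[OF bG bV1, of "\<lambda>_. 0"]) simp_all
  have "(LBINT u:A. - V2 (u, y)) = - (LBINT u:A. V2 (u, y))" for A y by (simp add: set_int_def)
  thus "wd 1 G (\<lambda>p. - V2 p)"
   using halfline_eq[of "\<lambda>u. V2 (u, _)", OF z(2)] G(3,4) by (intro wd_x_I[OF bG bV2', of "\<lambda>_. 0"]) simp_all
  have bX: "bm (xprim (\<lambda>p. F p t))"
   by (rule xprim_bm[of _ K]) (use wp(7) K wp(11)[OF out] in auto)
  show "wd 1 (xprim (\<lambda>p. F p t)) (\<lambda>p. F p t)"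
   using halfline_eq[of "\<lambda>u. F (u, _) t", OF z(3)] line by (intro wd_x_I[OF bX bF, of "\<lambda>_. 0"]) (simp_all add: xprim_def)
  show "(LINT p|lborel. xprim (\<lambda>p. F p t) p * V2 p) = (LINT p|lborel. G p * F p t)"
   by (rule xprim_dual[of _ K]) (use wp(3-7) K G wp(9,11)[OF out] in \<open>auto simp: mem_Times_iff\<close>)
  show "xprim (\<lambda>p. F p t) p = 0" if p: "p \<notin> osq c d r"
  proof -
   have Fz: "F (u, snd p) t = 0" if "(u, snd p) \<notin> osq c d r" for u using wp(11)[OF that] .
   consider "snd p \<notin> {d<..<d+r}" | "fst p \<le> c" | "c + r \<le> fst p" using p by (cases p) force
   thus ?thesis
   proof cases
    case 1
    hence "F (u, snd p) t = 0" for u by (intro Fz) auto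
    thus ?thesis by (simp add: xprim_def set_int_def)
   next
    case 2
    hence "ind {..fst p} u *\<^sub>R F (u, snd p) t = 0" for u using Fz[of u] by (auto simp: indicator_def)
    thus ?thesis by (simp only: xprim_def set_int_def Bochner_Integration.integral_zero)
   next
    case 3
    hence "ind {..fst p} u *\<^sub>R F (u, snd p) t = F (u, snd p) t" for u using Fz[of u] by (auto simp: indicator_def)
    thus ?thesis using line[of "snd p"] by (simp only: xprim_def set_int_def)
   qed
  qed
qed

section \<open>Pairings with space-time test functions\<close>

definition bt :: "(plane \<Rightarrow> real \<Rightarrow> real) \<Rightarrow> bool" where
  "bt k \<longleftrightarrow> bm (\<lambda>z. k (fst z) (snd z))"

text \<open>The integral to which every term of the weak equations reduces, up to the sign in
  \<open>deriv_distr\<close>.\<close>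

definition act :: "real \<Rightarrow> (spacetime \<Rightarrow> real) \<Rightarrow> spacetime \<Rightarrow> (plane \<Rightarrow> real \<Rightarrow> real) \<Rightarrow> real" where
  "act T ph v k = (LINT z:torus_cell \<times> {0<..<T}|lborel. per (\<lambda>p. k p (snd z)) (fst z) * pd v ph z)"

lemma bt_slice: assumes "bt k" shows "bm (\<lambda>p. k p t)"
proof -
  have "(\<lambda>p :: plane. (p, t)) \<in> Bor"
   by (intro Bor_contI continuous_intros)
  from measurable_compose[OF this bm_borel] show ?thesis using assms unfolding bt_def bm_def by fastforce
qed

lemma bt_const: assumes "bm k" shows "bt (\<lambda>p t. k p)"
proof -
  have "(fst :: plane \<times> real \<Rightarrow> _) \<in> Bor"
   by (intro Bor_contI continuous_intros)
  from measurable_compose[OF this bm_borel[OF assms]] show ?thesis using assms unfolding bt_def bm_def by blast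
qed

lemma bt_mult: "bt k \<Longrightarrow> bt l \<Longrightarrow> bt (\<lambda>p t. k p t * l p t)"
  unfolding bt_def by (rule bm_mult)

lemma bt_lincomb: "bt k \<Longrightarrow> bt l \<Longrightarrow> bt (\<lambda>p t. a * k p t + b * l p t)"
  unfolding bt_def by (rule bm_lincomb)

lemma test_smooth: "ph \<in> spacetime_tests T \<Longrightarrow> smooth ph"
  by (auto simp: spacetime_tests_def tests_supported_in_def)

lemma act_props:
  fixes T :: real
  assumes k: "bt k" and ph: "smooth ph"
  shows "(\<lambda>z. per (\<lambda>p. k p (snd z)) (fst z) * pd v ph z) \<in> Bor"
   and "\<exists>K. \<forall>x\<in>torus_cell. \<forall>t\<in>{0<..<T}. \<bar>per (\<lambda>p. k p (snd (x, t))) (fst (x, t)) * pd v ph (x, t)\<bar> \<le> K"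
   and "set_integrable lborel (torus_cell \<times> {0<..<T}) (\<lambda>z. per (\<lambda>p. k p (snd z)) (fst z) * pd v ph z)"
proof -
  obtain K where K: "\<And>p t. \<bar>k p t\<bar> \<le> K" using k unfolding bt_def bm_def by auto
  hence K0: "0 \<le> K" using K[of undefined undefined] by linarith
  obtain L where L: "\<And>x t. x \<in> torus_cell \<Longrightarrow> t \<in> {0<..<T} \<Longrightarrow> \<bar>pd v ph (x, t)\<bar> \<le> L"
   by (rule spacetime_bound[OF smooth_continuous[OF smooth_pd[OF ph]]]) blast
  show m: "(\<lambda>z. per (\<lambda>p. k p (snd z)) (fst z) * pd v ph z) \<in> Bor"
   using k unfolding bt_def by (intro borel_measurable_times per_t_borel bm_borel smooth_borel smooth_pd ph)
  have b: "\<bar>per (\<lambda>p. k p (snd (x, t))) (fst (x, t)) * pd v ph (x, t)\<bar> \<le> K * L" if "x \<in> torus_cell" "t \<in> {0<..<T}" for x t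
   unfolding abs_mult by (rule mult_mono) (use K K0 L[OF that] in \<open>auto simp: per_def\<close>)
  thus "\<exists>K. \<forall>x\<in>torus_cell. \<forall>t\<in>{0<..<T}. \<bar>per (\<lambda>p. k p (snd (x, t))) (fst (x, t)) * pd v ph (x, t)\<bar> \<le> K" by blast
  show "set_integrable lborel (torus_cell \<times> {0<..<T}) (\<lambda>z. per (\<lambda>p. k p (snd z)) (fst z) * pd v ph z)"
   by (rule spacetime_int(1)[OF m b])
qed

lemma act_lincomb:
  assumes "bt k" "bt l" "smooth ph"
  shows "act T ph v (\<lambda>p t. a * k p t + b * l p t) = a * act T ph v k + b * act T ph v l"
proof -
  have "per (\<lambda>p. a * k p (snd z) + b * l p (snd z)) (fst z) * pd v ph z =
   a * (per (\<lambda>p. k p (snd z)) (fst z) * pd v ph z) + b * (per (\<lambda>p. l p (snd z)) (fst z) * pd v ph z)" for z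
   by (simp add: per_def algebra_simps)
  thus ?thesis using act_props(3)[OF assms(1,3), of T v] act_props(3)[OF assms(2,3), of T v]
   unfolding act_def by (simp add: set_integral_add)
qed

lemma act_iterated:
  assumes "bt k" "smooth ph"
  shows "act T ph v k = (LINT x:torus_cell|lborel. LINT t:{0<..<T}|lborel. per (\<lambda>p. k p t) x * pd v ph (x, t))"
proof -
  obtain K where "\<And>x t. x \<in> torus_cell \<Longrightarrow> t \<in> {0<..<T} \<Longrightarrow> \<bar>per (\<lambda>p. k p (snd (x, t))) (fst (x, t)) * pd v ph (x, t)\<bar> \<le> K"
   using act_props(2)[OF assms, of T v] by blast
  from spacetime_int(3)[OF act_props(1)[OF assms] this] show ?thesis unfolding act_def fst_conv snd_conv .
qed

lemma act_time:
  assumes T: "0 < T" and k: "bm k" and ph: "ph \<in> spacetime_tests T"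
  shows "act T ph time_dir (\<lambda>p t. k p) = 0"
proof -
  have s: "smooth ph" by (rule test_smooth[OF ph])
  have z: "ph (x, 0) = 0" "ph (x, T) = 0" for x
   using ph T by (auto simp: spacetime_tests_def tests_supported_in_def) (meson atLeastAtMost_iff not_le order_less_le_trans)+
  have "(LBINT t:{0<..<T}. pd time_dir ph (x, t)) = ph (x, T) - ph (x, 0)" for x
  proof (rule FTC_Ioo(1))
   show "((\<lambda>t. ph (x, t)) has_real_derivative pd time_dir ph (x, t)) (at t)" for t
    using smooth_line[OF s, of "(x, 0)" time_dir t] by (simp add: time_dir_def)
   show "cont (\<lambda>t. pd time_dir ph (x, t))"
    by (rule continuous_on_compose2[OF smooth_continuous[OF smooth_pd[OF s], of UNIV]]) (auto intro!: continuous_intros)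
  qed (use T in simp)
  thus ?thesis unfolding act_iterated[OF bt_const[OF k] s] by (simp add: z set_int_def)
qed

text \<open>Slices of a space-time test function at fixed time are test functions on the torus, so
  an identity on each slice can be integrated over t. Two directions are treated together because
  only their sum has to vanish.\<close>

lemma act_space:
  assumes k: "bt k" "bt l" and ph: "ph \<in> spacetime_tests T"
   and z: "\<And>t ps. ps \<in> torus_tests \<Longrightarrow> (LINT x:torus_cell|lborel. per (\<lambda>p. k p t) x * pd (axis i 1) ps x) +
    (LINT x:torus_cell|lborel. per (\<lambda>p. l p t) x * pd (axis j 1) ps x) = 0"
  shows "act T ph (space_dir i) k + act T ph (space_dir j) l = 0"
proof -
  let ?f = "\<lambda>z. per (\<lambda>p. k p (snd z)) (fst z) * pd (space_dir i) ph z + per (\<lambda>p. l p (snd z)) (fst z) * pd (space_dir j) ph z"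
  have s: "smooth ph" by (rule test_smooth[OF ph])
  obtain K where K: "\<And>x t. x \<in> torus_cell \<Longrightarrow> t \<in> {0<..<T} \<Longrightarrow> \<bar>per (\<lambda>p. k p (snd (x, t))) (fst (x, t)) * pd (space_dir i) ph (x, t)\<bar> \<le> K"
   using act_props(2)[OF k(1) s, of T "space_dir i"] by blast
  obtain L where L: "\<And>x t. x \<in> torus_cell \<Longrightarrow> t \<in> {0<..<T} \<Longrightarrow> \<bar>per (\<lambda>p. l p (snd (x, t))) (fst (x, t)) * pd (space_dir j) ph (x, t)\<bar> \<le> L"
   using act_props(2)[OF k(2) s, of T "space_dir j"] by blast
  have "act T ph (space_dir i) k + act T ph (space_dir j) l = (LINT z:torus_cell \<times> {0<..<T}|lborel. ?f z)"
   unfolding act_def by (rule set_integral_add(2)[symmetric, OF act_props(3)[OF k(1) s] act_props(3)[OF k(2) s]])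
  also have "\<dots> = (LINT t:{0<..<T}|lborel. LINT x:torus_cell|lborel. ?f (x, t))"
  proof (rule spacetime_int(2)[where K="K + L"])
   show "?f \<in> Bor" by (intro borel_measurable_add act_props(1) k s)
   show "\<bar>?f (x, t)\<bar> \<le> K + L" if "x \<in> torus_cell" "t \<in> {0<..<T}" for x t using K[OF that] L[OF that] by linarith
  qed
  also have "\<dots> = (LINT t:{0<..<T}|lborel. 0)"
  proof -
   have "(LINT x:torus_cell|lborel. ?f (x, t)) = 0" for t
   proof -
    note sl = spacetime_slice[OF ph, of t]
    have pdx: "pd (space_dir i) ph (x, t) = pd (axis i 1) (\<lambda>x. ph (x, t)) x" for i x by (simp add: sl(2) space_dir_def)
    show ?thesis using z[OF sl(1), of t] set_integral_add(2)[OF bm_cell[OF bm_per[OF bt_slice[OF k(1), of t]] tests_continuous(2)[OF sl(1), of "axis i 1"]]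
      bm_cell[OF bm_per[OF bt_slice[OF k(2), of t]] tests_continuous(2)[OF sl(1), of "axis j 1"]]]
     unfolding pdx fst_conv snd_conv by simp
   qed
   thus ?thesis by simp
  qed
  finally show ?thesis by (simp add: set_int_def)
qed

text \<open>In the nonintegrable case the integral is 0 by convention, so the bound holds for every
  such g.\<close>

lemma abs_set_integral_le:
  fixes g :: "real \<Rightarrow> real"
  assumes ab: "a \<le> b" and g: "\<And>t. t \<in> {a<..<b} \<Longrightarrow> \<bar>g t\<bar> \<le> K" and K: "0 \<le> K"
  shows "\<bar>LBINT t:{a<..<b}. g t\<bar> \<le> K * (b - a)"
proof (cases "integrable lborel (\<lambda>t. ind {a<..<b} t *\<^sub>R g t)")
  case True
  have "\<bar>LBINT t:{a<..<b}. g t\<bar> \<le> (LBINT t. \<bar>ind {a<..<b} t *\<^sub>R g t\<bar>)"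
   unfolding set_int_def by (rule integral_abs_bound)
  also have "\<dots> \<le> (LBINT t. K * ind {a<..<b} t)"
  proof (rule int_mono)
   show "integrable lborel (\<lambda>t. K * ind {a<..<b} t)" using ab by simp
   show "\<bar>ind {a<..<b} t *\<^sub>R g t\<bar> \<le> K * ind {a<..<b} t" for t using g[of t] K by (auto simp: indicator_def)
  qed (rule integrable_abs[OF True])
  also have "\<dots> = K * (b - a)" using ab by simp
  finally show ?thesis .
next
  case False
  thus ?thesis using ab K by (simp add: set_int_def not_integrable_integral_eq)
qed

lemma act_z:
  assumes "bt k" "ph \<in> spacetime_tests T"
  shows "act T ph (space_dir 3) k = 0"
proof -
  have z: "bt (\<lambda>p t. 0)" by (rule bt_const[OF bm_const])
  have "wd 3 (\<lambda>p. k p t) (\<lambda>_. 0)" for t by (rule wd_z_I[OF bt_slice[OF assms(1)] bm_const]) simp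
  hence "act T ph (space_dir 3) k + act T ph (space_dir 3) (\<lambda>p t. 0) = 0"
   by (intro act_space[OF assms(1) z assms(2)]) (simp add: wd_def per_def set_int_def)
  thus ?thesis by (simp add: act_def per_def set_int_def)
qed

lemma slice_test3:
  assumes ph: "smooth (ph :: spacetime \<Rightarrow> real)"
  shows "test3 (\<lambda>q. ph (ins 3 s (fst q, fst (snd q)), snd (snd q))) (\<lambda>q. pd (space_dir 1) ph (ins 3 s (fst q, fst (snd q)), snd (snd q)))
   (\<lambda>q. pd (space_dir 2) ph (ins 3 s (fst q, fst (snd q)), snd (snd q))) (\<lambda>q. pd time_dir ph (ins 3 s (fst q, fst (snd q)), snd (snd q)))"
proof -
  define A where "A q = (ins 3 s (fst q, fst (snd q)), snd (snd q))" for q :: "real \<times> real \<times> real"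
  have A: "A q = (s *\<^sub>R axis 3 1, 0) + fst q *\<^sub>R space_dir 1 + fst (snd q) *\<^sub>R space_dir 2 + snd (snd q) *\<^sub>R time_dir" for q
   unfolding A_def by (simp add: space_dir_def time_dir_def vec_eq_iff forall_3 ins3 axis_def)
  have dA: "(A has_derivative (\<lambda>h. fst h *\<^sub>R space_dir 1 + fst (snd h) *\<^sub>R space_dir 2 + snd (snd h) *\<^sub>R time_dir)) (at q)" for q
   unfolding A[abs_def] by (auto intro!: derivative_eq_intros)
  have cA: "cont A" unfolding A[abs_def] by (intro continuous_intros)
  have "((\<lambda>q. ph (A q)) has_derivative (\<lambda>(a, b, c). a * pd (space_dir 1) ph (A q) + b * pd (space_dir 2) ph (A q) + c * pd time_dir ph (A q))) (at q)" for q
  proof -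
   have lin: "linear (frechet_derivative ph (at (A q)))"
    by (rule linear_frechet_derivative[OF differentiableI[OF smooth_has_derivative[OF ph]]])
   have "(\<lambda>h. frechet_derivative ph (at (A q)) (fst h *\<^sub>R space_dir 1 + fst (snd h) *\<^sub>R space_dir 2 + snd (snd h) *\<^sub>R time_dir)) =
    (\<lambda>(a, b, c). a * pd (space_dir 1) ph (A q) + b * pd (space_dir 2) ph (A q) + c * pd time_dir ph (A q))"
    by (simp add: fun_eq_iff linear_add[OF lin] linear_scale[OF lin])
   thus ?thesis using has_derivative_compose[OF dA smooth_has_derivative[OF ph], of q] by simp
  qed
  moreover have "cont (\<lambda>q. pd v ph (A q))" for v
   by (rule continuous_on_compose2[OF smooth_continuous[OF smooth_pd[OF ph], of UNIV] cA]) simp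
  ultimately show ?thesis unfolding test3_def A_def by blast
qed

lemma wave_bt:
  assumes "wave S V1 V2 F G"
  shows "bm V1" "bm V2" "bm G" "bt F"
proof -
  obtain K where "\<And>p t. \<bar>V1 p\<bar> \<le> K \<and> \<bar>V2 p\<bar> \<le> K \<and> \<bar>G p\<bar> \<le> K \<and> \<bar>F p t\<bar> \<le> K" using wave_props(12)[OF assms] by blast
  thus "bm V1" "bm V2" "bm G" "bt F" unfolding bt_def using wave_props(3-6)[OF assms] by (blast intro: bmI)+
qed

lemma wave_transport:
  assumes "wave S V1 V2 F G" "test3 ph phx phy pht" "\<And>x y t. t \<notin> {a..b} \<Longrightarrow> ph (x, y, t) = 0"
  shows "(LINT p|lborel. LINT t|lborel. F p t * (pht (fst p, snd p, t) + V1 p * phx (fst p, snd p, t) + V2 p * phy (fst p, snd p, t))) = 0"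
proof -
  have "\<forall>ph phx phy pht a b. test3 ph phx phy pht \<longrightarrow> (\<forall>x y t. t \<notin> {a..b} \<longrightarrow> ph (x, y, t) = 0) \<longrightarrow>
     (LINT p|lborel. LINT t|lborel. F p t * (pht (fst p, snd p, t) + V1 p * phx (fst p, snd p, t) + V2 p * phy (fst p, snd p, t))) = 0"
   using assms(1) unfolding wave_def by (elim conjE)
  from this[rule_format, OF assms(2), of a b] assms(3) show ?thesis by blast
qed

text \<open>For fixed third coordinate the test function becomes a planar one by
  \<open>slice_test3\<close>, and the transport equation of the wave holds on the slice; integrating
  over that coordinate gives the torus. The passage between the whole plane and the cell, and
  between all times and \<open>{0<..<T}\<close>, rests on the supports of F and of the test
  function.\<close>

lemma act_wave:
  assumes w: "wave S V1 V2 F G" and S: "S \<subseteq> {0<..<1} \<times> {0<..<1}" and T: "0 < T" and ph: "ph \<in> spacetime_tests T"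
  shows "act T ph time_dir F + act T ph (space_dir 1) (\<lambda>p t. F p t * V1 p) + act T ph (space_dir 2) (\<lambda>p t. F p t * V2 p) = 0"
proof -
  have s: "smooth ph" by (rule test_smooth[OF ph])
  obtain a b where ab: "0 < a" "b < T" "\<And>x t. t \<notin> {a..b} \<Longrightarrow> ph (x, t) = 0"
   using ph unfolding spacetime_tests_def tests_supported_in_def by blast
  note bw = wave_bt[OF w]
  have b1: "bt (\<lambda>p t. F p t * V1 p)" and b2: "bt (\<lambda>p t. F p t * V2 p)" by (intro bt_mult bw bt_const)+
  define f where "f z = per (\<lambda>p. F p (snd z)) (fst z) * pd time_dir ph z + per (\<lambda>p. F p (snd z) * V1 p) (fst z) * pd (space_dir 1) ph z
   + per (\<lambda>p. F p (snd z) * V2 p) (fst z) * pd (space_dir 2) ph z" for z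
  have fm: "f \<in> Bor"
   unfolding f_def[abs_def] by (rule borel_measurable_add[OF borel_measurable_add[OF act_props(1)[OF bw(4) s] act_props(1)[OF b1 s]] act_props(1)[OF b2 s]])
  obtain K where K: "0 \<le> K" "\<And>x t. x \<in> torus_cell \<Longrightarrow> t \<in> {0<..<T} \<Longrightarrow> \<bar>f (x, t)\<bar> \<le> K"
  proof -
   obtain K0 where K0: "\<And>x t. x \<in> torus_cell \<Longrightarrow> t \<in> {0<..<T} \<Longrightarrow> \<bar>per (\<lambda>p. F p (snd (x, t))) (fst (x, t)) * pd time_dir ph (x, t)\<bar> \<le> K0"
    using act_props(2)[OF bw(4) s, of T time_dir] by blast
   obtain K1 where K1: "\<And>x t. x \<in> torus_cell \<Longrightarrow> t \<in> {0<..<T} \<Longrightarrow> \<bar>per (\<lambda>p. F p (snd (x, t)) * V1 p) (fst (x, t)) * pd (space_dir 1) ph (x, t)\<bar> \<le> K1"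
    using act_props(2)[OF b1 s, of T "space_dir 1"] by blast
   obtain K2 where K2: "\<And>x t. x \<in> torus_cell \<Longrightarrow> t \<in> {0<..<T} \<Longrightarrow> \<bar>per (\<lambda>p. F p (snd (x, t)) * V2 p) (fst (x, t)) * pd (space_dir 2) ph (x, t)\<bar> \<le> K2"
    using act_props(2)[OF b2 s, of T "space_dir 2"] by blast
   show ?thesis
   proof (rule that[of "max 0 (K0 + K1 + K2)"])
    show "\<bar>f (x, t)\<bar> \<le> max 0 (K0 + K1 + K2)" if "x \<in> torus_cell" "t \<in> {0<..<T}" for x t
     using K0[OF that] K1[OF that] K2[OF that] unfolding f_def by linarith
   qed simp
  qed
  define h where "h x = (LINT t:{0<..<T}|lborel. f (x, t))" for x
  have "act T ph time_dir F + act T ph (space_dir 1) (\<lambda>p t. F p t * V1 p) + act T ph (space_dir 2) (\<lambda>p t. F p t * V2 p) =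
    (LINT z:torus_cell \<times> {0<..<T}|lborel. f z)"
   using act_props(3)[OF bw(4) s, of T time_dir] act_props(3)[OF b1 s, of T "space_dir 1"] act_props(3)[OF b2 s, of T "space_dir 2"]
   unfolding act_def f_def by (simp add: set_integral_add)
  also have "\<dots> = (LINT x:torus_cell|lborel. h x)" unfolding h_def by (rule spacetime_int(3)[OF fm K(2)])
  also have "\<dots> = (LINT s:{0<..<1}|lborel. LINT p:{0<..<1}\<times>{0<..<1}|lborel. h (ins 3 s p))"
  proof (rule int_ins(2)[where K="K * T"])
   show "h \<in> Bor"
   proof -
    have D: "UNIV \<times> {0<..<T} \<in> sets (borel :: spacetime measure)" by (intro borel_open open_Times) auto
    have "(\<lambda>z. ind (UNIV \<times> {0<..<T}) z * f z) \<in> Bor" by (rule borel_measurable_times[OF borel_measurable_indicator[OF D] fm])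
    moreover have "ind (UNIV \<times> {0<..<T}) z = ind {0<..<T} (snd z)" for z :: spacetime by (cases z) (simp add: indicator_def)
    ultimately have "(\<lambda>z. ind {0<..<T} (snd z) *\<^sub>R f z) \<in> Bor" by simp
    from borel_param_integral[OF this] show ?thesis unfolding h_def[abs_def] set_int_def by simp
   qed
   show "\<bar>h x\<bar> \<le> K * T" if "x \<in> box 0 1" for x
    using abs_set_integral_le[of 0 T "\<lambda>t. f (x, t)" K] K that T box_subset_cbox[of 0 "1 :: real^3"] unfolding h_def torus_cell_def by auto
  qed
  also have "\<dots> = (LINT s:{0<..<1::real}|lborel. (0::real))"
   unfolding set_int_def[of _ "{0<..<1}"]
  proof (rule int_cong[OF refl])
   fix r :: real
   show "ind {0<..<1} r *\<^sub>R (LINT p:{0<..<1}\<times>{0<..<1}|lborel. h (ins 3 r p)) = ind {0<..<1} r *\<^sub>R 0"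
   proof (cases "r \<in> {0<..<1}")
    case True
    note t3 = slice_test3[OF s, of r]
    let ?d = "\<lambda>v p t. pd v ph (ins 3 r p, t)"
    have supp: "?d (space_dir 1) p t = 0" "?d (space_dir 2) p t = 0" "?d time_dir p t = 0" if "t \<notin> {a..b}" for p t
     using test3_supp[OF t3 _ that, of "fst p" "snd p"] ab(3) by simp_all
    have "(LINT p|lborel. LINT t|lborel. F p t * (?d time_dir p t + V1 p * ?d (space_dir 1) p t + V2 p * ?d (space_dir 2) p t)) = 0"
    proof -
     have "ph (ins 3 r (fst (x, y, t), fst (snd (x, y, t))), snd (snd (x, y, t))) = 0" if "t \<notin> {a..b}" for x y t
      using ab(3)[OF that] by simp
     from wave_transport[OF w t3 this]
     have "(LINT p|lborel. LINT t|lborel. F p t * (?d time_dir (fst p, snd p) t + V1 p * ?d (space_dir 1) (fst p, snd p) t + V2 p * ?d (space_dir 2) (fst p, snd p) t)) = 0"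
      unfolding fst_conv snd_conv .
     thus ?thesis by simp
    qed
    moreover have "ind ({0<..<1} \<times> {0<..<1}) p *\<^sub>R h (ins 3 r p) =
      (LINT t|lborel. F p t * (?d time_dir p t + V1 p * ?d (space_dir 1) p t + V2 p * ?d (space_dir 2) p t))" for p
    proof (cases "p \<in> {0<..<1} \<times> {0<..<1}")
     case p: True
     have "ind {0<..<T} t *\<^sub>R f (ins 3 r p, t) = F p t * (?d time_dir p t + V1 p * ?d (space_dir 1) p t + V2 p * ?d (space_dir 2) p t)" for t
     proof (cases "t \<in> {0<..<T}")
      case False
      hence "t \<notin> {a..b}" using ab by auto
      from supp[OF this, of p] False show ?thesis by simp
     qed (simp add: f_def per_ins(3)[OF True p] algebra_simps)
     thus ?thesis using p by (simp add: h_def set_int_def)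
    next
     case False
     hence "F p t = 0" for t using wave_props(11)[OF w] S by blast
     thus ?thesis using False by simp
    qed
    ultimately show ?thesis by (simp add: set_int_def)
   qed simp
  qed
  finally show ?thesis by (simp add: set_int_def)
qed

section \<open>Vector potentials\<close>

text \<open>The arithmetic-geometric mean inequality with weight \<open>2 ^ n\<close>; after
  integration it turns an L^2 bound \<open>(1/4) ^ n\<close> into an L^1 bound of order
  \<open>(1/2) ^ n\<close>.\<close>

lemma norm_le_weighted: "norm x \<le> (2 ^ n * (norm x)\<^sup>2 + (1/2) ^ n) / 2"
proof -
  have "0 \<le> (2 ^ n * norm x - 1)\<^sup>2" by simp
  hence "2 * 2 ^ n * norm x \<le> (2 ^ n)\<^sup>2 * (norm x)\<^sup>2 + 1" by (simp add: power2_diff power_mult_distrib)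
  hence "2 * 2 ^ n * norm x \<le> 2 ^ n * (2 ^ n * (norm x)\<^sup>2 + (1/2) ^ n)" by (simp add: algebra_simps power2_eq_square flip: power_mult_distrib)
  hence "2 ^ n * (2 * norm x) \<le> 2 ^ n * (2 ^ n * (norm x)\<^sup>2 + (1/2) ^ n)" by (simp add: mult_ac)
  thus ?thesis by simp
qed

lemma (in finite_measure) L1_of_L2:
  fixes d :: "'a \<Rightarrow> 'b::{banach, second_countable_topology}"
  assumes d: "d \<in> borel_measurable M" "integrable M (\<lambda>x. (norm (d x))\<^sup>2)" "(LINT x|M. (norm (d x))\<^sup>2) \<le> (1/4) ^ n"
  shows "integrable M (\<lambda>x. norm (d x))" "(LINT x|M. norm (d x)) \<le> (1 + measure M (space M)) * (1/2) ^ n"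
proof -
  have i: "integrable M (\<lambda>x. (2 ^ n * (norm (d x))\<^sup>2 + (1/2) ^ n) / 2)" using d(2) by simp
  show id: "integrable M (\<lambda>x. norm (d x))"
   by (rule Bochner_Integration.integrable_bound[OF i]) (use d(1) norm_le_weighted[of "d _" n] in \<open>auto intro: AE_I2\<close>)
  have "(LINT x|M. norm (d x)) \<le> (LINT x|M. (2 ^ n * (norm (d x))\<^sup>2 + (1/2) ^ n) / 2)"
   by (rule int_mono[OF id i norm_le_weighted])
  also have "\<dots> = (2 ^ n * (LINT x|M. (norm (d x))\<^sup>2) + (1/2) ^ n * measure M (space M)) / 2"
   using d(2) by simp
  also have "\<dots> \<le> (2 ^ n * (1/4) ^ n + (1/2) ^ n * measure M (space M)) / 2" using d(3) by simp
  also have "2 ^ n * (1/4) ^ n = (1/2 :: real) ^ n" by (simp flip: power_mult_distrib)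
  also have "((1/2) ^ n + (1/2) ^ n * measure M (space M)) / 2 \<le> (1 + measure M (space M)) * (1/2) ^ n"
   by (simp add: field_simps)
  finally show "(LINT x|M. norm (d x)) \<le> (1 + measure M (space M)) * (1/2) ^ n" .
qed

lemma norm_sq_le: "(norm (x + y))\<^sup>2 \<le> 2 * (norm x)\<^sup>2 + 2 * (norm y)\<^sup>2"
proof -
  have "(norm (x + y))\<^sup>2 \<le> (norm x + norm y)\<^sup>2" by (intro power_mono norm_triangle_ineq) simp
  moreover have "0 \<le> (norm x - norm y)\<^sup>2" by simp
  ultimately show ?thesis by (simp add: power2_sum power2_diff)
qed

lemma norm_sq_diff_le: "(norm (x - y))\<^sup>2 \<le> 2 * (norm x)\<^sup>2 + 2 * (norm y)\<^sup>2"
  using norm_sq_le[of x "- y"] by simp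

text \<open>The geometric rate makes the L^1 norms of the increments summable, so the sequence
  itself converges almost everywhere, without passing to a subsequence. The limit can thus be
  written as a pointwise \<open>lim\<close> of the given functions.\<close>

lemma (in finite_measure) L2_limit:
  fixes G :: "nat \<Rightarrow> 'a \<Rightarrow> 'b::{banach, second_countable_topology}"
  assumes G: "\<And>n. G n \<in> borel_measurable M" "\<And>n. integrable M (\<lambda>x. (norm (G n x))\<^sup>2)"
   and cauchy: "\<And>n m. n \<le> m \<Longrightarrow> (LINT x|M. (norm (G n x - G m x))\<^sup>2) \<le> (1/4) ^ n"
  defines "g \<equiv> \<lambda>x. lim (\<lambda>n. G n x)"
  shows "integrable M (\<lambda>x. (norm (g x))\<^sup>2)" "integrable M (\<lambda>x. norm (G n x - g x))"
   "(LINT x|M. norm (G n x - g x)) \<le> (1 + measure M (space M)) * (1/2) ^ n"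
proof -
  note [measurable] = G(1)
  have gm [measurable]: "g \<in> borel_measurable M" unfolding g_def by measurable
  have i2: "integrable M (\<lambda>x. (norm (G n x - G m x))\<^sup>2)" for n m
   by (rule Bochner_Integration.integrable_bound[of M "\<lambda>x. 2 * (norm (G n x))\<^sup>2 + 2 * (norm (G m x))\<^sup>2"])
    (use G norm_sq_diff_le in auto)
  have d: "integrable M (\<lambda>x. norm (G (Suc n) x - G n x))"
   "(LINT x|M. norm (G (Suc n) x - G n x)) \<le> (1 + measure M (space M)) * (1/2) ^ n" for n
   by (rule L1_of_L2; use i2 cauchy[of n "Suc n"] in \<open>simp add: norm_minus_commute\<close>)+
  have "(\<integral>\<^sup>+ x. (\<Sum>n. ennreal (norm (G (Suc n) x - G n x))) \<partial>M) = (\<Sum>n. \<integral>\<^sup>+ x. ennreal (norm (G (Suc n) x - G n x)) \<partial>M)"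
   by (rule nn_integral_suminf) measurable
  also have "\<dots> = (\<Sum>n. ennreal (LINT x|M. norm (G (Suc n) x - G n x)))"
   by (simp add: nn_integral_eq_integral[OF d(1)])
  also have "\<dots> \<le> (\<Sum>n. ennreal ((1 + measure M (space M)) * (1/2) ^ n))"
   by (intro suminf_le ennreal_leI d(2)) auto
  also have "\<dots> = ennreal (\<Sum>n. (1 + measure M (space M)) * (1/2) ^ n)"
   by (intro suminf_ennreal2 summable_mult summable_geometric) auto
  finally have "(\<integral>\<^sup>+ x. (\<Sum>n. ennreal (norm (G (Suc n) x - G n x))) \<partial>M) \<noteq> \<infinity>" by (auto simp: top_unique)
  hence "AE x in M. (\<Sum>n. ennreal (norm (G (Suc n) x - G n x))) \<noteq> \<infinity>"
   by (intro nn_integral_PInf_AE) measurable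
  hence lim: "AE x in M. (\<lambda>n. G n x) \<longlonglongrightarrow> g x"
  proof eventually_elim
   case (elim x)
   hence "summable (\<lambda>n. norm (G (Suc n) x - G n x))" by (intro summable_suminf_not_top) auto
   hence "summable (\<lambda>n. G (Suc n) x - G n x)" by (rule summable_norm_cancel)
   hence "convergent (\<lambda>n. \<Sum>k<n. G (Suc k) x - G k x)" by (simp add: summable_iff_convergent)
   then obtain l where "(\<lambda>n. G n x - G 0 x) \<longlonglongrightarrow> l" unfolding sum_lessThan_telescope[of "\<lambda>n. G n x"] convergent_def by blast
   from tendsto_add[OF this tendsto_const[of "G 0 x"]] have "(\<lambda>n. G n x) \<longlonglongrightarrow> l + G 0 x" by simp
   thus ?case unfolding g_def by (simp add: limI)
  qed
  \<comment> \<open>Fatou's lemma in the second index carries the Cauchy estimate over to the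
    limit.\<close>
  have fatou: "(\<integral>\<^sup>+ x. ennreal ((norm (G n x - g x))\<^sup>2) \<partial>M) \<le> ennreal ((1/4) ^ n)" for n
  proof -
   have "(\<integral>\<^sup>+ x. ennreal ((norm (G n x - g x))\<^sup>2) \<partial>M) = (\<integral>\<^sup>+ x. liminf (\<lambda>m. ennreal ((norm (G n x - G m x))\<^sup>2)) \<partial>M)"
   proof (rule nn_integral_cong_AE)
    show "AE x in M. ennreal ((norm (G n x - g x))\<^sup>2) = liminf (\<lambda>m. ennreal ((norm (G n x - G m x))\<^sup>2))"
     using lim
    proof eventually_elim
     case (elim x)
     have "(\<lambda>m. ennreal ((norm (G n x - G m x))\<^sup>2)) \<longlonglongrightarrow> ennreal ((norm (G n x - g x))\<^sup>2)"
      by (intro tendsto_ennrealI tendsto_power tendsto_norm tendsto_diff tendsto_const elim)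
     from lim_imp_Liminf[OF sequentially_bot this] show ?case ..
    qed
   qed
   also have "\<dots> \<le> liminf (\<lambda>m. \<integral>\<^sup>+ x. ennreal ((norm (G n x - G m x))\<^sup>2) \<partial>M)"
    by (rule nn_integral_liminf) measurable
   also have "\<dots> \<le> liminf (\<lambda>m. ennreal ((1/4) ^ n))"
   proof (rule Liminf_mono)
    show "\<forall>\<^sub>F m in sequentially. (\<integral>\<^sup>+ x. ennreal ((norm (G n x - G m x))\<^sup>2) \<partial>M) \<le> ennreal ((1/4) ^ n)"
     using eventually_ge_at_top[of n]
     by eventually_elim (simp add: nn_integral_eq_integral[OF i2] cauchy ennreal_leI)
   qed
   also have "\<dots> = ennreal ((1/4) ^ n)" by (simp add: Liminf_const)
   finally show ?thesis .
  qed
  have i2g: "integrable M (\<lambda>x. (norm (G n x - g x))\<^sup>2)" for n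
   by (rule integrableI_bounded) (use fatou[of n] in \<open>auto intro: le_less_trans\<close>)
  have "(LINT x|M. (norm (G n x - g x))\<^sup>2) \<le> (1/4) ^ n" for n
   using fatou[of n] by (simp add: nn_integral_eq_integral[OF i2g])
  thus "integrable M (\<lambda>x. norm (G n x - g x))" "(LINT x|M. norm (G n x - g x)) \<le> (1 + measure M (space M)) * (1/2) ^ n"
   using L1_of_L2[of "\<lambda>x. G n x - g x" n] i2g by auto
  show "integrable M (\<lambda>x. (norm (g x))\<^sup>2)"
  proof (rule Bochner_Integration.integrable_bound[of M "\<lambda>x. 2 * (norm (G 0 x))\<^sup>2 + 2 * (norm (G 0 x - g x))\<^sup>2"])
   have "(norm (g x))\<^sup>2 \<le> 2 * (norm (G 0 x))\<^sup>2 + 2 * (norm (G 0 x - g x))\<^sup>2" for x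
    using norm_sq_diff_le[of "G 0 x" "G 0 x - g x"] by simp
   thus "AE x in M. norm ((norm (g x))\<^sup>2) \<le> norm (2 * (norm (G 0 x))\<^sup>2 + 2 * (norm (G 0 x - g x))\<^sup>2)"
    by (intro AE_I2) simp
  qed (use G(2) i2g in auto)
qed

section \<open>Projection onto gradients\<close>

abbreviation cm :: "(real^3) measure" where
  "cm \<equiv> restrict_space lborel torus_cell"

lemma cell_borel: "torus_cell \<in> sets borel"
  by (simp add: torus_cell_def)

lemma space_cm: "space cm = torus_cell"
  by (simp add: space_restrict_space)

lemma finite_cm: "finite_measure cm"
  using emeasure_lborel_cbox_finite[of 0 "1 :: real^3"]
  by (intro finite_measureI) (simp add: emeasure_restrict_space space_cm cell_borel torus_cell_def less_top[symmetric])

lemma cm_integral: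
  fixes f :: "real^3 \<Rightarrow> 'b::{banach, second_countable_topology}"
  shows "(LINT x|cm. f x) = (LINT x:torus_cell|lborel. f x)" "integrable cm f \<longleftrightarrow> set_integrable lborel torus_cell f"
  unfolding set_int_def set_integrable_def
  by (simp_all add: integral_restrict_space integrable_restrict_space cell_borel)

lemma cm_borel: "f \<in> Bor \<Longrightarrow> f \<in> borel_measurable cm"
  by (rule measurable_restrict_space1) simp

lemma cm_integrable:
  fixes f :: "real^3 \<Rightarrow> 'b::{banach, second_countable_topology}"
  assumes "f \<in> Bor" "\<And>x. x \<in> torus_cell \<Longrightarrow> norm (f x) \<le> K"
  shows "integrable cm f"
  by (rule finite_measure.integrable_const_bound[OF finite_cm AE_I2 cm_borel[OF assms(1)], of K])
   (use assms(2) in \<open>simp add: space_cm\<close>)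

lemma cell_continuous_bound:
  fixes f :: "real^3 \<Rightarrow> 'b::real_normed_vector"
  assumes "cont f"
  obtains K where "\<And>x. x \<in> torus_cell \<Longrightarrow> norm (f x) \<le> K"
proof -
  have "bounded (f ` torus_cell)" unfolding torus_cell_def
   by (intro compact_imp_bounded compact_continuous_image continuous_on_subset[OF assms]) auto
  then obtain K where "\<forall>y\<in>f ` torus_cell. norm y \<le> K" unfolding bounded_iff ..
  thus ?thesis using that by blast
qed

lemma cm_dot:
  fixes g w :: "real^3 \<Rightarrow> real^3"
  assumes g: "g \<in> Bor" "integrable cm (\<lambda>x. (norm (g x))\<^sup>2)"
   and w: "w \<in> Bor" "\<And>x. x \<in> torus_cell \<Longrightarrow> norm (w x) \<le> L"
  shows "integrable cm (\<lambda>x. g x \<bullet> w x)"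
proof -
  have i: "integrable cm (\<lambda>x. \<bar>L\<bar> * ((norm (g x))\<^sup>2 + 1))"
   by (rule integrable_mult_right[OF Bochner_Integration.integrable_add[OF g(2) finite_measure.integrable_const[OF finite_cm]]])
  show ?thesis
  proof (rule Bochner_Integration.integrable_bound[OF i])
   show "(\<lambda>x. g x \<bullet> w x) \<in> borel_measurable cm" using g(1) w(1) by (intro cm_borel borel_measurable_inner)
   show "AE x in cm. norm (g x \<bullet> w x) \<le> norm (\<bar>L\<bar> * ((norm (g x))\<^sup>2 + 1))"
   proof (rule AE_I2)
    fix x assume "x \<in> space cm"
    hence "norm (w x) \<le> \<bar>L\<bar>" using w(2) by (fastforce simp: space_cm)
    have "norm (g x \<bullet> w x) \<le> norm (g x) * norm (w x)" by (simp add: Cauchy_Schwarz_ineq2)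
    also have "\<dots> \<le> ((norm (g x))\<^sup>2 + 1) * \<bar>L\<bar>"
    proof (rule mult_mono)
     have "norm (g x) * 2 \<le> (norm (g x))\<^sup>2 + 1" using norm_le_weighted[of "g x" 0] by simp
     thus "norm (g x) \<le> (norm (g x))\<^sup>2 + 1" using norm_ge_zero[of "g x"] by linarith
    qed (use \<open>norm (w x) \<le> \<bar>L\<bar>\<close> in auto)
    finally show "norm (g x \<bullet> w x) \<le> norm (\<bar>L\<bar> * ((norm (g x))\<^sup>2 + 1))" by (simp add: mult.commute abs_mult)
   qed
  qed
qed

definition grad :: "(real^3 \<Rightarrow> real) \<Rightarrow> real^3 \<Rightarrow> real^3" where
  "grad ps x = (\<chi> i. pd (axis i 1) ps x)"

lemma grad_continuous: "ps \<in> torus_tests \<Longrightarrow> cont (grad ps)"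
  unfolding grad_def[abs_def] by (intro continuous_on_vec_lambda tests_continuous(2))

lemma grad_borel: "ps \<in> torus_tests \<Longrightarrow> grad ps \<in> Bor"
  by (intro Bor_contI grad_continuous)

lemma grad_periodic: "ps \<in> torus_tests \<Longrightarrow> periodic (grad ps)"
  using pd_periodic[of ps] unfolding torus_tests_def periodic_def grad_def by simp

lemma tests_lincomb:
  assumes "ps \<in> torus_tests" "et \<in> torus_tests"
  shows "(\<lambda>x. a * ps x + b * et x) \<in> torus_tests" "grad (\<lambda>x. a * ps x + b * et x) x = a *\<^sub>R grad ps x + b *\<^sub>R grad et x"
proof -
  have s: "smooth ps" "smooth et" using assms by (auto simp: torus_tests_def)
  thus "(\<lambda>x. a * ps x + b * et x) \<in> torus_tests"
   using assms smooth_lincomb[OF s] by (simp add: torus_tests_def periodic_def)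
  have "\<And>z. ps differentiable (at z)" "\<And>z. et differentiable (at z)"
   by (rule differentiableI[OF smooth_has_derivative[OF s(1)]], rule differentiableI[OF smooth_has_derivative[OF s(2)]])
  hence "pd v (\<lambda>x. a * ps x + b * et x) x = a * pd v ps x + b * pd v et x" for v
   by (rule fun_cong[OF pd_lincomb])
  thus "grad (\<lambda>x. a * ps x + b * et x) x = a *\<^sub>R grad ps x + b *\<^sub>R grad et x"
   by (simp add: grad_def vec_eq_iff)
qed

text \<open>Least squares: g is the limit of a minimising sequence of smooth gradients for the L^2
  distance to A. Minimality gives orthogonality of \<open>A - g\<close> to all gradients, the weak
  form of being divergence free. The last conclusion serves to transfer identities from smooth
  gradients to g.\<close>

lemma helmholtz:
  fixes A :: "real^3 \<Rightarrow> real^3"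
  assumes A: "A \<in> Bor" "\<And>x. norm (A x) \<le> K"
  obtains g pss where "g \<in> Bor" "periodic g" "integrable cm (\<lambda>x. (norm (g x))\<^sup>2)"
   "\<And>n. pss n \<in> torus_tests" "\<And>ps. ps \<in> torus_tests \<Longrightarrow> (LINT x|cm. (A x - g x) \<bullet> grad ps x) = 0"
   "\<And>w L. w \<in> Bor \<Longrightarrow> (\<And>x. x \<in> torus_cell \<Longrightarrow> norm (w x) \<le> L) \<Longrightarrow>
    (\<lambda>n. LINT x|cm. grad (pss n) x \<bullet> w x) \<longlonglongrightarrow> (LINT x|cm. g x \<bullet> w x)"
proof -
  interpret finite_measure cm by (rule finite_cm)
  define D where "D ps = (LINT x|cm. (norm (A x - grad ps x))\<^sup>2)" for ps
  have int: "integrable cm (\<lambda>x. (norm (a *\<^sub>R A x - u x))\<^sup>2)" "integrable cm (\<lambda>x. (a *\<^sub>R A x - u x) \<bullet> v x)"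
   if u: "cont u" and v: "cont v" for a and u v :: "real^3 \<Rightarrow> real^3"
  proof -
   obtain L where L: "\<And>x. x \<in> torus_cell \<Longrightarrow> norm (u x) \<le> L" by (rule cell_continuous_bound[OF u]) blast
   obtain L' where L': "\<And>x. x \<in> torus_cell \<Longrightarrow> norm (v x) \<le> L'" by (rule cell_continuous_bound[OF v]) blast
   have m: "(\<lambda>x. a *\<^sub>R A x - u x) \<in> Bor"
    by (intro borel_measurable_diff borel_measurable_scaleR borel_measurable_const A(1) Bor_contI[OF u])
   have b: "norm (a *\<^sub>R A x - u x) \<le> \<bar>a\<bar> * K + L" if "x \<in> torus_cell" for x
   proof -
    have "norm (a *\<^sub>R A x - u x) \<le> \<bar>a\<bar> * norm (A x) + norm (u x)" using norm_triangle_ineq4[of "a *\<^sub>R A x" "u x"] by simp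
    moreover have "\<bar>a\<bar> * norm (A x) \<le> \<bar>a\<bar> * K" using A(2) by (intro mult_left_mono) auto
    ultimately show ?thesis using L[OF that] by linarith
   qed
   show i2: "integrable cm (\<lambda>x. (norm (a *\<^sub>R A x - u x))\<^sup>2)"
    by (rule cm_integrable[of _ "(\<bar>a\<bar> * K + L)\<^sup>2"]) (use m b in \<open>auto intro: power_mono\<close>)
   show "integrable cm (\<lambda>x. (a *\<^sub>R A x - u x) \<bullet> v x)"
    by (rule cm_dot[OF m i2 Bor_contI[OF v] L'])
  qed
  have iD: "integrable cm (\<lambda>x. (norm (A x - grad ps x))\<^sup>2)" if "ps \<in> torus_tests" for ps
   using int(1)[OF grad_continuous[OF that] grad_continuous[OF that], of 1] by simp
  have zero: "(\<lambda>_. 0) \<in> torus_tests" by (simp add: torus_tests_def smooth_const periodic_def)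
  define m where "m = Inf (D ` torus_tests)"
  have bdd: "bdd_below (D ` torus_tests)" by (rule bdd_belowI[of _ 0]) (auto simp: D_def)
  have m: "m \<le> D ps" if "ps \<in> torus_tests" for ps unfolding m_def using bdd that by (intro cInf_lower) auto
  \<comment> \<open>In the parallelogram law the two slacks enter with factor 2, so the division by
    4 leaves at most \<open>(1/4) ^ n\<close> in total.\<close>
  have "\<exists>ps\<in>torus_tests. D ps < m + (1/4) ^ n / 4" for n
  proof -
   have "Inf (D ` torus_tests) < m + (1/4) ^ n / 4" by (simp add: m_def)
   thus ?thesis using cInf_lessD[of "D ` torus_tests"] zero by blast
  qed
  then obtain pss where pss: "\<And>n. pss n \<in> torus_tests" "\<And>n. D (pss n) < m + (1/4) ^ n / 4" by metis
  have cauchy: "(LINT x|cm. (norm (grad (pss n) x - grad (pss k) x))\<^sup>2) \<le> (1/4) ^ n" if "n \<le> k" for n k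
  proof -
   define et where "et = (\<lambda>x. 1/2 * pss n x + 1/2 * pss k x)"
   have et: "et \<in> torus_tests" "grad et x = (1/2) *\<^sub>R grad (pss n) x + (1/2) *\<^sub>R grad (pss k) x" for x
    unfolding et_def by (rule tests_lincomb[OF pss(1) pss(1)])+
   \<comment> \<open>The parallelogram law for \<open>a - p\<close> and \<open>a - q\<close>; the
     midpoint is again the gradient of a test function, so its distance is at least the
     infimum.\<close>
   have "(norm (p - q))\<^sup>2 = 2 * (norm (a - p))\<^sup>2 + 2 * (norm (a - q))\<^sup>2 - 4 * (norm (a - ((1/2) *\<^sub>R p + (1/2) *\<^sub>R q)))\<^sup>2" for a p q :: "real^3"
    by (simp add: power2_norm_eq_inner algebra_simps inner_commute)
   hence "(LINT x|cm. (norm (grad (pss n) x - grad (pss k) x))\<^sup>2) =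
     (LINT x|cm. 2 * (norm (A x - grad (pss n) x))\<^sup>2 + 2 * (norm (A x - grad (pss k) x))\<^sup>2 - 4 * (norm (A x - grad et x))\<^sup>2)"
    unfolding et(2) by (intro int_cong) auto
   also have "\<dots> = 2 * D (pss n) + 2 * D (pss k) - 4 * D et"
    unfolding D_def by (simp add: iD pss(1) et(1))
   also have "\<dots> \<le> 2 * (m + (1/4) ^ n / 4) + 2 * (m + (1/4) ^ k / 4) - 4 * m"
    by (intro diff_mono add_mono mult_left_mono less_imp_le[OF pss(2)] m[OF et(1)]) simp_all
   also have "\<dots> \<le> (1/4) ^ n"
   proof -
    have le: "2 * (m + a / 4) + 2 * (m + b / 4) - 4 * m \<le> a" if "b \<le> a" for a b :: real using that by (simp add: field_simps)
    show ?thesis by (rule le, rule power_decreasing[OF that]) simp_all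
   qed
   finally show ?thesis .
  qed
  \<comment> \<open>The limit is taken at every point of space, so that Borel measurability and
    periodicity are inherited from the gradients.\<close>
  define g where "g x = lim (\<lambda>n. grad (pss n) x)" for x
  have gm: "g \<in> Bor" unfolding g_def[abs_def]
   by (intro borel_measurable_lim_metric grad_borel pss)
  have gp: "periodic g" using grad_periodic[OF pss(1)] unfolding periodic_def g_def by simp
  have G2: "integrable cm (\<lambda>x. (norm (grad (pss n) x))\<^sup>2)" for n
   using int(1)[OF grad_continuous[OF pss(1)] grad_continuous[OF pss(1)], of 0] by simp
  note L2 = L2_limit[OF cm_borel[OF grad_borel[OF pss(1)]] G2 cauchy, folded g_def]
  have weak: "(\<lambda>n. LINT x|cm. grad (pss n) x \<bullet> w x) \<longlonglongrightarrow> (LINT x|cm. g x \<bullet> w x)"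
   if w: "w \<in> Bor" "\<And>x. x \<in> torus_cell \<Longrightarrow> norm (w x) \<le> L" for w L
  proof -
   let ?C = "1 + measure cm (space cm)"
   have iG: "integrable cm (\<lambda>x. grad (pss n) x \<bullet> w x)" for n by (rule cm_dot[OF grad_borel[OF pss(1)] G2 w])
   have ig: "integrable cm (\<lambda>x. g x \<bullet> w x)" by (rule cm_dot[OF gm L2(1) w])
   have le: "norm ((LINT x|cm. grad (pss n) x \<bullet> w x) - (LINT x|cm. g x \<bullet> w x)) \<le> \<bar>L\<bar> * (?C * (1/2) ^ n)" for n
   proof -
    have "(LINT x|cm. grad (pss n) x \<bullet> w x) - (LINT x|cm. g x \<bullet> w x) = (LINT x|cm. (grad (pss n) x - g x) \<bullet> w x)"
     using iG ig by (simp add: inner_diff_left)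
    also have "norm \<dots> \<le> (LINT x|cm. norm ((grad (pss n) x - g x) \<bullet> w x))" by (rule integral_norm_bound)
    also have "\<dots> \<le> (LINT x|cm. \<bar>L\<bar> * norm (grad (pss n) x - g x))"
    proof (rule int_mono)
     show "integrable cm (\<lambda>x. norm ((grad (pss n) x - g x) \<bullet> w x))" using iG ig by (simp add: inner_diff_left)
     show "integrable cm (\<lambda>x. \<bar>L\<bar> * norm (grad (pss n) x - g x))" using L2(2) by simp
     fix x assume "x \<in> space cm"
     hence "norm (w x) \<le> \<bar>L\<bar>" using w(2) by (fastforce simp: space_cm)
     have "norm ((grad (pss n) x - g x) \<bullet> w x) \<le> norm (grad (pss n) x - g x) * norm (w x)" by (simp add: Cauchy_Schwarz_ineq2)
     also have "\<dots> \<le> norm (grad (pss n) x - g x) * \<bar>L\<bar>" using \<open>norm (w x) \<le> \<bar>L\<bar>\<close> by (intro mult_left_mono) auto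
     finally show "norm ((grad (pss n) x - g x) \<bullet> w x) \<le> \<bar>L\<bar> * norm (grad (pss n) x - g x)" by (simp add: mult.commute)
    qed
    also have "\<dots> \<le> \<bar>L\<bar> * (?C * (1/2) ^ n)" using L2(3)[of n] by (simp add: mult_left_mono)
    finally show ?thesis .
   qed
   have "(\<lambda>n. \<bar>L\<bar> * (?C * (1/2) ^ n)) \<longlonglongrightarrow> \<bar>L\<bar> * (?C * 0)"
    by (intro tendsto_mult tendsto_const LIMSEQ_realpow_zero) auto
   hence "(\<lambda>n. \<bar>L\<bar> * (?C * (1/2) ^ n)) \<longlonglongrightarrow> 0" by simp
   hence "(\<lambda>n. (LINT x|cm. grad (pss n) x \<bullet> w x) - (LINT x|cm. g x \<bullet> w x)) \<longlonglongrightarrow> 0"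
    by (rule Lim_null_comparison[OF always_eventually, rotated]) (intro allI le)
   thus ?thesis by (rule LIM_zero_cancel)
  qed
  have orth: "(LINT x|cm. (A x - g x) \<bullet> grad ps x) = 0" if ps: "ps \<in> torus_tests" for ps
  proof -
   note gc = grad_continuous[OF ps]
   obtain L where L: "\<And>x. x \<in> torus_cell \<Longrightarrow> norm (grad ps x) \<le> L" by (rule cell_continuous_bound[OF gc]) blast
   define N where "N = (LINT x|cm. (norm (grad ps x))\<^sup>2)"
   define c where "c = (LINT x|cm. (A x - g x) \<bullet> grad ps x)"
   have iA: "integrable cm (\<lambda>x. A x \<bullet> grad ps x)" using int(2)[OF continuous_on_const gc, of 1 0] by simp
   have ig: "integrable cm (\<lambda>x. g x \<bullet> grad ps x)" by (rule cm_dot[OF gm L2(1) grad_borel[OF ps] L])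
   have c: "c = (LINT x|cm. A x \<bullet> grad ps x) - (LINT x|cm. g x \<bullet> grad ps x)"
    using iA ig by (simp add: c_def inner_diff_left)
   have key: "0 \<le> - 2 * s * c + s\<^sup>2 * N" for s
   proof (rule LIMSEQ_le_const)
    define cn where "cn n = (LINT x|cm. A x \<bullet> grad ps x) - (LINT x|cm. grad (pss n) x \<bullet> grad ps x)" for n
    have "cn \<longlonglongrightarrow> c" unfolding cn_def c by (intro tendsto_diff tendsto_const weak[OF grad_borel[OF ps] L])
    hence "(\<lambda>n. (1/4) ^ n / 4 - 2 * s * cn n + s\<^sup>2 * N) \<longlonglongrightarrow> 0 / 4 - 2 * s * c + s\<^sup>2 * N"
     by (intro tendsto_intros LIMSEQ_realpow_zero) auto
    thus "(\<lambda>n. (1/4) ^ n / 4 - 2 * s * cn n + s\<^sup>2 * N) \<longlonglongrightarrow> - 2 * s * c + s\<^sup>2 * N" by simp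
    have "0 \<le> (1/4) ^ n / 4 - 2 * s * cn n + s\<^sup>2 * N" for n
    proof -
     define et where "et = (\<lambda>x. 1 * pss n x + s * ps x)"
     have et: "et \<in> torus_tests" "grad et x = 1 *\<^sub>R grad (pss n) x + s *\<^sub>R grad ps x" for x
      unfolding et_def by (rule tests_lincomb[OF pss(1) ps])+
     have iG: "integrable cm (\<lambda>x. grad (pss n) x \<bullet> grad ps x)" by (rule cm_dot[OF grad_borel[OF pss(1)] G2 grad_borel[OF ps] L])
     have iN: "integrable cm (\<lambda>x. (norm (grad ps x))\<^sup>2)" using int(1)[OF gc gc, of 0] by simp
     have "(norm (a - (1 *\<^sub>R p + s *\<^sub>R q)))\<^sup>2 = (norm (a - p))\<^sup>2 - 2 * s * (a \<bullet> q - p \<bullet> q) + s\<^sup>2 * (norm q)\<^sup>2" for a p q :: "real^3"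
      by (simp add: power2_norm_eq_inner algebra_simps inner_commute power2_eq_square[of s])
     hence "D et = (LINT x|cm. (norm (A x - grad (pss n) x))\<^sup>2 - 2 * s * (A x \<bullet> grad ps x - grad (pss n) x \<bullet> grad ps x) + s\<^sup>2 * (norm (grad ps x))\<^sup>2)"
      unfolding D_def et(2) by (intro int_cong) auto
     also have "\<dots> = D (pss n) - 2 * s * cn n + s\<^sup>2 * N"
      using iD[OF pss(1), of n] iA iG iN unfolding D_def cn_def N_def by simp
     finally show ?thesis using m[OF et(1)] pss(2)[of n] by linarith
    qed
    thus "\<exists>N0. \<forall>n\<ge>N0. 0 \<le> (1/4) ^ n / 4 - 2 * s * cn n + s\<^sup>2 * N" by blast
   qed
   have N0: "0 \<le> N" by (simp add: N_def)
   \<comment> \<open>The optimal s would be \<open>c / N\<close>; the denominator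
     \<open>N + 1\<close> avoids a separate case \<open>N = 0\<close> and still forces c to
     vanish.\<close>
   have "0 \<le> - 2 * (c / (N + 1)) * c + (c / (N + 1))\<^sup>2 * N" by (rule key)
   also have "\<dots> = - (c\<^sup>2 / (N + 1)) - (c / (N + 1))\<^sup>2"
   proof -
    have "- 2 * (c / k) * c + (c / k)\<^sup>2 * (k - 1) = - (c\<^sup>2 / k) - (c / k)\<^sup>2" if "0 < k" for k
     using that by (simp add: field_simps power2_eq_square)
    from this[of "N + 1"] N0 show ?thesis by simp
   qed
   finally have "c\<^sup>2 / (N + 1) \<le> 0" using zero_le_power2[of "c / (N + 1)"] by linarith
   hence "c = 0" using N0 by (simp add: divide_le_0_iff)
   thus ?thesis by (simp add: c_def)
  qed
  show ?thesis by (rule that[OF gm gp L2(1) pss(1) orth weak])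
qed

lemma cell_deriv_zero:
  assumes et: "cont et'" "\<And>x s. ((\<lambda>s. et (x + s *\<^sub>R axis j 1)) has_real_derivative et' (x + s *\<^sub>R axis j 1)) (at s)"
   and per: "periodic et"
  shows "(LINT x|cm. et' x) = 0"
proof -
  obtain K where K: "\<And>x. x \<in> box 0 1 \<Longrightarrow> \<bar>et' x\<bar> \<le> K" by (rule cell_bound[OF et(1)]) blast
  have "(LBINT s:{0<..<1}. et' (ins j s p)) = et (ins j 1 p) - et (ins j 0 p)" for p
  proof (rule FTC_Ioo(1))
   show "((\<lambda>s. et (ins j s p)) has_real_derivative et' (ins j s p)) (at s)" for s
    using et(2)[of "ins j 0 p" s] by (simp only: ins_line[symmetric])
   show "cont (\<lambda>s. et' (ins j s p))"
    using continuous_on_compose2[OF et(1) continuous_on_compose2[OF ins_continuous, of UNIV "\<lambda>s. (s, p)"]]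
    by (simp add: continuous_on_Pair continuous_on_id continuous_on_const)
  qed simp
  also have "et (ins j 1 p) - et (ins j 0 p) = 0" for p
   using per ins_line[of j 1 p] by (simp add: periodic_def)
  finally have z: "(LBINT s:{0<..<1}. et' (ins j s p)) = 0" for p .
  show ?thesis unfolding cm_integral(1)
   using int_ins(1)[OF Bor_contI[OF et(1)] K, of j] unfolding z
   by (simp add: set_int_def)
qed

lemma cell_pd_zero: "ps \<in> torus_tests \<Longrightarrow> (LINT x|cm. pd (axis i 1) ps x) = 0"
  by (rule cell_deriv_zero[of _ ps]) (auto simp: torus_tests_def intro: smooth_line smooth_continuous smooth_pd)

text \<open>Both sides equal minus the integral of et times a mixed second derivative of ps, by the
  product rule and periodicity. It is the weak form of the fact that gradients have no curl.\<close>

lemma cell_curl_grad: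
  assumes "ps \<in> torus_tests" "et \<in> torus_tests"
  shows "(LINT x|cm. pd (axis i 1) et x * pd (axis j 1) ps x) = (LINT x|cm. pd (axis j 1) et x * pd (axis i 1) ps x)"
proof -
  have s: "smooth ps" "smooth et" using assms by (auto simp: torus_tests_def)
  have c: "cont (pd (axis i 1) et)" "cont (pd (axis i 1) (pd (axis j 1) ps))" "cont et" "cont (pd (axis i 1) ps)" for i j
   by (intro smooth_continuous smooth_pd s)+
  have int: "integrable cm f" if f: "cont f" for f :: "real^3 \<Rightarrow> real"
  proof -
   obtain K where "\<And>x. x \<in> torus_cell \<Longrightarrow> norm (f x) \<le> K" by (rule cell_continuous_bound[OF f]) blast
   thus ?thesis by (rule cm_integrable[OF Bor_contI[OF f]])
  qed
  have *: "(LINT x|cm. pd (axis i 1) et x * pd (axis j 1) ps x) = - (LINT x|cm. et x * pd (axis i 1) (pd (axis j 1) ps) x)" for i j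
  proof -
   have "(LINT x|cm. pd (axis i 1) et x * pd (axis j 1) ps x + et x * pd (axis i 1) (pd (axis j 1) ps) x) = 0"
   proof (rule cell_deriv_zero[where et="\<lambda>x. et x * pd (axis j 1) ps x"])
    show "cont (\<lambda>x. pd (axis i 1) et x * pd (axis j 1) ps x + et x * pd (axis i 1) (pd (axis j 1) ps) x)"
     by (intro continuous_on_add continuous_on_mult c)
    show "((\<lambda>s. et (x + s *\<^sub>R axis i 1) * pd (axis j 1) ps (x + s *\<^sub>R axis i 1)) has_real_derivative
     pd (axis i 1) et (x + s *\<^sub>R axis i 1) * pd (axis j 1) ps (x + s *\<^sub>R axis i 1) +
     et (x + s *\<^sub>R axis i 1) * pd (axis i 1) (pd (axis j 1) ps) (x + s *\<^sub>R axis i 1)) (at s)" for x s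
     using DERIV_mult[OF smooth_line[OF s(2), of x "axis i 1" s] smooth_line[OF smooth_pd[OF s(1), of "axis j 1"], of x "axis i 1" s]]
     by (simp add: mult.commute)
    show "periodic (\<lambda>x. et x * pd (axis j 1) ps x)"
     using pd_periodic[OF assms(1)] assms(2) by (simp add: torus_tests_def periodic_def)
   qed
   thus ?thesis
    using int[OF continuous_on_mult[OF c(1)[of i] c(4)[of j]]] int[OF continuous_on_mult[OF c(3) c(2)[of j i]]] by simp
  qed
  have "pd (axis i 1) (pd (axis j 1) ps) x = pd (axis j 1) (pd (axis i 1) ps) x" for x
   by (rule pd_commute[OF s(1)])
  thus ?thesis unfolding * by (simp only:)
qed

text \<open>Gauge invariance. The required potential is A minus an L^2 limit of gradients and minus
  a constant. The curl is unchanged since gradients have none, the divergence vanishes by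
  orthogonality, and neither correction contributes to the helicity because B is divergence free
  with mean zero. So the helicity may be computed with any bounded periodic potential.\<close>

lemma helicity_of_potential:
  fixes A B :: "real^3 \<Rightarrow> real^3"
  assumes A: "A \<in> Bor" "\<And>x. norm (A x) \<le> K" "periodic A"
   and B: "B \<in> Bor" "\<And>x. norm (B x) \<le> K" "periodic B"
   and curl: "\<And>ps i. ps \<in> torus_tests \<Longrightarrow> (LINT x|cm. A x $ (i + 1) * pd (axis (i + 2) 1) ps x) - (LINT x|cm. A x $ (i + 2) * pd (axis (i + 1) 1) ps x) = (LINT x|cm. B x $ i * ps x)"
  shows "has_helicity B (LINT x:torus_cell|lborel. A x \<bullet> B x)"
proof -
  interpret finite_measure cm by (rule finite_cm)
  have one: "measure cm torus_cell = 1"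
   by (subst measure_restrict_space) (simp_all add: cell_borel torus_cell_def content_cbox_cart interval_ne_empty_cart)
  obtain g pss where g: "g \<in> Bor" "periodic g" "integrable cm (\<lambda>x. (norm (g x))\<^sup>2)"
   and pss: "\<And>n. pss n \<in> torus_tests" and orth: "\<And>ps. ps \<in> torus_tests \<Longrightarrow> (LINT x|cm. (A x - g x) \<bullet> grad ps x) = 0"
   and weak: "\<And>w L. w \<in> Bor \<Longrightarrow> (\<And>x. x \<in> torus_cell \<Longrightarrow> norm (w x) \<le> L) \<Longrightarrow>
    (\<lambda>n. LINT x|cm. grad (pss n) x \<bullet> w x) \<longlonglongrightarrow> (LINT x|cm. g x \<bullet> w x)"
   by (rule helmholtz[OF A(1,2)]) blast
  have iA: "integrable cm A" by (rule cm_integrable[OF A(1,2)])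
  have iB: "integrable cm B" by (rule cm_integrable[OF B(1,2)])
  have ig: "integrable cm g"
  proof (rule Bochner_Integration.integrable_bound[of cm "\<lambda>x. (norm (g x))\<^sup>2 + 1"])
   have "norm (g x) \<le> (norm (g x))\<^sup>2 + 1" for x
   proof -
    have "norm (g x) * 2 \<le> (norm (g x))\<^sup>2 + 1" using norm_le_weighted[of "g x" 0] by simp
    thus ?thesis using norm_ge_zero[of "g x"] by linarith
   qed
   thus "AE x in cm. norm (g x) \<le> norm ((norm (g x))\<^sup>2 + 1)" by (intro AE_I2) (simp add: abs_of_nonneg)
  qed (use g(3) cm_borel[OF g(1)] in auto)
  define c where "c = (LINT x|cm. A x - g x)"
  define a where "a x = A x - g x - c" for x
  have A2: "integrable cm (\<lambda>x. (norm (A x))\<^sup>2)" and B2: "integrable cm (\<lambda>x. (norm (B x))\<^sup>2)"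
   by (rule cm_integrable[of _ "K\<^sup>2"]; use A B in \<open>auto intro: power_mono\<close>)+
  have am: "a \<in> Bor"
   unfolding a_def[abs_def] by (intro borel_measurable_diff A(1) g(1) borel_measurable_const)
  have a2: "integrable cm (\<lambda>x. (norm (a x))\<^sup>2)"
  proof (rule Bochner_Integration.integrable_bound[of cm "\<lambda>x. 2 * (2 * (norm (A x))\<^sup>2 + 2 * (norm (g x))\<^sup>2) + 2 * (norm c)\<^sup>2"])
   have "(norm (a x))\<^sup>2 \<le> 2 * (2 * (norm (A x))\<^sup>2 + 2 * (norm (g x))\<^sup>2) + 2 * (norm c)\<^sup>2" for x
    unfolding a_def by (rule order_trans[OF norm_sq_diff_le]) (intro add_right_mono mult_left_mono norm_sq_diff_le, simp)
   thus "AE x in cm. norm ((norm (a x))\<^sup>2) \<le> norm (2 * (2 * (norm (A x))\<^sup>2 + 2 * (norm (g x))\<^sup>2) + 2 * (norm c)\<^sup>2)"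
    by (intro AE_I2) (simp add: abs_of_nonneg)
  qed (use g(3) A2 cm_borel[OF am] in auto)
  have amean: "(LINT x|cm. a x) = 0"
   unfolding a_def using iA ig one by (simp add: c_def space_cm)
  have cst: "integrable cm (\<lambda>x. g x $ i * w x)" "integrable cm (\<lambda>x. A x $ i * w x)" "integrable cm w"
   "(\<lambda>n. LINT x|cm. pd (axis i 1) (pss n) x * w x) \<longlonglongrightarrow> (LINT x|cm. g x $ i * w x)"
   if w: "cont w" for i and w :: "real^3 \<Rightarrow> real"
  proof -
   obtain L where L: "\<And>x. x \<in> torus_cell \<Longrightarrow> norm (w x) \<le> L" by (rule cell_continuous_bound[OF w]) blast
   note wb = Bor_contI[OF w]
   have v: "(\<lambda>x. w x *\<^sub>R axis i 1 :: real^3) \<in> Bor" "\<And>x. x \<in> torus_cell \<Longrightarrow> norm (w x *\<^sub>R axis i 1 :: real^3) \<le> L"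
    using wb L by (auto intro!: borel_measurable_scaleR)
   have e: "y \<bullet> (s *\<^sub>R axis i 1) = y $ i * s" for y :: "real^3" and s by (simp add: inner_axis)
   show "integrable cm (\<lambda>x. g x $ i * w x)" using cm_dot[OF g(1,3) v] unfolding e .
   show "integrable cm (\<lambda>x. A x $ i * w x)" using cm_dot[OF A(1) A2 v] unfolding e .
   show "integrable cm w" by (rule cm_integrable[OF wb L])
   show "(\<lambda>n. LINT x|cm. pd (axis i 1) (pss n) x * w x) \<longlonglongrightarrow> (LINT x|cm. g x $ i * w x)"
    using weak[OF v] unfolding e by (simp add: grad_def)
  qed
  have aw: "(LINT x|cm. a x $ i * pd (axis j 1) ps x) = (LINT x|cm. A x $ i * pd (axis j 1) ps x) - (LINT x|cm. g x $ i * pd (axis j 1) ps x)"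
   if ps: "ps \<in> torus_tests" for i j ps
  proof -
   note t = tests_continuous(2)[OF ps, of "axis j 1"]
   note w = cst(1)[OF t, where i=i] cst(2)[OF t, where i=i] cst(3)[OF t]
   have "(LINT x|cm. a x $ i * pd (axis j 1) ps x) = (LINT x|cm. A x $ i * pd (axis j 1) ps x - g x $ i * pd (axis j 1) ps x - c $ i * pd (axis j 1) ps x)"
    by (intro int_cong) (auto simp: a_def algebra_simps)
   also have "\<dots> = (LINT x|cm. A x $ i * pd (axis j 1) ps x) - (LINT x|cm. g x $ i * pd (axis j 1) ps x) - c $ i * (LINT x|cm. pd (axis j 1) ps x)"
    using w by simp
   finally show ?thesis by (simp add: cell_pd_zero[OF ps])
  qed
  have gcurl: "(LINT x|cm. g x $ i * pd (axis j 1) ps x) = (LINT x|cm. g x $ j * pd (axis i 1) ps x)" if ps: "ps \<in> torus_tests" for i j ps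
  proof (rule LIMSEQ_unique[OF cst(4)[OF tests_continuous(2)[OF ps]]])
   show "(\<lambda>n. LINT x|cm. pd (axis i 1) (pss n) x * pd (axis j 1) ps x) \<longlonglongrightarrow> (LINT x|cm. g x $ j * pd (axis i 1) ps x)"
    unfolding cell_curl_grad[OF ps pss, where i=i and j=j] by (rule cst(4)[OF tests_continuous(2)[OF ps]])
  qed
  have adiv: "(\<Sum>i\<in>UNIV. LINT x|cm. a x $ i * pd (axis i 1) ps x) = 0" if ps: "ps \<in> torus_tests" for ps
  proof -
   have "(\<Sum>i\<in>UNIV. LINT x|cm. a x $ i * pd (axis i 1) ps x) = (LINT x|cm. (\<Sum>i\<in>UNIV. A x $ i * pd (axis i 1) ps x - g x $ i * pd (axis i 1) ps x))"
    using cst(1,2)[OF tests_continuous(2)[OF ps]] by (simp add: aw[OF ps])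
   also have "\<dots> = (LINT x|cm. (A x - g x) \<bullet> grad ps x)"
    by (simp add: inner_vec_def grad_def algebra_simps)
   finally show ?thesis using orth[OF ps] by simp
  qed
  have iBw: "integrable cm (\<lambda>x. B x $ i * w x)" if w: "cont w" for i and w :: "real^3 \<Rightarrow> real"
  proof -
   obtain L where L: "\<And>x. x \<in> torus_cell \<Longrightarrow> norm (w x) \<le> L" by (rule cell_continuous_bound[OF w]) blast
   have v: "(\<lambda>x. w x *\<^sub>R axis i 1 :: real^3) \<in> Bor" "\<And>x. x \<in> torus_cell \<Longrightarrow> norm (w x *\<^sub>R axis i 1 :: real^3) \<le> L"
    using Bor_contI[OF w] L by (auto intro!: borel_measurable_scaleR)
   show ?thesis using cm_dot[OF B(1) B2 v] by (simp add: inner_axis mult.commute)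
  qed
  \<comment> \<open>The curl identity tested with the constant 1.\<close>
  have Bmean: "(LINT x|cm. B x) = 0"
  proof -
   have t: "(\<lambda>_. 1) \<in> torus_tests" by (simp add: torus_tests_def smooth_const periodic_def)
   have "(LINT x|cm. B x) $ i = 0" for i
   proof -
    have "(LINT x|cm. B x $ i * 1) = 0" using curl[OF t, of i] by (simp add: frechet_derivative_const)
    thus ?thesis using integral_inner_left[of "axis i 1" cm B] iB by (simp add: inner_axis)
   qed
   thus ?thesis by (simp add: vec_eq_iff)
  qed
  \<comment> \<open>The curl identity tested with the partial derivatives of ps; the six terms
    cancel in pairs, since mixed derivatives commute.\<close>
  have Bdiv: "(LINT x|cm. grad ps x \<bullet> B x) = 0" if ps: "ps \<in> torus_tests" for ps
  proof -
   have s: "smooth ps" using ps by (simp add: torus_tests_def)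
   note cu = curl[OF pd_periodic[OF ps]]
   have co: "(LINT x|cm. A x $ k * pd (axis i 1) (pd (axis j 1) ps) x) = (LINT x|cm. A x $ k * pd (axis j 1) (pd (axis i 1) ps) x)" for i j k
   proof -
    have "pd (axis i 1) (pd (axis j 1) ps) x = pd (axis j 1) (pd (axis i 1) ps) x" for x by (rule pd_commute[OF s])
    thus ?thesis by (simp only:)
   qed
   have "(LINT x|cm. grad ps x \<bullet> B x) = (LINT x|cm. (\<Sum>i\<in>UNIV. B x $ i * pd (axis i 1) ps x))"
    by (simp add: inner_vec_def grad_def mult.commute)
   also have "\<dots> = (\<Sum>i\<in>UNIV. LINT x|cm. B x $ i * pd (axis i 1) ps x)"
    using iBw[OF tests_continuous(2)[OF ps]] by simp
   also have "\<dots> = 0"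
    using cu[of 1 "axis 1 1"] cu[of 2 "axis 2 1"] cu[of 3 "axis 3 1"] co[of 1 2 3] co[of 2 3 1] co[of 3 1 2]
    by (simp add: sum_3 numeral_3_wrap)
   finally show ?thesis .
  qed
  have "(LINT x|cm. g x \<bullet> B x) = 0"
  proof (rule LIMSEQ_unique[OF weak[OF B(1,2)]])
   show "(\<lambda>n. LINT x|cm. grad (pss n) x \<bullet> B x) \<longlonglongrightarrow> 0" by (simp add: Bdiv[OF pss])
  qed
  hence hel: "(LINT x|cm. a x \<bullet> B x) = (LINT x|cm. A x \<bullet> B x)"
   using cm_dot[OF A(1) A2 B(1,2)] cm_dot[OF g(1,3) B(1,2)] iB Bmean by (simp add: a_def inner_diff_left)
  have ap: "periodic a" using A(3) g(2) by (simp add: periodic_def a_def)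
  have acurl: "- (LINT x|cm. a x $ (i + 2) * pd (axis (i + 1) 1) ps x) - - (LINT x|cm. a x $ (i + 1) * pd (axis (i + 2) 1) ps x) = (LINT x|cm. B x $ i * ps x)"
   if ps: "ps \<in> torus_tests" for i ps
   using curl[OF ps, of i] gcurl[OF ps, of "i + 1" "i + 2"] unfolding aw[OF ps] by linarith
  have "vector_potential B a"
   unfolding vector_potential_def torus_L2_def div_distr_def curl_distr_def deriv_distr_def regular_distr_def cm_integral[symmetric]
   using am ap a2 amean adiv acurl by (simp add: sum_negf)
  moreover have "torus_L2 B" unfolding torus_L2_def cm_integral[symmetric] using B B2 by simp
  ultimately show ?thesis
   unfolding has_helicity_def cm_integral(1)[symmetric] using Bmean hel by blast
qed

section \<open>The solution\<close>

definition field :: "(3 \<Rightarrow> plane \<Rightarrow> real \<Rightarrow> real) \<Rightarrow> spacetime \<Rightarrow> real^3" where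
  "field X z = (\<chi> i. per (\<lambda>p. X i p (snd z)) (fst z))"

lemma vec_borel:
  fixes f :: "'a::topological_space \<Rightarrow> real^3"
  assumes "\<And>i. (\<lambda>x. f x $ i) \<in> Bor"
  shows "f \<in> Bor"
  by (subst borel_measurable_euclidean_space)
   (use assms in \<open>auto simp: Basis_vec_def inner_axis\<close>)

lemma norm_le_components: "norm x \<le> \<bar>x $ 1\<bar> + \<bar>x $ 2\<bar> + \<bar>x $ 3\<bar>" for x :: "real^3"
  using norm_le_l1_cart[of x] by (simp add: sum_3)

lemma bm_vec:
  fixes f :: "'a::euclidean_space \<Rightarrow> real^3"
  assumes "\<And>i. bm (\<lambda>x. f x $ i)"
  shows "f \<in> Bor" "\<exists>K. \<forall>x. norm (f x) \<le> K"
proof -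
  show "f \<in> Bor" by (rule vec_borel[OF bm_borel[OF assms]])
  have "\<forall>i. \<exists>K. \<forall>x. \<bar>f x $ i\<bar> \<le> K" using assms unfolding bm_def by blast
  then obtain K where K: "\<And>i x. \<bar>f x $ i\<bar> \<le> K i" by metis
  have "norm (f x) \<le> K 1 + K 2 + K 3" for x
   using norm_le_components[of "f x"] K[of x 1] K[of x 2] K[of x 3] by linarith
  thus "\<exists>K. \<forall>x. norm (f x) \<le> K" by blast
qed

lemma bt_field: "bt k \<Longrightarrow> bm (\<lambda>z :: spacetime. per (\<lambda>p. k p (snd z)) (fst z))"
  using per_t_borel[of k] unfolding bt_def bm_def per_def by auto

lemma field_props:
  assumes "\<And>i. bt (X i)"
  shows "field X \<in> Bor" "\<exists>K. \<forall>z. norm (field X z) \<le> K" "periodic (\<lambda>x. field X (x, t))"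
proof -
  have "bm (\<lambda>z. field X z $ i)" for i using bt_field[OF assms] by (simp add: field_def)
  thus "field X \<in> Bor" "\<exists>K. \<forall>z. norm (field X z) \<le> K" by (intro bm_vec; assumption)+
  show "periodic (\<lambda>x. field X (x, t))" using per_periodic unfolding periodic_def field_def by simp
qed

lemma field_Linfty:
  assumes "\<And>i. bt (X i)"
  shows "torus_Linfty {0..T} (field X)"
proof -
  have D: "UNIV \<times> {0..T} \<in> sets (borel :: spacetime measure)" by (intro borel_closed closed_Times) auto
  note fp = field_props[of X, OF assms]
  obtain K where K: "\<And>z. norm (field X z) \<le> K" using fp(2) by blast
  hence "AE z\<in>UNIV \<times> {0..T} in lborel. norm (field X z) \<le> K" by (intro AE_I2) simp
  thus ?thesis unfolding torus_Linfty_def set_borel_measurable_def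
   using fp(1,3) D by (blast intro: borel_measurable_scaleR borel_measurable_indicator)
qed

lemma field_L2_loc:
  assumes "\<And>i. bt (X i)"
  shows "torus_L2_loc T (field X)"
proof -
  note fp = field_props[of X, OF assms]
  have D: "UNIV \<times> {0<..<T} \<in> sets (borel :: spacetime measure)" by (intro borel_open open_Times) auto
  obtain K where K: "\<And>z. norm (field X z) \<le> K" using fp(2) by blast
  have "set_integrable lborel (torus_cell \<times> {a..b}) (\<lambda>z. (norm (field X z))\<^sup>2)" for a b :: real
  proof -
   have c: "torus_cell \<times> {a..b} \<in> sets borel" "bounded (torus_cell \<times> {a..b})"
    unfolding torus_cell_def
    by (intro borel_closed closed_Times closed_cbox closed_real_atLeastAtMost, intro bounded_Times bounded_cbox compact_imp_bounded[OF compact_Icc])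
   show ?thesis unfolding set_integrable_def
   proof (rule integrable_bdd[OF _ _ c(2)])
    show "(\<lambda>z. ind (torus_cell \<times> {a..b}) z *\<^sub>R (norm (field X z))\<^sup>2) \<in> Bor"
     by (rule borel_measurable_scaleR[OF borel_measurable_indicator[OF c(1)] borel_measurable_power[OF measurable_compose[OF fp(1) borel_measurable_norm]]])
    show "\<bar>ind (torus_cell \<times> {a..b}) z *\<^sub>R (norm (field X z))\<^sup>2\<bar> \<le> K\<^sup>2" for z
     using power_mono[OF K[of z], of 2] by (auto simp: indicator_def)
   qed simp
  qed
  thus ?thesis unfolding torus_L2_loc_def set_borel_measurable_def
   using fp D by (auto intro!: borel_measurable_scaleR borel_measurable_indicator)
qed

lemma zero_pressure: "spacetime_distribution T (\<lambda>_. 0)"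
  unfolding spacetime_distribution_def by (auto intro!: exI[of _ 0])

text \<open>By the sign in \<open>deriv_distr\<close> each distributional equation is the negative
  of an \<open>act\<close> identity. The pressure is the zero distribution, and the indices in the
  cross product and the curl are reduced modulo 3.\<close>

lemma mhd_of_act:
  assumes bt: "\<And>i. bt (U i)" "\<And>i. bt (B i)"
   and mom: "\<And>ph i. ph \<in> spacetime_tests T \<Longrightarrow> act T ph time_dir (U i) + (\<Sum>j\<in>UNIV. act T ph (space_dir j) (\<lambda>p t. U i p t * U j p t - B i p t * B j p t)) = 0"
   and ind: "\<And>ph i. ph \<in> spacetime_tests T \<Longrightarrow> act T ph time_dir (B i) +
    act T ph (space_dir (i + 1)) (\<lambda>p t. B i p t * U (i + 1) p t - B (i + 1) p t * U i p t) -
    act T ph (space_dir (i + 2)) (\<lambda>p t. B (i + 2) p t * U i p t - B i p t * U (i + 2) p t) = 0"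
   and div: "\<And>ph. ph \<in> spacetime_tests T \<Longrightarrow> (\<Sum>j\<in>UNIV. act T ph (space_dir j) (U j)) = 0"
    "\<And>ph. ph \<in> spacetime_tests T \<Longrightarrow> (\<Sum>j\<in>UNIV. act T ph (space_dir j) (B j)) = 0"
  shows "ideal_MHD_weak_solution T (field U) (field B)"
proof -
  let ?D = "torus_cell \<times> {0<..<T}"
  have reg: "deriv_distr v (regular_distr ?D (\<lambda>z. field X z $ i)) ph = - act T ph v (X i)" for v X i ph
   by (simp add: deriv_distr_def regular_distr_def act_def field_def)
  have reg2: "deriv_distr v (regular_distr ?D (\<lambda>z. field U z $ i * field U z $ j - field B z $ i * field B z $ j)) ph =
    - act T ph v (\<lambda>p t. U i p t * U j p t - B i p t * B j p t)" for v i j ph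
   by (simp add: deriv_distr_def regular_distr_def act_def field_def per_def)
  have cross: "deriv_distr v (regular_distr ?D (\<lambda>z. cross3 (field B z) (field U z) $ i)) ph =
    - act T ph v (\<lambda>p t. B (i + 1) p t * U (i + 2) p t - B (i + 2) p t * U (i + 1) p t)" for v i ph
  proof -
   have "cross3 (field B z) (field U z) $ i = per (\<lambda>p. B (i + 1) p (snd z) * U (i + 2) p (snd z) - B (i + 2) p (snd z) * U (i + 1) p (snd z)) (fst z)" for z
    using exhaust_3[of i] by (auto simp: cross3_def field_def per_def numeral_3_wrap)
   thus ?thesis by (simp add: deriv_distr_def regular_distr_def act_def)
  qed
  have i3: "i + 1 + 1 = i + 2" "i + 1 + 2 = i" "i + 2 + 1 = i" "i + 2 + 2 = i + 1" for i :: 3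
   using exhaust_3[of i] by (auto simp: numeral_3_wrap)
  show ?thesis
   unfolding ideal_MHD_weak_solution_def Let_def
  proof (intro conjI exI[of _ "\<lambda>_. 0"] ballI allI)
   fix ph i assume ph: "ph \<in> spacetime_tests T"
   show "deriv_distr time_dir (regular_distr ?D (\<lambda>z. field U z $ i)) ph +
     div_distr space_dir (\<lambda>j. regular_distr ?D (\<lambda>z. field U z $ i * field U z $ j - field B z $ i * field B z $ j)) ph +
     deriv_distr (space_dir i) (\<lambda>_. 0) ph = 0"
    unfolding div_distr_def reg reg2 using mom[OF ph, of i] by (simp add: deriv_distr_def sum_negf)
   show "deriv_distr time_dir (regular_distr ?D (\<lambda>z. field B z $ i)) ph +
     curl_distr space_dir (\<lambda>j. regular_distr ?D (\<lambda>z. cross3 (field B z) (field U z) $ j)) i ph = 0"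
    unfolding curl_distr_def reg cross i3 using ind[OF ph, of i] by simp
  next
   fix ph assume ph: "ph \<in> spacetime_tests T"
   show "div_distr space_dir (\<lambda>j. regular_distr ?D (\<lambda>z. field U z $ j)) ph = 0"
    "div_distr space_dir (\<lambda>j. regular_distr ?D (\<lambda>z. field B z $ j)) ph = 0"
    unfolding div_distr_def reg using div[OF ph] by (simp_all add: sum_negf)
  qed (intro field_L2_loc bt zero_pressure)+
qed

text \<open>The first square carries \<open>z\<^sup>- = V\<close> and \<open>z\<^sup>+ = F\<close>,
  the second one the exchanged roles, and the right half of the unit square is the strip. There
  \<open>sm2\<close> and \<open>sm3\<close> are the second and third component of the vector
  potential; their zero end values fit it to zero outside.\<close>

locale mhd_data =
  fixes V1 V2 V1' V2' G G' :: "plane \<Rightarrow> real" and F F' :: "plane \<Rightarrow> real \<Rightarrow> real"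
   and sm2 sm2' sm3 sm3' :: "real \<Rightarrow> real"
  assumes w: "wave (osq 0 0 (1/2)) V1 V2 F G" "wave (osq 0 (1/2) (1/2)) V1' V2' F' G'"
   and line: "\<And>y t. (LBINT x. F (x, y) t) = 0" "\<And>y t. (LBINT x. F' (x, y) t) = 0"
   and GF: "\<And>t. (LINT p|lborel. G p * F p t) = 0" "\<And>t. (LINT p|lborel. G' p * F' p t) = 0"
   and sm2: "\<And>s. (sm2 has_real_derivative sm2' s) (at s)" "cont sm2'" "sm2 (1/2) = 0" "sm2 1 = 0"
   and sm3: "\<And>s. (sm3 has_real_derivative sm3' s) (at s)" "cont sm3'" "sm3 (1/2) = 0" "sm3 1 = 0"
begin

text \<open>Half the sum of the Elsasser fields, while \<open>B\<close> is half the difference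
  \<open>z\<^sup>+ - z\<^sup>-\<close>. The factors 1 and -1 give the components the shape of the
  closure lemmas for linear combinations.\<close>

definition U :: "3 \<Rightarrow> plane \<Rightarrow> real \<Rightarrow> real" where
  "U i p t = (if i = 1 then 1/2 * V1 p + 1/2 * V1' p
   else if i = 2 then 1 * (1/2 * V2 p + 1/2 * V2' p) + (-1) * strip sm3' p
   else 1 * (1/2 * F p t + 1/2 * F' p t) + 1 * strip sm2' p)"

definition B :: "3 \<Rightarrow> plane \<Rightarrow> real \<Rightarrow> real" where
  "B i p t = (if i = 1 then (-1/2) * V1 p + 1/2 * V1' p
   else if i = 2 then 1 * ((-1/2) * V2 p + 1/2 * V2' p) + (-1) * strip sm3' p
   else 1 * (1/2 * F p t + (-1/2) * F' p t) + 1 * strip sm2' p)"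

abbreviation "W t \<equiv> xprim (\<lambda>p. F p t)"
abbreviation "W' t \<equiv> xprim (\<lambda>p. F' p t)"

lemma U_simps: "U 1 = (\<lambda>p t. 1/2 * V1 p + 1/2 * V1' p)" "U 2 = (\<lambda>p t. 1 * (1/2 * V2 p + 1/2 * V2' p) + (-1) * strip sm3' p)"
   "U 3 = (\<lambda>p t. 1 * (1/2 * F p t + 1/2 * F' p t) + 1 * strip sm2' p)"
  and B_simps: "B 1 = (\<lambda>p t. (-1/2) * V1 p + 1/2 * V1' p)" "B 2 = (\<lambda>p t. 1 * ((-1/2) * V2 p + 1/2 * V2' p) + (-1) * strip sm3' p)"
   "B 3 = (\<lambda>p t. 1 * (1/2 * F p t + (-1/2) * F' p t) + 1 * strip sm2' p)"
  by (simp_all add: U_def B_def fun_eq_iff)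

lemma sub: "osq 0 0 (1/2) \<subseteq> {0<..<1} \<times> {0<..<1}" "osq 0 (1/2) (1/2) \<subseteq> {0<..<1} \<times> {0<..<1}"
  by auto

lemmas pot = wave_pot[OF w(1) sub(1) line(1)] and pot' = wave_pot[OF w(2) sub(2) line(2)]
lemmas bts = wave_bt[OF w(1)] wave_bt[OF w(2)] strip_bm[OF sm2(2)] strip_bm[OF sm3(2)]

text \<open>The two squares and the strip are disjoint, so at every point at most one of the three
  building blocks is nonzero. The quadratic identities below are checked case by case, without mixed
  terms.\<close>

lemma regions:
  obtains "V1 p = 0" "V2 p = 0" "G p = 0" "\<And>t. F p t = 0" "\<And>t. W t p = 0" "V1' p = 0" "V2' p = 0" "G' p = 0" "\<And>t. F' p t = 0" "\<And>t. W' t p = 0"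
  | "V1 p = 0" "V2 p = 0" "G p = 0" "\<And>t. F p t = 0" "\<And>t. W t p = 0" "\<And>sm. strip sm p = 0"
  | "V1' p = 0" "V2' p = 0" "G' p = 0" "\<And>t. F' p t = 0" "\<And>t. W' t p = 0" "\<And>sm. strip sm p = 0"
proof -
  note z = wave_props(8-11)[OF w(1)] pot(4)
  note z' = wave_props(8-11)[OF w(2)] pot'(4)
  have s: "strip sm p = 0" if "fst p \<le> 1/2" for sm using that by (simp add: strip_def)
  show ?thesis
  proof (cases "p \<in> osq 0 0 (1/2)")
   case True
   hence "p \<notin> osq 0 (1/2) (1/2)" "fst p \<le> 1/2" by (auto simp: mem_Times_iff)
   thus ?thesis using that(3) z' s by blast
  next
   case False
   note zz = z[OF False]
   show ?thesis
   proof (cases "p \<in> osq 0 (1/2) (1/2)")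
    case True
    hence "fst p \<le> 1/2" by (auto simp: mem_Times_iff)
    thus ?thesis using that(2) zz s by blast
   next
    case False
    thus ?thesis using that(1) zz z'[OF False] by blast
   qed
  qed
qed

lemma bt: "bt (U i)" "bt (B i)"
proof -
  have U: "bt (U 1)" "bt (U 2)" "bt (U 3)" unfolding U_simps by (intro bt_lincomb bts bt_const)+
  have B: "bt (B 1)" "bt (B 2)" "bt (B 3)" unfolding B_simps by (intro bt_lincomb bts bt_const)+
  show "bt (U i)" "bt (B i)" using exhaust_3[of i] U B by auto
qed

text \<open>In Elsasser variables the stress is the symmetric part of the product of
  \<open>z\<^sup>+\<close> and \<open>z\<^sup>-\<close>. In the squares one factor is planar and the
  other vertical, so the purely planar entries vanish; in the strip
  \<open>z\<^sup>- = 0\<close>.\<close>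

lemma stress:
  "U 1 p t * U 1 p t - B 1 p t * B 1 p t = 0" "U 1 p t * U 2 p t - B 1 p t * B 2 p t = 0"
  "U 2 p t * U 1 p t - B 2 p t * B 1 p t = 0" "U 2 p t * U 2 p t - B 2 p t * B 2 p t = 0"
  "U 3 p t * U 1 p t - B 3 p t * B 1 p t = 1/2 * (F p t * V1 p) + 1/2 * (F' p t * V1' p)"
  "U 3 p t * U 2 p t - B 3 p t * B 2 p t = 1/2 * (F p t * V2 p) + 1/2 * (F' p t * V2' p)"
  by (rule regions[of p]; simp add: U_simps B_simps algebra_simps)+

lemma emf:
  "B 1 p t * U 2 p t - B 2 p t * U 1 p t = 0"
  "B 3 p t * U 1 p t - B 1 p t * U 3 p t = 1/2 * (F p t * V1 p) + (-1/2) * (F' p t * V1' p)"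
  "B 2 p t * U 3 p t - B 3 p t * U 2 p t = (-1/2) * (F p t * V2 p) + 1/2 * (F' p t * V2' p)"
  by (rule regions[of p]; simp add: U_simps B_simps algebra_simps)+

text \<open>Third component of a vector potential of the magnetic field; \<open>A2\<close> is the
  second one and the first is zero. \<open>A3u\<close> is the analogous stream function of the
  velocity and serves to show that its divergence vanishes.\<close>

definition A3 :: "plane \<Rightarrow> real" where
  "A3 p = 1 * ((-1/2) * G p + 1/2 * G' p) + 1 * strip sm3 p"

definition A3u :: "plane \<Rightarrow> real" where
  "A3u p = 1 * (1/2 * G p + 1/2 * G' p) + 1 * strip sm3 p"

definition A2 :: "real \<Rightarrow> plane \<Rightarrow> real" where
  "A2 t p = 1 * (1/2 * W t p + (-1/2) * W' t p) + 1 * strip sm2 p"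

lemma wds:
  "wd 2 A3 (\<lambda>p. B 1 p t)" "wd 1 A3 (\<lambda>p. - B 2 p t)" "wd 1 (A2 t) (\<lambda>p. B 3 p t)"
  "wd 2 A3u (\<lambda>p. U 1 p t)" "wd 1 A3u (\<lambda>p. - U 2 p t)"
proof -
  note st = strip_wd[OF sm3] strip_wd[OF sm2]
  show "wd 2 A3 (\<lambda>p. B 1 p t)"
   using wd_lincomb[OF wd_lincomb[OF pot(1) pot'(1), of "-1/2" "1/2"] st(2), of 1 1] by (simp add: A3_def[abs_def] B_simps)
  show "wd 1 A3 (\<lambda>p. - B 2 p t)"
   using wd_lincomb[OF wd_lincomb[OF pot(2) pot'(2), of "-1/2" "1/2"] st(1), of 1 1] by (simp add: A3_def[abs_def] B_simps algebra_simps)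
  show "wd 1 (A2 t) (\<lambda>p. B 3 p t)"
   using wd_lincomb[OF wd_lincomb[OF pot(3)[of t] pot'(3)[of t], of "1/2" "-1/2"] st(3), of 1 1] by (simp add: A2_def[abs_def] B_simps)
  show "wd 2 A3u (\<lambda>p. U 1 p t)"
   using wd_lincomb[OF wd_lincomb[OF pot(1) pot'(1), of "1/2" "1/2"] st(2), of 1 1] by (simp add: A3u_def[abs_def] U_simps)
  show "wd 1 A3u (\<lambda>p. - U 2 p t)"
   using wd_lincomb[OF wd_lincomb[OF pot(2) pot'(2), of "1/2" "1/2"] st(1), of 1 1] by (simp add: A3u_def[abs_def] U_simps algebra_simps)
qed

end

section \<open>The equations, the energies and the helicity\<close>

lemma cell_plane_lincomb:
  assumes "bm k" "bm l" "\<And>p. p \<notin> {0<..<1} \<times> {0<..<1} \<Longrightarrow> k p = 0" "\<And>p. p \<notin> {0<..<1} \<times> {0<..<1} \<Longrightarrow> l p = 0"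
  shows "(LINT x:torus_cell|lborel. per (\<lambda>p. a * k p + b * l p) x) = a * (LINT p|lborel. k p) + b * (LINT p|lborel. l p)"
  using cell_lincomb[OF assms(1,2) continuous_on_const[of UNIV 1], of a b] cell_per_plane[OF assms(1,3)] cell_per_plane[OF assms(2,4)] by simp

lemma cell_sum:
  assumes "bm k" "bm l" "bm m"
  shows "(LINT x:torus_cell|lborel. per (\<lambda>p. a * k p + b * l p + c * m p) x) = a * (LINT x:torus_cell|lborel. per k x) +
   b * (LINT x:torus_cell|lborel. per l x) + c * (LINT x:torus_cell|lborel. per m x)"
proof -
  have 1: "cont (\<lambda>x :: real^3. 1 :: real)" by simp
  show ?thesis
   using cell_lincomb[OF bm_lincomb[OF assms(1,2), of a b] assms(3) 1, where a=1 and b=c] cell_lincomb[OF assms(1,2) 1, of a b] by simp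
qed

text \<open>A field with stream function A is divergence free: the two weak derivatives are tested
  with derivatives of ps, and mixed derivatives commute.\<close>

lemma wd_div:
  assumes "wd 2 A X" "wd 1 A (\<lambda>p. - Y p)" "ps \<in> torus_tests"
  shows "(LINT x:torus_cell|lborel. per X x * pd (axis 1 1) ps x) + (LINT x:torus_cell|lborel. per Y x * pd (axis 2 1) ps x) = 0"
proof -
  have s: "smooth ps" using assms(3) by (simp add: torus_tests_def)
  have "(LINT x:torus_cell|lborel. per A x * pd (axis 2 1) (pd (axis 1 1) ps) x) = - (LINT x:torus_cell|lborel. per X x * pd (axis 1 1) ps x)"
   using assms(1) pd_periodic[OF assms(3)] unfolding wd_def by blast
  moreover have "(LINT x:torus_cell|lborel. per A x * pd (axis 1 1) (pd (axis 2 1) ps) x) = - (LINT x:torus_cell|lborel. per (\<lambda>p. - Y p) x * pd (axis 2 1) ps x)"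
   using assms(2) pd_periodic[OF assms(3)] unfolding wd_def by blast
  moreover have "(LINT x:torus_cell|lborel. per (\<lambda>p. - Y p) x * pd (axis 2 1) ps x) = - (LINT x:torus_cell|lborel. per Y x * pd (axis 2 1) ps x)"
   by (simp add: per_def set_int_def)
  moreover have "pd (axis 1 1) (pd (axis 2 1) ps) x = pd (axis 2 1) (pd (axis 1 1) ps) x" for x by (rule pd_commute[OF s])
  ultimately show ?thesis by simp
qed

context mhd_data begin

text \<open>The first two components are stationary; their planar fluxes vanish by
  \<open>stress\<close> and \<open>emf\<close>, and derivatives in the third direction vanish
  because nothing depends on it. The third components reduce to half the sum, for the induction
  equation half the difference, of the transport equations of F and F'.\<close>

lemma act_equations:
  assumes T: "0 < T" and ph: "ph \<in> spacetime_tests T"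
  shows "act T ph time_dir (U i) + (\<Sum>j\<in>UNIV. act T ph (space_dir j) (\<lambda>p t. U i p t * U j p t - B i p t * B j p t)) = 0"
   and "act T ph time_dir (B i) +
    act T ph (space_dir (i + 1)) (\<lambda>p t. B i p t * U (i + 1) p t - B (i + 1) p t * U i p t) -
    act T ph (space_dir (i + 2)) (\<lambda>p t. B (i + 2) p t * U i p t - B i p t * U (i + 2) p t) = 0"
   and "(\<Sum>j\<in>UNIV. act T ph (space_dir j) (U j)) = 0" "(\<Sum>j\<in>UNIV. act T ph (space_dir j) (B j)) = 0"
proof -
  have s: "smooth ph" by (rule test_smooth[OF ph])
  have z: "act T ph v (\<lambda>p t. 0) = 0" for v by (simp add: act_def per_def set_int_def)
  have a3: "act T ph (space_dir 3) k = 0" if "bt k" for k by (rule act_z[OF that ph])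
  have bM: "bt (\<lambda>p t. X p t * Y p t - Z p t * Q p t)" if "bt X" "bt Y" "bt Z" "bt Q" for X Y Z Q
   using bt_lincomb[OF bt_mult[OF that(1,2)] bt_mult[OF that(3,4)], of 1 "-1"] by simp
  have b: "bt (\<lambda>p t. F p t * V1 p)" "bt (\<lambda>p t. F p t * V2 p)" "bt (\<lambda>p t. F' p t * V1' p)" "bt (\<lambda>p t. F' p t * V2' p)"
   "bt F" "bt F'" "bt (\<lambda>p t. strip sm2' p)"
   by (intro bt_mult bts bt_const)+
  have tU: "act T ph time_dir (U 1) = 0" "act T ph time_dir (U 2) = 0" "act T ph time_dir (B 1) = 0" "act T ph time_dir (B 2) = 0"
   "act T ph time_dir (\<lambda>p t. strip sm2' p) = 0"
   unfolding U_simps B_simps by (intro act_time[OF T _ ph] bm_lincomb bts)+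
  note wv = act_wave[OF w(1) sub(1) T ph] act_wave[OF w(2) sub(2) T ph]
  note al = act_lincomb[OF _ _ s]
  have t3: "act T ph time_dir (U 3) = 1/2 * act T ph time_dir F + 1/2 * act T ph time_dir F'"
   "act T ph time_dir (B 3) = 1/2 * act T ph time_dir F + (-1/2) * act T ph time_dir F'"
   unfolding U_simps B_simps al[OF bt_lincomb[OF b(5,6)] b(7)] al[OF b(5,6)] tU(5) by simp_all
  have "act T ph time_dir (U 1) + (\<Sum>j\<in>UNIV. act T ph (space_dir j) (\<lambda>p t. U 1 p t * U j p t - B 1 p t * B j p t)) = 0"
   "act T ph time_dir (U 2) + (\<Sum>j\<in>UNIV. act T ph (space_dir j) (\<lambda>p t. U 2 p t * U j p t - B 2 p t * B j p t)) = 0"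
   unfolding sum_3 stress by (simp_all add: tU z a3 bM bt)
  moreover have "act T ph time_dir (U 3) + (\<Sum>j\<in>UNIV. act T ph (space_dir j) (\<lambda>p t. U 3 p t * U j p t - B 3 p t * B j p t)) = 0"
   unfolding sum_3 stress a3[OF bM[OF bt(1) bt(1) bt(2) bt(2)]] t3 al[OF b(1,3)] al[OF b(2,4)]
   using wv by simp
  ultimately show "act T ph time_dir (U i) + (\<Sum>j\<in>UNIV. act T ph (space_dir j) (\<lambda>p t. U i p t * U j p t - B i p t * B j p t)) = 0"
   using exhaust_3[of i] by auto
  show "(\<Sum>j\<in>UNIV. act T ph (space_dir j) (U j)) = 0"
   using act_space[OF bt(1) bt(1) ph wd_div[OF wds(4,5)]] a3[OF bt(1)] by (simp add: sum_3)
  show "(\<Sum>j\<in>UNIV. act T ph (space_dir j) (B j)) = 0"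
   using act_space[OF bt(2) bt(2) ph wd_div[OF wds(1,2)]] a3[OF bt(2)] by (simp add: sum_3)
  have e: "act T ph (space_dir 3) (\<lambda>p t. B 3 p t * U 1 p t - B 1 p t * U 3 p t) = 0"
   "act T ph (space_dir 3) (\<lambda>p t. B 2 p t * U 3 p t - B 3 p t * U 2 p t) = 0"
   by (rule a3[OF bM[OF bt(2) bt(1) bt(2) bt(1)]])+
  have "act T ph time_dir (B 1) + act T ph (space_dir 2) (\<lambda>p t. B 1 p t * U 2 p t - B 2 p t * U 1 p t) -
    act T ph (space_dir 3) (\<lambda>p t. B 3 p t * U 1 p t - B 1 p t * U 3 p t) = 0"
   "act T ph time_dir (B 2) + act T ph (space_dir 3) (\<lambda>p t. B 2 p t * U 3 p t - B 3 p t * U 2 p t) -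
    act T ph (space_dir 1) (\<lambda>p t. B 1 p t * U 2 p t - B 2 p t * U 1 p t) = 0"
   unfolding e emf(1) by (simp_all add: tU z)
  moreover have "act T ph time_dir (B 3) + act T ph (space_dir 1) (\<lambda>p t. B 3 p t * U 1 p t - B 1 p t * U 3 p t) -
    act T ph (space_dir 2) (\<lambda>p t. B 2 p t * U 3 p t - B 3 p t * U 2 p t) = 0"
   unfolding emf t3 al[OF b(1,3)] al[OF b(2,4)] using wv by simp
  ultimately show "act T ph time_dir (B i) +
    act T ph (space_dir (i + 1)) (\<lambda>p t. B i p t * U (i + 1) p t - B (i + 1) p t * U i p t) -
    act T ph (space_dir (i + 2)) (\<lambda>p t. B (i + 2) p t * U i p t - B i p t * U (i + 2) p t) = 0"
   using exhaust_3[of i] by (auto simp: numeral_3_wrap)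
qed

lemma mhd: "0 < T \<Longrightarrow> ideal_MHD_weak_solution T (field U) (field B)"
  by (rule mhd_of_act[OF bt act_equations])

definition S :: real where
  "S = (LINT x:torus_cell|lborel. per (\<lambda>p. (strip sm2' p)\<^sup>2 + (strip sm3' p)\<^sup>2) x)"

text \<open>Energy is a quarter of the integral of the sum of the squared Elsasser fields and
  cross-helicity a quarter of that of the difference. The second square enters the latter with the
  opposite sign, as the roles are exchanged; the strip, where \<open>u = B\<close>, contributes S to
  both.\<close>

lemma energies:
  "total_energy (\<lambda>x. field U (x, t)) (\<lambda>x. field B (x, t)) =
   1/4 * ((LINT p|lborel. (V1 p)\<^sup>2 + (V2 p)\<^sup>2) + (LINT p|lborel. (F p t)\<^sup>2)) +
   1/4 * ((LINT p|lborel. (V1' p)\<^sup>2 + (V2' p)\<^sup>2) + (LINT p|lborel. (F' p t)\<^sup>2)) + S"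
  "cross_helicity (\<lambda>x. field U (x, t)) (\<lambda>x. field B (x, t)) =
   1/4 * ((LINT p|lborel. (F p t)\<^sup>2) - (LINT p|lborel. (V1 p)\<^sup>2 + (V2 p)\<^sup>2)) +
   1/4 * ((LINT p|lborel. (V1' p)\<^sup>2 + (V2' p)\<^sup>2) - (LINT p|lborel. (F' p t)\<^sup>2)) + S"
proof -
  have sq: "bm (\<lambda>p. (f p)\<^sup>2)" if "bm f" for f :: "plane \<Rightarrow> real"
   using bm_mult[OF that that] by (simp add: power2_eq_square)
  have bF: "bm (\<lambda>p. F p t)" "bm (\<lambda>p. F' p t)" by (intro bt_slice bts)+
  have bV: "bm (\<lambda>p. (V1 p)\<^sup>2 + (V2 p)\<^sup>2)" "bm (\<lambda>p. (V1' p)\<^sup>2 + (V2' p)\<^sup>2)" "bm (\<lambda>p. (strip sm2' p)\<^sup>2 + (strip sm3' p)\<^sup>2)"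
   by (intro bm_add sq bts)+
  have z: "p \<notin> {0<..<1} \<times> {0<..<1} \<Longrightarrow> V1 p = 0 \<and> V2 p = 0 \<and> F p t = 0 \<and> V1' p = 0 \<and> V2' p = 0 \<and> F' p t = 0" for p
  proof -
   assume "p \<notin> {0<..<1} \<times> {0<..<1}"
   hence "p \<notin> osq 0 0 (1/2)" "p \<notin> osq 0 (1/2) (1/2)" using sub by blast+
   thus "V1 p = 0 \<and> V2 p = 0 \<and> F p t = 0 \<and> V1' p = 0 \<and> V2' p = 0 \<and> F' p t = 0"
    using wave_props(8,9,11)[OF w(1)] wave_props(8,9,11)[OF w(2)] by simp
  qed
  have bP: "bm (\<lambda>p. 1 * ((V1 p)\<^sup>2 + (V2 p)\<^sup>2) + 1 * (F p t)\<^sup>2)" "bm (\<lambda>p. 1 * ((V1' p)\<^sup>2 + (V2' p)\<^sup>2) + 1 * (F' p t)\<^sup>2)"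
   "bm (\<lambda>p. (-1) * ((V1 p)\<^sup>2 + (V2 p)\<^sup>2) + 1 * (F p t)\<^sup>2)" "bm (\<lambda>p. (-1) * ((V1' p)\<^sup>2 + (V2' p)\<^sup>2) + 1 * (F' p t)\<^sup>2)"
   by (intro bm_lincomb bV sq bF)+
  have "(norm (field U (x, t)))\<^sup>2 + (norm (field B (x, t)))\<^sup>2 =
    per (\<lambda>p. 1/2 * (1 * ((V1 p)\<^sup>2 + (V2 p)\<^sup>2) + 1 * (F p t)\<^sup>2) + 1/2 * (1 * ((V1' p)\<^sup>2 + (V2' p)\<^sup>2) + 1 * (F' p t)\<^sup>2) +
     2 * ((strip sm2' p)\<^sup>2 + (strip sm3' p)\<^sup>2)) x" for x
   unfolding power2_norm_eq_inner inner_vec_def sum_3 field_def vec_lambda_beta fst_conv snd_conv per_def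
   by (rule regions[of "(frac (x $ 1), frac (x $ 2))"]) (simp_all add: U_simps B_simps algebra_simps power2_eq_square)
  hence "(LINT x:torus_cell|lborel. (norm (field U (x, t)))\<^sup>2 + (norm (field B (x, t)))\<^sup>2) =
   1/2 * (LINT x:torus_cell|lborel. per (\<lambda>p. 1 * ((V1 p)\<^sup>2 + (V2 p)\<^sup>2) + 1 * (F p t)\<^sup>2) x) +
   1/2 * (LINT x:torus_cell|lborel. per (\<lambda>p. 1 * ((V1' p)\<^sup>2 + (V2' p)\<^sup>2) + 1 * (F' p t)\<^sup>2) x) + 2 * S"
   using cell_sum[OF bP(1,2) bV(3), of "1/2" "1/2" 2] by (simp only: S_def)
  thus "total_energy (\<lambda>x. field U (x, t)) (\<lambda>x. field B (x, t)) =
   1/4 * ((LINT p|lborel. (V1 p)\<^sup>2 + (V2 p)\<^sup>2) + (LINT p|lborel. (F p t)\<^sup>2)) +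
   1/4 * ((LINT p|lborel. (V1' p)\<^sup>2 + (V2' p)\<^sup>2) + (LINT p|lborel. (F' p t)\<^sup>2)) + S"
   using cell_plane_lincomb[OF bV(1) sq[OF bF(1)], of 1 1] cell_plane_lincomb[OF bV(2) sq[OF bF(2)], of 1 1] z unfolding total_energy_def by (simp add: field_simps)
  have "field U (x, t) \<bullet> field B (x, t) =
    per (\<lambda>p. 1/4 * ((-1) * ((V1 p)\<^sup>2 + (V2 p)\<^sup>2) + 1 * (F p t)\<^sup>2) + (-1/4) * ((-1) * ((V1' p)\<^sup>2 + (V2' p)\<^sup>2) + 1 * (F' p t)\<^sup>2) +
     1 * ((strip sm2' p)\<^sup>2 + (strip sm3' p)\<^sup>2)) x" for x
   unfolding inner_vec_def sum_3 field_def vec_lambda_beta fst_conv snd_conv per_def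
   by (rule regions[of "(frac (x $ 1), frac (x $ 2))"]) (simp_all add: U_simps B_simps algebra_simps power2_eq_square)
  hence "(LINT x:torus_cell|lborel. field U (x, t) \<bullet> field B (x, t)) =
   1/4 * (LINT x:torus_cell|lborel. per (\<lambda>p. (-1) * ((V1 p)\<^sup>2 + (V2 p)\<^sup>2) + 1 * (F p t)\<^sup>2) x) +
   (-1/4) * (LINT x:torus_cell|lborel. per (\<lambda>p. (-1) * ((V1' p)\<^sup>2 + (V2' p)\<^sup>2) + 1 * (F' p t)\<^sup>2) x) + 1 * S"
   using cell_sum[OF bP(3,4) bV(3), of "1/4" "-1/4" 1] by (simp only: S_def)
  thus "cross_helicity (\<lambda>x. field U (x, t)) (\<lambda>x. field B (x, t)) =
   1/4 * ((LINT p|lborel. (F p t)\<^sup>2) - (LINT p|lborel. (V1 p)\<^sup>2 + (V2 p)\<^sup>2)) +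
   1/4 * ((LINT p|lborel. (V1' p)\<^sup>2 + (V2' p)\<^sup>2) - (LINT p|lborel. (F' p t)\<^sup>2)) + S"
   using cell_plane_lincomb[OF bV(1) sq[OF bF(1)], of "-1" 1] cell_plane_lincomb[OF bV(2) sq[OF bF(2)], of "-1" 1] z unfolding cross_helicity_def by (simp add: field_simps)
qed

end

context mhd_data begin

text \<open>In the squares \<open>A \<bullet> B\<close> consists of multiples of
  \<open>W * V2\<close> and of \<open>G * F\<close>, for either wave. Both have integral zero, the
  first by \<open>wave_pot\<close> and the second by \<open>GF\<close>, so only the strip
  contributes, with the Wronskian of its two potentials.\<close>

lemma helicity:
  "has_helicity (\<lambda>x. field B (x, t)) (LINT x:torus_cell|lborel. per (\<lambda>p. strip sm3 p * strip sm2' p - strip sm2 p * strip sm3' p) x)"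
proof -
  note wdt = wds(1,2,3)[of t]
  have bA: "bm A3" "bm (A2 t)" using wdt unfolding wd_def by blast+
  have cs: "cont sm2" "cont sm3"
   using sm2(1) sm3(1) by (intro continuous_at_imp_continuous_on ballI DERIV_isCont; blast)+
  have bW: "bm (W t)" "bm (W' t)" using pot(3)[of t] pot'(3)[of t] unfolding wd_def by blast+
  have bF: "bm (\<lambda>p. F p t)" "bm (\<lambda>p. F' p t)" by (intro bt_slice bts)+
  define k :: "3 \<Rightarrow> plane \<Rightarrow> real" where "k i = (if i = 1 then (\<lambda>_. 0) else if i = 2 then A2 t else A3)" for i
  define A :: "real^3 \<Rightarrow> real^3" where "A x = (\<chi> i. per (k i) x)" for x
  define Bt where "Bt x = field B (x, t)" for x
  have k: "k 1 = (\<lambda>_. 0)" "k 2 = A2 t" "k 3 = A3" by (simp_all add: k_def)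
  have bk: "bm (k i)" for i using bA bm_const[where 'a="plane", of 0] by (simp add: k_def)
  have bA': "bm (\<lambda>x. A x $ i)" for i using bm_per[OF bk] by (simp add: A_def)
  have bB': "bm (\<lambda>x. Bt x $ i)" for i using bm_per[OF bt_slice[OF bt(2)]] by (simp add: Bt_def field_def)
  obtain KA where KA: "\<And>x. norm (A x) \<le> KA" using bm_vec(2)[OF bA'] by blast
  obtain KB where KB: "\<And>x. norm (Bt x) \<le> KB" using bm_vec(2)[OF bB'] by blast
  have Bc: "Bt x $ i = per (\<lambda>p. B i p t) x" for x i by (simp add: Bt_def field_def)
  have Ac: "A x $ 1 = 0" "A x $ 2 = per (A2 t) x" "A x $ 3 = per A3 x" for x
   unfolding A_def vec_lambda_beta k by (simp_all add: per_def)
  have "has_helicity Bt (LINT x:torus_cell|lborel. A x \<bullet> Bt x)"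
  proof (rule helicity_of_potential[of A "max KA KB"])
   show "A \<in> Bor" "Bt \<in> Bor" by (rule bm_vec(1)[OF bA'], rule bm_vec(1)[OF bB'])
   show "norm (A x) \<le> max KA KB" "norm (Bt x) \<le> max KA KB" for x using KA[of x] KB[of x] by (simp_all add: le_max_iff_disj)
   show "periodic A" using per_periodic unfolding periodic_def A_def by simp
   show "periodic Bt" unfolding Bt_def[abs_def] by (rule field_props(3)[OF bt(2)])
   fix ps and i :: 3 assume ps: "ps \<in> torus_tests"
   have "(LINT x:torus_cell|lborel. per (A2 t) x * pd (axis 3 1) ps x) = 0"
    using wd_z_I[OF bA(2) bm_const, of 0] ps by (simp add: wd_def per_def)
   moreover have "(LINT x:torus_cell|lborel. per A3 x * pd (axis 2 1) ps x) = - (LINT x:torus_cell|lborel. per (\<lambda>p. B 1 p t) x * ps x)"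
    "(LINT x:torus_cell|lborel. per (A2 t) x * pd (axis 1 1) ps x) = - (LINT x:torus_cell|lborel. per (\<lambda>p. B 3 p t) x * ps x)"
    using wdt(1,3) ps unfolding wd_def by blast+
   moreover have "(LINT x:torus_cell|lborel. per A3 x * pd (axis 1 1) ps x) = - (LINT x:torus_cell|lborel. per (\<lambda>p. - B 2 p t) x * ps x)"
    using wdt(2) ps unfolding wd_def by blast
   moreover have "- (LINT x:torus_cell|lborel. per (\<lambda>p. - B 2 p t) x * ps x) = (LINT x:torus_cell|lborel. per (\<lambda>p. B 2 p t) x * ps x)"
    by (simp add: per_def set_int_def)
   ultimately show "(LINT x|cm. A x $ (i + 1) * pd (axis (i + 2) 1) ps x) - (LINT x|cm. A x $ (i + 2) * pd (axis (i + 1) 1) ps x) = (LINT x|cm. Bt x $ i * ps x)"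
    using exhaust_3[of i] unfolding cm_integral(1) Bc by (auto simp: numeral_3_wrap Ac)
  qed
  moreover have "(LINT x:torus_cell|lborel. A x \<bullet> Bt x) = (LINT x:torus_cell|lborel. per (\<lambda>p. strip sm3 p * strip sm2' p - strip sm2 p * strip sm3' p) x)"
  proof -
   let ?m = "\<lambda>p. 1 * (strip sm3 p * strip sm2' p) + (-1) * (strip sm2 p * strip sm3' p)"
   have bm4: "bm (\<lambda>p. W t p * V2 p)" "bm (\<lambda>p. W' t p * V2' p)" "bm (\<lambda>p. G p * F p t)" "bm (\<lambda>p. G' p * F' p t)"
    by (intro bm_mult bW bF bts)+
   have z: "W t p = 0 \<and> G p = 0 \<and> W' t p = 0 \<and> G' p = 0" if "p \<notin> {0<..<1} \<times> {0<..<1}" for p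
   proof -
    have "p \<notin> osq 0 0 (1/2)" "p \<notin> osq 0 (1/2) (1/2)" using that sub by blast+
    thus ?thesis using wave_props(10)[OF w(1)] wave_props(10)[OF w(2)] pot(4) pot'(4) by simp
   qed
   have "A x \<bullet> Bt x = per (\<lambda>p. (-1/4) * (1 * (W t p * V2 p) + 1 * (W' t p * V2' p)) + (-1/4) * (1 * (G p * F p t) + 1 * (G' p * F' p t)) + 1 * ?m p) x" for x
    unfolding inner_vec_def sum_3 Ac Bc per_def
    by (rule regions[of "(frac (x $ 1), frac (x $ 2))"]) (simp_all add: A2_def A3_def B_simps algebra_simps)
   hence "(LINT x:torus_cell|lborel. A x \<bullet> Bt x) =
     (-1/4) * (LINT x:torus_cell|lborel. per (\<lambda>p. 1 * (W t p * V2 p) + 1 * (W' t p * V2' p)) x) +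
     (-1/4) * (LINT x:torus_cell|lborel. per (\<lambda>p. 1 * (G p * F p t) + 1 * (G' p * F' p t)) x) + 1 * (LINT x:torus_cell|lborel. per ?m x)"
    using cell_sum[of "\<lambda>p. 1 * (W t p * V2 p) + 1 * (W' t p * V2' p)" "\<lambda>p. 1 * (G p * F p t) + 1 * (G' p * F' p t)" ?m "-1/4" "-1/4" 1,
      OF bm_lincomb[OF bm4(1,2)] bm_lincomb[OF bm4(3,4)] bm_lincomb[OF bm_mult bm_mult]] bts strip_bm[OF cs(1)] strip_bm[OF cs(2)] by simp
   also have "(LINT x:torus_cell|lborel. per (\<lambda>p. 1 * (W t p * V2 p) + 1 * (W' t p * V2' p)) x) = 0"
    by (subst cell_plane_lincomb[OF bm4(1,2)]) (simp_all add: z pot(5) pot'(5) GF)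
   also have "(LINT x:torus_cell|lborel. per (\<lambda>p. 1 * (G p * F p t) + 1 * (G' p * F' p t)) x) = 0"
    by (subst cell_plane_lincomb[OF bm4(3,4)]) (simp_all add: z GF)
   finally show ?thesis by simp
  qed
  ultimately show ?thesis by (simp add: Bt_def[abs_def])
qed

end

text \<open>With \<open>q = (s - 1/2) * (1 - s)\<close> the potentials of the strip are multiples of
  \<open>s * q\<close> and q. Their Wronskian is a multiple of the square of q, their energy density
  a multiple of the sum of the squared derivatives; over the strip these densities have integrals
  1/960 and 1/15.\<close>

lemma DERIV_poly_strip:
  shows "((\<lambda>s::real. s ^ 5 / 5 - 3/4 * s ^ 4 + 13/12 * s ^ 3 - 3/4 * s ^ 2 + s / 4) has_real_derivative ((s - 1/2) * (1 - s))\<^sup>2) (at s)"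
   and "((\<lambda>s::real. 9/5 * s ^ 5 - 9/2 * s ^ 4 + 16/3 * s ^ 3 - 9/2 * s ^ 2 + 5/2 * s) has_real_derivative (3/2 - 2 * s)\<^sup>2 + (3 * s - 3 * s\<^sup>2 - 1/2)\<^sup>2) (at s)"
   and "((\<lambda>s::real. (s - 1/2) * (1 - s)) has_real_derivative 3/2 - 2 * s) (at s)"
   and "((\<lambda>s::real. s * ((s - 1/2) * (1 - s))) has_real_derivative 3 * s - 3 * s\<^sup>2 - 1/2) (at s)"
  by (auto intro!: derivative_eq_intros simp: field_simps power2_eq_square power3_eq_cube power4_eq_xxxx)

theorem corollary1:
  shows "\<exists>M::real. M > 0 \<and>
    (\<forall>(T::real) (h::real) (e::real \<Rightarrow> real) (w::real \<Rightarrow> real).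
       T > 0 \<and> continuous_on {0..T} e \<and> continuous_on {0..T} w \<and>
       (\<forall>t\<in>{0..T}. e t - \<bar>w t\<bar> > M * \<bar>h\<bar>) \<longrightarrow>
       (\<exists>u B. ideal_MHD_weak_solution T u B \<and>
          torus_Linfty {0..T} u \<and> torus_Linfty {0..T} B \<and>
          (AE t\<in>{0..T} in lborel.
             total_energy (\<lambda>x. u (x, t)) (\<lambda>x. B (x, t)) = e t \<and>
             cross_helicity (\<lambda>x. u (x, t)) (\<lambda>x. B (x, t)) = w t) \<and>
          (AE t\<in>{0..T} in lborel. has_helicity (\<lambda>x. B (x, t)) h)))"
proof (rule exI[of _ 129], intro conjI allI impI)
  fix T h :: real and e w :: "real \<Rightarrow> real"
  assume "T > 0 \<and> continuous_on {0..T} e \<and> continuous_on {0..T} w \<and> (\<forall>t\<in>{0..T}. e t - \<bar>w t\<bar> > 129 * \<bar>h\<bar>)"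
  hence T: "0 < T" and e: "continuous_on {0..T} e" and w: "continuous_on {0..T} w"
   and gap: "\<And>t. t \<in> {0..T} \<Longrightarrow> 129 * \<bar>h\<bar> < e t - \<bar>w t\<bar>" by auto
  have c: "continuous_on {0..T} (\<lambda>t. e t - \<bar>w t\<bar> - 129 * \<bar>h\<bar>)" by (intro continuous_intros e w)
  have ne: "{0..T} \<noteq> {}" using T by simp
  obtain b where b: "b \<in> {0..T}" "\<And>t. t \<in> {0..T} \<Longrightarrow> e b - \<bar>w b\<bar> - 129 * \<bar>h\<bar> \<le> e t - \<bar>w t\<bar> - 129 * \<bar>h\<bar>"
   using continuous_attains_inf[OF compact_Icc ne c] by blast
  \<comment> \<open>The uniform surplus in the hypothesis; it also serves as the flow energy of each
    square.\<close>
  define \<nu> where "\<nu> = e b - \<bar>w b\<bar> - 129 * \<bar>h\<bar>"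
  have \<nu>: "0 < \<nu>" "\<And>t. t \<in> {0..T} \<Longrightarrow> \<nu> + 129 * \<bar>h\<bar> \<le> e t - \<bar>w t\<bar>" using gap[OF b(1)] b(2) by (auto simp: \<nu>_def)
  \<comment> \<open>The squared norm of \<open>z\<^sup>+\<close> integrates to
    \<open>2 * (e t + w t)\<close>. It consists of the integral of \<open>F\<^sup>2\<close>, the
    flow energy \<nu> of the second square and, as \<open>z\<^sup>+ = 2 * u\<close> in the strip,
    four times \<open>S = 64 * \<bar>h\<bar>\<close>. Half of 256 is 128, so 129 leaves a positive
    profile. For \<open>z\<^sup>-\<close> the strip contributes nothing.\<close>
  define g1 where "g1 t = 2 * (e t + w t) - 256 * \<bar>h\<bar> - \<nu>" for t
  define g2 where "g2 t = 2 * (e t - w t) - \<nu>" for t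
  have g1: "continuous_on {0..T} g1" "\<And>t. t \<in> {0..T} \<Longrightarrow> 0 < g1 t"
   and g2: "continuous_on {0..T} g2" "\<And>t. t \<in> {0..T} \<Longrightarrow> 0 < g2 t"
  proof -
   show "continuous_on {0..T} g1" "continuous_on {0..T} g2" unfolding g1_def g2_def by (intro continuous_intros e w)+
   fix t assume "t \<in> {0..T}"
   hence *: "\<nu> + 129 * \<bar>h\<bar> \<le> e t - \<bar>w t\<bar>" by (rule \<nu>(2))
   have "0 < 2 * (x + y) - 256 * \<bar>h\<bar> - \<nu> \<and> 0 < 2 * (x - y) - \<nu>" if "\<nu> + 129 * \<bar>h\<bar> \<le> x - \<bar>y\<bar>" for x y
    using that \<nu>(1) by (smt (verit))
   from this[OF *] show "0 < g1 t" "0 < g2 t" unfolding g1_def g2_def by simp_all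
  qed
  obtain V1 V2 F G where W1: "wave (osq 0 0 (1/2)) V1 V2 F G" "(LINT p|lborel. (V1 p)\<^sup>2 + (V2 p)\<^sup>2) = \<nu>"
   "\<And>y t. (LBINT x. F (x, y) t) = 0" "\<And>t. (LINT p|lborel. G p * F p t) = 0"
   "\<And>t. t \<in> {0..T} \<Longrightarrow> (LINT p|lborel. (F p t)\<^sup>2) = g1 t"
   using profile_exists[OF less_imp_le[OF T] g1 \<nu>(1), of 0 0] by blast
  obtain V1' V2' F' G' where W2: "wave (osq 0 (1/2) (1/2)) V1' V2' F' G'" "(LINT p|lborel. (V1' p)\<^sup>2 + (V2' p)\<^sup>2) = \<nu>"
   "\<And>y t. (LBINT x. F' (x, y) t) = 0" "\<And>t. (LINT p|lborel. G' p * F' p t) = 0"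
   "\<And>t. t \<in> {0..T} \<Longrightarrow> (LINT p|lborel. (F' p t)\<^sup>2) = g2 t"
   using profile_exists[OF less_imp_le[OF T] g2 \<nu>(1), of 0 "1/2"] by blast
  \<comment> \<open>The integral 1/960 of the Wronskian density is scaled to modulus
    \<open>\<bar>h\<bar>\<close>; the strip energy is then 960/15 = 64 times
    \<open>\<bar>h\<bar>\<close>.\<close>
  define \<kappa> where "\<kappa> = sqrt (960 * \<bar>h\<bar>)"
  \<comment> \<open>The sign of h enters through one of the two components only, so the energy does
    not see it.\<close>
  define rh where "rh = (if 0 \<le> h then \<kappa> else - \<kappa>)"
  have \<kappa>: "\<kappa> * \<kappa> = 960 * \<bar>h\<bar>" "rh * rh = 960 * \<bar>h\<bar>" "rh * \<kappa> = 960 * h" by (auto simp: \<kappa>_def rh_def)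
  define sm2 where "sm2 s = rh * (s * ((s - 1/2) * (1 - s)))" for s
  define sm2' where "sm2' s = rh * (3 * s - 3 * s\<^sup>2 - 1/2)" for s
  define sm3 where "sm3 s = \<kappa> * ((s - 1/2) * (1 - s))" for s
  define sm3' where "sm3' s = \<kappa> * (3/2 - 2 * s)" for s
  interpret mhd_data V1 V2 V1' V2' G G' F F' sm2 sm2' sm3 sm3'
  proof
   show "(sm2 has_real_derivative sm2' s) (at s)" "(sm3 has_real_derivative sm3' s) (at s)" for s
    unfolding sm2_def[abs_def] sm2'_def sm3_def[abs_def] sm3'_def by (intro DERIV_cmult DERIV_poly_strip)+
   show "cont sm2'" "cont sm3'" unfolding sm2'_def[abs_def] sm3'_def[abs_def] by (intro continuous_intros)+
  qed (use W1 W2 in \<open>auto simp: sm2_def sm3_def\<close>)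
  have S: "S = 64 * \<bar>h\<bar>"
  proof -
   have "(strip sm2' p)\<^sup>2 + (strip sm3' p)\<^sup>2 = strip (\<lambda>s. 960 * \<bar>h\<bar> * ((3/2 - 2 * s)\<^sup>2 + (3 * s - 3 * s\<^sup>2 - 1/2)\<^sup>2)) p" for p
   proof -
    have "(sm2' s)\<^sup>2 + (sm3' s)\<^sup>2 = rh * rh * (3 * s - 3 * s\<^sup>2 - 1/2)\<^sup>2 + \<kappa> * \<kappa> * (3/2 - 2 * s)\<^sup>2" for s
     by (simp add: sm2'_def sm3'_def power_mult_distrib power2_eq_square[of \<kappa>] power2_eq_square[of rh])
    thus ?thesis unfolding \<kappa> by (simp add: strip_def algebra_simps)
   qed
   hence "S = (LINT x:torus_cell|lborel. per (strip (\<lambda>s. 960 * \<bar>h\<bar> * ((3/2 - 2 * s)\<^sup>2 + (3 * s - 3 * s\<^sup>2 - 1/2)\<^sup>2))) x)"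
    by (simp add: S_def)
   also have "\<dots> = 64 * \<bar>h\<bar>"
    by (subst cell_per_strip[OF DERIV_cmult[OF DERIV_poly_strip(2)]]) (auto intro!: continuous_intros simp: power_divide)
   finally show ?thesis .
  qed
  have H: "has_helicity (\<lambda>x. field B (x, t)) h" for t
  proof -
   have "strip sm3 p * strip sm2' p - strip sm2 p * strip sm3' p = strip (\<lambda>s. 960 * h * ((s - 1/2) * (1 - s))\<^sup>2) p" for p
   proof -
    have "sm3 s * sm2' s - sm2 s * sm3' s = rh * \<kappa> * ((s - 1/2) * (1 - s))\<^sup>2" for s
     unfolding sm2_def sm2'_def sm3_def sm3'_def by algebra
    thus ?thesis unfolding \<kappa> by (simp add: strip_def)
   qed
   hence "(LINT x:torus_cell|lborel. per (\<lambda>p. strip sm3 p * strip sm2' p - strip sm2 p * strip sm3' p) x) =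
     (LINT x:torus_cell|lborel. per (strip (\<lambda>s. 960 * h * ((s - 1/2) * (1 - s))\<^sup>2)) x)" by simp
   also have "\<dots> = h"
    by (subst cell_per_strip[OF DERIV_cmult[OF DERIV_poly_strip(1)]]) (auto intro!: continuous_intros simp: power_divide)
   finally show ?thesis using helicity[of t] by simp
  qed
  have E: "total_energy (\<lambda>x. field U (x, t)) (\<lambda>x. field B (x, t)) = e t \<and> cross_helicity (\<lambda>x. field U (x, t)) (\<lambda>x. field B (x, t)) = w t"
   if "t \<in> {0..T}" for t
   unfolding energies W1(2) W2(2) W1(5)[OF that] W2(5)[OF that] S g1_def g2_def by (simp add: field_simps)
  show "\<exists>u B. ideal_MHD_weak_solution T u B \<and> torus_Linfty {0..T} u \<and> torus_Linfty {0..T} B \<and>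
    (AE t\<in>{0..T} in lborel. total_energy (\<lambda>x. u (x, t)) (\<lambda>x. B (x, t)) = e t \<and> cross_helicity (\<lambda>x. u (x, t)) (\<lambda>x. B (x, t)) = w t) \<and>
    (AE t\<in>{0..T} in lborel. has_helicity (\<lambda>x. B (x, t)) h)"
   by (intro exI[of _ "field U"] exI[of _ "field B"] conjI mhd T field_Linfty bt AE_I2 impI E H)
qed simp

end
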